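(* Let $(M,J,\overline g,\overline\omega)$ be a Kähler manifold of real dimension $2n$, let $L$ be a smooth compact oriented $n$-dimensional manifold, and let $\iota:L\to M$ be a totally real immersion. The following conditions are equivalent: (1) $\iota$ is $J$-minimal; (2) $H_J[\iota]=0$; (3) $\xi_J[\iota]=0$; (4) $\Omega_J[\iota]$ is parallel. If $M$ is Kähler–Einstein with non-zero scalar curvature then these conditions are also equivalent to $\iota$ being minimal Lagrangian. More generally, if $M$ has definite Ricci form then these conditions imply that $\iota$ is $\overline\rho$-Lagrangian.
   Context: Conventions: $h=\overline g-i\overline\omega$, $\overline\omega(X,Y)=\overline g(JX,Y)$, $\overline\nabla$ is the Levi-Civita connection of $\overline g$, $K_M=\Lambda^{(n,0)}T^*M$ with the Hermitian metric and connection induced by $h$ and $\overline\nabla$, and $\overline\rho(\cdot,\cdot)=\overline{\mathrm{Ric}}(J\cdot,\cdot)$ is the Ricci form; it is definite if $\overline{\mathrm{Ric}}$ is positive definite or negative definite everywhere. $M$ is Kähler–Einstein if $\overline\rho=\lambda\overline\omega$ for a constant $\lambda$. An immersion $\iota:L\to M$ is totally real if $T_{\iota(p)}M=\iota_*(T_pL)\oplus J\iota_*(T_pL)$ for all $p$; $\pi_L$ and $\pi_J$ denote the corresponding projections onto $\iota_*(T_pL)$ and $J\iota_*(T_pL)$. We identify $T_pL$ with $\iota_*(T_pL)$ and let $g=\iota^*\overline g$. Given a positive basis $v_1,\dots,v_n$ of $T_pL$, let $v_i^*,(Jv_i)^*$ be the dual basis of the real basis $v_1,\dots,v_n,Jv_1,\dots,Jv_n$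 of $T_{\iota(p)}M$. The canonical section $\Omega_J[\iota]$ of $\iota^*K_M$ is $$\Omega_J[\iota]=\frac{(v_1^*+i(Jv_1)^* )\wedge\dots\wedge(v_n^*+i(Jv_n)^* )}{|(v_1^*+i(Jv_1)^* )\wedge\dots\wedge(v_n^*+i(Jv_n)^* )|_h},$$ independent of the basis (the norm is normalised so that the numerator has norm 1 when the $v_i$ are $h$-unitary). It is parallel if $\overline\nabla_X\Omega_J[\iota]=0$ for all $X\in TL$, in the pull-back connection on $\iota^*K_M$. The $J$-volume form is $\mathrm{vol}_J[\iota]=\iota^*\Omega_J[\iota]$, which equals $\rho_J\,\mathrm{vol}_g$ with $\rho_J=(\det_{\mathbb C}h(e_i,e_j))^{1/2}$ for a $g$-orthonormal basis $e_i$ of $T_pL$. The $J$-volume is $\mathrm{Vol}_J(\iota)=\int_L\mathrm{vol}_J[\iota]$. $\iota$ is $J$-minimal if it is a critical point of $\mathrm{Vol}_J$ on the space of totally real immersions. The $J$-mean curvature $H_J[\iota]$ is (minus) the gradient of $\mathrm{Vol}_J$: the section of $J\iota_*(TL)$ such that $\frac{d}{dt}\big|_{t=0}\mathrm{Vol}_J(\iota_t)=-\int_L\overline g(H_J[\iota],JY)\,\mathrm{vol}_J[\iota]$ whenever $\iota_0=\iota$, $\frac{\partial\iota_t}{\partial t}|_{t=0}=JY$, $Y$ tangent to $L$. The Maslov 1-form $\xi_J[\iota]$ on $L$ is $\xi_J[\iota](X)=$ trace of the (well-defined) endomorphism $v\mapsto J\pi_J\overline\nabla_Xv$ of $T_pL$.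 $\iota$ is minimal if its mean curvature vector for $\overline g$ vanishes, Lagrangian if $\iota^*\overline\omega=0$, and $\overline\rho$-Lagrangian if $\iota^*\overline\rho=0$. *)

theory Defs
  imports "HOL-Analysis.Analysis"
begin

section \<open>Smooth manifolds\<close>

text \<open>
  A \<^term>\<open>k\<close>-times continuously differentiable map on an open subset of a Euclidean space: all
  iterated directional derivatives up to order \<^term>\<open>k\<close> exist and are continuous.
\<close>

primrec Ck_on :: "nat \<Rightarrow> 'a::euclidean_space set \<Rightarrow> ('a \<Rightarrow> 'b::real_normed_vector) \<Rightarrow> bool" where
  "Ck_on 0 S f \<longleftrightarrow> continuous_on S f"
| "Ck_on (Suc k) S f \<longleftrightarrow> (\<forall>x\<in>S. f differentiable (at x)) \<and>
     (\<forall>v. Ck_on k S (\<lambda>x. frechet_derivative f (at x) v))"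

definition smooth_on :: "'a::euclidean_space set \<Rightarrow> ('a \<Rightarrow> 'b::real_normed_vector) \<Rightarrow> bool" where
  "smooth_on S f \<longleftrightarrow> open S \<and> (\<forall>k. Ck_on k S f)"

type_synonym ('m, 'e) chart = "'m set \<times> ('m \<Rightarrow> 'e)"

definition cdom :: "('m, 'e) chart \<Rightarrow> 'm set" where
  "cdom c = fst c"

definition coord :: "('m, 'e) chart \<Rightarrow> 'm \<Rightarrow> 'e" where
  "coord c = snd c"

definition cimg :: "('m, 'e) chart \<Rightarrow> 'e set" where
  "cimg c = coord c ` cdom c"

definition cinv :: "('m, 'e) chart \<Rightarrow> 'e \<Rightarrow> 'm" where
  "cinv c = inv_into (cdom c) (coord c)"

definition is_chart :: "('m::topological_space, 'e::euclidean_space) chart \<Rightarrow> bool" where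
  "is_chart c \<longleftrightarrow> open (cdom c) \<and> open (cimg c) \<and>
     homeomorphism (cdom c) (cimg c) (coord c) (cinv c)"

definition smooth_atlas ::
  "('m::{t2_space, second_countable_topology}, 'e::euclidean_space) chart set \<Rightarrow> bool" where
  "smooth_atlas A \<longleftrightarrow> (\<forall>c\<in>A. is_chart c) \<and> (\<Union>c\<in>A. cdom c) = UNIV \<and>
     (\<forall>c\<in>A. \<forall>d\<in>A. smooth_on (coord c ` (cdom c \<inter> cdom d)) (coord d \<circ> cinv c))"

definition smooth_map ::
  "('l::topological_space, 'a::euclidean_space) chart set \<Rightarrow>
   ('m::topological_space, 'b::euclidean_space) chart set \<Rightarrow> ('l \<Rightarrow> 'm) \<Rightarrow> bool" where
  "smooth_map B A f \<longleftrightarrow> continuous_on UNIV f \<and>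
     (\<forall>c\<in>B. \<forall>d\<in>A. smooth_on (coord c ` (cdom c \<inter> f -` cdom d)) (coord d \<circ> f \<circ> cinv c))"

definition smooth_fun ::
  "('l, 'a::euclidean_space) chart set \<Rightarrow> ('l \<Rightarrow> 'b::real_normed_vector) \<Rightarrow> bool" where
  "smooth_fun B f \<longleftrightarrow> (\<forall>c\<in>B. smooth_on (cimg c) (f \<circ> cinv c))"


subsection \<open>Tangent vectors\<close>

text \<open>
  A tangent vector at \<^term>\<open>p\<close> is identified with its components in one chart around \<^term>\<open>p\<close> that is
  chosen once and for all, \<^term>\<open>chart_at A p\<close>.  So every tangent space is the model vector space,
  and tensors at \<^term>\<open>p\<close> are multilinear maps on the model space.  The components in any other chart
  are obtained with the derivative of the transition map.  Smoothness of a tensor field always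
  means smoothness of its components in the charts of the atlas (the chosen chart varies
  non-smoothly with the point).
\<close>

definition chart_at :: "('m, 'e) chart set \<Rightarrow> 'm \<Rightarrow> ('m, 'e) chart" where
  "chart_at A p = (SOME c. c \<in> A \<and> p \<in> cdom c)"

definition transition ::
  "('m, 'e::euclidean_space) chart \<Rightarrow> ('m, 'e) chart \<Rightarrow> 'm \<Rightarrow> 'e \<Rightarrow> 'e" where
  "transition c d p = frechet_derivative (coord d \<circ> cinv c) (at (coord c p))"

definition to_chart ::
  "('m, 'e::euclidean_space) chart set \<Rightarrow> ('m, 'e) chart \<Rightarrow> 'm \<Rightarrow> 'e \<Rightarrow> 'e" where
  "to_chart A c p = transition (chart_at A p) c p"

definition from_chart ::
  "('m, 'e::euclidean_space) chart set \<Rightarrow> ('m, 'e) chart \<Rightarrow> 'm \<Rightarrow> 'e \<Rightarrow> 'e" where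
  "from_chart A c p = transition c (chart_at A p) p"

definition tangent_map ::
  "('l, 'a::euclidean_space) chart set \<Rightarrow> ('m, 'b::euclidean_space) chart set \<Rightarrow>
   ('l \<Rightarrow> 'm) \<Rightarrow> 'l \<Rightarrow> 'a \<Rightarrow> 'b" where
  "tangent_map B A f p =
     frechet_derivative (coord (chart_at A (f p)) \<circ> f \<circ> cinv (chart_at B p))
       (at (coord (chart_at B p) p))"

definition smooth_vector_field ::
  "('l, 'a::euclidean_space) chart set \<Rightarrow> ('l \<Rightarrow> 'a) \<Rightarrow> bool" where
  "smooth_vector_field B Y \<longleftrightarrow>
     (\<forall>c\<in>B. smooth_on (cimg c) (\<lambda>x. to_chart B c (cinv c x) (Y (cinv c x))))"

text \<open>A smooth section of the pull-back bundle of \<open>TM\<close> under \<^term>\<open>f\<close>.\<close>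

definition smooth_section_along ::
  "('l, 'a::euclidean_space) chart set \<Rightarrow> ('m, 'b::euclidean_space) chart set \<Rightarrow>
   ('l \<Rightarrow> 'm) \<Rightarrow> ('l \<Rightarrow> 'b) \<Rightarrow> bool" where
  "smooth_section_along B A f V \<longleftrightarrow>
     (\<forall>c\<in>B. \<forall>d\<in>A. smooth_on (coord c ` (cdom c \<inter> f -` cdom d))
        (\<lambda>x. to_chart A d (f (cinv c x)) (V (cinv c x))))"

definition trace_lin :: "('a::euclidean_space \<Rightarrow> 'a) \<Rightarrow> real" where
  "trace_lin f = (\<Sum>b\<in>Basis. f b \<bullet> b)"


subsection \<open>Orientation and integration of top-degree forms\<close>

text \<open>
  An orientation is given by an atlas all of whose transition maps preserve orientation.
\<close>

definition oriented_atlas ::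
  "('l::{t2_space, second_countable_topology}, real^'n) chart set \<Rightarrow> bool" where
  "oriented_atlas B \<longleftrightarrow> smooth_atlas B \<and>
     (\<forall>c\<in>B. \<forall>d\<in>B. \<forall>p \<in> cdom c \<inter> cdom d. det (matrix (transition c d p)) > 0)"

text \<open>A positive basis of the tangent space at a point, in components in the chosen oriented chart.\<close>

definition positive_basis :: "('n::finite \<Rightarrow> real^'n) \<Rightarrow> bool" where
  "positive_basis v \<longleftrightarrow> det (\<chi> i j. v i $ j) > 0"

definition partition_of_unity ::
  "('l::topological_space, 'a::euclidean_space) chart set \<Rightarrow>
   nat \<Rightarrow> (nat \<Rightarrow> ('l, 'a) chart) \<Rightarrow> (nat \<Rightarrow> 'l \<Rightarrow> real) \<Rightarrow> bool" where
  "partition_of_unity B k c \<psi> \<longleftrightarrow>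
     (\<forall>i<k. c i \<in> B \<and> smooth_fun B (\<psi> i) \<and> (\<forall>p. \<psi> i p \<ge> 0) \<and>
        closure {p. \<psi> i p \<noteq> 0} \<subseteq> cdom (c i)) \<and>
     (\<forall>p. (\<Sum>i<k. \<psi> i p) = 1)"

text \<open>
  A complex-valued \<open>n\<close>-form assigns to each point an alternating \<open>n\<close>-linear map; its coefficient
  in a chart is its value on the coordinate frame.
\<close>

definition form_coeff ::
  "('l, real^'n) chart set \<Rightarrow> ('l, real^'n) chart \<Rightarrow>
   ('l \<Rightarrow> ('n::finite \<Rightarrow> real^'n) \<Rightarrow> complex) \<Rightarrow> real^'n \<Rightarrow> complex" where
  "form_coeff B c \<alpha> x = \<alpha> (cinv c x) (\<lambda>i. from_chart B c (cinv c x) (axis i 1))"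

text \<open>The integral over a compact oriented manifold, by means of finite partitions of unity.\<close>

definition form_integral ::
  "('l::topological_space, real^'n) chart set \<Rightarrow>
   ('l \<Rightarrow> ('n::finite \<Rightarrow> real^'n) \<Rightarrow> complex) \<Rightarrow> complex" where
  "form_integral B \<alpha> = (THE I. \<forall>k c \<psi>. partition_of_unity B k c \<psi> \<longrightarrow>
     I = (\<Sum>i<k. LINT x:cimg (c i)|lborel. \<psi> i (cinv (c i) x) *\<^sub>R form_coeff B (c i) \<alpha> x))"


section \<open>Riemannian and Kaehler geometry of the ambient manifold\<close>

context
  fixes A :: "('m::{t2_space, second_countable_topology}, 'e::euclidean_space) chart set"
    and g :: "'m \<Rightarrow> 'e \<Rightarrow> 'e \<Rightarrow> real"
    and J :: "'m \<Rightarrow> 'e \<Rightarrow> 'e"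
begin

definition metric_in :: "('m, 'e) chart \<Rightarrow> 'e \<Rightarrow> 'e \<Rightarrow> 'e \<Rightarrow> real" where
  "metric_in c x u v =
     g (cinv c x) (from_chart A c (cinv c x) u) (from_chart A c (cinv c x) v)"

definition riemannian_metric :: bool where
  "riemannian_metric \<longleftrightarrow>
     (\<forall>p. bilinear (g p) \<and> (\<forall>u v. g p u v = g p v u) \<and> (\<forall>v. v \<noteq> 0 \<longrightarrow> g p v v > 0)) \<and>
     (\<forall>c\<in>A. \<forall>u v. smooth_on (cimg c) (\<lambda>x. metric_in c x u v))"

text \<open>
  The Levi-Civita connection in a chart: the covariant derivative of the coordinate field
  \<^term>\<open>v\<close> in direction \<^term>\<open>u\<close> at \<^term>\<open>x\<close> is \<open>christoffel c x u v\<close>; it is the only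
  torsion-free (symmetric) choice that is compatible with the metric.
\<close>

definition christoffel :: "('m, 'e) chart \<Rightarrow> 'e \<Rightarrow> 'e \<Rightarrow> 'e \<Rightarrow> 'e" where
  "christoffel c x = (THE \<Gamma>. bilinear \<Gamma> \<and> (\<forall>u v. \<Gamma> u v = \<Gamma> v u) \<and>
     (\<forall>u v w. frechet_derivative (\<lambda>y. metric_in c y u v) (at x) w =
        metric_in c x (\<Gamma> w u) v + metric_in c x u (\<Gamma> w v)))"

text \<open>The curvature \<open>R(u,v)w = \<nabla>\<^sub>u \<nabla>\<^sub>v w - \<nabla>\<^sub>v \<nabla>\<^sub>u w\<close> on coordinate fields.\<close>

definition curvature_in :: "('m, 'e) chart \<Rightarrow> 'e \<Rightarrow> 'e \<Rightarrow> 'e \<Rightarrow> 'e \<Rightarrow> 'e" where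
  "curvature_in c x u v w =
     frechet_derivative (\<lambda>y. christoffel c y v w) (at x) u
     - frechet_derivative (\<lambda>y. christoffel c y u w) (at x) v
     + christoffel c x u (christoffel c x v w) - christoffel c x v (christoffel c x u w)"

definition Ricci :: "'m \<Rightarrow> 'e \<Rightarrow> 'e \<Rightarrow> real" where
  "Ricci p v w = trace_lin (\<lambda>u. curvature_in (chart_at A p) (coord (chart_at A p) p) u v w)"

definition scalar_curvature :: "'m \<Rightarrow> real" where
  "scalar_curvature p = (THE s. \<forall>E. card E = DIM('e) \<and>
     (\<forall>u\<in>E. \<forall>v\<in>E. g p u v = (if u = v then 1 else 0)) \<longrightarrow> s = (\<Sum>e\<in>E. Ricci p e e))"

definition acs_in :: "('m, 'e) chart \<Rightarrow> 'e \<Rightarrow> 'e \<Rightarrow> 'e" where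
  "acs_in c x v = to_chart A c (cinv c x) (J (cinv c x) (from_chart A c (cinv c x) v))"

definition almost_complex_structure :: bool where
  "almost_complex_structure \<longleftrightarrow> (\<forall>p. linear (J p) \<and> (\<forall>v. J p (J p v) = - v)) \<and>
     (\<forall>c\<in>A. \<forall>v. smooth_on (cimg c) (\<lambda>x. acs_in c x v))"

text \<open>Kaehler: Riemannian with an orthogonal almost complex structure that is parallel,
  \<open>\<nabla>\<^sub>u (J v) = J (\<nabla>\<^sub>u v)\<close>.\<close>

definition kaehler_manifold :: bool where
  "kaehler_manifold \<longleftrightarrow> smooth_atlas A \<and> riemannian_metric \<and> almost_complex_structure \<and>
     (\<forall>p u v. g p (J p u) (J p v) = g p u v) \<and>
     (\<forall>c\<in>A. \<forall>x\<in>cimg c. \<forall>u v.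
        frechet_derivative (\<lambda>y. acs_in c y v) (at x) u + christoffel c x u (acs_in c x v)
          = acs_in c x (christoffel c x u v))"

definition kform :: "'m \<Rightarrow> 'e \<Rightarrow> 'e \<Rightarrow> real" where
  "kform p u v = g p (J p u) v"

definition hermitian_form :: "'m \<Rightarrow> 'e \<Rightarrow> 'e \<Rightarrow> complex" where
  "hermitian_form p u v = of_real (g p u v) - \<i> * of_real (kform p u v)"

definition ricci_form :: "'m \<Rightarrow> 'e \<Rightarrow> 'e \<Rightarrow> real" where
  "ricci_form p u v = Ricci p (J p u) v"

definition definite_ricci :: bool where
  "definite_ricci \<longleftrightarrow>
     (\<forall>p v. v \<noteq> 0 \<longrightarrow> Ricci p v v > 0) \<or> (\<forall>p v. v \<noteq> 0 \<longrightarrow> Ricci p v v < 0)"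

definition kaehler_einstein :: bool where
  "kaehler_einstein \<longleftrightarrow> (\<exists>a::real. \<forall>p u v. ricci_form p u v = a * kform p u v)"

text \<open>
  The norm on the complex line \<open>\<Lambda>\<^bsup>(n,0)\<^esup>T\<^sub>p\<^sup>*M\<close>: a form is its value on a unitary basis times the
  wedge product of the dual basis, which has norm 1.
\<close>

definition unitary_basis :: "'m \<Rightarrow> ('n::finite \<Rightarrow> 'e) \<Rightarrow> bool" where
  "unitary_basis p e \<longleftrightarrow> (\<forall>i j. hermitian_form p (e i) (e j) = (if i = j then 1 else 0))"

definition canonical_norm :: "'m \<Rightarrow> (('n::finite \<Rightarrow> 'e) \<Rightarrow> complex) \<Rightarrow> real" where
  "canonical_norm p \<alpha> = (THE r. \<forall>e. unitary_basis p e \<longrightarrow> r = cmod (\<alpha> e))"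

end


section \<open>Totally real immersions\<close>

context
  fixes A :: "('m::{t2_space, second_countable_topology}, 'e::euclidean_space) chart set"
    and g :: "'m \<Rightarrow> 'e \<Rightarrow> 'e \<Rightarrow> real"
    and J :: "'m \<Rightarrow> 'e \<Rightarrow> 'e"
    and B :: "('l::{t2_space, second_countable_topology}, real^'n::finite) chart set"
begin

abbreviation tmap :: "('l \<Rightarrow> 'm) \<Rightarrow> 'l \<Rightarrow> real^'n \<Rightarrow> 'e" where
  "tmap \<iota> \<equiv> tangent_map B A \<iota>"

abbreviation tangent_space :: "('l \<Rightarrow> 'm) \<Rightarrow> 'l \<Rightarrow> 'e set" where
  "tangent_space \<iota> p \<equiv> range (tmap \<iota> p)"

abbreviation J_tangent_space :: "('l \<Rightarrow> 'm) \<Rightarrow> 'l \<Rightarrow> 'e set" where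
  "J_tangent_space \<iota> p \<equiv> J (\<iota> p) ` tangent_space \<iota> p"

definition totally_real_immersion :: "('l \<Rightarrow> 'm) \<Rightarrow> bool" where
  "totally_real_immersion \<iota> \<longleftrightarrow> smooth_map B A \<iota> \<and>
     (\<forall>p. inj (tmap \<iota> p) \<and>
        {a + b | a b. a \<in> tangent_space \<iota> p \<and> b \<in> J_tangent_space \<iota> p} = UNIV \<and>
        tangent_space \<iota> p \<inter> J_tangent_space \<iota> p = {0})"

definition proj_J :: "('l \<Rightarrow> 'm) \<Rightarrow> 'l \<Rightarrow> 'e \<Rightarrow> 'e" where
  "proj_J \<iota> p w = (THE b. b \<in> J_tangent_space \<iota> p \<and> w - b \<in> tangent_space \<iota> p)"

text \<open>The pull-back Levi-Civita connection: covariant derivative at \<^term>\<open>p\<close> in direction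
  \<^term>\<open>X\<close> of a section \<^term>\<open>V\<close> of the pull-back of \<open>TM\<close>.\<close>

definition cov_deriv :: "('l \<Rightarrow> 'm) \<Rightarrow> ('l \<Rightarrow> 'e) \<Rightarrow> 'l \<Rightarrow> real^'n \<Rightarrow> 'e" where
  "cov_deriv \<iota> V p X = (let c = chart_at B p; d = chart_at A (\<iota> p) in
     frechet_derivative (\<lambda>x. to_chart A d (\<iota> (cinv c x)) (V (cinv c x))) (at (coord c p)) X
     + christoffel A g d (coord d (\<iota> p)) (tmap \<iota> p X) (V p))"

text \<open>
  The push-forward by \<^term>\<open>\<iota>\<close> of the vector field near \<^term>\<open>p\<close> that extends \<^term>\<open>v\<close> with constant
  components.  It is only used in expressions that do not depend on the chosen extension.
\<close>

definition extension :: "('l \<Rightarrow> 'm) \<Rightarrow> 'l \<Rightarrow> real^'n \<Rightarrow> 'l \<Rightarrow> 'e" where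
  "extension \<iota> p v q = tmap \<iota> q (from_chart B (chart_at B p) q v)"

definition maslov_form :: "('l \<Rightarrow> 'm) \<Rightarrow> 'l \<Rightarrow> real^'n \<Rightarrow> real" where
  "maslov_form \<iota> p X = trace_lin (\<lambda>v. inv (tmap \<iota> p)
     (J (\<iota> p) (proj_J \<iota> p (cov_deriv \<iota> (extension \<iota> p v) p X))))"


subsection \<open>The canonical section and the J-volume\<close>

text \<open>
  For a basis \<^term>\<open>v\<close> of \<open>T\<^sub>pL\<close>, the \<open>i\<close>-th component of \<open>coframe \<iota> p v w\<close> is
  \<open>v\<^sub>i\<^sup>*(w) + i (J v\<^sub>i)\<^sup>*(w)\<close>; the wedge product of these 1-forms is a determinant.
\<close>

definition coframe :: "('l \<Rightarrow> 'm) \<Rightarrow> 'l \<Rightarrow> ('n \<Rightarrow> real^'n) \<Rightarrow> 'e \<Rightarrow> complex^'n" where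
  "coframe \<iota> p v w = (THE z. w =
     (\<Sum>i\<in>UNIV. Re (z $ i) *\<^sub>R tmap \<iota> p (v i) + Im (z $ i) *\<^sub>R J (\<iota> p) (tmap \<iota> p (v i))))"

definition coframe_wedge ::
  "('l \<Rightarrow> 'm) \<Rightarrow> 'l \<Rightarrow> ('n \<Rightarrow> real^'n) \<Rightarrow> ('n \<Rightarrow> 'e) \<Rightarrow> complex" where
  "coframe_wedge \<iota> p v w = det (\<chi> i j. coframe \<iota> p v (w j) $ i)"

definition Omega_J :: "('l \<Rightarrow> 'm) \<Rightarrow> 'l \<Rightarrow> ('n \<Rightarrow> 'e) \<Rightarrow> complex" where
  "Omega_J \<iota> p = (THE \<Omega>. \<forall>v. positive_basis v \<longrightarrow>
     \<Omega> = (\<lambda>w. coframe_wedge \<iota> p v w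
               / of_real (canonical_norm g J (\<iota> p) (coframe_wedge \<iota> p v))))"

text \<open>
  The connection on the pull-back of \<open>K\<^sub>M\<close>:
  \<open>(\<nabla>\<^sub>X \<Omega>)(w\<^sub>1,\<dots>,w\<^sub>n) = X(\<Omega>(w\<^sub>1,\<dots>,w\<^sub>n)) - \<Sum>\<^sub>j \<Omega>(w\<^sub>1,\<dots>,\<nabla>\<^sub>X w\<^sub>j,\<dots>,w\<^sub>n)\<close>,
  where the \<open>w\<^sub>j\<close> are extended by the sections with constant components in the chart
  \<open>chart_at A (\<iota> p)\<close>.
\<close>

definition cov_deriv_form ::
  "('l \<Rightarrow> 'm) \<Rightarrow> ('l \<Rightarrow> ('n \<Rightarrow> 'e) \<Rightarrow> complex) \<Rightarrow> 'l \<Rightarrow> real^'n \<Rightarrow> ('n \<Rightarrow> 'e) \<Rightarrow> complex" where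
  "cov_deriv_form \<iota> \<Omega> p X w = (let c = chart_at B p; d = chart_at A (\<iota> p);
       W = (\<lambda>j q. from_chart A d (\<iota> q) (w j)) in
     frechet_derivative (\<lambda>x. \<Omega> (cinv c x) (\<lambda>j. W j (cinv c x))) (at (coord c p)) X
     - (\<Sum>j\<in>UNIV. \<Omega> p (w(j := cov_deriv \<iota> (W j) p X))))"

definition parallel_form :: "('l \<Rightarrow> 'm) \<Rightarrow> ('l \<Rightarrow> ('n \<Rightarrow> 'e) \<Rightarrow> complex) \<Rightarrow> bool" where
  "parallel_form \<iota> \<Omega> \<longleftrightarrow> (\<forall>p X w. cov_deriv_form \<iota> \<Omega> p X w = 0)"

definition vol_J :: "('l \<Rightarrow> 'm) \<Rightarrow> 'l \<Rightarrow> ('n \<Rightarrow> real^'n) \<Rightarrow> complex" where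
  "vol_J \<iota> p v = Omega_J \<iota> p (\<lambda>i. tmap \<iota> p (v i))"

text \<open>Real-valued, but typed as the integral of a complex form.\<close>

definition Vol_J :: "('l \<Rightarrow> 'm) \<Rightarrow> complex" where
  "Vol_J \<iota> = form_integral B (vol_J \<iota>)"


subsection \<open>J-minimality and the J-mean curvature\<close>

text \<open>A smooth family of totally real immersions \<open>F t\<close>, \<open>\<bar>t\<bar> < \<epsilon>\<close>, through \<^term>\<open>\<iota>\<close>.\<close>

definition variation :: "('l \<Rightarrow> 'm) \<Rightarrow> real \<Rightarrow> (real \<Rightarrow> 'l \<Rightarrow> 'm) \<Rightarrow> bool" where
  "variation \<iota> \<epsilon> F \<longleftrightarrow> \<epsilon> > 0 \<and> F 0 = \<iota> \<and> (\<forall>t. \<bar>t\<bar> < \<epsilon> \<longrightarrow> totally_real_immersion (F t)) \<and>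
     continuous_on ({-\<epsilon><..<\<epsilon>} \<times> UNIV) (\<lambda>(t, p). F t p) \<and>
     (\<forall>c\<in>B. \<forall>d\<in>A. smooth_on
        {(t, x). \<bar>t\<bar> < \<epsilon> \<and> x \<in> cimg c \<and> F t (cinv c x) \<in> cdom d}
        (\<lambda>(t, x). coord d (F t (cinv c x))))"

definition variation_field :: "(real \<Rightarrow> 'l \<Rightarrow> 'm) \<Rightarrow> 'l \<Rightarrow> 'e" where
  "variation_field F p = vector_derivative (\<lambda>t. coord (chart_at A (F 0 p)) (F t p)) (at 0)"

definition J_minimal :: "('l \<Rightarrow> 'm) \<Rightarrow> bool" where
  "J_minimal \<iota> \<longleftrightarrow>
     (\<forall>\<epsilon> F. variation \<iota> \<epsilon> F \<longrightarrow> ((\<lambda>t. Vol_J (F t)) has_vector_derivative 0) (at 0))"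

definition J_mean_curvature :: "('l \<Rightarrow> 'm) \<Rightarrow> 'l \<Rightarrow> 'e" where
  "J_mean_curvature \<iota> = (THE H. smooth_section_along B A \<iota> H \<and>
     (\<forall>p. H p \<in> J_tangent_space \<iota> p) \<and>
     (\<forall>\<epsilon> F Y. variation \<iota> \<epsilon> F \<and> smooth_vector_field B Y \<and>
        variation_field F = (\<lambda>p. J (\<iota> p) (tmap \<iota> p (Y p))) \<longrightarrow>
        ((\<lambda>t. Vol_J (F t)) has_vector_derivative
           - form_integral B (\<lambda>p v. of_real (g (\<iota> p) (H p) (J (\<iota> p) (tmap \<iota> p (Y p))))
                                    * vol_J \<iota> p v)) (at 0)))"


subsection \<open>Minimal, Lagrangian and Ricci-Lagrangian immersions\<close>

definition normal_part :: "('l \<Rightarrow> 'm) \<Rightarrow> 'l \<Rightarrow> 'e \<Rightarrow> 'e" where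
  "normal_part \<iota> p w =
     (THE \<nu>. (\<forall>u\<in>tangent_space \<iota> p. g (\<iota> p) \<nu> u = 0) \<and> w - \<nu> \<in> tangent_space \<iota> p)"

definition second_fundamental_form :: "('l \<Rightarrow> 'm) \<Rightarrow> 'l \<Rightarrow> real^'n \<Rightarrow> real^'n \<Rightarrow> 'e" where
  "second_fundamental_form \<iota> p X Y =
     normal_part \<iota> p (cov_deriv \<iota> (extension \<iota> p Y) p X)"

text \<open>The trace of the second fundamental form with respect to the induced metric.\<close>

definition mean_curvature :: "('l \<Rightarrow> 'm) \<Rightarrow> 'l \<Rightarrow> 'e" where
  "mean_curvature \<iota> p = (THE H. \<forall>e :: 'n \<Rightarrow> real^'n.
     (\<forall>i j. g (\<iota> p) (tmap \<iota> p (e i)) (tmap \<iota> p (e j)) = (if i = j then 1 else 0)) \<longrightarrow>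
     H = (\<Sum>i\<in>UNIV. second_fundamental_form \<iota> p (e i) (e i)))"

definition minimal_immersion :: "('l \<Rightarrow> 'm) \<Rightarrow> bool" where
  "minimal_immersion \<iota> \<longleftrightarrow> (\<forall>p. mean_curvature \<iota> p = 0)"

definition lagrangian :: "('l \<Rightarrow> 'm) \<Rightarrow> bool" where
  "lagrangian \<iota> \<longleftrightarrow> (\<forall>p u v. kform g J (\<iota> p) (tmap \<iota> p u) (tmap \<iota> p v) = 0)"

definition ricci_lagrangian :: "('l \<Rightarrow> 'm) \<Rightarrow> bool" where
  "ricci_lagrangian \<iota> \<longleftrightarrow>
     (\<forall>p u v. ricci_form A g J (\<iota> p) (tmap \<iota> p u) (tmap \<iota> p v) = 0)"

end

end

theory Submission
  imports Defs
begin

text \<open>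
  In a chart, a totally real map \<open>F\<close> has the complex frame \<open>E\<^sub>i = \<partial>\<^sub>iF\<close> of the pull-back of \<open>TM\<close>.  As the
  connection is complex linear it is given by a matrix \<open>\<omega>\<close> of complex 1-forms, and everything is read
  off from its trace \<open>\<theta>\<close>: the density \<open>\<rho> = (det h(E\<^sub>i,E\<^sub>j))\<^bsup>1/2\<^esup>\<close> satisfies \<open>d\<rho> = \<rho> Re \<theta>\<close>, the Maslov
  form is \<open>\<xi> = - Im \<theta>\<close>, hence \<open>\<nabla>\<Omega> = i \<xi> \<otimes> \<Omega>\<close>, and \<open>d\<theta>\<close> is the complex trace of the curvature, whose
  imaginary part is the Ricci form up to a factor.  So \<open>\<xi> = 0\<close> is equivalent to parallelism of \<open>\<Omega>\<close>
  and implies that the Ricci form vanishes on \<open>L\<close>.  For a Lagrangian immersion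
  \<open>\<langle>\<nabla>\<^sub>XY, JZ\<rangle>\<close> is totally symmetric, so \<open>- \<xi>(X) = \<langle>H, JX\<rangle>\<close> for the mean curvature vector \<open>H\<close>.

  The same computation in space-time, for a variation with velocity \<open>T + JY\<close>, gives
  \<open>\<partial>\<^sub>t\<rho> = div(\<rho> T) + \<rho> \<xi>(Y)\<close>; the divergence integrates to zero, so the first variation of the
  \<open>J\<close>-volume is the integral of \<open>\<xi>(Y)\<close>.  Variations supported in one chart, with \<open>Y\<close> a bump function
  times a constant field, show that \<open>\<xi>\<close> is determined by the first variation.
\<close>

section \<open>Smooth maps between Euclidean spaces\<close>

text \<open>In the frame E the canonical section is \<rho> times the wedge product of the dual
  complex coframe. The connection acts on that wedge product by - \<theta> and the real factor
  \<rho> contributes Re \<theta>, so only - i Im \<theta> survives. In space-time the variation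
  field W has complex coordinates z, and torsion-freeness replaces \<nabla>_t E_i by \<nabla>_i W;
  the trace expresses the time component of \<theta> by derivatives of z and by \<theta> along L.

  Two features of the definitions shape the rest. Tangent vectors are components in a chosen chart
  that jumps with the point, so a pointwise formula can be differentiated only after it has been
  carried to fixed charts; hence the invariance of \<xi> under changes of chart on both manifolds.
  And the connection, \<Omega>, the integral, both mean curvatures and the scalar curvature are
  definite descriptions, so existence and uniqueness come before any computation. In the Einstein
  case a non-zero scalar curvature forces a non-zero Einstein constant, which lets the Ricci form
  detect the Kaehler form on L.\<close>

abbreviation fd :: "('a::real_normed_vector \<Rightarrow> 'b::real_normed_vector) \<Rightarrow> 'a \<Rightarrow> 'a \<Rightarrow> 'b" where
  "fd f x \<equiv> frechet_derivative f (at x)"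

lemma has_derivative_fd: "f differentiable (at x) \<Longrightarrow> (f has_derivative fd f x) (at x)"
  by (simp add: frechet_derivative_works)

lemma fd_eqI: "(f has_derivative f') (at x) \<Longrightarrow> fd f x = f'"
  by (metis frechet_derivative_at)

text \<open>\<open>frechet_derivative\<close> chooses among all derivatives at \<open>x\<close>.
  Functions that agree near \<open>x\<close> have the same derivatives, possibly none, so the choice
  agrees even where nothing is differentiable.\<close>

lemma fd_cong:
  assumes "open S" "x \<in> S" "\<And>y. y \<in> S \<Longrightarrow> f y = g y"
  shows "fd f x = fd g x"
proof -
  have "(f has_derivative h) (at x) \<longleftrightarrow> (g has_derivative h) (at x)" for h
    using assms by (metis has_derivative_transform_within_open)
  then show ?thesis by (simp add: frechet_derivative_def)
qed

lemma differentiable_cong: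
  assumes "open S" "x \<in> S" "\<And>y. y \<in> S \<Longrightarrow> f y = g y" "f differentiable (at x)"
  shows "g differentiable (at x)"
  using assms by (metis differentiable_def has_derivative_transform_within_open)

lemma linear_fd: "f differentiable (at x) \<Longrightarrow> linear (fd f x)"
  by (rule linear_frechet_derivative)

lemma linear_sum_Basis:
  fixes L :: "'a::euclidean_space \<Rightarrow> 'b::real_vector"
  assumes "linear L"
  shows "L v = (\<Sum>b\<in>Basis. (v \<bullet> b) *\<^sub>R L b)"
proof -
  have "L v = L (\<Sum>b\<in>Basis. (v \<bullet> b) *\<^sub>R b)" by (simp add: euclidean_representation)
  also have "\<dots> = (\<Sum>b\<in>Basis. (v \<bullet> b) *\<^sub>R L b)"
    using assms by (simp add: linear_sum linear_cmul)
  finally show ?thesis .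
qed

section \<open>Closure properties of C^k and smooth maps\<close>

lemma Ck_on_cong:
  assumes "open S" "\<And>x. x \<in> S \<Longrightarrow> f x = g x" "Ck_on k S f"
  shows "Ck_on k S g"
  using assms(2,3)
proof (induction k arbitrary: f g)
  case 0
  then show ?case by (auto cong: continuous_on_cong)
next
  case (Suc k)
  have "Ck_on k S (\<lambda>x. fd g x v)" for v
    by (rule Suc.IH[of "\<lambda>x. fd f x v"])
       (use Suc.prems fd_cong[OF \<open>open S\<close>, of _ f g] in \<open>auto\<close>)
  then show ?case using Suc.prems differentiable_cong[OF \<open>open S\<close>] by simp blast
qed

lemma Ck_on_subset: "Ck_on k S f \<Longrightarrow> T \<subseteq> S \<Longrightarrow> Ck_on k T f"
  by (induction k arbitrary: f) (auto intro: continuous_on_subset)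

lemma Ck_on_SucD: "Ck_on (Suc k) S f \<Longrightarrow> Ck_on k S f"
proof (induction k arbitrary: f)
  case 0
  then show ?case
    by (auto intro!: differentiable_imp_continuous_on differentiable_at_imp_differentiable_on)
qed auto

lemma Ck_on_local:
  assumes "\<And>x. x \<in> S \<Longrightarrow> \<exists>T. open T \<and> x \<in> T \<and> Ck_on k T f"
  shows "Ck_on k S f"
  using assms
proof (induction k arbitrary: f)
  case 0
  show ?case
  proof (simp, unfold continuous_on_eq_continuous_within, intro ballI)
    fix x assume "x \<in> S"
    with 0 obtain T where "open T" "x \<in> T" "continuous_on T f" by auto
    then show "continuous (at x within S) f"
      by (meson continuous_at_imp_continuous_at_within continuous_on_eq_continuous_at)
  qed
next
  case (Suc k)
  show ?case
  proof (simp, intro conjI ballI allI)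
    fix x assume "x \<in> S"
    then obtain T where "x \<in> T" "Ck_on (Suc k) T f" using Suc.prems by blast
    then show "f differentiable at x" by simp
  next
    fix v show "Ck_on k S (\<lambda>x. fd f x v)"
    proof (rule Suc.IH)
      fix x assume "x \<in> S"
      then obtain T where "open T" "x \<in> T" "Ck_on (Suc k) T f" using Suc.prems by blast
      then show "\<exists>T. open T \<and> x \<in> T \<and> Ck_on k T (\<lambda>x. fd f x v)" by auto
    qed
  qed
qed

lemma Ck_on_const: "Ck_on k S (\<lambda>x. c)"
  by (induction k arbitrary: c) (auto simp: frechet_derivative_const)

lemma Ck_on_bounded_linear:
  fixes f :: "'a::euclidean_space \<Rightarrow> 'b::real_normed_vector"
  assumes "bounded_linear f" shows "Ck_on k S f"
proof (cases k)
  case 0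
  then show ?thesis using assms by (simp add: linear_continuous_on)
next
  case (Suc j)
  have "fd f x = f" for x using assms by (intro fd_eqI bounded_linear_imp_has_derivative)
  then show ?thesis using Suc assms by (simp add: Ck_on_const bounded_linear_imp_differentiable)
qed

lemma Ck_on_add:
  assumes "open S" "Ck_on k S f" "Ck_on k S g"
  shows "Ck_on k S (\<lambda>x. f x + g x)"
  using assms(2,3)
proof (induction k arbitrary: f g)
  case 0 then show ?case by (auto intro: continuous_on_add)
next
  case (Suc k)
  have eq: "fd (\<lambda>x. f x + g x) x = (\<lambda>v. fd f x v + fd g x v)" if "x \<in> S" for x
    using Suc.prems that by (intro fd_eqI has_derivative_add) (auto intro: has_derivative_fd)
  have "Ck_on k S (\<lambda>x. fd (\<lambda>x. f x + g x) x v)" for v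
    by (rule Ck_on_cong[OF \<open>open S\<close> _ Suc.IH[of "\<lambda>x. fd f x v" "\<lambda>x. fd g x v"]])
       (use Suc.prems eq in auto)
  then show ?case using Suc.prems by (auto intro: differentiable_add)
qed

lemma Ck_on_sum:
  assumes "open S" "\<And>i. i \<in> I \<Longrightarrow> Ck_on k S (f i)"
  shows "Ck_on k S (\<lambda>x. \<Sum>i\<in>I. f i x)"
  using assms(2)
  by (induction I rule: infinite_finite_induct) (auto intro!: Ck_on_add Ck_on_const \<open>open S\<close>)

lemma Ck_on_bilinear:
  assumes "bounded_bilinear h" "open S" "Ck_on k S f" "Ck_on k S g"
  shows "Ck_on k S (\<lambda>x. h (f x) (g x))"
  using assms(3,4)
proof (induction k arbitrary: f g)
  case 0
  then show ?case using bounded_bilinear.continuous_on[OF assms(1)] by auto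
next
  case (Suc k)
  interpret bounded_bilinear h by fact
  have der: "((\<lambda>x. h (f x) (g x)) has_derivative (\<lambda>v. h (f x) (fd g x v) + h (fd f x v) (g x))) (at x)"
    if "x \<in> S" for x
    using Suc.prems that by (intro FDERIV) (auto intro: has_derivative_fd)
  have "Ck_on k S (\<lambda>x. fd (\<lambda>x. h (f x) (g x)) x v)" for v
  proof (rule Ck_on_cong[OF \<open>open S\<close>])
    show "Ck_on k S (\<lambda>x. h (f x) (fd g x v) + h (fd f x v) (g x))"
      using Suc.prems Ck_on_SucD[OF Suc.prems(1)] Ck_on_SucD[OF Suc.prems(2)]
      by (intro Ck_on_add Suc.IH \<open>open S\<close>) auto
  qed (use fd_eqI[OF der] in auto)
  then show ?case using der by (auto simp: differentiable_def)
qed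

lemma Ck_on_compose:
  fixes f :: "'b::euclidean_space \<Rightarrow> 'c::real_normed_vector" and g :: "'a::euclidean_space \<Rightarrow> 'b"
  assumes "open S" "open T" "g ` S \<subseteq> T" "Ck_on k T f" "Ck_on k S g"
  shows "Ck_on k S (\<lambda>x. f (g x))"
  using assms(4,5)
proof (induction k arbitrary: f)
  case 0
  then show ?case using assms(3) by (auto intro: continuous_on_compose2)
next
  case (Suc k)
  have der: "((\<lambda>x. f (g x)) has_derivative (\<lambda>v. fd f (g x) (fd g x v))) (at x)" if "x \<in> S" for x
  proof -
    have "g x \<in> T" using that assms(3) by auto
    then have "(f has_derivative fd f (g x)) (at (g x))" "(g has_derivative fd g x) (at x)"
      using Suc.prems that by (auto intro: has_derivative_fd)
    then show ?thesis using has_derivative_compose by blast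
  qed
  have k: "Ck_on k S g" using Ck_on_SucD[OF Suc.prems(2)] .
  have "Ck_on k S (\<lambda>x. fd (\<lambda>x. f (g x)) x v)" for v
  proof (rule Ck_on_cong[OF \<open>open S\<close>])
    \<comment> \<open>The direction \<open>fd g x v\<close> varies with \<open>x\<close>. Expanding
      it in the basis leaves derivatives of \<open>f\<close> in fixed directions, to which the
      induction hypothesis applies.\<close>
    show "Ck_on k S (\<lambda>x. \<Sum>b\<in>Basis. (fd g x v \<bullet> b) *\<^sub>R fd f (g x) b)"
    proof (intro Ck_on_sum[OF \<open>open S\<close>] Ck_on_bilinear[OF bounded_bilinear_scaleR \<open>open S\<close>])
      fix b :: 'b
      show "Ck_on k S (\<lambda>x. fd g x v \<bullet> b)"
        using Suc.prems(2) by (intro Ck_on_bilinear[OF bounded_bilinear_inner \<open>open S\<close>] Ck_on_const) auto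
      show "Ck_on k S (\<lambda>x. fd f (g x) b)"
        using Suc.prems k by (intro Suc.IH[of "\<lambda>y. fd f y b"]) auto
    qed
    fix x assume x: "x \<in> S"
    then have "linear (fd f (g x))" using Suc.prems assms(3) by (intro linear_fd) auto
    then show "(\<Sum>b\<in>Basis. (fd g x v \<bullet> b) *\<^sub>R fd f (g x) b) = fd (\<lambda>x. f (g x)) x v"
      by (subst fd_eqI[OF der[OF x]]) (rule linear_sum_Basis[symmetric])
  qed
  then show ?case using der by (auto simp: differentiable_def)
qed

lemma smooth_on_open: "smooth_on S f \<Longrightarrow> open S" by (simp add: smooth_on_def)

lemma smooth_onD:
  assumes "smooth_on S f" "x \<in> S"
  shows smooth_on_differentiable: "f differentiable (at x)"
    and smooth_on_has_derivative: "(f has_derivative fd f x) (at x)"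
    and smooth_on_linear_fd: "linear (fd f x)"
proof -
  have "Ck_on (Suc 0) S f" using assms by (auto simp only: smooth_on_def)
  then show "f differentiable (at x)" using assms by simp
  then show "(f has_derivative fd f x) (at x)" "linear (fd f x)"
    by (auto intro: has_derivative_fd linear_fd)
qed

lemma smooth_on_continuous: "smooth_on S f \<Longrightarrow> continuous_on S f"
  unfolding smooth_on_def by (metis Ck_on.simps(1))

lemma smooth_on_fd: "smooth_on S f \<Longrightarrow> smooth_on S (\<lambda>x. fd f x v)"
  unfolding smooth_on_def by (metis Ck_on.simps(2))

lemma smooth_on_cong:
  "smooth_on S f \<Longrightarrow> (\<And>x. x \<in> S \<Longrightarrow> f x = g x) \<Longrightarrow> smooth_on S g"
  unfolding smooth_on_def using Ck_on_cong by metis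

lemma smooth_on_subset: "smooth_on S f \<Longrightarrow> open T \<Longrightarrow> T \<subseteq> S \<Longrightarrow> smooth_on T f"
  unfolding smooth_on_def using Ck_on_subset by metis

lemma smooth_on_local:
  assumes "\<And>x. x \<in> S \<Longrightarrow> \<exists>T. x \<in> T \<and> T \<subseteq> S \<and> smooth_on T f"
  shows "smooth_on S f"
  unfolding smooth_on_def
proof (intro conjI allI)
  have "\<exists>T. open T \<and> x \<in> T \<and> T \<subseteq> S" if "x \<in> S" for x
    using assms[OF that] smooth_on_open by blast
  then show "open S" by (subst open_subopen) blast
  show "Ck_on k S f" for k
  proof (rule Ck_on_local)
    fix x assume "x \<in> S"
    then show "\<exists>T. open T \<and> x \<in> T \<and> Ck_on k T f"
      using assms[of x] unfolding smooth_on_def by blast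
  qed
qed

lemma smooth_on_const [simp]: "open S \<Longrightarrow> smooth_on S (\<lambda>x. c)"
  by (simp add: smooth_on_def Ck_on_const)

lemma smooth_on_bounded_linear: "bounded_linear f \<Longrightarrow> open S \<Longrightarrow> smooth_on S f"
  by (simp add: smooth_on_def Ck_on_bounded_linear)

lemma smooth_on_id [simp]: "open S \<Longrightarrow> smooth_on S (\<lambda>x. x)"
  by (rule smooth_on_bounded_linear) auto

lemma smooth_on_add: "smooth_on S f \<Longrightarrow> smooth_on S g \<Longrightarrow> smooth_on S (\<lambda>x. f x + g x)"
  by (simp add: smooth_on_def Ck_on_add)

lemma smooth_on_sum:
  "open S \<Longrightarrow> (\<And>i. i \<in> I \<Longrightarrow> smooth_on S (f i)) \<Longrightarrow> smooth_on S (\<lambda>x. \<Sum>i\<in>I. f i x)"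
  by (simp add: smooth_on_def Ck_on_sum)

lemma smooth_on_bilinear:
  "bounded_bilinear h \<Longrightarrow> smooth_on S f \<Longrightarrow> smooth_on S g \<Longrightarrow> smooth_on S (\<lambda>x. h (f x) (g x))"
  by (simp add: smooth_on_def Ck_on_bilinear)

lemma smooth_on_compose:
  fixes f :: "'b::euclidean_space \<Rightarrow> 'c::real_normed_vector" and g :: "'a::euclidean_space \<Rightarrow> 'b"
  shows "smooth_on T f \<Longrightarrow> smooth_on S g \<Longrightarrow> g ` S \<subseteq> T \<Longrightarrow> smooth_on S (\<lambda>x. f (g x))"
  unfolding smooth_on_def by (metis Ck_on_compose)

lemma smooth_on_linear_compose:
  fixes g :: "'a::euclidean_space \<Rightarrow> 'b::euclidean_space"
  assumes "bounded_linear f" "smooth_on S g"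
  shows "smooth_on S (\<lambda>x. f (g x))"
  by (rule smooth_on_compose[OF smooth_on_bounded_linear[OF assms(1) open_UNIV] assms(2)]) auto

lemmas smooth_on_scaleR = smooth_on_bilinear[OF bounded_bilinear_scaleR]
lemmas smooth_on_mult = smooth_on_bilinear[OF bounded_bilinear_mult]
lemmas smooth_on_inner = smooth_on_bilinear[OF bounded_bilinear_inner]

lemma smooth_on_minus: "smooth_on S f \<Longrightarrow> smooth_on S (\<lambda>x. - f x)"
  using smooth_on_scaleR[of S "\<lambda>x. -1" f] smooth_on_open by force

lemma smooth_on_diff: "smooth_on S f \<Longrightarrow> smooth_on S g \<Longrightarrow> smooth_on S (\<lambda>x. f x - g x)"
  using smooth_on_add[OF _ smooth_on_minus, of S f g] by simp

lemma smooth_on_Basis: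
  fixes f :: "'a::euclidean_space \<Rightarrow> 'b::euclidean_space"
  assumes "open S" "\<And>b. b \<in> Basis \<Longrightarrow> smooth_on S (\<lambda>x. f x \<bullet> b)"
  shows "smooth_on S f"
proof (rule smooth_on_cong)
  show "smooth_on S (\<lambda>x. \<Sum>b\<in>Basis. (f x \<bullet> b) *\<^sub>R b)"
    by (intro smooth_on_sum smooth_on_scaleR assms smooth_on_const)
qed (simp add: euclidean_representation)

lemma smooth_on_Pair:
  fixes f :: "'a::euclidean_space \<Rightarrow> 'b::euclidean_space" and g :: "'a \<Rightarrow> 'c::euclidean_space"
  assumes "smooth_on S f" "smooth_on S g"
  shows "smooth_on S (\<lambda>x. (f x, g x))"
proof (rule smooth_on_Basis[OF smooth_on_open[OF assms(1)]])
  fix b :: "'b \<times> 'c"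
  show "smooth_on S (\<lambda>x. (f x, g x) \<bullet> b)"
    using assms smooth_on_open[OF assms(1)]
    by (cases b) (auto simp: inner_Pair intro!: smooth_on_add smooth_on_inner)
qed

text \<open>Smoothness of a field of linear maps always means smoothness of its values on fixed
  vectors; expanding the argument in the basis passes to arguments that vary smoothly.\<close>

lemma smooth_on_linear_app:
  fixes V :: "'a::euclidean_space \<Rightarrow> 'b::euclidean_space" and L :: "'a \<Rightarrow> 'b \<Rightarrow> 'c::real_normed_vector"
  assumes "\<And>x. x \<in> S \<Longrightarrow> linear (L x)" "\<And>b. smooth_on S (\<lambda>x. L x b)" "smooth_on S V"
  shows "smooth_on S (\<lambda>x. L x (V x))"
proof (rule smooth_on_cong)
  show "smooth_on S (\<lambda>x. \<Sum>b\<in>Basis. (V x \<bullet> b) *\<^sub>R L x b)"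
    using smooth_on_open[OF assms(3)]
    by (intro smooth_on_sum smooth_on_scaleR smooth_on_inner assms smooth_on_const)
qed (use assms(1) linear_sum_Basis in metis)

text \<open>Product rule for a field of linear maps. The field is never regarded as a map into a
  space of operators, so its derivative appears as that of \<open>L y (V x)\<close>, with the
  argument frozen at \<open>x\<close>.\<close>

lemma fd_linear_app:
  fixes V :: "'a::euclidean_space \<Rightarrow> 'b::euclidean_space" and L :: "'a \<Rightarrow> 'b \<Rightarrow> 'c::real_normed_vector"
  assumes "open S" "\<And>x. x \<in> S \<Longrightarrow> linear (L x)" "\<And>b. smooth_on S (\<lambda>x. L x b)" "smooth_on S V" "x \<in> S"
  shows "((\<lambda>y. L y (V y)) has_derivative (\<lambda>u. fd (\<lambda>y. L y (V x)) x u + L x (fd V x u))) (at x)"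
proof -
  have d1: "((\<lambda>y. \<Sum>b\<in>Basis. (w y \<bullet> b) *\<^sub>R L y b) has_derivative
     (\<lambda>u. \<Sum>b\<in>Basis. (w x \<bullet> b) *\<^sub>R fd (\<lambda>y. L y b) x u + (fd w x u \<bullet> b) *\<^sub>R L x b)) (at x)"
    if "smooth_on S w" for w
  proof (rule has_derivative_sum)
    fix b :: 'b
    have 1: "((\<lambda>y. w y \<bullet> b) has_derivative (\<lambda>u. fd w x u \<bullet> b)) (at x)"
      by (intro has_derivative_inner_left smooth_on_has_derivative[OF that assms(5)])
    show "((\<lambda>y. (w y \<bullet> b) *\<^sub>R L y b) has_derivative
       (\<lambda>u. (w x \<bullet> b) *\<^sub>R fd (\<lambda>y. L y b) x u + (fd w x u \<bullet> b) *\<^sub>R L x b)) (at x)"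
      by (rule has_derivative_scaleR[OF 1 smooth_on_has_derivative[OF assms(3,5)]])
  qed
  have d2: "((\<lambda>y. L y (w y)) has_derivative
     (\<lambda>u. \<Sum>b\<in>Basis. (w x \<bullet> b) *\<^sub>R fd (\<lambda>y. L y b) x u + (fd w x u \<bullet> b) *\<^sub>R L x b)) (at x)"
    if "smooth_on S w" for w
    by (rule has_derivative_transform_within_open[OF d1[OF that] \<open>open S\<close> \<open>x \<in> S\<close>])
       (use assms(2) linear_sum_Basis in metis)
  have e: "fd (\<lambda>y. L y (V x)) x u = (\<Sum>b\<in>Basis. (V x \<bullet> b) *\<^sub>R fd (\<lambda>y. L y b) x u)" for u
    using fd_eqI[OF d2[of "\<lambda>_. V x"]] \<open>open S\<close> by (simp add: frechet_derivative_const)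
  have "(\<lambda>u. \<Sum>b\<in>Basis. (V x \<bullet> b) *\<^sub>R fd (\<lambda>y. L y b) x u + (fd V x u \<bullet> b) *\<^sub>R L x b) =
     (\<lambda>u. fd (\<lambda>y. L y (V x)) x u + L x (fd V x u))"
    by (rule ext, subst linear_sum_Basis[OF assms(2)[OF assms(5)]]) (simp add: e sum.distrib)
  then show ?thesis using d2[OF assms(4)] by simp
qed

lemma linear_fd_arg:
  fixes L :: "'a::euclidean_space \<Rightarrow> 'b::euclidean_space \<Rightarrow> 'c::real_normed_vector"
  assumes "open S" "\<And>x. x \<in> S \<Longrightarrow> linear (L x)" "\<And>b. smooth_on S (\<lambda>x. L x b)" "x \<in> S"
  shows "linear (\<lambda>w. fd (\<lambda>y. L y w) x u)"
proof (rule linearI)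
  fix a b :: 'b and r :: real
  have "fd (\<lambda>y. L y (a + b)) x = fd (\<lambda>y. L y a + L y b) x"
    by (rule fd_cong[OF assms(1,4)]) (rule linear_add[OF assms(2)])
  also have "\<dots> = (\<lambda>u. fd (\<lambda>y. L y a) x u + fd (\<lambda>y. L y b) x u)"
    by (intro fd_eqI has_derivative_add smooth_on_has_derivative[OF assms(3,4)])
  finally show "fd (\<lambda>y. L y (a + b)) x u = fd (\<lambda>y. L y a) x u + fd (\<lambda>y. L y b) x u" by simp
  have "fd (\<lambda>y. L y (r *\<^sub>R a)) x = fd (\<lambda>y. r *\<^sub>R L y a) x"
    by (rule fd_cong[OF assms(1,4)]) (rule linear_cmul[OF assms(2)])
  also have "\<dots> = (\<lambda>u. r *\<^sub>R fd (\<lambda>y. L y a) x u)"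
    by (intro fd_eqI has_derivative_scaleR_right smooth_on_has_derivative[OF assms(3,4)])
  finally show "fd (\<lambda>y. L y (r *\<^sub>R a)) x u = r *\<^sub>R fd (\<lambda>y. L y a) x u" by simp
qed

section \<open>Linear systems that depend smoothly on a parameter\<close>

lemma linear_bij_inv:
  fixes L :: "'a::real_vector \<Rightarrow> 'b::real_vector"
  assumes "linear L" "bij L"
  shows "linear (inv L)"
proof (rule linearI)
  have L: "L (inv L y) = y" for y using assms(2) by (simp add: bij_is_surj surj_f_inv_f)
  have R: "inv L (L x) = x" for x using assms(2) by (simp add: bij_is_inj inv_f_f)
  show "inv L (a + b) = inv L a + inv L b" for a b
    using R[of "inv L a + inv L b"] by (simp add: linear_add[OF assms(1)] L)
  show "inv L (r *\<^sub>R a) = r *\<^sub>R inv L a" for a r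
    using R[of "r *\<^sub>R inv L a"] by (simp add: linear_cmul[OF assms(1)] L)
qed

text \<open>\<open>norm (L u)\<close> attains its minimum on the compact unit sphere, and
  injectivity makes that minimum positive.\<close>

lemma linear_iso_bound_below:
  fixes L :: "'a::euclidean_space \<Rightarrow> 'b::real_normed_vector"
  assumes "linear L" "inj L"
  obtains m where "m > 0" "\<And>u. m * norm u \<le> norm (L u)"
proof (cases "\<exists>u::'a. norm u = 1")
  case True
  have ne: "sphere (0::'a) 1 \<noteq> {}" using True by (auto simp: sphere_def dist_norm)
  have "continuous_on (sphere 0 1) (\<lambda>u. norm (L u))"
    using assms(1) by (intro continuous_on_norm linear_continuous_on linear_conv_bounded_linear[THEN iffD1])
  then obtain u0 where u0: "u0 \<in> sphere 0 1" "\<And>u. u \<in> sphere 0 1 \<Longrightarrow> norm (L u0) \<le> norm (L u)"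
    using continuous_attains_inf[OF compact_sphere ne] by blast
  have "L u0 \<noteq> 0" using assms u0(1) linear_injective_0 by fastforce
  moreover have "norm (L u0) * norm u \<le> norm (L u)" for u
  proof (cases "u = 0")
    case False
    then have "norm (L u0) \<le> norm (L ((1 / norm u) *\<^sub>R u))" by (intro u0) auto
    also have "\<dots> = norm (L u) / norm u" using assms(1) by (simp add: linear_cmul)
    finally show ?thesis using False by (simp add: field_simps)
  qed (use assms(1) in \<open>simp add: linear_0\<close>)
  ultimately show ?thesis using that[of "norm (L u0)"] by auto
next
  case False
  have "u = 0" for u :: 'a
  proof (rule ccontr)
    assume "u \<noteq> 0" then have "norm ((1 / norm u) *\<^sub>R u) = 1" by simp
    then show False using False by blast
  qed
  then show ?thesis using that[of 1] by (metis norm_zero mult_zero_right norm_ge_zero zero_less_one)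
qed

text \<open>Injectivity is an open condition, with a locally uniform constant: near
  \<open>x0\<close> the maps differ from \<open>L x0\<close> by at most \<open>m / 2\<close> in the
  sum of the deviations on the basis, which costs half of the lower bound.\<close>

lemma linear_family_bound_below:
  fixes L :: "'p::t2_space \<Rightarrow> 'a::euclidean_space \<Rightarrow> 'b::real_normed_vector"
  assumes lin: "\<And>x. x \<in> S \<Longrightarrow> linear (L x)" and cont: "\<And>u. continuous_on S (\<lambda>x. L x u)"
    and "open S" "x0 \<in> S" "inj (L x0)"
  obtains m where "m > 0" "\<forall>\<^sub>F x in nhds x0. x \<in> S \<and> (\<forall>u. m * norm u \<le> norm (L x u))"
proof -
  obtain m where m: "m > 0" "\<And>u. m * norm u \<le> norm (L x0 u)"
    using linear_iso_bound_below[OF lin[OF \<open>x0 \<in> S\<close>] \<open>inj (L x0)\<close>] by blast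
  have tend: "((\<lambda>x. \<Sum>b\<in>Basis. norm (L x b - L x0 b)) \<longlongrightarrow> (\<Sum>b\<in>Basis. norm (L x0 b - L x0 b))) (at x0)"
  proof (intro tendsto_sum tendsto_norm tendsto_diff tendsto_const)
    fix b have "isCont (\<lambda>x. L x b) x0"
      using cont[of b] assms(3,4) by (simp add: continuous_on_eq_continuous_at)
    then show "((\<lambda>x. L x b) \<longlongrightarrow> L x0 b) (at x0)" by (rule isContD)
  qed
  then have "\<forall>\<^sub>F x in at x0. (\<Sum>b\<in>Basis. norm (L x b - L x0 b)) < m / 2"
    using m(1) by (intro order_tendstoD(2)[OF tend]) auto
  then have "\<forall>\<^sub>F x in nhds x0. (\<Sum>b\<in>Basis. norm (L x b - L x0 b)) < m / 2"
    unfolding eventually_at_filter by (rule eventually_mono) (use m(1) in auto)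
  moreover have "\<forall>\<^sub>F x in nhds x0. x \<in> S" using assms(3,4) by (simp add: eventually_nhds_in_open)
  ultimately have "\<forall>\<^sub>F x in nhds x0. x \<in> S \<and> (\<forall>u. (m/2) * norm u \<le> norm (L x u))"
  proof eventually_elim
    case (elim x)
    have "(m/2) * norm u \<le> norm (L x u)" for u
    proof -
      have "L x u - L x0 u = (\<Sum>b\<in>Basis. (u \<bullet> b) *\<^sub>R (L x b - L x0 b))"
        using linear_sum_Basis[OF lin[OF elim(2)], of u] linear_sum_Basis[OF lin[OF assms(4)], of u]
        by (simp add: sum_subtractf[symmetric] scaleR_right_diff_distrib)
      also have "norm \<dots> \<le> (\<Sum>b\<in>Basis. norm u * norm (L x b - L x0 b))"
        by (rule sum_norm_le) (auto intro!: mult_right_mono Basis_le_norm)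
      also have "\<dots> \<le> norm u * (m / 2)"
        unfolding sum_distrib_left[symmetric] using elim by (intro mult_left_mono) auto
      finally have "norm (L x u - L x0 u) \<le> norm u * (m / 2)" .
      moreover have "norm (L x0 u) \<le> norm (L x u) + norm (L x u - L x0 u)"
        by (metis norm_triangle_sub norm_minus_commute)
      ultimately show ?thesis using m(2)[of u] by (simp add: field_simps)
    qed
    then show ?case using elim by blast
  qed
  then show ?thesis using that[of "m/2"] m(1) by simp
qed

text \<open>The formula comes from formally differentiating \<open>L x (v x) = b x\<close>. That
  \<open>v\<close> is differentiable at all is the point: \<open>L (x0 + h)\<close> maps the
  remainder of \<open>v\<close> to something of higher order than \<open>h\<close>, and the locally
  uniform lower bound for \<open>L\<close> carries this back to the remainder.\<close>

lemma linear_system_has_derivative: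
  fixes L :: "'p::euclidean_space \<Rightarrow> 'a::euclidean_space \<Rightarrow> 'b::euclidean_space"
  assumes "open S" and lin: "\<And>x. x \<in> S \<Longrightarrow> linear (L x)" and inj: "\<And>x. x \<in> S \<Longrightarrow> bij (L x)"
    and sm: "\<And>u. smooth_on S (\<lambda>x. L x u)" and b: "b differentiable (at x0)"
    and eq: "\<And>x. x \<in> S \<Longrightarrow> L x (v x) = b x" and x0: "x0 \<in> S"
  shows "(v has_derivative (\<lambda>h. inv (L x0) (fd b x0 h - fd (\<lambda>x. L x (v x0)) x0 h))) (at x0)"
proof -
  obtain m where m: "m > 0" "\<forall>\<^sub>F x in nhds x0. x \<in> S \<and> (\<forall>u. m * norm u \<le> norm (L x u))"
    using linear_family_bound_below[OF lin smooth_on_continuous[OF sm] \<open>open S\<close> x0 bij_is_inj[OF inj[OF x0]]] by blast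
  define D where "D h = inv (L x0) (fd b x0 h - fd (\<lambda>x. L x (v x0)) x0 h)" for h
  have LD: "L x0 (D h) = fd b x0 h - fd (\<lambda>x. L x (v x0)) x0 h" for h
    unfolding D_def by (rule surj_f_inv_f[OF bij_is_surj[OF inj[OF x0]]])
  have linD: "linear D"
  proof -
    have "linear (\<lambda>h. fd b x0 h - fd (\<lambda>x. L x (v x0)) x0 h)"
      by (intro linear_compose_sub linear_fd[OF b] smooth_on_linear_fd[OF sm x0])
    from linear_compose[OF this linear_bij_inv[OF lin[OF x0] inj[OF x0]]]
    show ?thesis by (simp add: D_def[abs_def] o_def)
  qed
  have "((\<lambda>h. norm (v (x0 + h) - v x0 - D h) / norm h) \<longlongrightarrow> 0) (at 0)"
  proof -
    \<comment> \<open>\<open>L (x0 + h)\<close> applied to the remainder of \<open>v\<close> equals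
      \<open>e1 h - e2 h\<close>, the remainders of \<open>b\<close> and of
      \<open>L _ (v x0)\<close>, minus the change of \<open>L\<close> on \<open>D h\<close>; the
      latter is at most \<open>norm h * e3 h\<close>, and \<open>e3\<close> tends to 0.\<close>
    define e1 where "e1 h = b (x0 + h) - b x0 - fd b x0 h" for h
    define e2 where "e2 h = L (x0+h) (v x0) - L x0 (v x0) - fd (\<lambda>x. L x (v x0)) x0 h" for h
    define e3 where "e3 h = (\<Sum>c\<in>Basis. norm (L (x0+h) (D c) - L x0 (D c)))" for h
    have t1: "((\<lambda>h. norm (e1 h) / norm h) \<longlongrightarrow> 0) (at 0)"
      using has_derivative_fd[OF b] unfolding e1_def has_derivative_at by auto
    have t2: "((\<lambda>h. norm (e2 h) / norm h) \<longlongrightarrow> 0) (at 0)"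
      using smooth_on_has_derivative[OF sm x0] unfolding e2_def has_derivative_at by auto
    have t3: "(e3 \<longlongrightarrow> 0) (at 0)"
    proof -
      have "((\<lambda>h. L (x0 + h) (D c)) \<longlongrightarrow> L x0 (D c)) (at 0)" for c
        using smooth_on_continuous[OF sm[of "D c"]] x0 \<open>open S\<close>
        by (intro LIM_offset_zero isContD) (simp add: continuous_on_eq_continuous_at)
      then have "(e3 \<longlongrightarrow> (\<Sum>c\<in>Basis. norm (L x0 (D c) - L x0 (D c)))) (at 0)"
        unfolding e3_def by (intro tendsto_sum tendsto_norm tendsto_diff tendsto_const)
      then show ?thesis by simp
    qed
    have "((\<lambda>h. (norm (e1 h) / norm h + norm (e2 h) / norm h + e3 h) / m) \<longlongrightarrow> (0 + 0 + 0) / m) (at 0)"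
      using m(1) by (intro tendsto_divide tendsto_add t1 t2 t3 tendsto_const) auto
    then have t: "((\<lambda>h. (norm (e1 h) / norm h + norm (e2 h) / norm h + e3 h) / m) \<longlongrightarrow> 0) (at 0)" by simp
    have "\<forall>\<^sub>F h in at 0. x0 + h \<in> S \<and> (\<forall>u. m * norm u \<le> norm (L (x0 + h) u))"
    proof -
      have "filterlim (\<lambda>h. x0 + h) (nhds x0) (at 0)"
        using tendsto_add[OF tendsto_const tendsto_ident_at, of x0 0 UNIV] by simp
      from eventually_compose_filterlim[OF m(2) this] show ?thesis .
    qed
    moreover have "\<forall>\<^sub>F h in at (0::'p). h \<noteq> 0" by (simp add: eventually_at_filter)
    ultimately have ev: "\<forall>\<^sub>F h in at 0. norm (v (x0 + h) - v x0 - D h) / norm h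
       \<le> (norm (e1 h) / norm h + norm (e2 h) / norm h + e3 h) / m"
    proof eventually_elim
      case (elim h)
      then have S: "x0 + h \<in> S" by simp
      have l: "linear (L (x0 + h))" using lin[OF S] .
      have "L (x0+h) (v (x0 + h) - v x0 - D h) = e1 h - e2 h - (L (x0+h) (D h) - L x0 (D h))"
        using eq[OF S] eq[OF x0] LD by (simp add: linear_diff[OF l] e1_def e2_def)
      moreover have "norm (L (x0+h) (D h) - L x0 (D h)) \<le> norm h * e3 h"
      proof -
        have eqd: "D h = (\<Sum>c\<in>Basis. (h \<bullet> c) *\<^sub>R D c)" by (rule linear_sum_Basis[OF linD])
        have "L y (D h) = (\<Sum>c\<in>Basis. (h \<bullet> c) *\<^sub>R L y (D c))" if "y \<in> S" for y
          by (subst eqd) (simp add: linear_sum[OF lin[OF that]] linear_cmul[OF lin[OF that]])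
        then have "L (x0+h) (D h) - L x0 (D h) = (\<Sum>c\<in>Basis. (h \<bullet> c) *\<^sub>R (L (x0+h) (D c) - L x0 (D c)))"
          using S x0 by (simp add: sum_subtractf[symmetric] scaleR_right_diff_distrib)
        also have "norm \<dots> \<le> (\<Sum>c\<in>Basis. norm h * norm (L (x0+h) (D c) - L x0 (D c)))"
          by (rule sum_norm_le) (auto intro!: mult_right_mono Basis_le_norm)
        finally show ?thesis by (simp add: e3_def sum_distrib_left)
      qed
      ultimately have "norm (L (x0+h) (v (x0 + h) - v x0 - D h)) \<le> norm (e1 h) + norm (e2 h) + norm h * e3 h"
        by (smt (verit) norm_triangle_ineq4)
      then have "m * norm (v (x0 + h) - v x0 - D h) \<le> norm (e1 h) + norm (e2 h) + norm h * e3 h"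
        using elim by (meson order_trans)
      then show ?case using elim m(1) by (simp add: field_simps)
    qed
    show ?thesis
      by (rule tendsto_sandwich[OF _ ev tendsto_const t]) auto
  qed
  then show ?thesis unfolding D_def[symmetric] has_derivative_at
    using linD linear_conv_bounded_linear by blast
qed

text \<open>The lower bound gives
  \<open>m * norm (v x - v x0) \<le> norm (b x - L x (v x0))\<close>, and the right-hand side is
  continuous in \<open>x\<close> and vanishes at \<open>x0\<close>.\<close>

lemma continuous_on_linear_system:
  fixes L :: "'p::euclidean_space \<Rightarrow> 'a::euclidean_space \<Rightarrow> 'b::euclidean_space"
  assumes "open S" and lin: "\<And>x. x \<in> S \<Longrightarrow> linear (L x)" and inj: "\<And>x. x \<in> S \<Longrightarrow> inj (L x)"
    and cont: "\<And>u. continuous_on S (\<lambda>x. L x u)" and b: "continuous_on S b"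
    and eq: "\<And>x. x \<in> S \<Longrightarrow> L x (v x) = b x"
  shows "continuous_on S v"
  unfolding continuous_on_eq_continuous_at[OF \<open>open S\<close>]
proof
  fix x0 assume x0: "x0 \<in> S"
  obtain m where m: "m > 0" "\<forall>\<^sub>F x in nhds x0. x \<in> S \<and> (\<forall>u. m * norm u \<le> norm (L x u))"
    using linear_family_bound_below[OF lin cont \<open>open S\<close> x0 inj[OF x0]] by blast
  have c: "isCont b x0" "isCont (\<lambda>x. L x (v x0)) x0"
    using b cont[of "v x0"] x0 \<open>open S\<close> by (auto simp: continuous_on_eq_continuous_at)
  have "((\<lambda>x. norm (b x - L x (v x0)) / m) \<longlongrightarrow> norm (b x0 - L x0 (v x0)) / m) (at x0)"
    using m(1) by (intro tendsto_divide tendsto_norm tendsto_diff tendsto_const isContD[OF c(1)] isContD[OF c(2)]) auto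
  then have t: "((\<lambda>x. norm (b x - L x (v x0)) / m) \<longlongrightarrow> 0) (at x0)" by (simp add: eq x0)
  have "\<forall>\<^sub>F x in at x0. norm (v x - v x0) \<le> norm (b x - L x (v x0)) / m"
    unfolding eventually_at_filter
    using m(2)
  proof eventually_elim
    case (elim x)
    then have "m * norm (v x - v x0) \<le> norm (L x (v x - v x0))" by blast
    also have "L x (v x - v x0) = b x - L x (v x0)" using elim by (simp add: linear_diff[OF lin] eq)
    finally show ?case using m(1) by (simp add: field_simps)
  qed
  then have "((\<lambda>x. norm (v x - v x0)) \<longlongrightarrow> 0) (at x0)"
    by (intro tendsto_sandwich[OF _ _ tendsto_const t]) auto
  then show "isCont v x0" by (simp add: isCont_def LIM_zero_iff tendsto_norm_zero_iff)
qed

text \<open>The derivative of the solution again solves a linear system with the same left-hand side,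
  so that its smoothness follows by induction on the order of differentiability.\<close>

lemma Ck_on_linear_system:
  fixes L :: "'p::euclidean_space \<Rightarrow> 'a::euclidean_space \<Rightarrow> 'b::euclidean_space"
  assumes "open S" and lin: "\<And>x. x \<in> S \<Longrightarrow> linear (L x)" and bij: "\<And>x. x \<in> S \<Longrightarrow> bij (L x)"
    and sm: "\<And>u. smooth_on S (\<lambda>x. L x u)"
    and "\<And>x. x \<in> S \<Longrightarrow> L x (v x) = b x" "Ck_on k S b"
  shows "Ck_on k S v"
  using assms(5,6)
proof (induction k arbitrary: v b)
  case 0
  then show ?case
    using continuous_on_linear_system[OF assms(1) lin bij_is_inj[OF bij] smooth_on_continuous[OF sm]] by auto
next
  case (Suc k)
  have der: "(v has_derivative (\<lambda>h. inv (L x) (fd b x h - fd (\<lambda>y. L y (v x)) x h))) (at x)"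
    if "x \<in> S" for x
    using Suc.prems that by (intro linear_system_has_derivative[OF assms(1) lin bij sm _ _ that]) auto
  have v: "Ck_on k S v" using Suc.IH Suc.prems Ck_on_SucD by blast
  have "Ck_on k S (\<lambda>x. fd v x h)" for h
  proof (rule Suc.IH)
    fix x assume x: "x \<in> S"
    have "fd (\<lambda>y. L y (v x)) x h = (\<Sum>c\<in>Basis. (v x \<bullet> c) *\<^sub>R fd (\<lambda>y. L y c) x h)"
      by (rule linear_sum_Basis[OF linear_fd_arg[OF assms(1) lin sm x]])
    then show "L x (fd v x h) = fd b x h - (\<Sum>c\<in>Basis. (v x \<bullet> c) *\<^sub>R fd (\<lambda>y. L y c) x h)"
      using bij[OF x] by (simp add: fd_eqI[OF der[OF x]] bij_is_surj surj_f_inv_f)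
  next
    have "Ck_on k S (\<lambda>x. fd b x h + (\<Sum>c\<in>Basis. (v x \<bullet> c) *\<^sub>R (- fd (\<lambda>y. L y c) x h)))"
    proof (intro Ck_on_add[OF \<open>open S\<close>] Ck_on_sum[OF \<open>open S\<close>] Ck_on_bilinear[OF bounded_bilinear_scaleR \<open>open S\<close>]
        Ck_on_bilinear[OF bounded_bilinear_inner \<open>open S\<close>] v Ck_on_const)
      show "Ck_on k S (\<lambda>x. - fd (\<lambda>y. L y c) x h)" for c
        using smooth_on_minus[OF smooth_on_fd[OF sm[of c]]] by (simp add: smooth_on_def)
    qed (use Suc.prems in auto)
    then show "Ck_on k S (\<lambda>x. fd b x h - (\<Sum>c\<in>Basis. (v x \<bullet> c) *\<^sub>R fd (\<lambda>y. L y c) x h))"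
      by (simp add: sum_negf)
  qed
  then show ?case using der by (auto simp: differentiable_def)
qed

lemma smooth_on_linear_system:
  fixes L :: "'p::euclidean_space \<Rightarrow> 'a::euclidean_space \<Rightarrow> 'b::euclidean_space"
  assumes "\<And>x. x \<in> S \<Longrightarrow> linear (L x)" "\<And>x. x \<in> S \<Longrightarrow> bij (L x)"
    and "\<And>u. smooth_on S (\<lambda>x. L x u)" "smooth_on S b" "\<And>x. x \<in> S \<Longrightarrow> L x (v x) = b x"
  shows "smooth_on S v"
  using Ck_on_linear_system[of S L v b] assms unfolding smooth_on_def by blast

section \<open>Symmetry of second derivatives\<close>

lemma has_real_derivative_along:
  fixes f :: "'a::euclidean_space \<Rightarrow> real"
  assumes "smooth_on S f" "a + t *\<^sub>R u \<in> S"
  shows "((\<lambda>s. f (a + s *\<^sub>R u)) has_real_derivative fd f (a + t *\<^sub>R u) u) (at t)"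
proof -
  have "((\<lambda>s. a + s *\<^sub>R u) has_derivative (\<lambda>s. s *\<^sub>R u)) (at t)"
    by (auto intro!: derivative_eq_intros)
  from has_derivative_compose[OF this smooth_on_has_derivative[OF assms]]
  have "((\<lambda>s. f (a + s *\<^sub>R u)) has_derivative (\<lambda>s. fd f (a + t *\<^sub>R u) (s *\<^sub>R u))) (at t)" .
  moreover have "(\<lambda>s. fd f (a + t *\<^sub>R u) (s *\<^sub>R u)) = (\<lambda>s. fd f (a + t *\<^sub>R u) u * s)"
    by (simp add: linear_cmul[OF smooth_on_linear_fd[OF assms]] fun_eq_iff)
  ultimately show ?thesis by (simp add: has_field_derivative_def)
qed

text \<open>Two applications of the mean value theorem: along \<open>u\<close> to the increment of
  \<open>f\<close> in direction \<open>v\<close>, then along \<open>v\<close> to the derivative in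
  direction \<open>u\<close>.\<close>

lemma second_difference_mean_value:
  fixes f :: "'a::euclidean_space \<Rightarrow> real"
  assumes sm: "smooth_on S f" and ball: "ball x r \<subseteq> S" and h: "0 < h" "h * (norm u + norm v) < r"
  obtains y where "dist x y \<le> h * (norm u + norm v)"
    "f (x + h *\<^sub>R u + h *\<^sub>R v) - f (x + h *\<^sub>R u) - f (x + h *\<^sub>R v) + f x
       = h * h * fd (\<lambda>y. fd f y u) y v"
proof -
  have inS: "x + s *\<^sub>R u + t *\<^sub>R v \<in> S" and
    dst: "dist x (x + s *\<^sub>R u + t *\<^sub>R v) \<le> h * (norm u + norm v)"
    if "0 \<le> s" "s \<le> h" "0 \<le> t" "t \<le> h" for s t
  proof -
    have "dist x (x + s *\<^sub>R u + t *\<^sub>R v) = norm (s *\<^sub>R u + t *\<^sub>R v)"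
      by (simp add: dist_norm norm_minus_commute algebra_simps)
    also have "\<dots> \<le> s * norm u + t * norm v"
      using norm_triangle_ineq[of "s *\<^sub>R u" "t *\<^sub>R v"] that by simp
    also have "\<dots> \<le> h * (norm u + norm v)"
      using that by (simp add: distrib_left add_mono mult_right_mono)
    finally show "dist x (x + s *\<^sub>R u + t *\<^sub>R v) \<le> h * (norm u + norm v)" .
    then show "x + s *\<^sub>R u + t *\<^sub>R v \<in> S" using h(2) ball by auto
  qed
  define \<phi> where "\<phi> s = f ((x + h *\<^sub>R v) + s *\<^sub>R u) - f (x + s *\<^sub>R u)" for s
  have "(\<phi> has_real_derivative fd f ((x + h *\<^sub>R v) + s *\<^sub>R u) u - fd f (x + s *\<^sub>R u) u) (at s)"
    if "0 \<le> s" "s \<le> h" for s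
    unfolding \<phi>_def using inS[of s h] inS[of s 0] that h
    by (intro DERIV_diff has_real_derivative_along[OF sm]) (auto simp: algebra_simps)
  from MVT2[OF h(1) this] obtain s where s: "0 < s" "s < h"
    "\<phi> h - \<phi> 0 = h * (fd f ((x + h *\<^sub>R v) + s *\<^sub>R u) u - fd f (x + s *\<^sub>R u) u)" by auto
  have "((\<lambda>t. fd f ((x + s *\<^sub>R u) + t *\<^sub>R v) u) has_real_derivative
      fd (\<lambda>y. fd f y u) ((x + s *\<^sub>R u) + t *\<^sub>R v) v) (at t)" if "0 \<le> t" "t \<le> h" for t
    using inS[of s t] s that by (intro has_real_derivative_along[OF smooth_on_fd[OF sm]]) auto
  from MVT2[OF h(1) this] obtain t where t: "0 < t" "t < h"
    "fd f ((x + s *\<^sub>R u) + h *\<^sub>R v) u - fd f (x + s *\<^sub>R u) u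
      = h * fd (\<lambda>y. fd f y u) ((x + s *\<^sub>R u) + t *\<^sub>R v) v" by auto
  have "f (x + h *\<^sub>R u + h *\<^sub>R v) - f (x + h *\<^sub>R u) - f (x + h *\<^sub>R v) + f x = \<phi> h - \<phi> 0"
    by (simp add: \<phi>_def algebra_simps)
  also have "\<dots> = h * h * fd (\<lambda>y. fd f y u) ((x + s *\<^sub>R u) + t *\<^sub>R v) v"
    using s(3) t(3) by (simp add: add_ac)
  finally show ?thesis using that[of "(x + s *\<^sub>R u) + t *\<^sub>R v"] dst[of s t] s t by auto
qed

text \<open>The second difference is symmetric in \<open>u\<close> and \<open>v\<close>, so for
  small \<open>h\<close> both mixed derivatives take the same value at points near \<open>x\<close>;
  continuity brings these values arbitrarily close to those at \<open>x\<close>.\<close>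

lemma fd_commute_real:
  fixes f :: "'a::euclidean_space \<Rightarrow> real"
  assumes sm: "smooth_on S f" and "x \<in> S"
  shows "fd (\<lambda>y. fd f y u) x v = fd (\<lambda>y. fd f y v) x u"
proof (rule ccontr)
  define F where "F u v y = fd (\<lambda>y. fd f y u) y v" for u v y
  assume "\<not> ?thesis"
  then have e: "\<bar>F u v x - F v u x\<bar> / 2 > 0" by (simp add: F_def)
  have cont: "isCont (F u v) x" for u v
    unfolding F_def[abs_def] using smooth_on_continuous[OF smooth_on_fd[OF smooth_on_fd[OF sm]]] \<open>x \<in> S\<close> smooth_on_open[OF sm]
    by (simp add: continuous_on_eq_continuous_at)
  obtain d1 where d1: "d1 > 0" "\<And>y. dist y x < d1 \<Longrightarrow> dist (F u v y) (F u v x) < \<bar>F u v x - F v u x\<bar> / 2"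
    using cont[of u v, unfolded continuous_at_eps_delta] e by blast
  obtain d2 where d2: "d2 > 0" "\<And>y. dist y x < d2 \<Longrightarrow> dist (F v u y) (F v u x) < \<bar>F u v x - F v u x\<bar> / 2"
    using cont[of v u, unfolded continuous_at_eps_delta] e by blast
  obtain r where r: "r > 0" "ball x r \<subseteq> S"
    using smooth_on_open[OF sm] \<open>x \<in> S\<close> openE by blast
  define m where "m = min r (min d1 d2)"
  \<comment> \<open>The summand 1 covers \<open>u = v = 0\<close>, and the factor 2 makes the later
    bound by \<open>m\<close> strict.\<close>
  define h where "h = m / (2 * (norm u + norm v + 1))"
  have "m > 0" using d1 d2 r by (simp add: m_def)
  have pos: "norm u + norm v + 1 > 0" by (simp add: add_nonneg_pos)
  have "h > 0" using \<open>m > 0\<close> pos by (simp add: h_def)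
  have "h * (norm u + norm v) \<le> h * (norm u + norm v + 1)" using \<open>h > 0\<close> by simp
  also have "\<dots> = m / 2" using pos by (simp add: h_def field_simps)
  also have "\<dots> < m" using \<open>m > 0\<close> by simp
  finally have hm: "h * (norm u + norm v) < m" .
  obtain y1 where y1: "dist x y1 \<le> h * (norm u + norm v)"
    "f (x + h *\<^sub>R u + h *\<^sub>R v) - f (x + h *\<^sub>R u) - f (x + h *\<^sub>R v) + f x = h * h * F u v y1"
    unfolding F_def by (rule second_difference_mean_value[OF sm r(2) \<open>h > 0\<close>, of u v]) (use hm m_def in auto)
  obtain y2 where y2: "dist x y2 \<le> h * (norm v + norm u)"
    "f (x + h *\<^sub>R v + h *\<^sub>R u) - f (x + h *\<^sub>R v) - f (x + h *\<^sub>R u) + f x = h * h * F v u y2"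
    unfolding F_def by (rule second_difference_mean_value[OF sm r(2) \<open>h > 0\<close>, of v u]) (use hm m_def in \<open>auto simp: add.commute\<close>)
  have "h * h * F u v y1 = h * h * F v u y2" using y1(2) y2(2) by (simp add: algebra_simps)
  then have "F u v y1 = F v u y2" using \<open>h > 0\<close> by simp
  moreover have "dist (F u v y1) (F u v x) < \<bar>F u v x - F v u x\<bar> / 2"
    using y1(1) hm by (intro d1) (simp add: dist_commute m_def)
  moreover have "dist (F v u y2) (F v u x) < \<bar>F u v x - F v u x\<bar> / 2"
    using y2(1) hm by (intro d2) (simp add: dist_commute m_def add.commute)
  ultimately show False by (simp add: dist_real_def abs_if split: if_splits)
qed

lemma fd_inner:
  fixes f :: "'a::real_normed_vector \<Rightarrow> 'b::real_inner"
  assumes "f differentiable (at x)"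
  shows "fd (\<lambda>y. f y \<bullet> b) x v = fd f x v \<bullet> b"
  using fd_eqI[OF has_derivative_inner_left[OF has_derivative_fd[OF assms], of b]] by simp

lemma fd_commute:
  fixes f :: "'a::euclidean_space \<Rightarrow> 'b::euclidean_space"
  assumes sm: "smooth_on S f" and x: "x \<in> S"
  shows "fd (\<lambda>y. fd f y u) x v = fd (\<lambda>y. fd f y v) x u"
proof (rule euclidean_eqI)
  fix b :: 'b
  have smb: "smooth_on S (\<lambda>y. f y \<bullet> b)"
    using sm smooth_on_open[OF sm] by (intro smooth_on_inner) auto
  have "fd (\<lambda>y. fd f y u) x v \<bullet> b = fd (\<lambda>y. fd (\<lambda>y. f y \<bullet> b) y u) x v" for u v
  proof -
    have "fd (\<lambda>y. fd f y u) x v \<bullet> b = fd (\<lambda>y. fd f y u \<bullet> b) x v"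
      by (rule fd_inner[symmetric]) (rule smooth_on_differentiable[OF smooth_on_fd[OF sm] x])
    also have "fd (\<lambda>y. fd f y u \<bullet> b) x = fd (\<lambda>y. fd (\<lambda>y. f y \<bullet> b) y u) x"
      by (rule fd_cong[OF smooth_on_open[OF sm] x]) (simp add: fd_inner smooth_on_differentiable[OF sm])
    finally show ?thesis .
  qed
  then show "fd (\<lambda>y. fd f y u) x v \<bullet> b = fd (\<lambda>y. fd f y v) x u \<bullet> b"
    using fd_commute_real[OF smb x, of u v] by simp
qed

section \<open>Bump functions\<close>

text \<open>The powers of \<open>s\<close> in the denominator make the family closed under
  differentiation up to linear combinations, so smoothness at 0 is an induction over all
  \<open>n\<close> at once.\<close>

definition flat_exp :: "nat \<Rightarrow> real \<Rightarrow> real" where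
  "flat_exp n s = (if s > 0 then exp (- 1 / s) / s ^ n else 0)"

lemma flat_exp_tendsto: "(flat_exp n \<longlongrightarrow> 0) (at_right 0)"
proof -
  have "((\<lambda>s::real. exp (- 1 / s) / s ^ n) \<longlongrightarrow> 0) (at_right 0)"
  proof -
    have "((\<lambda>x::real. x ^ n / exp x) \<longlongrightarrow> 0) at_top" by (rule tendsto_power_div_exp_0)
    from filterlim_compose[OF this filterlim_inverse_at_top_right]
    have "((\<lambda>s::real. inverse s ^ n / exp (inverse s)) \<longlongrightarrow> 0) (at_right 0)" .
    moreover have "inverse s ^ n / exp (inverse s) = exp (- 1 / s) / s ^ n" for s :: real
      by (simp add: divide_inverse exp_minus power_inverse mult.commute)
    ultimately show ?thesis by (simp only:)
  qed
  then show ?thesis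
    by (rule Lim_transform_eventually) (auto simp: eventually_at_filter flat_exp_def)
qed

lemma flat_exp_derivative:
  "(flat_exp n has_real_derivative flat_exp (n + 2) s - n * flat_exp (n + 1) s) (at s)"
proof (cases s "0::real" rule: linorder_cases)
  case greater
  have "((\<lambda>s. exp (- 1 / s) / s ^ n) has_real_derivative
      flat_exp (n + 2) s - n * flat_exp (n + 1) s) (at s)"
  proof -
    have e: "((\<lambda>s. exp (- 1 / s)) has_real_derivative exp (- 1 / s) * (1 / s\<^sup>2)) (at s)"
      using greater by (auto intro!: derivative_eq_intros simp: power2_eq_square)
    have p: "((\<lambda>s. s ^ n) has_real_derivative real n * s ^ (n - 1)) (at s)"
      by (auto intro!: derivative_eq_intros)
    have eq: "(exp (- 1 / s) * (1 / s\<^sup>2) * s ^ n - exp (- 1 / s) * (real n * s ^ (n - 1))) / (s ^ n * s ^ n)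
      = flat_exp (n + 2) s - real n * flat_exp (n + 1) s"
      using greater by (cases n) (simp_all add: flat_exp_def field_simps power2_eq_square)
    show ?thesis using DERIV_divide[OF e p] greater unfolding eq by simp
  qed
  then show ?thesis
    by (rule has_field_derivative_transform_within_open[where S="{0<..}"])
       (use greater in \<open>auto simp: flat_exp_def\<close>)
next
  case less
  have "((\<lambda>_. 0) has_real_derivative 0) (at s)" by simp
  then have "(flat_exp n has_real_derivative 0) (at s)"
    by (rule has_field_derivative_transform_within_open[where S="{..<0}"])
       (use less in \<open>auto simp: flat_exp_def\<close>)
  then show ?thesis using less by (simp add: flat_exp_def)
next
  case equal
  have "((\<lambda>h. (flat_exp n (0 + h) - flat_exp n 0) / h) \<longlongrightarrow> 0) (at 0)"
  proof (subst filterlim_at_split, intro conjI)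
    show "((\<lambda>h. (flat_exp n (0 + h) - flat_exp n 0) / h) \<longlongrightarrow> 0) (at_left 0)"
      by (rule tendsto_eventually) (auto simp: eventually_at_filter flat_exp_def)
    \<comment> \<open>For \<open>h > 0\<close> the difference quotient is
      \<open>flat_exp (n + 1) h\<close>, so the decay at 0 of the next member of the family is the
      derivative of this one.\<close>
    show "((\<lambda>h. (flat_exp n (0 + h) - flat_exp n 0) / h) \<longlongrightarrow> 0) (at_right 0)"
      by (rule Lim_transform_eventually[OF flat_exp_tendsto[of "n+1"]])
         (auto simp: eventually_at_filter flat_exp_def)
  qed
  then show ?thesis using equal by (simp add: DERIV_def flat_exp_def)
qed

lemma smooth_on_flat_exp: "smooth_on UNIV (flat_exp n)"
proof -
  have fde: "fd (flat_exp n) s v = v * (flat_exp (n + 2) s - n * flat_exp (n + 1) s)" for n s v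
    using fd_eqI[OF flat_exp_derivative[unfolded has_field_derivative_def]] by simp
  have "Ck_on k UNIV (flat_exp n)" for k
  proof (induction k arbitrary: n)
    case 0
    then show ?case
      using DERIV_isCont[OF flat_exp_derivative] by (simp add: continuous_on_eq_continuous_at)
  next
    case (Suc k)
    have "flat_exp n differentiable (at s)" for s
      using flat_exp_derivative[of n s] unfolding has_field_derivative_def differentiable_def by blast
    moreover have "Ck_on k UNIV (\<lambda>s. v * (flat_exp (n + 2) s + (- real n) * flat_exp (n + 1) s))" for v
      by (intro Ck_on_bilinear[OF bounded_bilinear_mult] Ck_on_add Ck_on_const Suc.IH) auto
    ultimately show ?case by (simp add: fde)
  qed
  then show ?thesis by (simp add: smooth_on_def)
qed

definition bump :: "'a::euclidean_space \<Rightarrow> real \<Rightarrow> 'a \<Rightarrow> real" where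
  "bump a r x = flat_exp 0 (r\<^sup>2 - (x - a) \<bullet> (x - a))"

lemma smooth_on_bump: "smooth_on UNIV (bump a r)"
proof -
  have "smooth_on UNIV (\<lambda>x. r\<^sup>2 - (x - a) \<bullet> (x - a))"
    by (intro smooth_on_diff smooth_on_inner smooth_on_id smooth_on_const) auto
  from smooth_on_compose[OF smooth_on_flat_exp this] show ?thesis by (simp add: bump_def[abs_def])
qed

lemma bump_nonneg: "bump a r x \<ge> 0"
  by (simp add: bump_def flat_exp_def)

lemma bump_pos_iff: "r > 0 \<Longrightarrow> bump a r x > 0 \<longleftrightarrow> x \<in> ball a r"
proof -
  assume "r > 0"
  have "(x - a) \<bullet> (x - a) < r\<^sup>2 \<longleftrightarrow> norm (x - a) < r"
    using \<open>r > 0\<close> power2_less_imp_less[of "norm (x - a)" r] power_strict_mono[of "norm (x - a)" r 2]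
    by (auto simp: dot_square_norm)
  then show ?thesis by (simp add: bump_def flat_exp_def dist_norm norm_minus_commute)
qed

lemma bump_eq_0: "r > 0 \<Longrightarrow> x \<notin> ball a r \<Longrightarrow> bump a r x = 0"
  using bump_pos_iff[of r a x] bump_nonneg[of a r x] by linarith

section \<open>Traces of endomorphisms\<close>

lemma trace_lin_commute:
  fixes A :: "'a::euclidean_space \<Rightarrow> 'b::euclidean_space" and B :: "'b \<Rightarrow> 'a"
  assumes "linear A" "linear B"
  shows "trace_lin (\<lambda>x. B (A x)) = trace_lin (\<lambda>y. A (B y))"
proof -
  have "B (A a) \<bullet> a = (\<Sum>b\<in>Basis. (A a \<bullet> b) * (B b \<bullet> a))" for a
    by (subst linear_sum_Basis[OF assms(2), of "A a"]) (simp add: inner_sum_left)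
  moreover have "A (B b) \<bullet> b = (\<Sum>a\<in>Basis. (B b \<bullet> a) * (A a \<bullet> b))" for b
    by (subst linear_sum_Basis[OF assms(1), of "B b"]) (simp add: inner_sum_left)
  ultimately show ?thesis
    by (simp add: trace_lin_def) (subst sum.swap, simp add: mult.commute)
qed

lemma trace_lin_conjugate:
  fixes A :: "'a::euclidean_space \<Rightarrow> 'b::euclidean_space"
  assumes "linear A" "bij A" "linear S"
  shows "trace_lin (\<lambda>x. inv A (S (A x))) = trace_lin S"
proof -
  have "linear (\<lambda>y. inv A (S y))"
    using linear_compose[OF assms(3) linear_bij_inv[OF assms(1,2)]] by (simp add: o_def)
  from trace_lin_commute[OF assms(1) this]
  have "trace_lin (\<lambda>x. inv A (S (A x))) = trace_lin (\<lambda>y. A (inv A (S y)))" .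
  also have "\<dots> = trace_lin S" using assms(2) by (simp add: bij_is_surj surj_f_inv_f)
  finally show ?thesis .
qed

lemma trace_lin_uminus: "trace_lin (\<lambda>x. - f x) = - trace_lin f"
  by (simp add: trace_lin_def sum_negf)

lemma trace_lin_diff: "trace_lin (\<lambda>x. f x - g x) = trace_lin f - trace_lin g"
  by (simp add: trace_lin_def inner_diff_left sum_subtractf)

lemma trace_lin_vec:
  fixes f :: "real^'n \<Rightarrow> real^'n"
  shows "trace_lin f = (\<Sum>i\<in>UNIV. f (axis i 1) $ i)"
proof -
  have B: "(Basis :: (real^'n) set) = (\<lambda>i. axis i 1) ` UNIV"
    by (auto simp: Basis_vec_def)
  have "trace_lin f = (\<Sum>b\<in>(\<lambda>i. axis i (1::real)) ` UNIV. f b \<bullet> b)"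
    unfolding trace_lin_def B ..
  also have "\<dots> = (\<Sum>i\<in>UNIV. f (axis i 1) $ i)"
    by (subst sum.reindex) (auto simp: inj_on_def axis_eq_axis inner_axis)
  finally show ?thesis .
qed

lemma trace_lin_complex_vec:
  fixes f :: "complex^'n \<Rightarrow> complex^'n"
  shows "trace_lin f = (\<Sum>i\<in>UNIV. Re (f (axis i 1) $ i) + Im (f (axis i \<i>) $ i))"
proof -
  have B: "(Basis :: (complex^'n) set) = (\<lambda>i. axis i 1) ` UNIV \<union> (\<lambda>i. axis i \<i>) ` UNIV"
    by (auto simp: Basis_vec_def Basis_complex_def)
  have "trace_lin f = (\<Sum>b\<in>(\<lambda>i::'n. axis i 1) ` UNIV. f b \<bullet> b) + (\<Sum>b\<in>(\<lambda>i::'n. axis i \<i>) ` UNIV. f b \<bullet> b)"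
    unfolding trace_lin_def B by (rule sum.union_disjoint) (auto simp: axis_eq_axis)
  also have "\<dots> = (\<Sum>i\<in>UNIV. Re (f (axis i 1) $ i)) + (\<Sum>i\<in>UNIV. Im (f (axis i \<i>) $ i))"
    by (subst (1 2) sum.reindex) (auto simp: inj_on_def axis_eq_axis inner_axis)
  finally show ?thesis by (simp add: sum.distrib)
qed

section \<open>Inner products given as bilinear forms\<close>

text \<open>The metric at a point differs from the built-in inner product of the model space, which
  only defines \<open>trace_lin\<close>. The locale redoes orthonormalisation for \<open>G\<close>
  and shows that traces may be computed with \<open>G\<close>-orthonormal bases.\<close>

locale inner_form =
  fixes G :: "'a::euclidean_space \<Rightarrow> 'a \<Rightarrow> real"
  assumes bil: "bilinear G" and sym: "G u v = G v u" and pos: "v \<noteq> 0 \<Longrightarrow> G v v > 0"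
begin

lemmas G_simps = bilinear_ladd[OF bil] bilinear_radd[OF bil] bilinear_lmul[OF bil] bilinear_rmul[OF bil]
  bilinear_lneg[OF bil] bilinear_rneg[OF bil] bilinear_lsub[OF bil] bilinear_rsub[OF bil]
  bilinear_lzero[OF bil] bilinear_rzero[OF bil]

lemma G_linear: "linear (G u)" "linear (\<lambda>u. G u v)"
  using bil by (auto simp: bilinear_def)

lemma G_sum_left: "G (\<Sum>i\<in>I. f i) v = (\<Sum>i\<in>I. G (f i) v)"
  by (rule linear_sum[OF G_linear(2)])

lemma G_nondegenerate: "(\<And>w. G v w = 0) \<Longrightarrow> v = 0"
  using pos[of v] by fastforce

lemma G_eqI: "(\<And>w. G u w = G v w) \<Longrightarrow> u = v"
  using G_nondegenerate[of "u - v"] by (simp add: G_simps)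

lemma exists_orthogonal:
  assumes "finite E" "card E < DIM('a)"
  obtains v where "v \<noteq> 0" "\<And>e. e \<in> E \<Longrightarrow> G v e = 0"
proof -
  \<comment> \<open>The Riesz vector of \<open>\<lambda>v. G v e\<close> for the built-in inner
    product; orthogonality with respect to \<open>G\<close> becomes ordinary orthogonality to the
    vectors \<open>N e\<close>.\<close>
  define N where "N e = (\<Sum>b\<in>Basis. G b e *\<^sub>R b)" for e
  have N: "v \<bullet> N e = G v e" for v e
    by (simp add: N_def inner_sum_right linear_sum_Basis[OF G_linear(2), of v e] mult.commute)
  have "dim (N ` E) \<le> card E"
    using assms(1) by (metis card_image_le dim_le_card' finite_imageI order_trans)
  with assms(2) have "dim (N ` E) < DIM('a)" by simp
  then obtain v where "v \<noteq> 0" "\<And>y. y \<in> span (N ` E) \<Longrightarrow> orthogonal v y"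
    by (rule orthogonal_to_subspace_exists) blast
  then show ?thesis using that[of v] N by (metis image_eqI orthogonal_def span_base)
qed

lemma normalize:
  assumes "v \<noteq> 0"
  shows "G ((1 / sqrt (G v v)) *\<^sub>R v) ((1 / sqrt (G v v)) *\<^sub>R v) = 1"
  using pos[OF assms] by (simp add: G_simps)

lemma exists_orthonormal:
  assumes "finite I" "card I \<le> DIM('a)"
  shows "\<exists>e. \<forall>i\<in>I. \<forall>j\<in>I. G (e i) (e j) = (if i = j then 1 else 0)"
  using assms
proof (induction I)
  case (insert k I)
  then obtain e where e: "\<forall>i\<in>I. \<forall>j\<in>I. G (e i) (e j) = (if i = j then 1 else 0)" by auto
  have "card (e ` I) < DIM('a)"
    using insert card_image_le[OF insert(1), of e] by simp
  then obtain v where v: "v \<noteq> 0" "\<And>w. w \<in> e ` I \<Longrightarrow> G v w = 0"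
    using exists_orthogonal insert(1) by (metis finite_imageI)
  define u where "u = (1 / sqrt (G v v)) *\<^sub>R v"
  have u: "G u u = 1" "\<And>i. i \<in> I \<Longrightarrow> G u (e i) = 0" "\<And>i. i \<in> I \<Longrightarrow> G (e i) u = 0"
    using normalize[OF v(1)] v(2) by (simp_all add: u_def G_simps sym[of "e _"])
  show ?case
    by (rule exI[of _ "e(k := u)"]) (use e u insert(2) in auto)
qed simp

context
  fixes I :: "'i set" and e :: "'i \<Rightarrow> 'a"
  assumes fin: "finite I" and card: "card I = DIM('a)"
    and on: "\<And>i j. i \<in> I \<Longrightarrow> j \<in> I \<Longrightarrow> G (e i) (e j) = (if i = j then 1 else 0)"
begin

text \<open>The difference \<open>w\<close> of the two sides is \<open>G\<close>-orthogonal to all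
  \<open>e i\<close>. These are independent and, by their number, span the space, so
  \<open>w\<close> is orthogonal to itself.\<close>

lemma orthonormal_expansion: "v = (\<Sum>i\<in>I. G v (e i) *\<^sub>R e i)"
proof (rule ccontr)
  define w where "w = v - (\<Sum>i\<in>I. G v (e i) *\<^sub>R e i)"
  assume "v \<noteq> (\<Sum>i\<in>I. G v (e i) *\<^sub>R e i)"
  then have "w \<noteq> 0" by (simp add: w_def)
  have inj: "inj_on e I"
    by (rule inj_onI) (metis on zero_neq_one)
  have "independent (e ` I)"
  proof (rule independent_if_scalars_zero)
    fix f x assume *: "(\<Sum>x\<in>e ` I. f x *\<^sub>R x) = 0" "x \<in> e ` I"
    then obtain j where j: "j \<in> I" "x = e j" by auto
    have "0 = G (\<Sum>i\<in>I. f (e i) *\<^sub>R e i) (e j)"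
      using * by (simp add: sum.reindex[OF inj] G_simps)
    also have "\<dots> = (\<Sum>i\<in>I. f (e i) * (if i = j then 1 else 0))"
      by (simp add: G_sum_left G_simps on j(1))
    also have "\<dots> = f (e j)" using fin j(1) by (simp add: if_distrib cong: if_cong)
    finally show "f x = 0" using j by simp
  qed (use fin in simp)
  then have "span (e ` I) = UNIV"
    using card_eq_dim[of "e ` I" UNIV] card fin card_image[OF inj] by (auto simp: dim_UNIV)
  moreover have "G w x = 0" if "x \<in> span (e ` I)" for x
    using that
  proof (induction rule: span_induct_alt)
    case (step c x y)
    then obtain j where "j \<in> I" "x = e j" by auto
    then have "G w x = 0"
      using fin by (simp add: w_def G_simps G_sum_left on if_distrib cong: if_cong)
    then show ?case using step by (simp add: G_simps)
  qed (simp add: G_simps)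
  ultimately have "G w w = 0" by simp
  then show False using pos[OF \<open>w \<noteq> 0\<close>] by simp
qed

lemma trace_orthonormal:
  assumes "linear S"
  shows "trace_lin S = (\<Sum>i\<in>I. G (S (e i)) (e i))"
proof -
  have "S b \<bullet> b = (\<Sum>i\<in>I. G b (e i) * (S (e i) \<bullet> b))" for b
    using arg_cong[OF orthonormal_expansion[of b], of "\<lambda>x. S x \<bullet> b"]
    by (simp add: linear_sum[OF assms] linear_cmul[OF assms] inner_sum_left)
  then have "trace_lin S = (\<Sum>b\<in>Basis. \<Sum>i\<in>I. G b (e i) * (S (e i) \<bullet> b))"
    by (simp add: trace_lin_def)
  also have "\<dots> = (\<Sum>i\<in>I. \<Sum>b\<in>Basis. (S (e i) \<bullet> b) * G b (e i))"
    by (subst sum.swap) (simp add: mult.commute)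
  also have "\<dots> = (\<Sum>i\<in>I. G (S (e i)) (e i))"
  proof (rule sum.cong[OF refl])
    show "(\<Sum>b\<in>Basis. (S (e i) \<bullet> b) * G b (e i)) = G (S (e i)) (e i)" for i
      using linear_sum_Basis[OF G_linear(2), of "S (e i)" "e i"] by simp
  qed
  finally show ?thesis .
qed

end

text \<open>Needed for the symmetry of the Ricci tensor, whose two values are traces of mutually
  adjoint endomorphisms.\<close>

lemma trace_adjoint:
  assumes "linear S" "linear T" "\<And>u v. G (S u) v = G u (T v)"
  shows "trace_lin S = trace_lin T"
proof -
  obtain e :: "'a \<Rightarrow> 'a" where "\<forall>i\<in>Basis. \<forall>j\<in>Basis. G (e i) (e j) = (if i = j then 1 else 0)"
    using exists_orthonormal[of "Basis :: 'a set"] by auto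
  then have *: "G (e i) (e j) = (if i = j then 1 else 0)" if "i \<in> Basis" "j \<in> Basis" for i j
    using that by blast
  show ?thesis
    using trace_orthonormal[OF finite_Basis refl * assms(1)] trace_orthonormal[OF finite_Basis refl * assms(2)]
    by (simp add: assms(3)) (simp add: sym)
qed

end

section \<open>Complex frames and Hermitian determinants\<close>

lemma det_replace_row:
  fixes Z :: "'a::comm_ring_1^'n^'n"
  shows "det (\<chi> i. if i = k then a else Z $ i) =
    (\<Sum>p | p permutes UNIV. of_int (sign p) * (a $ p k * (\<Prod>i\<in>UNIV - {k}. Z $ i $ p i)))"
  unfolding det_def
proof (intro sum.cong refl)
  fix p :: "'n \<Rightarrow> 'n"
  have "(\<Prod>i\<in>UNIV. (\<chi> i. if i = k then a else Z $ i) $ i $ p i) =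
    a $ p k * (\<Prod>i\<in>UNIV - {k}. (\<chi> i. if i = k then a else Z $ i) $ i $ p i)"
    by (subst prod.remove[of UNIV k]) auto
  also have "(\<Prod>i\<in>UNIV - {k}. (\<chi> i. if i = k then a else Z $ i) $ i $ p i) = (\<Prod>i\<in>UNIV - {k}. Z $ i $ p i)"
    by (intro prod.cong) auto
  finally show "of_int (sign p) * (\<Prod>i\<in>UNIV. (\<chi> i. if i = k then a else Z $ i) $ i $ p i) =
    of_int (sign p) * (a $ p k * (\<Prod>i\<in>UNIV - {k}. Z $ i $ p i))" by simp
qed

lemma has_derivative_det:
  fixes Z :: "'a::real_normed_vector \<Rightarrow> 'b::real_normed_field^'n^'n"
  assumes "\<And>i j. ((\<lambda>x. Z x $ i $ j) has_derivative (\<lambda>h. Z' h $ i $ j)) (at x)"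
  shows "((\<lambda>x. det (Z x)) has_derivative
    (\<lambda>h. \<Sum>k\<in>UNIV. det (\<chi> i. if i = k then Z' h $ k else Z x $ i))) (at x)"
proof -
  have "((\<lambda>x. \<Sum>p | p permutes UNIV. of_int (sign p) * (\<Prod>i\<in>UNIV. Z x $ i $ p i)) has_derivative
    (\<lambda>h. \<Sum>p | p permutes UNIV. of_int (sign p) *
        (\<Sum>k\<in>UNIV. Z' h $ k $ p k * (\<Prod>i\<in>UNIV - {k}. Z x $ i $ p i)))) (at x)"
    by (intro has_derivative_sum has_derivative_mult_right has_derivative_prod assms)
  moreover have "(\<Sum>p | p permutes UNIV. of_int (sign p) *
        (\<Sum>k\<in>UNIV. Z' h $ k $ p k * (\<Prod>i\<in>UNIV - {k}. Z x $ i $ p i)))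
      = (\<Sum>k\<in>UNIV. det (\<chi> i. if i = k then Z' h $ k else Z x $ i))" for h
    unfolding det_replace_row sum_distrib_left by (rule sum.swap)
  ultimately show ?thesis unfolding det_def by simp
qed

text \<open>Row \<open>k\<close> of \<open>A ** Z\<close> is a combination of the rows of
  \<open>Z\<close>, and by Cramer's rule only the multiple \<open>A $ k $ k\<close> of row
  \<open>k\<close> itself contributes. Together with \<open>has_derivative_det\<close> this is
  Jacobi's formula, valid for singular \<open>Z\<close> too.\<close>

lemma sum_det_replace_row_mult_left:
  fixes Z :: "'a::field^'n^'n"
  shows "(\<Sum>k\<in>UNIV. det (\<chi> i. if i = k then (A ** Z) $ k else Z $ i)) = (\<Sum>k\<in>UNIV. A $ k $ k) * det Z"
proof -
  have "det (\<chi> i. if i = k then (A ** Z) $ k else Z $ i) = A $ k $ k * det Z" for k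
  proof -
    have "(A ** Z) $ k = (\<Sum>i\<in>UNIV. A $ k $ i *s row i Z)"
      by (simp add: vec_eq_iff matrix_matrix_mult_def row_def)
    moreover have "row i Z = Z $ i" for i by (simp add: row_def vec_eq_iff)
    ultimately show ?thesis using cramer_lemma_transpose[of k "A $ k" Z] by (simp cong: if_cong)
  qed
  then show ?thesis by (simp add: sum_distrib_right)
qed

text \<open>For invertible \<open>Z\<close> this is a similarity of the previous formula; comparing the derivatives of
  both sides of \<open>det (Z (1 + t A)) = det Z det (1 + t A)\<close> covers singular \<open>Z\<close> too.\<close>

lemma sum_det_replace_row_mult_right:
  fixes Z :: "complex^'n^'n"
  shows "(\<Sum>k\<in>UNIV. det (\<chi> i. if i = k then (Z ** A) $ k else Z $ i)) = (\<Sum>k\<in>UNIV. A $ k $ k) * det Z"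
proof -
  define W where "W M t = (\<chi> i j. M $ i $ j + complex_of_real t * (M ** A) $ i $ j)" for M :: "complex^'n^'n" and t
  have W: "W M t = M ** (mat 1 + (\<chi> i j. complex_of_real t * A $ i $ j))" for M t
    by (simp add: W_def vec_eq_iff matrix_add_ldistrib)
       (simp add: matrix_matrix_mult_def sum_distrib_left mult_ac)
  have W1: "W M t = M ** W (mat 1) t" for M t by (simp add: W)
  have der: "((\<lambda>t. det (W M t)) has_derivative
    (\<lambda>h. \<Sum>k\<in>UNIV. det (\<chi> i. if i = k then (\<chi> i j. complex_of_real h * (M ** A) $ i $ j) $ k else M $ i))) (at 0)" for M
  proof -
    have "((\<lambda>t. W M t $ i $ j) has_derivative (\<lambda>h. (\<chi> i j. complex_of_real h * (M ** A) $ i $ j) $ i $ j)) (at 0)" for i j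
      unfolding W_def by (auto intro!: derivative_eq_intros)
    moreover have "W M 0 = M" by (simp add: W_def vec_eq_iff)
    ultimately show ?thesis
      using has_derivative_det[of "W M" "\<lambda>h. \<chi> i j. complex_of_real h * (M ** A) $ i $ j" 0] by (simp cong: if_cong)
  qed
  have e: "(\<lambda>t. det (W Z t)) = (\<lambda>t. det Z * det (W (mat 1) t))"
    by (rule ext) (subst W1, simp add: det_mul)
  have "(\<lambda>h. \<Sum>k\<in>UNIV. det (\<chi> i. if i = k then (\<chi> i j. complex_of_real h * (Z ** A) $ i $ j) $ k else Z $ i))
    = (\<lambda>h. det Z * (\<Sum>k\<in>UNIV. det (\<chi> i. if i = k then (\<chi> i j. complex_of_real h * (mat 1 ** A) $ i $ j) $ k else mat 1 $ i)))"
    by (rule has_derivative_unique[OF der[of Z, unfolded e] has_derivative_mult_right[OF der]])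
  from fun_cong[OF this, of 1]
  have "(\<Sum>k\<in>UNIV. det (\<chi> i. if i = k then (Z ** A) $ k else Z $ i))
    = det Z * (\<Sum>k\<in>UNIV. det (\<chi> i. if i = k then (A ** mat 1) $ k else (mat 1 :: complex^'n^'n) $ i))"
    by (simp add: vec_lambda_eta cong: if_cong)
  then show ?thesis by (simp add: sum_det_replace_row_mult_left del: matrix_mul_rid)
qed

lemma det_cnj: "det (\<chi> i j. cnj (A $ i $ j)) = cnj (det A)" for A :: "complex^'n^'n"
  by (simp add: det_def)

section \<open>Complex frames of a real vector space with complex structure\<close>

text \<open>Multiplication by a complex number, with \<open>J\<close> in the role of i. The model
  space is a real vector space whose complex structure depends on the point, so \<open>J\<close> has
  to be an argument.\<close>

definition cact :: "('a::real_vector \<Rightarrow> 'a) \<Rightarrow> complex \<Rightarrow> 'a \<Rightarrow> 'a" where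
  "cact J z v = Re z *\<^sub>R v + Im z *\<^sub>R J v"

definition frame_map :: "('a::real_vector \<Rightarrow> 'a) \<Rightarrow> ('n::finite \<Rightarrow> 'a) \<Rightarrow> complex^'n \<Rightarrow> 'a" where
  "frame_map J E z = (\<Sum>i\<in>UNIV. cact J (z $ i) (E i))"

definition herm :: "('a \<Rightarrow> 'a \<Rightarrow> real) \<Rightarrow> ('a \<Rightarrow> 'a) \<Rightarrow> 'a \<Rightarrow> 'a \<Rightarrow> complex" where
  "herm G J u v = of_real (G u v) - \<i> * of_real (G (J u) v)"

lemma cact_1 [simp]: "cact J 1 v = v" by (simp add: cact_def)
lemma cact_0 [simp]: "cact J 0 v = 0" by (simp add: cact_def)
lemma cact_ii: "cact J \<i> v = J v" by (simp add: cact_def)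
lemma cact_of_real [simp]: "cact J (of_real r) v = r *\<^sub>R v" by (simp add: cact_def)
lemma cact_sum_left: "cact J (\<Sum>i\<in>I. f i) v = (\<Sum>i\<in>I. cact J (f i) v)"
  by (simp add: cact_def Re_sum Im_sum scaleR_sum_left sum.distrib)

lemma linear_cact: "linear J \<Longrightarrow> linear (cact J z)"
  by (rule linearI) (simp_all add: cact_def linear_add linear_cmul algebra_simps)

lemma linear_frame_map: "linear (frame_map J E)"
  unfolding frame_map_def
  by (rule linearI) (simp_all add: cact_def sum.distrib scaleR_sum_right algebra_simps)

lemma frame_map_axis: "frame_map J E (axis i c) = cact J c (E i)"
proof -
  have "frame_map J E (axis i c) = (\<Sum>j\<in>UNIV. if j = i then cact J c (E i) else 0)"
    unfolding frame_map_def by (intro sum.cong) (auto simp: axis_def)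
  then show ?thesis by simp
qed

locale complex_space =
  fixes J :: "'a::euclidean_space \<Rightarrow> 'a"
  assumes J_linear: "linear J" and J_J: "J (J v) = - v"
begin

lemmas J_simps = linear_add[OF J_linear] linear_diff[OF J_linear] linear_neg[OF J_linear]
  linear_cmul[OF J_linear] linear_0[OF J_linear] J_J

lemma cact_cact: "cact J z (cact J w v) = cact J (z * w) v"
  by (simp add: cact_def J_simps algebra_simps)

lemmas cact_sum = linear_sum[OF linear_cact[OF J_linear]]

lemma frame_map_smult: "frame_map J E (c *s z) = cact J c (frame_map J E z)"
  by (simp add: frame_map_def cact_sum cact_cact)

context
  fixes E :: "'n::finite \<Rightarrow> 'a"
  assumes bij: "bij (frame_map J E)"
begin

abbreviation "cof \<equiv> inv (frame_map J E)"

lemma frame_map_cof: "frame_map J E (cof v) = v"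
  using bij by (simp add: bij_is_surj surj_f_inv_f)

lemma cof_frame_map: "cof (frame_map J E z) = z"
  using bij by (simp add: bij_is_inj)

lemma linear_cof: "linear cof"
  by (rule linear_bij_inv[OF linear_frame_map bij])

lemmas cof_simps = linear_add[OF linear_cof] linear_diff[OF linear_cof] linear_neg[OF linear_cof]
  linear_cmul[OF linear_cof] linear_0[OF linear_cof]

lemma cof_eqI: "frame_map J E z = v \<Longrightarrow> cof v = z"
  using cof_frame_map by blast

lemma cof_cact: "cof (cact J c v) = c *s cof v"
  by (rule cof_eqI) (simp add: frame_map_smult frame_map_cof)

lemma cof_J: "cof (J v) = \<i> *s cof v"
  using cof_cact[of \<i> v] by (simp add: cact_ii)

lemma cof_frame: "cof (E i) = axis i 1"
  by (rule cof_eqI) (simp add: frame_map_axis)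

lemma cof_expand: "v = (\<Sum>i\<in>UNIV. cact J (cof v $ i) (E i))"
  using frame_map_cof[of v] by (simp add: frame_map_def)

text \<open>A complex number a + i b acts on the real plane with trace 2 a, so the real trace is
  twice the real part of the complex trace. Composing with \<open>J\<close> multiplies the complex
  trace by i.\<close>

lemma trace_complex_linear:
  assumes S: "linear S" "\<And>v. S (J v) = J (S v)"
  shows "trace_lin S = 2 * (\<Sum>i\<in>UNIV. Re (cof (S (E i)) $ i))"
    and "trace_lin (\<lambda>v. J (S v)) = - 2 * (\<Sum>i\<in>UNIV. Im (cof (S (E i)) $ i))"
proof -
  have *: "trace_lin T = (\<Sum>i\<in>UNIV. Re (cof (T (E i)) $ i) + Im (cof (T (J (E i))) $ i))" if "linear T" for T
    using trace_lin_conjugate[OF linear_frame_map bij that, symmetric]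
    by (simp add: trace_lin_complex_vec frame_map_axis cact_ii)
  show "trace_lin S = 2 * (\<Sum>i\<in>UNIV. Re (cof (S (E i)) $ i))"
    by (subst *[OF S(1)]) (simp add: S(2) cof_J sum_distrib_left)
  have "linear (\<lambda>v. J (S v))" using linear_compose[OF S(1) J_linear] by (simp add: o_def)
  then show "trace_lin (\<lambda>v. J (S v)) = - 2 * (\<Sum>i\<in>UNIV. Im (cof (S (E i)) $ i))"
    by (subst *) (simp_all add: S(2) cof_J J_J cof_simps sum_distrib_left)
qed

end

end

section \<open>Hermitian forms and Gram determinants\<close>

locale hermitian_space = inner_form G + complex_space J
  for G :: "'a::euclidean_space \<Rightarrow> 'a \<Rightarrow> real" and J :: "'a \<Rightarrow> 'a" +
  assumes J_isometry: "G (J u) (J v) = G u v"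
begin

lemma G_J_left: "G (J u) v = - G u (J v)"
  using J_isometry[of u "J v"] by (simp add: J_J G_simps)

lemma G_J_self: "G (J u) u = 0"
  using G_J_left[of u u] sym[of u "J u"] by simp

lemma herm_add_left: "herm G J (u + v) w = herm G J u w + herm G J v w"
  by (simp add: herm_def G_simps J_simps algebra_simps)

lemma herm_add_right: "herm G J w (u + v) = herm G J w u + herm G J w v"
  by (simp add: herm_def G_simps J_simps algebra_simps)

lemma herm_cact_left: "herm G J (cact J z u) v = z * herm G J u v"
  by (rule complex_eqI) (simp_all add: herm_def cact_def G_simps J_simps algebra_simps)

lemma herm_cnj: "herm G J v u = cnj (herm G J u v)"
  by (rule complex_eqI) (simp_all add: herm_def G_J_left[of v] sym[of v])

lemma herm_cact_right: "herm G J u (cact J z v) = cnj z * herm G J u v"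
  by (metis complex_cnj_mult herm_cact_left herm_cnj)

lemma herm_sum_left: "herm G J (\<Sum>i\<in>I. f i) v = (\<Sum>i\<in>I. herm G J (f i) v)"
  by (induction I rule: infinite_finite_induct)
     (simp_all add: herm_add_left, simp_all add: herm_def G_simps J_simps)

lemma herm_sum_right: "herm G J u (\<Sum>i\<in>I. f i) = (\<Sum>i\<in>I. herm G J u (f i))"
  by (induction I rule: infinite_finite_induct)
     (simp_all add: herm_add_right, simp_all add: herm_def G_simps)

text \<open>Gram-Schmidt. Hermitian orthogonality to \<open>e i\<close> means orthogonality to both
  \<open>e i\<close> and \<open>J (e i)\<close>, which is why the real dimension has to be twice the
  number of vectors.\<close>

lemma exists_unitary:
  assumes "finite I" "2 * card I \<le> DIM('a)"
  shows "\<exists>e. \<forall>i\<in>I. \<forall>j\<in>I. herm G J (e i) (e j) = (if i = j then 1 else 0)"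
  using assms
proof (induction I)
  case (insert k I)
  then obtain e where e: "\<forall>i\<in>I. \<forall>j\<in>I. herm G J (e i) (e j) = (if i = j then 1 else 0)" by auto
  have "card (e ` I \<union> J ` e ` I) \<le> card I + card I"
    by (rule order_trans[OF card_Un_le add_mono]) (auto intro: card_image_le order_trans[OF card_image_le] insert(1))
  then have "card (e ` I \<union> J ` e ` I) < DIM('a)" using insert by simp
  then obtain v where v: "v \<noteq> 0" "\<And>w. w \<in> e ` I \<union> J ` e ` I \<Longrightarrow> G v w = 0"
    using exists_orthogonal insert(1) by (metis finite_imageI finite_UnI)
  define u where "u = (1 / sqrt (G v v)) *\<^sub>R v"
  have vi: "G v (e i) = 0" "G v (J (e i)) = 0" if "i \<in> I" for i using v(2) that by auto
  have u1: "herm G J u u = 1"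
    using normalize[OF v(1)] G_J_self[of u] by (simp add: u_def herm_def)
  have u2: "herm G J u (e i) = 0" if "i \<in> I" for i
    using vi[OF that] by (simp add: herm_def u_def G_simps J_simps G_J_left)
  have u3: "herm G J (e i) u = 0" if "i \<in> I" for i
    using u2[OF that] herm_cnj[of "e i" u] by simp
  show ?case
    by (rule exI[of _ "e(k := u)"]) (use e u1 u2 u3 insert(2) in auto)
qed simp

text \<open>Let Z hold the coordinates of the unitary vectors in the frame and H the Gram matrix.
  Unitarity says that Z times H times the adjoint of Z is the identity; take determinants.\<close>

lemma gram_det:
  fixes E u :: "'n::finite \<Rightarrow> 'a"
  assumes bij: "bij (frame_map J E)" and u: "\<And>i j. herm G J (u i) (u j) = (if i = j then 1 else 0)"
  shows "det (\<chi> i j. herm G J (E i) (E j)) * of_real ((cmod (det (\<chi> i j. cof E (u i) $ j)))\<^sup>2) = 1"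
proof -
  define Z :: "complex^'n^'n" where "Z = (\<chi> i j. cof E (u i) $ j)"
  define H :: "complex^'n^'n" where "H = (\<chi> i j. herm G J (E i) (E j))"
  have "(Z ** H ** transpose (\<chi> i j. cnj (Z $ i $ j))) $ i $ j = mat 1 $ i $ j" for i j
  proof -
    have "herm G J (u i) (u j) = herm G J (\<Sum>k\<in>UNIV. cact J (Z $ i $ k) (E k)) (\<Sum>l\<in>UNIV. cact J (Z $ j $ l) (E l))"
      using cof_expand[OF bij, of "u i"] cof_expand[OF bij, of "u j"] by (simp add: Z_def)
    also have "\<dots> = (\<Sum>l\<in>UNIV. \<Sum>k\<in>UNIV. Z $ i $ k * H $ k $ l * cnj (Z $ j $ l))"
      by (simp add: herm_sum_left herm_sum_right herm_cact_left herm_cact_right H_def sum_distrib_left mult_ac)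
    also have "\<dots> = (Z ** H ** transpose (\<chi> i j. cnj (Z $ i $ j))) $ i $ j"
      by (simp add: matrix_matrix_mult_def transpose_def sum_distrib_right)
    finally show ?thesis using u[of i j] by (simp add: mat_def)
  qed
  then have "Z ** H ** transpose (\<chi> i j. cnj (Z $ i $ j)) = mat 1" by (simp add: vec_eq_iff)
  from arg_cong[OF this, of det] have "det Z * det H * cnj (det Z) = 1"
    by (simp add: det_mul det_cnj)
  then show ?thesis
    unfolding H_def[symmetric] Z_def[symmetric] complex_norm_square by (simp add: mult_ac)
qed

text \<open>Any unitary basis exhibits the determinant as the inverse of a positive real number, by
  \<open>gram_det\<close>.\<close>

lemma gram_det_pos:
  fixes E :: "'n::finite \<Rightarrow> 'a"
  assumes bij: "bij (frame_map J E)" and dim: "DIM('a) = 2 * CARD('n)"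
  shows "det (\<chi> i j. herm G J (E i) (E j)) = of_real (Re (det (\<chi> i j. herm G J (E i) (E j))))"
    and "Re (det (\<chi> i j. herm G J (E i) (E j))) > 0"
proof -
  obtain u :: "'n \<Rightarrow> 'a" where u: "\<And>i j. herm G J (u i) (u j) = (if i = j then 1 else 0)"
    using exists_unitary[of "UNIV :: 'n set"] dim by auto
  define d where "d = (cmod (det (\<chi> i j. cof E (u i) $ j)))\<^sup>2"
  have 1: "det (\<chi> i j. herm G J (E i) (E j)) * of_real d = 1"
    unfolding d_def by (rule gram_det[OF bij u])
  have "d \<noteq> 0" using 1 by auto
  then have "d > 0" by (simp add: d_def)
  have "det (\<chi> i j. herm G J (E i) (E j)) = of_real (1 / d)"
    using 1 \<open>d \<noteq> 0\<close> by (simp add: field_simps)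
  then show "det (\<chi> i j. herm G J (E i) (E j)) = of_real (Re (det (\<chi> i j. herm G J (E i) (E j))))"
    "Re (det (\<chi> i j. herm G J (E i) (E j))) > 0" using \<open>d > 0\<close> by simp_all
qed

text \<open>The left-hand side is the modulus of the wedge product of the dual coframe on a unitary
  basis. Its value does not depend on that basis, which is what makes \<open>canonical_norm\<close>
  well defined.\<close>

lemma norm_det_cof_unitary:
  fixes E u :: "'n::finite \<Rightarrow> 'a"
  assumes bij: "bij (frame_map J E)" and dim: "DIM('a) = 2 * CARD('n)"
    and u: "\<And>i j. herm G J (u i) (u j) = (if i = j then 1 else 0)"
  shows "cmod (det (\<chi> i j. cof E (u i) $ j)) = 1 / sqrt (Re (det (\<chi> i j. herm G J (E i) (E j))))"
proof -
  define r where "r = Re (det (\<chi> i j. herm G J (E i) (E j)))"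
  define c where "c = cmod (det (\<chi> i j. cof E (u i) $ j))"
  have "complex_of_real (r * c\<^sup>2) = 1"
    using gram_det[OF bij u] gram_det_pos(1)[OF bij dim] unfolding r_def c_def by simp
  then have "r * c\<^sup>2 = 1" using of_real_eq_1_iff by blast
  moreover have "r > 0" "c \<ge> 0" using gram_det_pos(2)[OF bij dim] by (simp_all add: r_def c_def)
  ultimately have "sqrt r * c = 1"
    using real_sqrt_mult[of r "c\<^sup>2"] by simp
  then show ?thesis using \<open>r > 0\<close> unfolding r_def[symmetric] c_def[symmetric] by (simp add: field_simps)
qed

end

section \<open>Product rules for tensor fields along a map\<close>

lemma fd_add:
  "f differentiable (at x) \<Longrightarrow> g differentiable (at x) \<Longrightarrow> fd (\<lambda>y. f y + g y) x v = fd f x v + fd g x v"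
  by (subst fd_eqI[OF has_derivative_add]) (auto intro: has_derivative_fd)

lemma fd_compose:
  assumes "smooth_on T f" "smooth_on S g" "g x \<in> T" "x \<in> S"
  shows "fd (\<lambda>y. f (g y)) x v = fd f (g x) (fd g x v)"
    and "(\<lambda>y. f (g y)) differentiable (at x)"
proof -
  have "((\<lambda>y. f (g y)) has_derivative (\<lambda>v. fd f (g x) (fd g x v))) (at x)"
    by (rule has_derivative_compose[OF smooth_on_has_derivative[OF assms(2,4)] smooth_on_has_derivative[OF assms(1,3)]])
  then show "fd (\<lambda>y. f (g y)) x v = fd f (g x) (fd g x v)" "(\<lambda>y. f (g y)) differentiable (at x)"
    by (auto simp: fd_eqI differentiable_def)
qed

lemma fd_bounded_linear:
  assumes "bounded_linear f" "g differentiable (at x)"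
  shows "fd (\<lambda>y. f (g y)) x v = f (fd g x v)"
  using fd_eqI[OF bounded_linear.has_derivative[OF assms(1) has_derivative_fd[OF assms(2)]]] by simp

lemma smooth_on_bilinear_field:
  fixes B :: "'b::euclidean_space \<Rightarrow> 'c::euclidean_space \<Rightarrow> 'd::euclidean_space \<Rightarrow> 'f::real_normed_vector"
    and F :: "'a::euclidean_space \<Rightarrow> 'b"
  assumes B: "\<And>y. y \<in> U \<Longrightarrow> bilinear (B y)" "\<And>v w. smooth_on U (\<lambda>y. B y v w)"
    and F: "smooth_on S F" "F ` S \<subseteq> U" and V: "smooth_on S V" and W: "smooth_on S W"
  shows "smooth_on S (\<lambda>x. B (F x) (V x) (W x))"
proof (rule smooth_on_linear_app[OF _ _ W])
  fix w show "smooth_on S (\<lambda>x. B (F x) (V x) w)"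
  proof (rule smooth_on_linear_app[OF _ _ V])
    show "smooth_on S (\<lambda>x. B (F x) v w)" for v by (rule smooth_on_compose[OF B(2) F])
    show "linear (\<lambda>v. B (F x) v w)" if "x \<in> S" for x
      using B(1)[of "F x"] F(2) that by (auto simp: bilinear_def)
  qed
next
  show "linear (B (F x) (V x))" if "x \<in> S" for x
    using B(1)[of "F x"] F(2) that by (auto simp: bilinear_def)
qed

lemma fd_bilinear_field:
  fixes B :: "'b::euclidean_space \<Rightarrow> 'c::euclidean_space \<Rightarrow> 'd::euclidean_space \<Rightarrow> 'f::real_normed_vector"
    and F :: "'a::euclidean_space \<Rightarrow> 'b"
  assumes B: "\<And>y. y \<in> U \<Longrightarrow> bilinear (B y)" "\<And>v w. smooth_on U (\<lambda>y. B y v w)"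
    and F: "smooth_on S F" "F ` S \<subseteq> U" and V: "smooth_on S V" and W: "smooth_on S W" and x: "x \<in> S"
  shows "fd (\<lambda>y. B (F y) (V y) (W y)) x X =
    fd (\<lambda>z. B z (V x) (W x)) (F x) (fd F x X) + B (F x) (fd V x X) (W x) + B (F x) (V x) (fd W x X)"
proof -
  have lin1: "linear (\<lambda>v. B (F y) v w)" "linear (B (F y) v)" if "y \<in> S" for y v w
    using B(1)[of "F y"] F(2) that by (auto simp: bilinear_def)
  have S: "open S" by (rule smooth_on_open[OF F(1)])
  have Fx: "F x \<in> U" using F(2) x by auto
  have "fd (\<lambda>y. B (F y) (V y) (W y)) x X = fd (\<lambda>y. B (F y) (V y) (W x)) x X + B (F x) (V x) (fd W x X)"
    by (subst fd_eqI[OF fd_linear_app[OF S lin1(2) _ W x]])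
       (auto intro!: smooth_on_bilinear_field[OF B F V] simp: S)
  also have "fd (\<lambda>y. B (F y) (V y) (W x)) x X = fd (\<lambda>y. B (F y) (V x) (W x)) x X + B (F x) (fd V x X) (W x)"
    by (subst fd_eqI[OF fd_linear_app[OF S lin1(1) _ V x]])
       (auto intro!: smooth_on_compose[OF B(2) F])
  also have "fd (\<lambda>y. B (F y) (V x) (W x)) x X = fd (\<lambda>z. B z (V x) (W x)) (F x) (fd F x X)"
    by (rule fd_compose(1)[OF B(2) F(1) Fx x])
  finally show ?thesis .
qed

lemma smooth_on_linear_field:
  fixes B :: "'b::euclidean_space \<Rightarrow> 'c::euclidean_space \<Rightarrow> 'd::real_normed_vector"
    and F :: "'a::euclidean_space \<Rightarrow> 'b"
  assumes B: "\<And>y. y \<in> U \<Longrightarrow> linear (B y)" "\<And>v. smooth_on U (\<lambda>y. B y v)"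
    and F: "smooth_on S F" "F ` S \<subseteq> U" and V: "smooth_on S V"
  shows "smooth_on S (\<lambda>x. B (F x) (V x))"
  by (rule smooth_on_linear_app[OF _ smooth_on_compose[OF B(2) F] V]) (use B(1) F(2) in blast)

lemma fd_linear_field:
  fixes B :: "'b::euclidean_space \<Rightarrow> 'c::euclidean_space \<Rightarrow> 'd::real_normed_vector"
    and F :: "'a::euclidean_space \<Rightarrow> 'b"
  assumes B: "\<And>y. y \<in> U \<Longrightarrow> linear (B y)" "\<And>v. smooth_on U (\<lambda>y. B y v)"
    and F: "smooth_on S F" "F ` S \<subseteq> U" and V: "smooth_on S V" and x: "x \<in> S"
  shows "fd (\<lambda>y. B (F y) (V y)) x X = fd (\<lambda>z. B z (V x)) (F x) (fd F x X) + B (F x) (fd V x X)"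
proof -
  have S: "open S" by (rule smooth_on_open[OF F(1)])
  have Fx: "F x \<in> U" using F(2) x by auto
  have lin: "linear (B (F y))" if "y \<in> S" for y using B(1) F(2) that by blast
  have "fd (\<lambda>y. B (F y) (V y)) x X = fd (\<lambda>y. B (F y) (V x)) x X + B (F x) (fd V x X)"
    by (subst fd_eqI[OF fd_linear_app[OF S lin _ V x]]) (auto intro!: smooth_on_compose[OF B(2) F])
  also have "fd (\<lambda>y. B (F y) (V x)) x X = fd (\<lambda>z. B z (V x)) (F x) (fd F x X)"
    by (rule fd_compose(1)[OF B(2) F(1) Fx x])
  finally show ?thesis .
qed

section \<open>Kaehler metrics in a chart\<close>

locale metric_chart =
  fixes U :: "'e::euclidean_space set" and G :: "'e \<Rightarrow> 'e \<Rightarrow> 'e \<Rightarrow> real"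
  assumes open_U: "open U" and inner_form: "x \<in> U \<Longrightarrow> inner_form (G x)"
    and smooth_G: "smooth_on U (\<lambda>x. G x u v)"
begin

definition is_christoffel :: "'e \<Rightarrow> ('e \<Rightarrow> 'e \<Rightarrow> 'e) \<Rightarrow> bool" where
  "is_christoffel x \<Gamma> \<longleftrightarrow> bilinear \<Gamma> \<and> (\<forall>u v. \<Gamma> u v = \<Gamma> v u) \<and>
     (\<forall>u v w. fd (\<lambda>y. G y u v) x w = G x (\<Gamma> w u) v + G x u (\<Gamma> w v))"

text \<open>The lowered difference \<tau> of two solutions is symmetric in its first two arguments
  and skew in its last two. Alternating the two rules six times returns to the start with the
  opposite sign.\<close>

lemma is_christoffel_unique:
  assumes x: "x \<in> U" and "is_christoffel x \<Gamma>" "is_christoffel x \<Gamma>'"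
  shows "\<Gamma> = \<Gamma>'"
proof (intro ext)
  interpret inner_form "G x" by (rule inner_form[OF x])
  fix u v
  define \<tau> where "\<tau> u v w = G x (\<Gamma> u v) w - G x (\<Gamma>' u v) w" for u v w
  have s: "\<tau> u v w = \<tau> v u w" for u v w using assms(2,3) unfolding is_christoffel_def \<tau>_def by metis
  have a: "\<tau> u v w = - \<tau> u w v" for u v w
  proof -
    have "G x (\<Gamma> u v) w + G x v (\<Gamma> u w) = G x (\<Gamma>' u v) w + G x v (\<Gamma>' u w)"
      using assms(2,3) unfolding is_christoffel_def by metis
    then show ?thesis by (simp add: \<tau>_def sym[of v])
  qed
  have z: "\<tau> u v w = 0" for w
    using s[of u v w] a[of u v w] s[of u w v] a[of w u v] s[of w v u] a[of v w u] s[of v u w] by linarith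
  show "\<Gamma> u v = \<Gamma>' u v" by (rule G_eqI) (use z in \<open>simp add: \<tau>_def\<close>)
qed

text \<open>Koszul's formula for coordinate fields, whose brackets vanish.\<close>

definition koszul :: "'e \<Rightarrow> 'e \<Rightarrow> 'e \<Rightarrow> 'e \<Rightarrow> real" where
  "koszul x u v w = (fd (\<lambda>y. G y v w) x u + fd (\<lambda>y. G y u w) x v - fd (\<lambda>y. G y u v) x w) / 2"

text \<open>Lowering of an index, expressed through the built-in inner product. Solving
  \<open>lower x y = b\<close> raises it again, and as a linear system with smooth coefficients this
  keeps the smooth dependence on \<open>x\<close>.\<close>

definition lower :: "'e \<Rightarrow> 'e \<Rightarrow> 'e" where
  "lower x a = (\<Sum>b\<in>Basis. G x a b *\<^sub>R b)"

definition christoffel_solution :: "'e \<Rightarrow> 'e \<Rightarrow> 'e \<Rightarrow> 'e" where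
  "christoffel_solution x u v = inv (lower x) (\<Sum>b\<in>Basis. koszul x u v b *\<^sub>R b)"

lemma lower:
  assumes x: "x \<in> U"
  shows linear_lower: "linear (lower x)" and bij_lower: "bij (lower x)"
    and inner_lower: "lower x a \<bullet> w = G x a w"
proof -
  interpret inner_form "G x" by (rule inner_form[OF x])
  show l: "linear (lower x)"
    by (rule linearI) (simp_all add: lower_def G_simps sum.distrib scaleR_add_left scaleR_sum_right)
  show i: "lower x a \<bullet> w = G x a w" for a w
    by (simp add: lower_def inner_sum_left linear_sum_Basis[OF G_linear(1), of a w] inner_commute[of w] mult.commute)
  have "a = 0" if "lower x a = 0" for a using i[of a] that by (intro G_nondegenerate) simp
  then have "inj (lower x)" using l by (simp add: linear_injective_0)
  then show "bij (lower x)" using l by (simp add: bij_def linear_injective_imp_surjective)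
qed

lemma fd_G:
  assumes x: "x \<in> U"
  shows fd_G_linear1: "linear (\<lambda>u. fd (\<lambda>y. G y u v) x w)"
    and fd_G_linear2: "linear (\<lambda>v. fd (\<lambda>y. G y u v) x w)"
    and fd_G_linear3: "linear (\<lambda>w. fd (\<lambda>y. G y u v) x w)"
    and fd_G_sym: "fd (\<lambda>y. G y u v) x w = fd (\<lambda>y. G y v u) x w"
proof -
  have b: "bilinear (G y)" if "y \<in> U" for y using inner_form[OF that] by (simp add: inner_form_def)
  show "linear (\<lambda>u. fd (\<lambda>y. G y u v) x w)"
    by (rule linear_fd_arg[OF open_U _ smooth_G x]) (use b in \<open>auto simp: bilinear_def\<close>)
  show "linear (\<lambda>v. fd (\<lambda>y. G y u v) x w)"
    by (rule linear_fd_arg[OF open_U _ smooth_G x]) (use b in \<open>auto simp: bilinear_def\<close>)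
  show "linear (\<lambda>w. fd (\<lambda>y. G y u v) x w)"
    by (rule smooth_on_linear_fd[OF smooth_G x])
  show "fd (\<lambda>y. G y u v) x w = fd (\<lambda>y. G y v u) x w"
    by (rule fun_cong[OF fd_cong[OF open_U x]]) (use inner_form inner_form.sym in blast)
qed

lemma koszul_linear:
  assumes x: "x \<in> U"
  shows "linear (\<lambda>u. koszul x u v w)" "linear (\<lambda>v. koszul x u v w)" "linear (\<lambda>w. koszul x u v w)"
proof -
  note l = linear_add[OF fd_G_linear1[OF x]] linear_add[OF fd_G_linear2[OF x]] linear_add[OF fd_G_linear3[OF x]]
    linear_cmul[OF fd_G_linear1[OF x]] linear_cmul[OF fd_G_linear2[OF x]] linear_cmul[OF fd_G_linear3[OF x]]
  show "linear (\<lambda>u. koszul x u v w)" "linear (\<lambda>v. koszul x u v w)" "linear (\<lambda>w. koszul x u v w)"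
    by (rule linearI; simp add: koszul_def l add_divide_distrib diff_divide_distrib algebra_simps)+
qed

lemma G_christoffel_solution:
  assumes x: "x \<in> U"
  shows "G x (christoffel_solution x u v) w = koszul x u v w"
proof -
  have "lower x (christoffel_solution x u v) = (\<Sum>b\<in>Basis. koszul x u v b *\<^sub>R b)"
    unfolding christoffel_solution_def using bij_lower[OF x] by (simp add: bij_is_surj surj_f_inv_f)
  then have "G x (christoffel_solution x u v) w = (\<Sum>b\<in>Basis. koszul x u v b *\<^sub>R b) \<bullet> w"
    using inner_lower[OF x] by metis
  also have "\<dots> = koszul x u v w"
    by (simp add: inner_sum_left linear_sum_Basis[OF koszul_linear(3)[OF x], of u v w] inner_commute[of w] mult.commute)
  finally show ?thesis .
qed

lemma is_christoffel_solution:
  assumes x: "x \<in> U"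
  shows "is_christoffel x (christoffel_solution x)"
proof -
  interpret inner_form "G x" by (rule inner_form[OF x])
  note G = G_christoffel_solution[OF x]
  have "bilinear (christoffel_solution x)"
    unfolding bilinear_def
    by (intro allI conjI linearI; rule G_eqI;
        simp add: G_simps G linear_add[OF koszul_linear(1)[OF x]] linear_add[OF koszul_linear(2)[OF x]]
          linear_cmul[OF koszul_linear(1)[OF x]] linear_cmul[OF koszul_linear(2)[OF x]])
  moreover have "christoffel_solution x u v = christoffel_solution x v u" for u v
    by (rule G_eqI) (simp add: G koszul_def fd_G_sym[OF x, of u v])
  moreover have "fd (\<lambda>y. G y u v) x w = G x (christoffel_solution x w u) v + G x u (christoffel_solution x w v)" for u v w
    by (simp add: G sym[of u] koszul_def fd_G_sym[OF x, of v u] fd_G_sym[OF x, of w v] fd_G_sym[OF x, of w u] field_simps)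
  ultimately show ?thesis unfolding is_christoffel_def by blast
qed

lemma smooth_christoffel_solution: "smooth_on U (\<lambda>x. christoffel_solution x u v)"
proof (rule smooth_on_linear_system[where L=lower and b="\<lambda>x. \<Sum>b\<in>Basis. koszul x u v b *\<^sub>R b"])
  show "smooth_on U (\<lambda>x. lower x a)" for a
    unfolding lower_def using open_U by (intro smooth_on_sum smooth_on_scaleR smooth_G smooth_on_const)
  have "smooth_on U (\<lambda>x. koszul x u v b)" for b
  proof -
    have "smooth_on U (\<lambda>x. (1/2) * (fd (\<lambda>y. G y v b) x u + fd (\<lambda>y. G y u b) x v - fd (\<lambda>y. G y u v) x b))"
      using open_U by (intro smooth_on_mult smooth_on_const smooth_on_add smooth_on_diff smooth_on_fd smooth_G)
    then show ?thesis by (simp add: koszul_def[abs_def])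
  qed
  then show "smooth_on U (\<lambda>x. \<Sum>b\<in>Basis. koszul x u v b *\<^sub>R b)"
    using open_U by (intro smooth_on_sum smooth_on_scaleR smooth_on_const)
  show "lower x (christoffel_solution x u v) = (\<Sum>b\<in>Basis. koszul x u v b *\<^sub>R b)" if "x \<in> U" for x
    unfolding christoffel_solution_def using bij_lower[OF that] by (simp add: bij_is_surj surj_f_inv_f)
qed (auto intro: linear_lower bij_lower)

lemma the_christoffel:
  "x \<in> U \<Longrightarrow> (THE \<Gamma>. is_christoffel x \<Gamma>) = christoffel_solution x"
  using is_christoffel_solution is_christoffel_unique by blast

end

section \<open>Covariant derivatives along maps into a Kaehler chart\<close>

text \<open>The Kaehler structure read in one chart. \<open>\<Gamma>\<close> is a parameter with its
  characterising properties, so that no definite description enters the computations.\<close>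

locale kaehler_chart =
  fixes U :: "'e::euclidean_space set" and G :: "'e \<Rightarrow> 'e \<Rightarrow> 'e \<Rightarrow> real"
    and J :: "'e \<Rightarrow> 'e \<Rightarrow> 'e" and \<Gamma> :: "'e \<Rightarrow> 'e \<Rightarrow> 'e \<Rightarrow> 'e"
  assumes open_U: "open U" and herm_space: "x \<in> U \<Longrightarrow> hermitian_space (G x) (J x)"
    and smooth_G: "smooth_on U (\<lambda>x. G x u v)" and smooth_J: "smooth_on U (\<lambda>x. J x v)"
    and smooth_\<Gamma>: "smooth_on U (\<lambda>x. \<Gamma> x u v)" and bilinear_\<Gamma>: "x \<in> U \<Longrightarrow> bilinear (\<Gamma> x)"
    and \<Gamma>_sym: "x \<in> U \<Longrightarrow> \<Gamma> x u v = \<Gamma> x v u"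
    and metric: "x \<in> U \<Longrightarrow> fd (\<lambda>y. G y u v) x w = G x (\<Gamma> x w u) v + G x u (\<Gamma> x w v)"
    and J_parallel: "x \<in> U \<Longrightarrow> fd (\<lambda>y. J y v) x u + \<Gamma> x u (J x v) = J x (\<Gamma> x u v)"
begin

lemma J_linear: "x \<in> U \<Longrightarrow> linear (J x)"
  using herm_space complex_space.J_linear hermitian_space.axioms(2) by blast

lemma bilinear_G: "x \<in> U \<Longrightarrow> bilinear (G x)"
  using herm_space inner_form.bil hermitian_space.axioms(1) by blast

lemmas \<Gamma>_simps = bilinear_ladd[OF bilinear_\<Gamma>] bilinear_radd[OF bilinear_\<Gamma>] bilinear_lmul[OF bilinear_\<Gamma>]
  bilinear_rmul[OF bilinear_\<Gamma>] bilinear_lzero[OF bilinear_\<Gamma>] bilinear_rzero[OF bilinear_\<Gamma>]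
  bilinear_lneg[OF bilinear_\<Gamma>] bilinear_rneg[OF bilinear_\<Gamma>] bilinear_lsub[OF bilinear_\<Gamma>] bilinear_rsub[OF bilinear_\<Gamma>]

definition curv :: "'e \<Rightarrow> 'e \<Rightarrow> 'e \<Rightarrow> 'e \<Rightarrow> 'e" where
  "curv x u v w = fd (\<lambda>y. \<Gamma> y v w) x u - fd (\<lambda>y. \<Gamma> y u w) x v + \<Gamma> x u (\<Gamma> x v w) - \<Gamma> x v (\<Gamma> x u w)"

text \<open>Covariant derivative of a field \<open>W\<close> along a map \<open>F\<close> from an
  arbitrary Euclidean space. \<open>F\<close> will be an immersion in charts, the identity (for the
  curvature identities), a transition map, and a variation as a map of space-time.\<close>

definition cov :: "('p::euclidean_space \<Rightarrow> 'e) \<Rightarrow> ('p \<Rightarrow> 'e) \<Rightarrow> 'p \<Rightarrow> 'p \<Rightarrow> 'e" where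
  "cov F W x X = fd W x X + \<Gamma> (F x) (fd F x X) (W x)"

context
  fixes F :: "'p::euclidean_space \<Rightarrow> 'e" and V :: "'p set"
  assumes F: "smooth_on V F" and FU: "F ` V \<subseteq> U"
begin

lemma F_in: "x \<in> V \<Longrightarrow> F x \<in> U" using FU by auto

lemma smooth_on_cov: "smooth_on V W \<Longrightarrow> smooth_on V (\<lambda>x. cov F W x X)"
  unfolding cov_def
  by (intro smooth_on_add smooth_on_fd smooth_on_bilinear_field[OF bilinear_\<Gamma> smooth_\<Gamma> F FU] F)

lemma linear_cov: "smooth_on V W \<Longrightarrow> x \<in> V \<Longrightarrow> linear (cov F W x)"
  unfolding cov_def
  by (rule linearI)
     (simp_all add: linear_add[OF smooth_on_linear_fd] linear_cmul[OF smooth_on_linear_fd] F \<Gamma>_simps F_in algebra_simps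
       linear_add[OF smooth_on_linear_fd[OF F]] linear_cmul[OF smooth_on_linear_fd[OF F]])

lemma smooth_on_G_field: "smooth_on V W \<Longrightarrow> smooth_on V W' \<Longrightarrow> smooth_on V (\<lambda>x. G (F x) (W x) (W' x))"
  by (rule smooth_on_bilinear_field[OF bilinear_G smooth_G F FU])

lemma smooth_on_J_field: "smooth_on V W \<Longrightarrow> smooth_on V (\<lambda>x. J (F x) (W x))"
  by (rule smooth_on_linear_field[OF J_linear smooth_J F FU])

lemma fd_G_field:
  assumes W: "smooth_on V W" "smooth_on V W'" and x: "x \<in> V"
  shows "fd (\<lambda>y. G (F y) (W y) (W' y)) x X = G (F x) (cov F W x X) (W' x) + G (F x) (W x) (cov F W' x X)"
proof -
  interpret hermitian_space "G (F x)" "J (F x)" by (rule herm_space[OF F_in[OF x]])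
  show ?thesis
    by (subst fd_bilinear_field[OF bilinear_G smooth_G F FU W x])
       (simp_all add: metric F_in x cov_def G_simps)
qed

lemma cov_J:
  assumes W: "smooth_on V W" and x: "x \<in> V"
  shows "cov F (\<lambda>y. J (F y) (W y)) x X = J (F x) (cov F W x X)"
proof -
  have "cov F (\<lambda>y. J (F y) (W y)) x X =
    (fd (\<lambda>z. J z (W x)) (F x) (fd F x X) + \<Gamma> (F x) (fd F x X) (J (F x) (W x))) + J (F x) (fd W x X)"
    unfolding cov_def by (subst fd_linear_field[OF J_linear smooth_J F FU W x]) simp_all
  then show ?thesis by (simp add: J_parallel F_in x cov_def linear_add[OF J_linear])
qed

lemma cov_add:
  assumes "smooth_on V W" "smooth_on V W'" "x \<in> V"
  shows "cov F (\<lambda>y. W y + W' y) x X = cov F W x X + cov F W' x X"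
  using assms by (simp add: cov_def fd_add smooth_on_differentiable \<Gamma>_simps F_in)

lemma cov_sum:
  assumes "\<And>i. i \<in> I \<Longrightarrow> smooth_on V (W i)" "x \<in> V"
  shows "cov F (\<lambda>y. \<Sum>i\<in>I. W i y) x X = (\<Sum>i\<in>I. cov F (W i) x X)"
  using assms
  by (induction I rule: infinite_finite_induct)
     (simp_all add: cov_add smooth_on_sum smooth_on_open[OF F], simp_all add: cov_def \<Gamma>_simps F_in)

lemma cov_scaleR:
  assumes "smooth_on V r" "smooth_on V W" "x \<in> V"
  shows "cov F (\<lambda>y. r y *\<^sub>R W y) x X = fd r x X *\<^sub>R W x + r x *\<^sub>R cov F W x X"
proof -
  have "fd (\<lambda>y. r y *\<^sub>R W y) x = (\<lambda>h. r x *\<^sub>R fd W x h + fd r x h *\<^sub>R W x)"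
    by (intro fd_eqI has_derivative_scaleR smooth_on_has_derivative[OF assms(1,3)] smooth_on_has_derivative[OF assms(2,3)])
  then show ?thesis by (simp add: cov_def \<Gamma>_simps F_in assms(3) algebra_simps)
qed

lemma smooth_on_cact:
  assumes "smooth_on V z" "smooth_on V W"
  shows "smooth_on V (\<lambda>y. cact (J (F y)) (z y) (W y))"
  unfolding cact_def
  by (intro smooth_on_add smooth_on_scaleR smooth_on_J_field assms smooth_on_linear_compose[OF bounded_linear_Re]
      smooth_on_linear_compose[OF bounded_linear_Im])

lemma cov_cact:
  assumes z: "smooth_on V z" and W: "smooth_on V W" and x: "x \<in> V"
  shows "cov F (\<lambda>y. cact (J (F y)) (z y) (W y)) x X = cact (J (F x)) (fd z x X) (W x) + cact (J (F x)) (z x) (cov F W x X)"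
proof -
  have r: "smooth_on V (\<lambda>y. Re (z y))" "smooth_on V (\<lambda>y. Im (z y))"
    using z by (auto intro: smooth_on_linear_compose bounded_linear_Re bounded_linear_Im)
  have d: "fd (\<lambda>y. Re (z y)) x X = Re (fd z x X)" "fd (\<lambda>y. Im (z y)) x X = Im (fd z x X)"
    by (simp_all add: fd_bounded_linear bounded_linear_Re bounded_linear_Im smooth_on_differentiable[OF z x])
  show ?thesis
    by (simp add: cact_def cov_add smooth_on_scaleR r W smooth_on_J_field x cov_scaleR cov_J d)
qed

lemma cov_torsion_free:
  assumes x: "x \<in> V"
  shows "cov F (\<lambda>y. fd F y Y) x X = cov F (\<lambda>y. fd F y X) x Y"
  unfolding cov_def using fd_commute[OF F x] \<Gamma>_sym[OF F_in[OF x]] by simp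

text \<open>In the iterated derivative the second derivatives of \<open>W\<close> and
  \<open>F\<close> are symmetric by \<open>fd_commute\<close>, and the two terms with a first
  derivative of \<open>W\<close> are exchanged by swapping \<open>X\<close> and \<open>Y\<close>.
  Only the derivative of \<open>\<Gamma>\<close> and the product of two \<open>\<Gamma>\<close>
  survive the antisymmetrisation.\<close>

lemma cov_curv:
  assumes W: "smooth_on V W" and x: "x \<in> V"
  shows "cov F (\<lambda>y. cov F W y Y) x X - cov F (\<lambda>y. cov F W y X) x Y = curv (F x) (fd F x X) (fd F x Y) (W x)"
proof -
  have *: "cov F (\<lambda>y. cov F W y Y) x X = fd (\<lambda>y. fd W y Y) x X +
     (fd (\<lambda>z. \<Gamma> z (fd F x Y) (W x)) (F x) (fd F x X) + \<Gamma> (F x) (fd (\<lambda>y. fd F y Y) x X) (W x) + \<Gamma> (F x) (fd F x Y) (fd W x X))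
     + \<Gamma> (F x) (fd F x X) (fd W x Y) + \<Gamma> (F x) (fd F x X) (\<Gamma> (F x) (fd F x Y) (W x))" for X Y
  proof -
    have sm: "smooth_on V (\<lambda>y. \<Gamma> (F y) (fd F y Y) (W y))"
      by (intro smooth_on_bilinear_field[OF bilinear_\<Gamma> smooth_\<Gamma> F FU] smooth_on_fd F W)
    have "fd (\<lambda>y. cov F W y Y) x X = fd (\<lambda>y. fd W y Y) x X + fd (\<lambda>y. \<Gamma> (F y) (fd F y Y) (W y)) x X"
      unfolding cov_def by (intro fd_add smooth_on_differentiable[OF _ x] smooth_on_fd W sm)
    also have "fd (\<lambda>y. \<Gamma> (F y) (fd F y Y) (W y)) x X = fd (\<lambda>z. \<Gamma> z (fd F x Y) (W x)) (F x) (fd F x X)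
        + \<Gamma> (F x) (fd (\<lambda>y. fd F y Y) x X) (W x) + \<Gamma> (F x) (fd F x Y) (fd W x X)"
      by (rule fd_bilinear_field[OF bilinear_\<Gamma> smooth_\<Gamma> F FU smooth_on_fd[OF F] W x])
    finally show ?thesis unfolding cov_def[of F "\<lambda>y. cov F W y Y"]
      by (simp add: cov_def[of F W] \<Gamma>_simps F_in x)
  qed
  show ?thesis
    unfolding * curv_def using fd_commute[OF F x, of X Y] fd_commute[OF W x, of X Y] by (simp add: algebra_simps)
qed

end

end

section \<open>Connection matrix, density and determinant form of a complex frame\<close>

context kaehler_chart
begin

lemma hermitian_space_at: "x \<in> U \<Longrightarrow> complex_space (J x)"
  using herm_space hermitian_space.axioms(2) by blast

definition frame_coef :: "('p::euclidean_space \<Rightarrow> 'e) \<Rightarrow> ('n::finite \<Rightarrow> 'p \<Rightarrow> 'e) \<Rightarrow> ('p \<Rightarrow> 'e) \<Rightarrow> 'p \<Rightarrow> complex^'n" where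
  "frame_coef F E W x = inv (frame_map (J (F x)) (\<lambda>i. E i x)) (W x)"

definition connection_coef :: "('p::euclidean_space \<Rightarrow> 'e) \<Rightarrow> ('n::finite \<Rightarrow> 'p \<Rightarrow> 'e) \<Rightarrow> 'n \<Rightarrow> 'p \<Rightarrow> 'p \<Rightarrow> complex^'n" where
  "connection_coef F E i X x = frame_coef F E (\<lambda>y. cov F (E i) y X) x"

text \<open>The 1-form \<theta> of the overview; the vectors
  \<open>connection_coef F E i X x\<close> are the rows of the matrix \<omega>.\<close>

definition connection_trace :: "('p::euclidean_space \<Rightarrow> 'e) \<Rightarrow> ('n::finite \<Rightarrow> 'p \<Rightarrow> 'e) \<Rightarrow> 'p \<Rightarrow> 'p \<Rightarrow> complex" where
  "connection_trace F E X x = (\<Sum>i\<in>UNIV. connection_coef F E i X x $ i)"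

definition gram_matrix :: "('p::euclidean_space \<Rightarrow> 'e) \<Rightarrow> ('n::finite \<Rightarrow> 'p \<Rightarrow> 'e) \<Rightarrow> 'p \<Rightarrow> complex^'n^'n" where
  "gram_matrix F E x = (\<chi> i j. herm (G (F x)) (J (F x)) (E i x) (E j x))"

definition J_density :: "('p::euclidean_space \<Rightarrow> 'e) \<Rightarrow> ('n::finite \<Rightarrow> 'p \<Rightarrow> 'e) \<Rightarrow> 'p \<Rightarrow> real" where
  "J_density F E x = sqrt (Re (det (gram_matrix F E x)))"

context
  fixes F :: "'p::euclidean_space \<Rightarrow> 'e" and V :: "'p set" and E :: "'n::finite \<Rightarrow> 'p \<Rightarrow> 'e"
  assumes F: "smooth_on V F" and FU: "F ` V \<subseteq> U"
    and E: "\<And>i. smooth_on V (E i)"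
    and bij: "\<And>x. x \<in> V \<Longrightarrow> bij (frame_map (J (F x)) (\<lambda>i. E i x))"
    and dim: "DIM('e) = 2 * CARD('n)"
begin

abbreviation "coef \<equiv> frame_coef F E"
abbreviation "conn_coef \<equiv> connection_coef F E"
abbreviation "conn_trace \<equiv> connection_trace F E"
abbreviation "gram \<equiv> gram_matrix F E"
abbreviation "dens \<equiv> J_density F E"

lemma F_mem: "x \<in> V \<Longrightarrow> F x \<in> U" using FU by auto

lemma V_open: "open V" using smooth_on_open[OF F] .

lemma frame_map_coef: "x \<in> V \<Longrightarrow> frame_map (J (F x)) (\<lambda>i. E i x) (coef W x) = W x"
  unfolding frame_coef_def by (rule complex_space.frame_map_cof[OF hermitian_space_at[OF F_mem] bij])

lemma coef_expand: "x \<in> V \<Longrightarrow> W x = (\<Sum>i\<in>UNIV. cact (J (F x)) (coef W x $ i) (E i x))"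
  using frame_map_coef[of x W] by (simp add: frame_map_def)

lemma smooth_on_coef:
  assumes "smooth_on V W" shows "smooth_on V (coef W)"
proof (rule smooth_on_linear_system[where L="\<lambda>x. frame_map (J (F x)) (\<lambda>i. E i x)" and b=W])
  fix u :: "complex^'n"
  show "smooth_on V (\<lambda>x. frame_map (J (F x)) (\<lambda>i. E i x) u)"
    unfolding frame_map_def by (intro smooth_on_sum V_open smooth_on_cact[OF F FU] smooth_on_const E)
qed (auto intro: linear_frame_map bij assms frame_map_coef)

lemma smooth_on_vec_nth:
  fixes z :: "'p \<Rightarrow> complex^'n"
  shows "smooth_on V z \<Longrightarrow> smooth_on V (\<lambda>x. z x $ i)"
  by (rule smooth_on_linear_compose[OF bounded_linear_vec_nth])

lemma fd_vec_nth:
  fixes z :: "'p \<Rightarrow> complex^'n"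
  shows "smooth_on V z \<Longrightarrow> x \<in> V \<Longrightarrow> fd (\<lambda>x. z x $ i) x X = fd z x X $ i"
  by (rule fd_bounded_linear[OF bounded_linear_vec_nth smooth_on_differentiable])

lemma smooth_on_conn_coef: "smooth_on V (conn_coef i X)"
  unfolding connection_coef_def[abs_def] by (intro smooth_on_coef smooth_on_cov[OF F FU] E)

lemma smooth_on_conn_trace: "smooth_on V (conn_trace X)"
  unfolding connection_trace_def[abs_def] by (intro smooth_on_sum V_open smooth_on_vec_nth smooth_on_conn_coef)

lemma linear_conn_trace: "x \<in> V \<Longrightarrow> linear (\<lambda>X. conn_trace X x)"
  using linear_cov[OF F FU E, of x] linear_bij_inv[OF linear_frame_map bij, of x]
  by (intro linearI) (simp_all add: connection_trace_def connection_coef_def frame_coef_def linear_add linear_cmul sum.distrib scaleR_sum_right)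

lemma coef_cov_frame_map:
  assumes z: "smooth_on V z" and x: "x \<in> V"
  shows "coef (\<lambda>y. cov F (\<lambda>y. frame_map (J (F y)) (\<lambda>i. E i y) (z y)) y X) x =
    fd z x X + (\<Sum>i\<in>UNIV. (z x $ i) *s conn_coef i X x)"
proof -
  interpret complex_space "J (F x)" by (rule hermitian_space_at[OF F_mem[OF x]])
  have zi: "smooth_on V (\<lambda>y. z y $ i)" for i by (rule smooth_on_vec_nth[OF z])
  have "cov F (\<lambda>y. frame_map (J (F y)) (\<lambda>i. E i y) (z y)) x X =
    (\<Sum>i\<in>UNIV. cact (J (F x)) (fd z x X $ i) (E i x) + cact (J (F x)) (z x $ i) (cov F (E i) x X))"
    unfolding frame_map_def
    by (subst cov_sum[OF F FU]) (simp_all add: smooth_on_cact[OF F FU] zi E x cov_cact[OF F FU] fd_vec_nth[OF z])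
  also have "\<dots> = frame_map (J (F x)) (\<lambda>i. E i x) (fd z x X) +
     (\<Sum>i\<in>UNIV. cact (J (F x)) (z x $ i) (cov F (E i) x X))"
    by (simp add: sum.distrib frame_map_def)
  finally show ?thesis
    using bij[OF x] by (simp add: frame_coef_def connection_coef_def cof_simps[OF bij[OF x]] cof_frame_map
      linear_sum[OF linear_cof[OF bij[OF x]]] cof_cact)
qed

text \<open>The frame combination with coefficients \<open>coef W\<close> agrees with
  \<open>W\<close> on the open set \<open>V\<close>, hence also to first order, so this is
  \<open>coef_cov_frame_map\<close> for \<open>z = coef W\<close>.\<close>

lemma coef_cov:
  assumes W: "smooth_on V W" and x: "x \<in> V"
  shows "coef (\<lambda>y. cov F W y X) x = fd (coef W) x X + (\<Sum>i\<in>UNIV. (coef W x $ i) *s conn_coef i X x)"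
proof -
  have eq: "frame_map (J (F y)) (\<lambda>i. E i y) (coef W y) = W y" if "y \<in> V" for y
    by (rule frame_map_coef[OF that])
  have "fd (\<lambda>y. frame_map (J (F y)) (\<lambda>i. E i y) (coef W y)) x = fd W x"
    by (rule fd_cong[OF V_open x]) (rule eq)
  then have "cov F (\<lambda>y. frame_map (J (F y)) (\<lambda>i. E i y) (coef W y)) x X = cov F W x X"
    by (simp add: cov_def eq x)
  then show ?thesis
    using coef_cov_frame_map[OF smooth_on_coef[OF W] x, of X] by (simp add: frame_coef_def)
qed

lemma gram_pos:
  assumes x: "x \<in> V"
  shows "det (gram x) = of_real (Re (det (gram x)))" "Re (det (gram x)) > 0"
  using hermitian_space.gram_det_pos[OF herm_space[OF F_mem[OF x]] bij[OF x] dim] unfolding gram_matrix_def by auto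

lemma density_pos: "x \<in> V \<Longrightarrow> dens x > 0"
  using gram_pos(2) by (simp add: J_density_def)

lemma cov_frame: "x \<in> V \<Longrightarrow> cov F (E i) x X = (\<Sum>k\<in>UNIV. cact (J (F x)) (conn_coef i X x $ k) (E k x))"
  using coef_expand[of x "\<lambda>y. cov F (E i) y X"] by (simp add: connection_coef_def)

text \<open>As metric and complex structure are parallel, so is the Hermitian form; thus the Gram
  matrix H satisfies dH = \<omega> H + H \<omega>' with \<omega>' the adjoint of \<omega>.\<close>

lemma gram_has_derivative:
  assumes x: "x \<in> V"
  shows "((\<lambda>y. gram y $ i $ j) has_derivative (\<lambda>X. ((\<chi> i k. conn_coef i X x $ k) ** gram x
      + gram x ** transpose (\<chi> i k. cnj (conn_coef i X x $ k))) $ i $ j)) (at x)"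
proof -
  interpret hermitian_space "G (F x)" "J (F x)" by (rule herm_space[OF F_mem[OF x]])
  have s1: "smooth_on V (\<lambda>y. G (F y) (E i y) (E j y))" by (intro smooth_on_G_field[OF F FU] E)
  have s2: "smooth_on V (\<lambda>y. G (F y) (J (F y) (E i y)) (E j y))"
    by (intro smooth_on_G_field[OF F FU] smooth_on_J_field[OF F FU] E)
  have "((\<lambda>y. of_real (G (F y) (E i y) (E j y)) - \<i> * of_real (G (F y) (J (F y) (E i y)) (E j y))) has_derivative
    (\<lambda>X. of_real (fd (\<lambda>y. G (F y) (E i y) (E j y)) x X) -
        \<i> * of_real (fd (\<lambda>y. G (F y) (J (F y) (E i y)) (E j y)) x X))) (at x)"
    by (intro has_derivative_diff has_derivative_mult_right has_derivative_of_real
         smooth_on_has_derivative[OF s1 x] smooth_on_has_derivative[OF s2 x])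
  moreover have "of_real (fd (\<lambda>y. G (F y) (E i y) (E j y)) x X) -
        \<i> * of_real (fd (\<lambda>y. G (F y) (J (F y) (E i y)) (E j y)) x X) =
     ((\<chi> i k. conn_coef i X x $ k) ** gram x
      + gram x ** transpose (\<chi> i k. cnj (conn_coef i X x $ k))) $ i $ j" for X
  proof -
    have "of_real (fd (\<lambda>y. G (F y) (E i y) (E j y)) x X) -
        \<i> * of_real (fd (\<lambda>y. G (F y) (J (F y) (E i y)) (E j y)) x X) =
      herm (G (F x)) (J (F x)) (cov F (E i) x X) (E j x) + herm (G (F x)) (J (F x)) (E i x) (cov F (E j) x X)"
      by (simp add: fd_G_field[OF F FU] E x smooth_on_J_field[OF F FU] cov_J[OF F FU] herm_def algebra_simps)
    also have "\<dots> = ((\<chi> i k. conn_coef i X x $ k) ** gram x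
      + gram x ** transpose (\<chi> i k. cnj (conn_coef i X x $ k))) $ i $ j"
      by (simp add: cov_frame x herm_sum_left herm_sum_right herm_cact_left herm_cact_right gram_matrix_def
         matrix_matrix_mult_def transpose_def mult.commute)
    finally show ?thesis .
  qed
  ultimately show ?thesis by (simp add: gram_matrix_def herm_def)
qed

text \<open>Jacobi's formula: \<omega> on the left contributes \<theta>, its adjoint on the right
  the conjugate of \<theta>.\<close>

lemma det_gram_has_derivative:
  assumes x: "x \<in> V"
  shows "((\<lambda>y. det (gram y)) has_derivative (\<lambda>X. of_real (2 * Re (conn_trace X x)) * det (gram x))) (at x)"
proof -
  have "(\<Sum>k\<in>UNIV. det (\<chi> i. if i = k then ((\<chi> i k. conn_coef i X x $ k) ** gram x
      + gram x ** transpose (\<chi> i k. cnj (conn_coef i X x $ k))) $ k else gram x $ i)) =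
      of_real (2 * Re (conn_trace X x)) * det (gram x)" (is "?l = _") for X
  proof -
    have "?l = (\<Sum>k\<in>UNIV. det (\<chi> i. if i = k then ((\<chi> i k. conn_coef i X x $ k) ** gram x) $ k else gram x $ i))
      + (\<Sum>k\<in>UNIV. det (\<chi> i. if i = k then (gram x ** transpose (\<chi> i k. cnj (conn_coef i X x $ k))) $ k else gram x $ i))"
      by (simp add: sum.distrib[symmetric] det_row_add cong: if_cong)
    also have "\<dots> = (conn_trace X x + cnj (conn_trace X x)) * det (gram x)"
      unfolding sum_det_replace_row_mult_left sum_det_replace_row_mult_right
      by (simp add: connection_trace_def transpose_def distrib_right)
    finally show ?thesis by (simp add: complex_add_cnj)
  qed
  then show ?thesis using has_derivative_det[of gram _ x, OF gram_has_derivative[OF x]] by simp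
qed

lemma density_has_derivative:
  assumes x: "x \<in> V"
  shows "(dens has_derivative (\<lambda>X. dens x * Re (conn_trace X x))) (at x)"
proof -
  define r where "r = Re (det (gram x))"
  have r: "r > 0" "det (gram x) = of_real r" using gram_pos[OF x] by (simp_all add: r_def)
  have 1: "((\<lambda>y. Re (det (gram y))) has_derivative (\<lambda>X. 2 * Re (conn_trace X x) * r)) (at x)"
    using has_derivative_Re[OF det_gram_has_derivative[OF x]] by (simp add: r(2))
  have 2: "(sqrt has_derivative (\<lambda>h. inverse (sqrt r) / 2 * h)) (at r)"
    using DERIV_real_sqrt[OF r(1)] by (simp only: has_field_derivative_def)
  have 3: "(dens has_derivative (\<lambda>X. inverse (sqrt r) / 2 * (2 * Re (conn_trace X x) * r))) (at x)"
    using has_derivative_compose[OF 1 2[unfolded r_def]] by (simp only: J_density_def[abs_def] r_def)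
  have e: "inverse (sqrt r) / 2 * (2 * c * r) = sqrt r * c" for c
    using r(1) by (simp add: field_simps)
  show ?thesis using 3[unfolded e] by (simp only: J_density_def r_def)
qed

lemma fd_density: "x \<in> V \<Longrightarrow> fd dens x X = dens x * Re (conn_trace X x)"
  using fd_eqI[OF density_has_derivative] by simp

text \<open>The equation d\<rho> = \<rho> Re \<theta> has a smooth coefficient, so each order of
  differentiability of \<rho> implies the next one.\<close>

lemma smooth_on_density: "smooth_on V dens"
proof -
  have "Ck_on k V dens" for k
  proof (induction k)
    case 0
    show ?case
      using density_has_derivative has_derivative_continuous by (simp add: continuous_on_eq_continuous_at[OF V_open]) blast
  next
    case (Suc k)
    have "Ck_on k V (\<lambda>x. dens x * Re (conn_trace v x))" for v
      using smooth_on_linear_compose[OF bounded_linear_Re smooth_on_conn_trace[of v]]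
      by (intro Ck_on_bilinear[OF bounded_bilinear_mult V_open Suc]) (simp add: smooth_on_def)
    then have "Ck_on k V (\<lambda>x. fd dens x v)" for v
      using Ck_on_cong[OF V_open, of "\<lambda>x. dens x * Re (conn_trace v x)" "\<lambda>x. fd dens x v" k]
      by (simp add: fd_density)
    then show ?case using density_has_derivative by (auto simp: differentiable_def)
  qed
  then show ?thesis by (simp add: smooth_on_def V_open)
qed

text \<open>The covariant derivative of \<rho> times the wedge product of the coframe, evaluated on
  fields \<open>W j\<close>. The terms with differentiated coordinates cancel, the connection matrix
  contributes - \<theta> by the determinant formulas, and \<rho> contributes Re \<theta>.\<close>

lemma cov_det_form:
  assumes W: "\<And>j. smooth_on V (W j)" and x: "x \<in> V"
  shows "fd (\<lambda>y. of_real (dens y) * det (\<chi> i j. coef (W j) y $ i)) x X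
     - (\<Sum>j\<in>UNIV. of_real (dens x) * det (\<chi> i k. (if k = j then coef (\<lambda>y. cov F (W j) y X) x else coef (W k) x) $ i))
    = - \<i> * Im (conn_trace X x) * (of_real (dens x) * det (\<chi> i j. coef (W j) x $ i))"
proof -
  define Z where "Z y = (\<chi> j. coef (W j) y)" for y
  define M where "M = (\<chi> i k. conn_coef i X x $ k)"
  \<comment> \<open>In the statement the fields are columns, as in \<open>coframe_wedge\<close>;
    transposing makes them rows, for which the derivative of \<open>det\<close> is stated.\<close>
  have dt: "det (\<chi> i j. coef (W j) y $ i) = det (Z y)" for y
    by (subst det_transpose[symmetric]) (simp add: Z_def transpose_def)
  have sm: "smooth_on V (coef (W j))" for j by (rule smooth_on_coef[OF W])
  have "((\<lambda>y. det (Z y)) has_derivative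
    (\<lambda>X. \<Sum>k\<in>UNIV. det (\<chi> i. if i = k then (\<chi> j. fd (coef (W j)) x X) $ k else Z x $ i))) (at x)"
  proof (rule has_derivative_det)
    fix i j
    have "((\<lambda>y. coef (W i) y $ j) has_derivative (\<lambda>h. fd (coef (W i)) x h $ j)) (at x)"
      by (rule bounded_linear.has_derivative[OF bounded_linear_vec_nth smooth_on_has_derivative[OF sm x]])
    then show "((\<lambda>y. Z y $ i $ j) has_derivative (\<lambda>h. (\<chi> j. fd (coef (W j)) x h) $ i $ j)) (at x)"
      by (simp add: Z_def)
  qed
  from has_derivative_mult[OF has_derivative_of_real[OF density_has_derivative[OF x]] this]
  have 1: "fd (\<lambda>y. of_real (dens y) * det (Z y)) x X =
    of_real (dens x) * (\<Sum>k\<in>UNIV. det (\<chi> i. if i = k then fd (coef (W k)) x X else Z x $ i))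
    + of_real (dens x * Re (conn_trace X x)) * det (Z x)"
    by (subst fd_eqI) (auto cong: if_cong)
  have row: "coef (\<lambda>y. cov F (W j) y X) x = fd (coef (W j)) x X + (Z x ** M) $ j" for j
    by (simp add: coef_cov[OF W x] vec_eq_iff Z_def M_def matrix_matrix_mult_def)
  have "det (\<chi> i k. (if k = j then coef (\<lambda>y. cov F (W j) y X) x else coef (W k) x) $ i) =
     det (\<chi> i. if i = j then fd (coef (W j)) x X else Z x $ i) + det (\<chi> i. if i = j then (Z x ** M) $ j else Z x $ i)" for j
  proof -
    have "det (\<chi> i k. (if k = j then coef (\<lambda>y. cov F (W j) y X) x else coef (W k) x) $ i)
      = det (\<chi> k. if k = j then fd (coef (W j)) x X + (Z x ** M) $ j else Z x $ k)"
      by (subst det_transpose[symmetric], rule arg_cong[where f=det])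
         (simp add: transpose_def vec_eq_iff row, simp add: Z_def)
    then show ?thesis by (simp only: det_row_add)
  qed
  then have 2: "(\<Sum>j\<in>UNIV. of_real (dens x) * det (\<chi> i k. (if k = j then coef (\<lambda>y. cov F (W j) y X) x else coef (W k) x) $ i))
    = of_real (dens x) * (\<Sum>k\<in>UNIV. det (\<chi> i. if i = k then fd (coef (W k)) x X else Z x $ i))
     + of_real (dens x) * (conn_trace X x * det (Z x))"
    using sum_det_replace_row_mult_right[of "Z x" M]
    by (simp add: sum.distrib distrib_left sum_distrib_left[symmetric] connection_trace_def M_def)
  have "of_real (Re c) - c = - \<i> * of_real (Im c)" for c by (simp add: complex_eq_iff)
  moreover have "d * S + d * R * D - (d * S + d * (C * D)) = (R - C) * (d * D)" for d S R D C :: complex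
    by (simp add: algebra_simps)
  ultimately show ?thesis unfolding dt 1 2 of_real_mult by simp
qed

text \<open>The trace of d\<omega> plus the quadratic term: since the trace of a product of two
  matrices does not depend on their order, the quadratic term drops out and d\<theta>
  remains.\<close>

lemma trace_curv:
  assumes x: "x \<in> V"
  shows "(\<Sum>i\<in>UNIV. inv (frame_map (J (F x)) (\<lambda>i. E i x)) (curv (F x) (fd F x X) (fd F x Y) (E i x)) $ i)
    = fd (conn_trace Y) x X - fd (conn_trace X) x Y"
proof -
  have *: "(\<Sum>i\<in>UNIV. coef (\<lambda>y. cov F (\<lambda>y. cov F (E i) y Y) y X) x $ i) = fd (conn_trace Y) x X
     + (\<Sum>i\<in>UNIV. \<Sum>k\<in>UNIV. conn_coef i Y x $ k * conn_coef k X x $ i)" for X Y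
  proof -
    have "coef (\<lambda>y. cov F (E i) y Y) = conn_coef i Y" for i by (simp add: connection_coef_def[abs_def])
    then have "coef (\<lambda>y. cov F (\<lambda>y. cov F (E i) y Y) y X) x $ i = fd (conn_coef i Y) x X $ i
       + (\<Sum>k\<in>UNIV. conn_coef i Y x $ k * conn_coef k X x $ i)" for i
      by (simp add: coef_cov[OF smooth_on_cov[OF F FU E] x])
    moreover have "fd (conn_trace Y) x X = (\<Sum>i\<in>UNIV. fd (conn_coef i Y) x X $ i)"
    proof -
      have "((\<lambda>y. \<Sum>i\<in>UNIV. conn_coef i Y y $ i) has_derivative (\<lambda>X. \<Sum>i\<in>UNIV. fd (conn_coef i Y) x X $ i)) (at x)"
        by (intro has_derivative_sum bounded_linear.has_derivative[OF bounded_linear_vec_nth]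
             smooth_on_has_derivative[OF smooth_on_conn_coef x])
      then show ?thesis by (simp add: connection_trace_def[abs_def] fd_eqI)
    qed
    ultimately show ?thesis by (simp add: sum.distrib)
  qed
  interpret complex_space "J (F x)" by (rule hermitian_space_at[OF F_mem[OF x]])
  have "(\<Sum>i\<in>UNIV. inv (frame_map (J (F x)) (\<lambda>i. E i x)) (curv (F x) (fd F x X) (fd F x Y) (E i x)) $ i)
    = (\<Sum>i\<in>UNIV. coef (\<lambda>y. cov F (\<lambda>y. cov F (E i) y Y) y X) x $ i) - (\<Sum>i\<in>UNIV. coef (\<lambda>y. cov F (\<lambda>y. cov F (E i) y X) y Y) x $ i)"
    by (simp add: cov_curv[OF F FU E x, symmetric] frame_coef_def cof_simps[OF bij[OF x]] sum_subtractf)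
  also have "\<dots> = fd (conn_trace Y) x X - fd (conn_trace X) x Y"
    unfolding * by (subst sum.swap) (simp add: mult.commute)
  finally show ?thesis .
qed

end

end

section \<open>Symmetries of the curvature and the Ricci tensor\<close>

context kaehler_chart
begin

sublocale metric_chart U G
  by (rule metric_chart.intro) (use open_U herm_space hermitian_space.axioms(1) smooth_G in blast)+

lemma is_christoffel: "x \<in> U \<Longrightarrow> is_christoffel x (\<Gamma> x)"
  unfolding is_christoffel_def using bilinear_\<Gamma> \<Gamma>_sym metric by blast

lemma cov_cong:
  assumes "open S" "x \<in> S" "\<And>y. y \<in> S \<Longrightarrow> W y = W' y"
  shows "cov F W x = cov F W' x"
  using fd_cong[OF assms] assms by (simp add: cov_def fun_eq_iff)

lemma cov_curv_ident:
  assumes "smooth_on U W" "x \<in> U"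
  shows "cov (\<lambda>y. y) (\<lambda>y. cov (\<lambda>y. y) W y Y) x X - cov (\<lambda>y. y) (\<lambda>y. cov (\<lambda>y. y) W y X) x Y = curv x X Y (W x)"
  using cov_curv[OF smooth_on_id[OF open_U] _ assms, of Y X] by simp

lemma fd_\<Gamma>_linear:
  assumes x: "x \<in> U"
  shows "linear (\<lambda>v. fd (\<lambda>y. \<Gamma> y v w) x u)" "linear (\<lambda>w. fd (\<lambda>y. \<Gamma> y v w) x u)" "linear (fd (\<lambda>y. \<Gamma> y v w) x)"
  by (rule linear_fd_arg[OF open_U _ smooth_\<Gamma> x], use bilinear_\<Gamma> in \<open>auto simp: bilinear_def\<close>)+
     (rule smooth_on_linear_fd[OF smooth_\<Gamma> x])

lemma curv_linear:
  assumes x: "x \<in> U"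
  shows "linear (\<lambda>u. curv x u v w)" "linear (\<lambda>v. curv x u v w)" "linear (\<lambda>w. curv x u v w)"
proof -
  note l = linear_add[OF fd_\<Gamma>_linear(1)[OF x]] linear_add[OF fd_\<Gamma>_linear(2)[OF x]] linear_add[OF fd_\<Gamma>_linear(3)[OF x]]
    linear_cmul[OF fd_\<Gamma>_linear(1)[OF x]] linear_cmul[OF fd_\<Gamma>_linear(2)[OF x]] linear_cmul[OF fd_\<Gamma>_linear(3)[OF x]]
  show "linear (\<lambda>u. curv x u v w)" "linear (\<lambda>v. curv x u v w)" "linear (\<lambda>w. curv x u v w)"
    by (rule linearI; simp add: curv_def l \<Gamma>_simps x algebra_simps)+
qed

lemma curv_skew: "curv x u v w = - curv x v u w"
  by (simp add: curv_def)

lemma bianchi: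
  assumes x: "x \<in> U"
  shows "curv x u v w + curv x v w u + curv x w u v = 0"
proof -
  have "fd (\<lambda>y. \<Gamma> y u v) x = fd (\<lambda>y. \<Gamma> y v u) x" for u v
    by (rule fd_cong[OF open_U x]) (rule \<Gamma>_sym)
  from this[of u v] this[of v w] this[of u w] \<Gamma>_sym[OF x, of u v] \<Gamma>_sym[OF x, of v w] \<Gamma>_sym[OF x, of u w]
  show ?thesis by (simp add: curv_def)
qed

text \<open>Differentiate \<open>G y w z\<close> twice, for constant fields \<open>w\<close> and
  \<open>z\<close>, and antisymmetrise: the left-hand side vanishes, and so do the products of first
  covariant derivatives.\<close>

lemma curv_metric:
  assumes x: "x \<in> U"
  shows "G x (curv x u v w) z = - G x w (curv x u v z)"
proof -
  interpret inner_form "G x" by (rule inner_form[OF x])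
  note id = smooth_on_id[OF open_U]
  have im: "(\<lambda>y. y) ` U \<subseteq> U" by simp
  define D where "D w = cov (\<lambda>y. y) (\<lambda>_. w)" for w
  have sD: "smooth_on U (\<lambda>y. D w y Y)" for w Y
    unfolding D_def by (intro smooth_on_cov[OF id im] smooth_on_const open_U)
  have 1: "fd (\<lambda>y. G y w z) y Y = G y (D w y Y) z + G y w (D z y Y)" if "y \<in> U" for y Y
    using fd_G_field[OF id im smooth_on_const[OF open_U] smooth_on_const[OF open_U] that] by (simp add: D_def)
  have 2: "fd (\<lambda>y. fd (\<lambda>y. G y w z) y Y) x X =
     G x (cov (\<lambda>y. y) (\<lambda>y. D w y Y) x X) z + G x (D w x Y) (D z x X) + (G x (D w x X) (D z x Y) + G x w (cov (\<lambda>y. y) (\<lambda>y. D z y Y) x X))"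
    for X Y
  proof -
    have "fd (\<lambda>y. fd (\<lambda>y. G y w z) y Y) x X = fd (\<lambda>y. G y (D w y Y) z + G y w (D z y Y)) x X"
      by (rule fun_cong[OF fd_cong[OF open_U x]]) (rule 1)
    also have "\<dots> = fd (\<lambda>y. G y (D w y Y) z) x X + fd (\<lambda>y. G y w (D z y Y)) x X"
      by (intro fd_add smooth_on_differentiable[OF _ x] smooth_on_G_field[OF id im] sD smooth_on_const open_U)
    finally show ?thesis
      using fd_G_field[OF id im sD smooth_on_const[OF open_U] x] fd_G_field[OF id im smooth_on_const[OF open_U] sD x]
      by (simp add: D_def)
  qed
  have c: "cov (\<lambda>y. y) (\<lambda>y. D w y v) x u - cov (\<lambda>y. y) (\<lambda>y. D w y u) x v = curv x u v w" for w u v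
    unfolding D_def using cov_curv_ident[OF smooth_on_const[OF open_U] x] by simp
  have "fd (\<lambda>y. fd (\<lambda>y. G y w z) y v) x u = fd (\<lambda>y. fd (\<lambda>y. G y w z) y u) x v"
    by (rule fd_commute[OF smooth_G x])
  then show ?thesis unfolding 2 c[symmetric] by (simp add: G_simps)
qed

lemma curv_J:
  assumes x: "x \<in> U"
  shows "curv x u v (J x w) = J x (curv x u v w)"
proof -
  note id = smooth_on_id[OF open_U]
  have im: "(\<lambda>y. y) ` U \<subseteq> U" by simp
  define D where "D W = cov (\<lambda>y. y) W" for W
  have sD: "smooth_on U (\<lambda>y. D (\<lambda>_. w) y Y)" for w Y
    unfolding D_def by (intro smooth_on_cov[OF id im] smooth_on_const open_U)
  have "D (\<lambda>y. D (\<lambda>y. J y w) y Y) x X = J x (D (\<lambda>y. D (\<lambda>_. w) y Y) x X)" for X Y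
  proof -
    have "D (\<lambda>y. D (\<lambda>y. J y w) y Y) x = D (\<lambda>y. J y (D (\<lambda>_. w) y Y)) x"
      unfolding D_def by (rule cov_cong[OF open_U x]) (rule cov_J[OF id im smooth_on_const[OF open_U]])
    then show ?thesis using cov_J[OF id im sD x] by (simp add: D_def)
  qed
  then show ?thesis
    using cov_curv_ident[OF smooth_J x, of w v u] cov_curv_ident[OF smooth_on_const[OF open_U] x, of w v u]
    by (simp add: D_def linear_diff[OF J_linear[OF x], symmetric])
qed

lemma curv_pair_symmetry:
  assumes x: "x \<in> U"
  shows "G x (curv x u v w) z = G x (curv x w z u) v"
proof -
  interpret inner_form "G x" by (rule inner_form[OF x])
  define \<tau> where "\<tau> u v w z = G x (curv x u v w) z" for u v w z
  have s: "\<tau> u v w z = - \<tau> v u w z" "\<tau> u v w z = - \<tau> u v z w" for u v w z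
  proof -
    show "\<tau> u v w z = - \<tau> v u w z"
      unfolding \<tau>_def by (subst curv_skew) (simp add: G_simps)
    show "\<tau> u v w z = - \<tau> u v z w"
      unfolding \<tau>_def by (subst curv_metric[OF x]) (simp add: sym[of w])
  qed
  have b: "\<tau> u v w z + \<tau> v w u z + \<tau> w u v z = 0" for u v w z
    unfolding \<tau>_def using arg_cong[OF bianchi[OF x, of u v w], of "\<lambda>a. G x a z"] by (simp add: G_simps)
  \<comment> \<open>Four Bianchi identities, rewritten by the skew symmetries so that only six
    values of \<tau> occur, all with the sign plus. Then (1) + (4) - (2) - (3) is twice the
    difference of the two values in question.\<close>
  have 1: "\<tau> u v w z + \<tau> v w u z + \<tau> w u v z = 0" by (rule b)
  have 2: "\<tau> w z u v + \<tau> v w u z + \<tau> v z w u = 0"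
    using b[of v w z u] s(2)[of v w z u] s(2)[of w z v u] s(1)[of z v w u] by linarith
  have 3: "\<tau> w z u v + \<tau> u z v w + \<tau> w u v z = 0"
    using b[of w z u v] s(1)[of z u w v] s(2)[of u z w v] s(1)[of u w z v] s(2)[of w u z v] by linarith
  have 4: "\<tau> u v w z + \<tau> u z v w + \<tau> v z w u = 0"
    using b[of z u v w] s(1)[of z u v w] s(2)[of u v z w] s(2)[of v z u w] by linarith
  have "\<tau> u v w z = \<tau> w z u v" using 1 2 3 4 by linarith
  then show ?thesis by (simp add: \<tau>_def)
qed

text \<open>Pair symmetry moves the two \<open>J\<close> to the other pair of arguments, where the
  curvature endomorphism commutes with \<open>J\<close> and \<open>J\<close> is an isometry.\<close>

lemma curv_J_J:
  assumes x: "x \<in> U"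
  shows "curv x (J x u) (J x v) w = curv x u v w"
proof -
  interpret hermitian_space "G x" "J x" by (rule herm_space[OF x])
  show ?thesis
  proof (rule G_eqI)
    fix z
    have "G x (curv x (J x u) (J x v) w) z = G x (curv x w z (J x u)) (J x v)" by (rule curv_pair_symmetry[OF x])
    also have "\<dots> = G x (curv x w z u) v" by (simp add: curv_J[OF x] J_isometry)
    also have "\<dots> = G x (curv x u v w) z" by (rule curv_pair_symmetry[OF x, symmetric])
    finally show "G x (curv x (J x u) (J x v) w) z = G x (curv x u v w) z" .
  qed
qed

definition Ric :: "'e \<Rightarrow> 'e \<Rightarrow> 'e \<Rightarrow> real" where
  "Ric x v w = trace_lin (\<lambda>u. curv x u v w)"

text \<open>The adjoint of a \<mapsto> R(a, v) w is b \<mapsto> R(b, w) v, and adjoint endomorphisms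
  have the same trace.\<close>

lemma Ric_sym:
  assumes x: "x \<in> U"
  shows "Ric x v w = Ric x w v"
proof -
  interpret inner_form "G x" by (rule inner_form[OF x])
  show ?thesis unfolding Ric_def
  proof (rule trace_adjoint[OF curv_linear(1)[OF x] curv_linear(1)[OF x]])
    fix a b
    have "G x (curv x a v w) b = G x (curv x w b a) v" by (rule curv_pair_symmetry[OF x])
    also have "\<dots> = - G x a (curv x w b v)" by (rule curv_metric[OF x])
    also have "\<dots> = G x a (curv x b w v)" by (subst curv_skew) (simp add: G_simps)
    finally show "G x (curv x a v w) b = G x a (curv x b w v)" .
  qed
qed

text \<open>Conjugation by \<open>J\<close> keeps the trace of z \<mapsto> R(z, J u) v. Inside it
  R(J z, J u) = R(z, u) removes two of the \<open>J\<close>, and the remaining one, with its sign,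
  is absorbed by \<open>v\<close>.\<close>

lemma Ric_J:
  assumes x: "x \<in> U"
  shows "Ric x (J x u) v = - Ric x u (J x v)"
proof -
  interpret hermitian_space "G x" "J x" by (rule herm_space[OF x])
  have ml: "linear (\<lambda>z. - J x z)" using J_linear by (intro linear_compose_neg)
  have "Ric x (J x u) v = trace_lin (\<lambda>z. curv x z (J x u) v)" by (simp add: Ric_def)
  also have "\<dots> = trace_lin (\<lambda>z. - J x (curv x (J x z) (J x u) v))"
  proof -
    have l: "linear (\<lambda>z. - J x (curv x z (J x u) v))"
      using linear_compose[OF curv_linear(1)[OF x] ml] by (simp add: o_def)
    show ?thesis using trace_lin_commute[OF J_linear l] by (simp add: J_simps)
  qed
  also have "\<dots> = - Ric x u (J x v)"
    by (simp add: trace_lin_uminus curv_J_J[OF x] Ric_def curv_J[OF x])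
  finally show ?thesis .
qed

text \<open>This identifies the curvature of the canonical bundle with the Ricci form. By Bianchi's
  identity \<open>J\<close> composed with R(u, v) is a difference of two endomorphisms whose traces
  are Ricci curvatures.\<close>

lemma trace_J_curv:
  assumes x: "x \<in> U"
  shows "trace_lin (\<lambda>z. J x (curv x u v z)) = 2 * Ric x (J x u) v"
proof -
  interpret hermitian_space "G x" "J x" by (rule herm_space[OF x])
  have "J x (curv x u v z) = curv x z v (J x u) - curv x z u (J x v)" for z
  proof -
    have "curv x u v z = - curv x v z u - curv x z u v"
      using bianchi[OF x, of u v z] by (simp add: algebra_simps eq_neg_iff_add_eq_0)
    then show ?thesis by (simp add: J_simps curv_J[OF x] curv_skew[of x v z])
  qed
  then have "trace_lin (\<lambda>z. J x (curv x u v z)) = Ric x v (J x u) - Ric x u (J x v)"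
    by (simp add: trace_lin_diff Ric_def)
  then show ?thesis using Ric_sym[OF x, of v "J x u"] Ric_J[OF x, of u v] by simp
qed

end

section \<open>Complex frames spanned by the image of a real linear map\<close>

definition re_vec :: "complex^'n \<Rightarrow> real^'n" where "re_vec z = (\<chi> i. Re (z $ i))"
definition im_vec :: "complex^'n \<Rightarrow> real^'n" where "im_vec z = (\<chi> i. Im (z $ i))"

lemma linear_re_vec: "linear re_vec" and linear_im_vec: "linear im_vec"
  by (rule linearI; simp add: re_vec_def im_vec_def vec_eq_iff)+

lemma re_vec_nth [simp]: "re_vec z $ i = Re (z $ i)" and im_vec_nth [simp]: "im_vec z $ i = Im (z $ i)"
  by (simp_all add: re_vec_def im_vec_def)

definition complex_vec :: "real^'n \<Rightarrow> real^'n \<Rightarrow> complex^'n" where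
  "complex_vec a b = (\<chi> i. Complex (a $ i) (b $ i))"

lemma re_complex_vec [simp]: "re_vec (complex_vec a b) = a" and im_complex_vec [simp]: "im_vec (complex_vec a b) = b"
  by (simp_all add: vec_eq_iff complex_vec_def)

lemma linear_vec_expand:
  fixes L :: "real^'n \<Rightarrow> 'b::real_vector"
  assumes "linear L"
  shows "L v = (\<Sum>i\<in>UNIV. v $ i *\<^sub>R L (axis i 1))"
proof -
  have "L v = L (\<Sum>i\<in>UNIV. v $ i *\<^sub>R axis i 1)"
    using basis_expansion[of v] by (simp add: scalar_mult_eq_scaleR)
  then show ?thesis by (simp add: linear_sum[OF assms] linear_cmul[OF assms])
qed

abbreviation frame_of :: "(real^'n \<Rightarrow> 'a) \<Rightarrow> 'n \<Rightarrow> 'a::real_vector" where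
  "frame_of L \<equiv> \<lambda>i. L (axis i 1)"

lemma frame_map_linear:
  assumes "linear L" "linear J"
  shows "frame_map J (frame_of L) z = L (re_vec z) + J (L (im_vec z))"
proof -
  have "frame_map J (frame_of L) z = (\<Sum>i\<in>UNIV. re_vec z $ i *\<^sub>R L (axis i 1)) + (\<Sum>i\<in>UNIV. im_vec z $ i *\<^sub>R J (L (axis i 1)))"
    by (simp add: frame_map_def cact_def sum.distrib)
  also have "\<dots> = L (re_vec z) + J (L (im_vec z))"
    using linear_vec_expand[OF assms(1), of "re_vec z"] linear_vec_expand[OF linear_compose[OF assms], of "im_vec z"]
    by (simp add: o_def)
  finally show ?thesis .
qed

lemma inv_frame_map_eqI:
  assumes "linear L" "linear J" "bij (frame_map J (frame_of L))" "w = L a + J (L b)"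
  shows "inv (frame_map J (frame_of L)) w = complex_vec a b"
proof -
  have "frame_map J (frame_of L) (complex_vec a b) = w" by (simp add: frame_map_linear assms)
  then show ?thesis using assms(3) by (metis bij_is_inj inv_f_f)
qed

text \<open>Total reality of an immersion with differential \<open>L\<close> will be the bijectivity
  of this frame map. The lemma is its invariance under changes of chart in the source, by
  \<open>\<phi>\<close>, and in the target, by \<open>\<theta>\<close>.\<close>

lemma bij_frame_map_conjugate:
  fixes L :: "real^'n \<Rightarrow> 'a::euclidean_space" and \<theta> :: "'a \<Rightarrow> 'b::euclidean_space" and \<phi> :: "real^'n \<Rightarrow> real^'n"
  assumes "linear L" "linear J" "linear J'" "linear \<theta>" "bij \<theta>" "linear \<phi>" "bij \<phi>"
    and \<theta>: "\<And>u. \<theta> (J u) = J' (\<theta> u)" and b: "bij (frame_map J (frame_of L))"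
  shows "bij (frame_map J' (frame_of (\<lambda>v. \<theta> (L (\<phi> v)))))"
proof -
  have lin: "linear (\<lambda>v. \<theta> (L (\<phi> v)))"
    using linear_compose[OF linear_compose[OF assms(6,1)] assms(4)] by (simp add: o_def)
  define c where "c z = complex_vec (\<phi> (re_vec z)) (\<phi> (im_vec z))" for z
  have "frame_map J' (frame_of (\<lambda>v. \<theta> (L (\<phi> v)))) z = \<theta> (frame_map J (frame_of L) (c z))" for z
    by (simp add: frame_map_linear[OF lin assms(3)] frame_map_linear[OF assms(1,2)] linear_add[OF assms(4)] \<theta> c_def)
  then have eq: "frame_map J' (frame_of (\<lambda>v. \<theta> (L (\<phi> v)))) = \<theta> \<circ> frame_map J (frame_of L) \<circ> c" by auto
  have "inj c"
  proof (rule injI)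
    fix z w assume "c z = c w"
    then have "\<phi> (re_vec z) = \<phi> (re_vec w)" "\<phi> (im_vec z) = \<phi> (im_vec w)"
      unfolding c_def by (metis re_complex_vec, metis im_complex_vec)
    then have "re_vec z = re_vec w" "im_vec z = im_vec w" using assms(7) by (auto simp: bij_def inj_def)
    then show "z = w" by (simp add: vec_eq_iff complex_eq_iff)
  qed
  moreover have "surj c"
  proof (rule surjI)
    fix w
    show "c (complex_vec (inv \<phi> (re_vec w)) (inv \<phi> (im_vec w))) = w"
      using assms(7) by (simp add: c_def bij_is_surj surj_f_inv_f) (simp add: complex_vec_def vec_eq_iff)
  qed
  ultimately show ?thesis unfolding eq using assms(5) b by (intro bij_comp) (auto simp: bij_def)
qed

section \<open>Maslov form and first variation of the density in one chart\<close>

context kaehler_chart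
begin

text \<open>The full covariant derivative of dF(v), tangential part included, for \<open>v\<close>
  with constant coordinates.\<close>

definition sff :: "(real^'n \<Rightarrow> 'e) \<Rightarrow> real^'n \<Rightarrow> real^'n \<Rightarrow> real^'n \<Rightarrow> 'e" where
  "sff F x X v = cov F (\<lambda>y. fd F y v) x X"

text \<open>Imaginary frame coordinates describe the projection to J TL; the sign is that of
  \<open>J\<close> applied twice in v \<mapsto> J \<pi>_J \<nabla>_X v.\<close>

definition maslov :: "(real^'n \<Rightarrow> 'e) \<Rightarrow> real^'n \<Rightarrow> real^'n \<Rightarrow> real" where
  "maslov F x X = - trace_lin (\<lambda>v. im_vec (inv (frame_map (J (F x)) (frame_of (fd F x))) (sff F x X v)))"

lemma maslov_conn_trace:
  "maslov F x X = - Im (connection_trace F (\<lambda>i y. fd F y (axis i 1)) X x)"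
  by (simp add: maslov_def trace_lin_vec sff_def connection_trace_def connection_coef_def frame_coef_def Im_sum)

text \<open>The first summand is the divergence of \<rho> Re z, where z are the complex coordinates
  of the velocity \<open>W\<close>; the second pairs Im z with Im \<theta>, that is with the Maslov
  form.\<close>

lemma first_variation_density:
  fixes F :: "real \<times> (real^'n) \<Rightarrow> 'e"
  defines "E \<equiv> \<lambda>i p. fd F p (0, axis i 1)" and "W \<equiv> \<lambda>p. fd F p (1, 0)"
  assumes F: "smooth_on V F" and FU: "F ` V \<subseteq> U"
    and bij: "\<And>p. p \<in> V \<Longrightarrow> bij (frame_map (J (F p)) (\<lambda>i. E i p))"
    and dim: "DIM('e) = 2 * CARD('n)" and p: "p \<in> V"
  shows "fd (J_density F E) p (1, 0) =
    (\<Sum>j\<in>UNIV. fd (\<lambda>p. J_density F E p * Re (frame_coef F E W p $ j)) p (0, axis j 1))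
    - J_density F E p * (\<Sum>j\<in>UNIV. Im (frame_coef F E W p $ j) * Im (connection_trace F E (0, axis j 1) p))"
proof -
  have E: "smooth_on V (E i)" for i unfolding E_def by (rule smooth_on_fd[OF F])
  have W: "smooth_on V W" unfolding W_def by (rule smooth_on_fd[OF F])
  note ctx = F FU E bij dim
  define z where "z = frame_coef F E W"
  define \<rho> where "\<rho> = J_density F E"
  have sz: "smooth_on V z" unfolding z_def by (rule smooth_on_coef[OF ctx W])
  have s\<rho>: "smooth_on V \<rho>" unfolding \<rho>_def by (rule smooth_on_density[OF ctx])
  \<comment> \<open>Torsion-freeness is used twice: \<nabla>_t E_i = \<nabla>_i W gives the
    derivatives of z, and \<nabla>_i E_j = \<nabla>_j E_i turns the remaining sum into \<theta>
    along the directions of L.\<close>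
  have "connection_trace F E (1, 0) p = (\<Sum>i\<in>UNIV. fd z p (0, axis i 1) $ i) + (\<Sum>j\<in>UNIV. z p $ j * connection_trace F E (0, axis j 1) p)"
  proof -
    have "connection_coef F E i (1, 0) p = fd z p (0, axis i 1) + (\<Sum>j\<in>UNIV. (z p $ j) *s connection_coef F E j (0, axis i 1) p)" for i
    proof -
      have "cov F (E i) p (1, 0) = cov F W p (0, axis i 1)"
        unfolding E_def W_def by (rule cov_torsion_free[OF F FU p])
      then have "connection_coef F E i (1, 0) p = frame_coef F E (\<lambda>y. cov F W y (0, axis i 1)) p"
        by (simp add: connection_coef_def frame_coef_def)
      then show ?thesis using coef_cov[OF ctx W p] by (simp add: z_def)
    qed
    moreover have "connection_coef F E j (0, axis i 1) p $ i = connection_coef F E i (0, axis j 1) p $ i" for i j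
    proof -
      have "cov F (E j) p (0, axis i 1) = cov F (E i) p (0, axis j 1)"
        unfolding E_def by (rule cov_torsion_free[OF F FU p])
      then show ?thesis by (simp add: connection_coef_def frame_coef_def)
    qed
    ultimately have "connection_trace F E (1, 0) p = (\<Sum>i\<in>UNIV. fd z p (0, axis i 1) $ i)
        + (\<Sum>i\<in>UNIV. \<Sum>j\<in>UNIV. z p $ j * connection_coef F E i (0, axis j 1) p $ i)"
      by (simp add: connection_trace_def sum.distrib)
    then show ?thesis by (subst (asm) sum.swap) (simp add: connection_trace_def sum_distrib_left)
  qed
  then have "fd \<rho> p (1, 0) = \<rho> p * (\<Sum>i\<in>UNIV. Re (fd z p (0, axis i 1) $ i))
     + \<rho> p * (\<Sum>j\<in>UNIV. Re (z p $ j) * Re (connection_trace F E (0, axis j 1) p) - Im (z p $ j) * Im (connection_trace F E (0, axis j 1) p))"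
    using fd_density[OF ctx p] by (simp add: \<rho>_def Re_sum distrib_left)
  moreover have "fd (\<lambda>p. \<rho> p * Re (z p $ j)) p (0, axis j 1) =
      \<rho> p * Re (fd z p (0, axis j 1) $ j) + \<rho> p * Re (connection_trace F E (0, axis j 1) p) * Re (z p $ j)" for j
  proof -
    have zj: "smooth_on V (\<lambda>p. Re (z p $ j))"
      by (intro smooth_on_linear_compose[OF bounded_linear_Re] smooth_on_vec_nth[OF ctx sz])
    have "fd (\<lambda>p. \<rho> p * Re (z p $ j)) p (0, axis j 1) =
       \<rho> p * fd (\<lambda>p. Re (z p $ j)) p (0, axis j 1) + fd \<rho> p (0, axis j 1) * Re (z p $ j)"
      using fd_eqI[OF has_derivative_mult[OF smooth_on_has_derivative[OF s\<rho> p] smooth_on_has_derivative[OF zj p]]] by simp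
    also have "fd (\<lambda>p. Re (z p $ j)) p (0, axis j 1) = Re (fd z p (0, axis j 1) $ j)"
      using fd_bounded_linear[OF bounded_linear_Re smooth_on_differentiable[OF smooth_on_vec_nth[OF ctx sz] p]]
        fd_vec_nth[OF ctx sz p] by simp
    finally show ?thesis using fd_density[OF ctx p] by (simp add: \<rho>_def)
  qed
  ultimately have "fd \<rho> p (1, 0) = (\<Sum>j\<in>UNIV. fd (\<lambda>p. \<rho> p * Re (z p $ j)) p (0, axis j 1))
    - \<rho> p * (\<Sum>j\<in>UNIV. Im (z p $ j) * Im (connection_trace F E (0, axis j 1) p))"
    by (simp add: sum.distrib sum_subtractf sum_distrib_left algebra_simps)
  then show ?thesis by (simp add: \<rho>_def z_def)
qed

end

section \<open>Invariance under changes of chart\<close>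

text \<open>A transition map \<open>\<theta>\<close> between two charts of the same Kaehler
  manifold, seen as a local isometry that intertwines the complex structures; \<open>S\<close> is
  the overlap in the first chart.\<close>

locale chart_transition =
  K: kaehler_chart U G J \<Gamma> + K': kaehler_chart U' G' J' \<Gamma>'
  for U :: "'e::euclidean_space set" and G J \<Gamma> and U' :: "'e set" and G' J' \<Gamma>' +
  fixes S :: "'e set" and \<theta> :: "'e \<Rightarrow> 'e"
  assumes \<theta>: "smooth_on S \<theta>" and SU: "S \<subseteq> U" and \<theta>U: "\<theta> ` S \<subseteq> U'"
    and bij_\<theta>: "x \<in> S \<Longrightarrow> bij (fd \<theta> x)"
    and G_\<theta>: "x \<in> S \<Longrightarrow> G x u v = G' (\<theta> x) (fd \<theta> x u) (fd \<theta> x v)"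
    and J_\<theta>: "x \<in> S \<Longrightarrow> fd \<theta> x (J x u) = J' (\<theta> x) (fd \<theta> x u)"
begin

lemma \<theta>_in: "x \<in> S \<Longrightarrow> \<theta> x \<in> U'" using \<theta>U by auto

text \<open>Pull the covariant derivative of d\<theta>(v) in the second chart back by d\<theta>. The
  result is symmetric and compatible with \<open>G\<close>, hence the Christoffel map of the first
  chart by uniqueness.\<close>

lemma christoffel_transition:
  assumes x: "x \<in> S"
  shows "fd \<theta> x (\<Gamma> x u v) = fd (\<lambda>y. fd \<theta> y v) x u + \<Gamma>' (\<theta> x) (fd \<theta> x u) (fd \<theta> x v)"
proof -
  have xU: "x \<in> U" using x SU by auto
  have oS: "open S" by (rule smooth_on_open[OF \<theta>])
  define c where "c u v = K'.cov \<theta> (\<lambda>y. fd \<theta> y v) x u" for u v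
  define \<Gamma>t where "\<Gamma>t u v = inv (fd \<theta> x) (c u v)" for u v
  have l: "linear (fd \<theta> x)" by (rule smooth_on_linear_fd[OF \<theta> x])
  have t: "fd \<theta> x (\<Gamma>t u v) = c u v" for u v
    unfolding \<Gamma>t_def using bij_\<theta>[OF x] by (simp add: bij_is_surj surj_f_inv_f)
  have c_sym: "c u v = c v u" for u v
    unfolding c_def by (rule K'.cov_torsion_free[OF \<theta> \<theta>U x])
  have li: "linear (inv (fd \<theta> x))" by (rule linear_bij_inv[OF l bij_\<theta>[OF x]])
  have cl: "linear (\<lambda>u. c u v)" for v
    unfolding c_def by (rule K'.linear_cov[OF \<theta> \<theta>U smooth_on_fd[OF \<theta>] x])
  have cl2: "linear (c u)" for u
  proof -
    have "c u = (\<lambda>v. c v u)" using c_sym by auto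
    then show ?thesis using cl[of u] by simp
  qed
  have "K.is_christoffel x \<Gamma>t"
    unfolding K.is_christoffel_def
  proof (intro conjI allI)
    show "bilinear \<Gamma>t"
      unfolding bilinear_def \<Gamma>t_def using linear_compose[OF cl li] linear_compose[OF cl2 li] by (simp add: o_def)
    show "\<Gamma>t u v = \<Gamma>t v u" for u v by (simp add: \<Gamma>t_def c_sym[of u v])
    fix u v w
    have "fd (\<lambda>y. G y u v) x = fd (\<lambda>y. G' (\<theta> y) (fd \<theta> y u) (fd \<theta> y v)) x"
      by (rule fd_cong[OF oS x]) (rule G_\<theta>)
    then have "fd (\<lambda>y. G y u v) x w = G' (\<theta> x) (c w u) (fd \<theta> x v) + G' (\<theta> x) (fd \<theta> x u) (c w v)"
      using K'.fd_G_field[OF \<theta> \<theta>U smooth_on_fd[OF \<theta>] smooth_on_fd[OF \<theta>] x] by (simp add: c_def)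
    then show "fd (\<lambda>y. G y u v) x w = G x (\<Gamma>t w u) v + G x u (\<Gamma>t w v)"
      by (simp add: G_\<theta>[OF x] t)
  qed
  then have "\<Gamma> x = \<Gamma>t" using K.is_christoffel_unique[OF xU K.is_christoffel[OF xU]] by blast
  then show ?thesis using t by (simp add: c_def K'.cov_def)
qed

context
  fixes F :: "real^'n \<Rightarrow> 'e" and V :: "(real^'n) set" and \<phi> :: "real^'n \<Rightarrow> real^'n" and V' :: "(real^'n) set"
  assumes F: "smooth_on V F" "F ` V \<subseteq> S" and \<phi>: "smooth_on V' \<phi>" "\<phi> ` V' \<subseteq> V"
begin

lemma fd_transition:
  assumes y: "y \<in> V'"
  shows "fd (\<lambda>y. \<theta> (F (\<phi> y))) y v = fd \<theta> (F (\<phi> y)) (fd F (\<phi> y) (fd \<phi> y v))"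
proof -
  have sF: "smooth_on V' (\<lambda>y. F (\<phi> y))" by (rule smooth_on_compose[OF F(1) \<phi>])
  have in1: "\<phi> y \<in> V" "F (\<phi> y) \<in> S" using y F(2) \<phi>(2) by auto
  show ?thesis
    by (simp add: fd_compose(1)[OF \<theta> sF in1(2) y] fd_compose(1)[OF F(1) \<phi>(1) in1(1) y])
qed

text \<open>\<open>sff\<close> is tensorial in the target; in the source it picks up the second
  derivative of \<open>\<phi>\<close>, because constant coordinates are not constant in another
  chart. That extra term is tangent to L.\<close>

lemma sff_transition:
  assumes y: "y \<in> V'"
  shows "K'.sff (\<lambda>y. \<theta> (F (\<phi> y))) y X v =
    fd \<theta> (F (\<phi> y)) (K.sff F (\<phi> y) (fd \<phi> y X) (fd \<phi> y v) + fd F (\<phi> y) (fd (\<lambda>y. fd \<phi> y v) y X))"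
proof -
  have oV: "open V'" by (rule smooth_on_open[OF \<phi>(1)])
  have in1: "\<phi> y \<in> V" "F (\<phi> y) \<in> S" using y F(2) \<phi>(2) by auto
  have sF: "smooth_on V' (\<lambda>y. F (\<phi> y))" by (rule smooth_on_compose[OF F(1) \<phi>])
  have sFS: "(\<lambda>y. F (\<phi> y)) ` V' \<subseteq> S" using F(2) \<phi>(2) by auto
  have lF: "linear (fd F z)" if "z \<in> V" for z by (rule smooth_on_linear_fd[OF F(1) that])
  have l\<theta>: "linear (fd \<theta> z)" if "z \<in> S" for z by (rule smooth_on_linear_fd[OF \<theta> that])
  define w where "w y = fd F (\<phi> y) (fd \<phi> y v)" for y
  have sw: "smooth_on V' w"
    unfolding w_def[abs_def] by (rule smooth_on_linear_field[OF lF smooth_on_fd[OF F(1)] \<phi> smooth_on_fd[OF \<phi>(1)]])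
  have fw: "fd w y X = fd (\<lambda>z. fd F z (fd \<phi> y v)) (\<phi> y) (fd \<phi> y X) + fd F (\<phi> y) (fd (\<lambda>y. fd \<phi> y v) y X)"
    unfolding w_def[abs_def] by (rule fd_linear_field[OF lF smooth_on_fd[OF F(1)] \<phi> smooth_on_fd[OF \<phi>(1)] y])
  have "fd (\<lambda>y. fd (\<lambda>y. \<theta> (F (\<phi> y))) y v) y = fd (\<lambda>y. fd \<theta> (F (\<phi> y)) (w y)) y"
    by (rule fd_cong[OF oV y]) (simp add: fd_transition w_def)
  then have 1: "fd (\<lambda>y. fd (\<lambda>y. \<theta> (F (\<phi> y))) y v) y X =
     fd (\<lambda>z. fd \<theta> z (w y)) (F (\<phi> y)) (fd (\<lambda>y. F (\<phi> y)) y X) + fd \<theta> (F (\<phi> y)) (fd w y X)"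
    using fd_linear_field[OF l\<theta> smooth_on_fd[OF \<theta>] sF sFS sw y] by simp
  have 2: "fd (\<lambda>y. F (\<phi> y)) y X = fd F (\<phi> y) (fd \<phi> y X)"
    by (rule fd_compose(1)[OF F(1) \<phi>(1) in1(1) y])
  show ?thesis
    unfolding K'.sff_def K'.cov_def 1 2 fd_transition[OF y] K.sff_def K.cov_def
    using christoffel_transition[OF in1(2), of "fd F (\<phi> y) (fd \<phi> y X)" "w y"]
    by (simp add: linear_add[OF l\<theta>[OF in1(2)]] fw w_def algebra_simps)
qed

lemma bij_frame_transition:
  assumes y: "y \<in> V'" and b\<phi>: "bij (fd \<phi> y)"
    and b: "bij (frame_map (J (F (\<phi> y))) (frame_of (fd F (\<phi> y))))"
  shows "bij (frame_map (J' (\<theta> (F (\<phi> y)))) (frame_of (fd (\<lambda>y. \<theta> (F (\<phi> y))) y)))"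
proof -
  have in1: "\<phi> y \<in> V" "F (\<phi> y) \<in> S" "F (\<phi> y) \<in> U" "\<theta> (F (\<phi> y)) \<in> U'"
    using y F(2) \<phi>(2) SU \<theta>_in[of "F (\<phi> y)"] by auto
  have "bij (frame_map (J' (\<theta> (F (\<phi> y)))) (frame_of (\<lambda>v. fd \<theta> (F (\<phi> y)) (fd F (\<phi> y) (fd \<phi> y v)))))"
    by (rule bij_frame_map_conjugate[OF smooth_on_linear_fd[OF F(1) in1(1)] K.J_linear[OF in1(3)] K'.J_linear[OF in1(4)]
      smooth_on_linear_fd[OF \<theta> in1(2)] bij_\<theta>[OF in1(2)] smooth_on_linear_fd[OF \<phi>(1) y] b\<phi> J_\<theta>[OF in1(2)] b])
  then show ?thesis by (simp add: fd_transition[OF y])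
qed

text \<open>The extra term of \<open>sff_transition\<close> is tangential and has no imaginary
  coordinates. What remains is conjugated by the derivative of \<open>\<phi>\<close>, which leaves
  the trace alone.\<close>

lemma maslov_transition:
  assumes y: "y \<in> V'" and b\<phi>: "bij (fd \<phi> y)"
    and b: "bij (frame_map (J (F (\<phi> y))) (frame_of (fd F (\<phi> y))))"
  shows "K'.maslov (\<lambda>y. \<theta> (F (\<phi> y))) y X = K.maslov F (\<phi> y) (fd \<phi> y X)"
proof -
  have in1: "\<phi> y \<in> V" "F (\<phi> y) \<in> S" "F (\<phi> y) \<in> U" "\<theta> (F (\<phi> y)) \<in> U'"
    using y F(2) \<phi>(2) SU \<theta>_in[of "F (\<phi> y)"] by auto
  define L where "L = fd F (\<phi> y)"
  define P where "P = fd \<phi> y"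
  define T where "T = fd \<theta> (F (\<phi> y))"
  define A where "A = frame_map (J (F (\<phi> y))) (frame_of L)"
  define s where "s v = K.sff F (\<phi> y) (P X) v" for v
  have lL: "linear L" unfolding L_def by (rule smooth_on_linear_fd[OF F(1) in1(1)])
  have lP: "linear P" unfolding P_def by (rule smooth_on_linear_fd[OF \<phi>(1) y])
  have lT: "linear T" unfolding T_def by (rule smooth_on_linear_fd[OF \<theta> in1(2)])
  have JT: "T (J (F (\<phi> y)) u) = J' (\<theta> (F (\<phi> y))) (T u)" for u
    by (simp add: T_def J_\<theta>[OF in1(2)])
  have PP: "P (inv P v) = v" for v using b\<phi> by (simp add: P_def bij_is_surj surj_f_inv_f)
  note JL = K.J_linear[OF in1(3)] and JL' = K'.J_linear[OF in1(4)]
  have bA: "bij A" using b by (simp add: A_def L_def)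
  have lin': "linear (\<lambda>v. T (L (P v)))"
    using linear_compose[OF linear_compose[OF lP lL] lT] by (simp add: o_def)
  have fdL: "fd (\<lambda>y. \<theta> (F (\<phi> y))) y = (\<lambda>v. T (L (P v)))"
    by (rule ext) (simp add: fd_transition[OF y] L_def P_def T_def)
  have ls: "linear s"
  proof -
    have "s = (\<lambda>v. K.cov F (\<lambda>y. fd F y (P X)) (\<phi> y) v)"
      unfolding s_def K.sff_def using K.cov_torsion_free[OF F(1) _ in1(1)] F(2) SU by fastforce
    then show ?thesis using K.linear_cov[OF F(1) _ smooth_on_fd[OF F(1)] in1(1)] F(2) SU by auto
  qed
  define M where "M v = im_vec (inv A (s v))" for v
  have lM: "linear M"
    using linear_compose[OF linear_compose[OF ls linear_bij_inv[OF linear_frame_map bA[unfolded A_def]]] linear_im_vec]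
    by (simp add: M_def[abs_def] A_def o_def)
  have "im_vec (inv (frame_map (J' (\<theta> (F (\<phi> y)))) (frame_of (fd (\<lambda>y. \<theta> (F (\<phi> y))) y))) (K'.sff (\<lambda>y. \<theta> (F (\<phi> y))) y X v))
     = inv P (M (P v))" for v
  proof -
    have "frame_map (J (F (\<phi> y))) (frame_of L) (inv A (s (P v))) = s (P v)"
      using bA by (simp add: A_def bij_is_surj surj_f_inv_f)
    then have e: "s (P v) = L (re_vec (inv A (s (P v)))) + J (F (\<phi> y)) (L (M (P v)))"
      by (simp add: frame_map_linear[OF lL JL] M_def)
    have "K'.sff (\<lambda>y. \<theta> (F (\<phi> y))) y X v = T (s (P v) + L (fd (\<lambda>y. fd \<phi> y v) y X))"
      by (simp add: sff_transition[OF y] s_def T_def P_def L_def)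
    \<comment> \<open>\<open>inv P\<close> is inserted to reach the shape required by
      \<open>inv_frame_map_eqI\<close> for the new differential, T after L after P. The second
      derivative of \<open>\<phi>\<close> goes into the real coordinates.\<close>
    also have "\<dots> = T (L (P (inv P (re_vec (inv A (s (P v))) + fd (\<lambda>y. fd \<phi> y v) y X)))) + J' (\<theta> (F (\<phi> y))) (T (L (P (inv P (M (P v))))))"
      by (subst e) (simp add: PP linear_add[OF lT] linear_add[OF lL] JT)
    finally have "inv (frame_map (J' (\<theta> (F (\<phi> y)))) (frame_of (\<lambda>v. T (L (P v))))) (K'.sff (\<lambda>y. \<theta> (F (\<phi> y))) y X v)
       = complex_vec (inv P (re_vec (inv A (s (P v))) + fd (\<lambda>y. fd \<phi> y v) y X)) (inv P (M (P v)))"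
      by (rule inv_frame_map_eqI[OF lin' JL' bij_frame_transition[OF y b\<phi> b, unfolded fdL]])
    then show ?thesis unfolding fdL by simp
  qed
  then have "K'.maslov (\<lambda>y. \<theta> (F (\<phi> y))) y X = - trace_lin (\<lambda>v. inv P (M (P v)))"
    by (simp add: K'.maslov_def)
  also have "trace_lin (\<lambda>v. inv P (M (P v))) = trace_lin M"
    by (rule trace_lin_conjugate[OF lP b\<phi>[folded P_def] lM])
  finally show ?thesis by (simp add: K.maslov_def M_def[abs_def] A_def L_def s_def P_def)
qed

end

end

section \<open>Manifolds\<close>

lemma is_chart_simps:
  assumes "is_chart c"
  shows open_cdom: "open (cdom c)" and open_cimg: "open (cimg c)"
    and cinv_coord: "p \<in> cdom c \<Longrightarrow> cinv c (coord c p) = p"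
    and coord_cinv: "x \<in> cimg c \<Longrightarrow> coord c (cinv c x) = x"
    and coord_in: "p \<in> cdom c \<Longrightarrow> coord c p \<in> cimg c"
    and cinv_in: "x \<in> cimg c \<Longrightarrow> cinv c x \<in> cdom c"
    and continuous_coord: "continuous_on (cdom c) (coord c)"
    and continuous_cinv: "continuous_on (cimg c) (cinv c)"
proof -
  have h: "homeomorphism (cdom c) (cimg c) (coord c) (cinv c)" using assms by (simp add: is_chart_def)
  show "open (cdom c)" "open (cimg c)" using assms by (auto simp: is_chart_def)
  show "p \<in> cdom c \<Longrightarrow> cinv c (coord c p) = p" "x \<in> cimg c \<Longrightarrow> coord c (cinv c x) = x"
    "p \<in> cdom c \<Longrightarrow> coord c p \<in> cimg c" "x \<in> cimg c \<Longrightarrow> cinv c x \<in> cdom c"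
    "continuous_on (cdom c) (coord c)" "continuous_on (cimg c) (cinv c)"
    using h by (auto simp: homeomorphism_def)
qed

locale atlas =
  fixes A :: "('m::{t2_space, second_countable_topology}, 'e::euclidean_space) chart set"
  assumes smooth_atlas: "smooth_atlas A"
begin

lemma is_chart: "c \<in> A \<Longrightarrow> is_chart c" using smooth_atlas by (simp add: smooth_atlas_def)

lemmas chart_simps = cinv_coord[OF is_chart] coord_cinv[OF is_chart] coord_in[OF is_chart] cinv_in[OF is_chart]
lemmas chart_open = open_cdom[OF is_chart] open_cimg[OF is_chart]

lemma chart_at: "chart_at A p \<in> A" "p \<in> cdom (chart_at A p)"
proof -
  have "p \<in> (\<Union>c\<in>A. cdom c)" using smooth_atlas unfolding smooth_atlas_def by blast
  then have "\<exists>c. c \<in> A \<and> p \<in> cdom c" by blast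
  from someI_ex[OF this] show "chart_at A p \<in> A" "p \<in> cdom (chart_at A p)" by (auto simp: chart_at_def)
qed

lemma coord_image_mem:
  assumes "c \<in> A" "P \<subseteq> cdom c"
  shows "x \<in> coord c ` P \<longleftrightarrow> x \<in> cimg c \<and> cinv c x \<in> P"
proof
  assume "x \<in> coord c ` P"
  then obtain p where "p \<in> P" "x = coord c p" by blast
  moreover from this have "p \<in> cdom c" using assms(2) by blast
  ultimately show "x \<in> cimg c \<and> cinv c x \<in> P" by (simp add: chart_simps[OF assms(1)])
next
  assume "x \<in> cimg c \<and> cinv c x \<in> P"
  then show "x \<in> coord c ` P" using chart_simps(2)[OF assms(1), of x] by (metis image_eqI)
qed

lemma open_coord_image:
  assumes "c \<in> A" "open P" shows "open (coord c ` (cdom c \<inter> P))"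
proof -
  have "coord c ` (cdom c \<inter> P) = cimg c \<inter> cinv c -` P"
    using coord_image_mem[OF assms(1), of "cdom c \<inter> P"] chart_simps(4)[OF assms(1)] by auto
  then show ?thesis
    using continuous_open_preimage[OF continuous_cinv[OF is_chart[OF assms(1)]] chart_open(2)[OF assms(1)] assms(2)] by simp
qed

lemma smooth_transition: "c \<in> A \<Longrightarrow> d \<in> A \<Longrightarrow> smooth_on (coord c ` (cdom c \<inter> cdom d)) (coord d \<circ> cinv c)"
  using smooth_atlas by (simp add: smooth_atlas_def)

lemma linear_transition: "c \<in> A \<Longrightarrow> d \<in> A \<Longrightarrow> p \<in> cdom c \<Longrightarrow> p \<in> cdom d \<Longrightarrow> linear (transition c d p)"
  unfolding transition_def by (rule smooth_on_linear_fd[OF smooth_transition]) auto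

lemma transition_transition:
  assumes "c \<in> A" "d \<in> A" "e \<in> A" "p \<in> cdom c" "p \<in> cdom d" "p \<in> cdom e"
  shows "transition d e p (transition c d p v) = transition c e p v"
proof -
  define S where "S = coord c ` (cdom c \<inter> (cdom d \<inter> cdom e))"
  have S: "open S" "coord c p \<in> S" unfolding S_def using assms
    by (auto intro!: open_coord_image open_Int chart_open)
  have "fd (coord e \<circ> cinv c) (coord c p) v = fd (\<lambda>x. (coord e \<circ> cinv d) ((coord d \<circ> cinv c) x)) (coord c p) v"
    by (rule fun_cong[OF fd_cong[OF S]]) (use assms in \<open>auto simp: S_def chart_simps\<close>)
  also have "\<dots> = fd (coord e \<circ> cinv d) ((coord d \<circ> cinv c) (coord c p)) (fd (coord d \<circ> cinv c) (coord c p) v)"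
    by (rule fd_compose(1)[OF smooth_transition smooth_transition]) (use assms in \<open>auto simp: chart_simps\<close>)
  finally show ?thesis using assms by (simp add: transition_def chart_simps)
qed

lemma transition_same:
  assumes "c \<in> A" "p \<in> cdom c"
  shows "transition c c p v = v"
proof -
  have "fd (coord c \<circ> cinv c) (coord c p) v = fd (\<lambda>x. x) (coord c p) v"
    by (rule fun_cong[OF fd_cong[OF chart_open(2)[OF assms(1)] chart_simps(3)[OF assms]]]) (use assms in \<open>auto simp: chart_simps\<close>)
  then show ?thesis by (simp add: transition_def frechet_derivative_ident)
qed

lemma transition_inverse:
  assumes "c \<in> A" "d \<in> A" "p \<in> cdom c" "p \<in> cdom d"
  shows "transition d c p (transition c d p v) = v"
  using assms by (simp add: transition_transition transition_same)

lemma bij_transition: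
  assumes "c \<in> A" "d \<in> A" "p \<in> cdom c" "p \<in> cdom d"
  shows "bij (transition c d p)"
  by (rule bij_betwI[where g="transition d c p"]) (use assms in \<open>auto simp: transition_inverse\<close>)

lemma to_from_chart:
  assumes "c \<in> A" "p \<in> cdom c"
  shows to_chart_from_chart: "to_chart A c p (from_chart A c p v) = v"
    and from_chart_to_chart: "from_chart A c p (to_chart A c p v) = v"
    and linear_to_chart: "linear (to_chart A c p)" and linear_from_chart: "linear (from_chart A c p)"
    and bij_to_chart: "bij (to_chart A c p)" and bij_from_chart: "bij (from_chart A c p)"
  using assms chart_at[of p]
  by (simp_all add: to_chart_def from_chart_def transition_inverse linear_transition bij_transition)

lemma to_chart_chart_at [simp]: "to_chart A (chart_at A p) p v = v"
  using chart_at[of p] by (simp add: to_chart_def transition_same)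

lemma from_chart_chart_at [simp]: "from_chart A (chart_at A p) p v = v"
  using chart_at[of p] by (simp add: from_chart_def transition_same)

lemma transition_to_chart:
  assumes "c \<in> A" "d \<in> A" "p \<in> cdom c" "p \<in> cdom d"
  shows "transition c d p (to_chart A c p v) = to_chart A d p v"
  using assms chart_at[of p] by (simp add: to_chart_def transition_transition)

lemma from_chart_transition:
  assumes "c \<in> A" "d \<in> A" "p \<in> cdom c" "p \<in> cdom d"
  shows "from_chart A d p (transition c d p v) = from_chart A c p v"
  using assms chart_at[of p] by (simp add: from_chart_def transition_transition)

end

locale atlas_pair = A: atlas A + B: atlas B
  for A :: "('m::{t2_space, second_countable_topology}, 'e::euclidean_space) chart set"
    and B :: "('l::{t2_space, second_countable_topology}, 'a::euclidean_space) chart set"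
begin

abbreviation rep :: "('l \<Rightarrow> 'm) \<Rightarrow> ('l, 'a) chart \<Rightarrow> ('m, 'e) chart \<Rightarrow> 'a \<Rightarrow> 'e" where
  "rep f c d \<equiv> coord d \<circ> f \<circ> cinv c"

abbreviation rep_dom :: "('l \<Rightarrow> 'm) \<Rightarrow> ('l, 'a) chart \<Rightarrow> ('m, 'e) chart \<Rightarrow> 'a set" where
  "rep_dom f c d \<equiv> coord c ` (cdom c \<inter> f -` cdom d)"

lemma rep_dom_mem: "c \<in> B \<Longrightarrow> x \<in> rep_dom f c d \<longleftrightarrow> x \<in> cimg c \<and> f (cinv c x) \<in> cdom d"
  using B.coord_image_mem[of c "cdom c \<inter> f -` cdom d" x] B.chart_simps(4)[of c x] by auto

context
  fixes f assumes f: "smooth_map B A f"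
begin

lemma smooth_rep: "c \<in> B \<Longrightarrow> d \<in> A \<Longrightarrow> smooth_on (rep_dom f c d) (rep f c d)"
  using f by (simp add: smooth_map_def)

lemma rep_image: "c \<in> B \<Longrightarrow> d \<in> A \<Longrightarrow> rep f c d ` rep_dom f c d \<subseteq> cimg d"
  by (auto simp: B.chart_simps A.chart_simps)

lemma open_rep_dom: "c \<in> B \<Longrightarrow> d \<in> A \<Longrightarrow> open (rep_dom f c d)"
  using smooth_on_open[OF smooth_rep] .

lemma fd_rep_transition:
  assumes "c \<in> B" "c' \<in> B" "d \<in> A" "d' \<in> A" "p \<in> cdom c" "p \<in> cdom c'" "f p \<in> cdom d" "f p \<in> cdom d'"
  shows "fd (rep f c' d') (coord c' p) (transition c c' p v) = transition d d' (f p) (fd (rep f c d) (coord c p) v)"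
proof -
  define S where "S = coord c ` (cdom c \<inter> (cdom c' \<inter> f -` (cdom d \<inter> cdom d')))"
  have cont: "open (f -` P)" if "open P" for P
    using f that by (simp add: smooth_map_def continuous_on_open_vimage)
  have S: "open S" "coord c p \<in> S" unfolding S_def using assms
    by (auto intro!: B.open_coord_image open_Int B.chart_open A.chart_open cont)
  have "fd (\<lambda>x. rep f c' d' ((coord c' \<circ> cinv c) x)) (coord c p) v = fd (\<lambda>x. (coord d' \<circ> cinv d) (rep f c d x)) (coord c p) v"
    by (rule fun_cong[OF fd_cong[OF S]]) (use assms in \<open>auto simp: S_def B.chart_simps A.chart_simps\<close>)
  moreover have "fd (\<lambda>x. rep f c' d' ((coord c' \<circ> cinv c) x)) (coord c p) v =
     fd (rep f c' d') ((coord c' \<circ> cinv c) (coord c p)) (fd (coord c' \<circ> cinv c) (coord c p) v)"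
    by (rule fd_compose(1)[OF smooth_rep B.smooth_transition]) (use assms in \<open>auto simp: B.chart_simps\<close>)
  moreover have "fd (\<lambda>x. (coord d' \<circ> cinv d) (rep f c d x)) (coord c p) v =
     fd (coord d' \<circ> cinv d) (rep f c d (coord c p)) (fd (rep f c d) (coord c p) v)"
    by (rule fd_compose(1)[OF A.smooth_transition smooth_rep]) (use assms in \<open>auto simp: B.chart_simps\<close>)
  ultimately show ?thesis using assms by (simp add: transition_def B.chart_simps)
qed

lemma to_chart_tangent_map:
  assumes "c \<in> B" "d \<in> A" "p \<in> cdom c" "f p \<in> cdom d"
  shows "to_chart A d (f p) (tangent_map B A f p v) = fd (rep f c d) (coord c p) (to_chart B c p v)"
proof -
  note ca = B.chart_at[of p] A.chart_at[of "f p"]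
  show ?thesis
    using fd_rep_transition[OF ca(1) assms(1) ca(3) assms(2) ca(2) assms(3) ca(4) assms(4), of v]
    by (simp add: to_chart_def tangent_map_def)
qed

lemma linear_tangent_map: "linear (tangent_map B A f p)"
  unfolding tangent_map_def
  by (rule smooth_on_linear_fd[OF smooth_rep]) (use B.chart_at[of p] A.chart_at[of "f p"] in auto)

end

end

section \<open>The Kaehler structure in the charts of an atlas\<close>

locale kaehler_atlas =
  fixes A :: "('m::{t2_space, second_countable_topology}, 'e::euclidean_space) chart set"
    and g :: "'m \<Rightarrow> 'e \<Rightarrow> 'e \<Rightarrow> real" and J :: "'m \<Rightarrow> 'e \<Rightarrow> 'e"
  assumes kaehler: "kaehler_manifold A g J"
begin

sublocale atlas A
  using kaehler by unfold_locales (simp add: kaehler_manifold_def)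

lemma hermitian_space: "hermitian_space (g p) (J p)"
  using kaehler
  by (intro hermitian_space.intro inner_form.intro complex_space.intro hermitian_space_axioms.intro)
     (auto simp: kaehler_manifold_def riemannian_metric_def almost_complex_structure_def)

lemma metric_in_coord: "c \<in> A \<Longrightarrow> p \<in> cdom c \<Longrightarrow>
    metric_in A g c (coord c p) u v = g p (from_chart A c p u) (from_chart A c p v)"
  by (simp add: metric_in_def chart_simps)

lemma metric_in_to_chart: "c \<in> A \<Longrightarrow> p \<in> cdom c \<Longrightarrow>
    metric_in A g c (coord c p) (to_chart A c p u) (to_chart A c p v) = g p u v"
  by (simp add: metric_in_coord to_from_chart)

lemma acs_in_to_chart: "c \<in> A \<Longrightarrow> p \<in> cdom c \<Longrightarrow>
    acs_in A J c (coord c p) (to_chart A c p v) = to_chart A c p (J p v)"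
  by (simp add: acs_in_def chart_simps to_from_chart)

lemma hermitian_space_in:
  assumes c: "c \<in> A" and x: "x \<in> cimg c"
  shows "hermitian_space (metric_in A g c x) (acs_in A J c x)"
proof -
  define p where "p = cinv c x"
  have p: "p \<in> cdom c" using c x by (simp add: p_def chart_simps)
  interpret h: hermitian_space "g p" "J p" by (rule hermitian_space)
  note F = linear_add[OF linear_from_chart[OF c p]] linear_cmul[OF linear_from_chart[OF c p]]
    linear_neg[OF linear_from_chart[OF c p]] linear_neg[OF linear_to_chart[OF c p]]
  note T = linear_add[OF linear_to_chart[OF c p]] linear_cmul[OF linear_to_chart[OF c p]]
  have nz: "from_chart A c p v \<noteq> 0" if "v \<noteq> 0" for v
    using to_chart_from_chart[OF c p, of v] that linear_0[OF linear_to_chart[OF c p]] by metis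
  show ?thesis
  proof (intro hermitian_space.intro inner_form.intro complex_space.intro hermitian_space_axioms.intro)
    show "bilinear (metric_in A g c x)"
      unfolding bilinear_def metric_in_def p_def[symmetric]
      by (intro conjI allI linearI) (simp_all add: F h.G_simps)
    show "metric_in A g c x u v = metric_in A g c x v u" for u v
      by (simp add: metric_in_def h.sym p_def[symmetric])
    show "0 < metric_in A g c x v v" if "v \<noteq> 0" for v
      using h.pos[OF nz[OF that]] by (simp add: metric_in_def p_def)
    show "linear (acs_in A J c x)"
      unfolding acs_in_def p_def[symmetric] by (rule linearI) (simp_all add: F T h.J_simps)
    show "acs_in A J c x (acs_in A J c x v) = - v" for v
      unfolding acs_in_def p_def[symmetric] by (simp add: to_from_chart[OF c p] h.J_J F)
    show "metric_in A g c x (acs_in A J c x u) (acs_in A J c x v) = metric_in A g c x u v" for u v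
      unfolding acs_in_def metric_in_def p_def[symmetric] by (simp add: to_from_chart[OF c p] h.J_isometry)
  qed
qed

text \<open>Koszul's formula and uniqueness from \<open>metric_chart\<close> evaluate the definite
  description \<open>christoffel\<close>; afterwards it is used only through the locale.\<close>

lemma kaehler_chart:
  assumes c: "c \<in> A"
  shows "kaehler_chart (cimg c) (metric_in A g c) (acs_in A J c) (christoffel A g c)"
proof -
  have sm: "smooth_on (cimg c) (\<lambda>x. metric_in A g c x u v)" "smooth_on (cimg c) (\<lambda>x. acs_in A J c x v)" for u v
    using kaehler c by (auto simp: kaehler_manifold_def riemannian_metric_def almost_complex_structure_def)
  interpret m: metric_chart "cimg c" "metric_in A g c"
    by (rule metric_chart.intro) (use chart_open[OF c] sm hermitian_space_in[OF c] hermitian_space.axioms(1) in blast)+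
  have eq: "christoffel A g c x = m.christoffel_solution x" if "x \<in> cimg c" for x
    using m.the_christoffel[OF that] unfolding christoffel_def m.is_christoffel_def .
  have ch: "m.is_christoffel x (christoffel A g c x)" if "x \<in> cimg c" for x
    using m.is_christoffel_solution[OF that] eq[OF that] by simp
  show ?thesis
  proof (rule kaehler_chart.intro)
    show "smooth_on (cimg c) (\<lambda>x. christoffel A g c x u v)" for u v
      by (rule smooth_on_cong[OF m.smooth_christoffel_solution]) (simp add: eq)
    show "fd (\<lambda>y. acs_in A J c y v) x u + christoffel A g c x u (acs_in A J c x v) = acs_in A J c x (christoffel A g c x u v)"
      if "x \<in> cimg c" for x u v
      using kaehler c that by (auto simp: kaehler_manifold_def)
  qed (use chart_open[OF c] sm hermitian_space_in[OF c] ch in \<open>auto simp: m.is_christoffel_def\<close>)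
qed

lemma chart_transition:
  assumes c: "c \<in> A" and d: "d \<in> A"
  shows "chart_transition (cimg c) (metric_in A g c) (acs_in A J c) (christoffel A g c)
    (cimg d) (metric_in A g d) (acs_in A J d) (christoffel A g d) (coord c ` (cdom c \<inter> cdom d)) (coord d \<circ> cinv c)"
proof -
  interpret K: kaehler_chart "cimg c" "metric_in A g c" "acs_in A J c" "christoffel A g c" by (rule kaehler_chart[OF c])
  interpret K': kaehler_chart "cimg d" "metric_in A g d" "acs_in A J d" "christoffel A g d" by (rule kaehler_chart[OF d])
  show ?thesis
  proof (intro chart_transition.intro chart_transition_axioms.intro K.kaehler_chart_axioms K'.kaehler_chart_axioms)
    fix x assume "x \<in> coord c ` (cdom c \<inter> cdom d)"
    then obtain p where p: "p \<in> cdom c" "p \<in> cdom d" "x = coord c p" by auto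
    have t: "fd (coord d \<circ> cinv c) x = transition c d p" by (simp add: transition_def p)
    show "bij (fd (coord d \<circ> cinv c) x)" unfolding t by (rule bij_transition[OF c d p(1,2)])
    show "metric_in A g c x u v = metric_in A g d ((coord d \<circ> cinv c) x) (fd (coord d \<circ> cinv c) x u) (fd (coord d \<circ> cinv c) x v)" for u v
      unfolding t by (simp add: p chart_simps metric_in_coord c d from_chart_transition)
    show "fd (coord d \<circ> cinv c) x (acs_in A J c x u) = acs_in A J d ((coord d \<circ> cinv c) x) (fd (coord d \<circ> cinv c) x u)" for u
      unfolding t by (simp add: p chart_simps acs_in_def c d from_chart_transition transition_to_chart)
  qed (use c d smooth_transition in \<open>auto simp: chart_simps\<close>)
qed

end

section \<open>Totally real immersions\<close>

lemma frame_map_intertwine: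
  assumes "linear T" "\<And>u. T (J u) = J' (T u)"
  shows "frame_map J' (\<lambda>i. T (E i)) z = T (frame_map J E z)"
  by (simp add: frame_map_def cact_def linear_sum[OF assms(1)] linear_add[OF assms(1)] linear_cmul[OF assms(1)] assms(2))

text \<open>Frame coordinates do not change when a complex linear map is applied to both the frame
  and the vector; this compares the tangent spaces with their charts.\<close>

lemma inv_frame_map_intertwine:
  assumes "linear T" "\<And>u. T (J u) = J' (T u)" "bij (frame_map J E)" "bij (frame_map J' (\<lambda>i. T (E i)))"
  shows "inv (frame_map J' (\<lambda>i. T (E i))) (T w) = inv (frame_map J E) w"
proof -
  have "frame_map J' (\<lambda>i. T (E i)) (inv (frame_map J E) w) = T w"
    using assms(3) by (simp add: frame_map_intertwine[of T J J', OF assms(1,2)] bij_is_surj surj_f_inv_f)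
  then show ?thesis using assms(4) by (metis bij_is_inj inv_f_f)
qed

text \<open>The frame map sends z to L(Re z) + J L(Im z). Injectivity of \<open>L\<close> and of
  this sum amounts to a trivial intersection of the two subspaces, surjectivity to their spanning
  everything.\<close>

lemma totally_real_iff_bij:
  fixes L :: "real^'n \<Rightarrow> 'e::euclidean_space"
  assumes L: "linear L" and J: "complex_space J"
  shows "inj L \<and> {a + b | a b. a \<in> range L \<and> b \<in> J ` range L} = UNIV \<and> range L \<inter> J ` range L = {0}
    \<longleftrightarrow> bij (frame_map J (frame_of L))"
proof -
  interpret complex_space J by (rule J)
  note fm = frame_map_linear[OF L J_linear]
  have L0: "L 0 = 0" by (rule linear_0[OF L])
  show ?thesis
  proof
    assume *: "inj L \<and> {a + b | a b. a \<in> range L \<and> b \<in> J ` range L} = UNIV \<and> range L \<inter> J ` range L = {0}"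
    have "z = 0" if z: "frame_map J (frame_of L) z = 0" for z
    proof -
      have 1: "L (re_vec z) = J (L (- im_vec z))"
        using z by (simp add: fm linear_neg[OF L] J_simps eq_neg_iff_add_eq_0)
      then have "L (re_vec z) \<in> range L \<inter> J ` range L" by blast
      then have 2: "L (re_vec z) = 0" using * by blast
      then have "J (J (L (- im_vec z))) = 0" using 1 J_simps(5) by simp
      then have "L (im_vec z) = 0" by (simp add: J_J linear_neg[OF L])
      then have "re_vec z = 0" "im_vec z = 0" using 2 * linear_injective_0[OF L] by blast+
      then show "z = 0" by (simp add: vec_eq_iff complex_eq_iff)
    qed
    then have "inj (frame_map J (frame_of L))" using linear_injective_0[OF linear_frame_map] by blast
    moreover have "w \<in> range (frame_map J (frame_of L))" for w
    proof -
      have "w \<in> {a + b | a b. a \<in> range L \<and> b \<in> J ` range L}" using * by blast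
      then obtain a b where "w = L a + J (L b)" by blast
      then have "w = frame_map J (frame_of L) (complex_vec a b)" by (simp add: fm)
      then show ?thesis by blast
    qed
    ultimately show "bij (frame_map J (frame_of L))" by (auto simp: bij_def)
  next
    assume b: "bij (frame_map J (frame_of L))"
    have eq: "complex_vec a b = complex_vec c d" if "L a + J (L b) = L c + J (L d)" for a b c d
    proof -
      have "frame_map J (frame_of L) (complex_vec a b) = frame_map J (frame_of L) (complex_vec c d)"
        using that by (simp add: fm)
      then show ?thesis using b by (auto simp: bij_def inj_def)
    qed
    have "inj L"
    proof (rule injI)
      fix a b assume "L a = L b"
      then have "complex_vec a 0 = complex_vec b 0" by (intro eq) simp
      then show "a = b" by (metis re_complex_vec)
    qed
    moreover have "w \<in> {a + b | a b. a \<in> range L \<and> b \<in> J ` range L}" for w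
    proof -
      obtain z where "w = frame_map J (frame_of L) z" using b by (metis bij_pointE)
      then have "w = L (re_vec z) + J (L (im_vec z))" by (simp add: fm)
      then show ?thesis by blast
    qed
    moreover have "w = 0" if "w \<in> range L \<inter> J ` range L" for w
    proof -
      from that obtain a where a: "w = L a" by (elim IntE rangeE)
      from that obtain b where b: "w = J (L b)" by (elim IntE imageE) simp
      from a b have "complex_vec a 0 = complex_vec 0 b" by (intro eq) (simp add: L0 J_simps(5))
      then have "a = 0" by (metis re_complex_vec)
      then show ?thesis using \<open>w = L a\<close> L0 by simp
    qed
    moreover have "0 \<in> range L \<inter> J ` range L" using L0 J_simps(5) by (metis Int_iff image_eqI rangeI)
    ultimately show "inj L \<and> {a + b | a b. a \<in> range L \<and> b \<in> J ` range L} = UNIV \<and> range L \<inter> J ` range L = {0}"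
      by blast
  qed
qed

lemma det_of_real: "det (\<chi> i j. of_real (N $ i $ j)) = (of_real (det N) :: complex)" for N :: "real^'n^'n"
  by (simp add: det_def)

lemma frame_map_real_change:
  fixes N :: "real^'n^'n"
  assumes "linear J"
  shows "frame_map J (\<lambda>i. \<Sum>j\<in>UNIV. N $ i $ j *\<^sub>R E j) z = frame_map J E (\<chi> j. \<Sum>i\<in>UNIV. of_real (N $ i $ j) * z $ i)"
proof -
  have "cact J c (\<Sum>j\<in>UNIV. N $ i $ j *\<^sub>R E j) = (\<Sum>j\<in>UNIV. cact J (of_real (N $ i $ j) * c) (E j))" for c i
    by (simp add: linear_sum[OF linear_cact[OF assms]] linear_cmul[OF linear_cact[OF assms]])
       (simp add: cact_def scaleR_add_right)
  then show ?thesis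
    unfolding frame_map_def by (simp add: cact_sum_left) (rule sum.swap)
qed

section \<open>The canonical section and the J-volume form\<close>

locale jgeometry = kaehler_atlas A g J + B: atlas B
  for A :: "('m::{t2_space, second_countable_topology}, 'e::euclidean_space) chart set"
    and g :: "'m \<Rightarrow> 'e \<Rightarrow> 'e \<Rightarrow> real" and J :: "'m \<Rightarrow> 'e \<Rightarrow> 'e"
    and B :: "('l::{t2_space, second_countable_topology}, real^'n::finite) chart set" +
  assumes oriented: "oriented_atlas B" and dim: "DIM('e) = 2 * CARD('n)"
begin

sublocale atlas_pair A B by unfold_locales

abbreviation "tm f p \<equiv> tangent_map B A f p"
abbreviation "frm f c d \<equiv> \<lambda>(i::'n) y. fd (rep f c d) y (axis i 1)"
abbreviation "maslov_in d \<equiv> kaehler_chart.maslov (acs_in A J d) (christoffel A g d)"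
abbreviation "dens_in d \<equiv> kaehler_chart.J_density (metric_in A g d) (acs_in A J d)"
abbreviation "coef_in d \<equiv> kaehler_chart.frame_coef (acs_in A J d)"
abbreviation "conn_in d \<equiv> kaehler_chart.connection_trace (acs_in A J d) (christoffel A g d)"

lemma complex_space: "complex_space (J p)"
  using hermitian_space hermitian_space.axioms(2) by blast

lemma acs_rep:
  assumes "c \<in> B" "d \<in> A" "p \<in> cdom c" "f p \<in> cdom d"
  shows "to_chart A d (f p) (J (f p) u) = acs_in A J d (rep f c d (coord c p)) (to_chart A d (f p) u)"
  using acs_in_to_chart[of d "f p"] assms by (simp add: B.chart_simps)

lemma bij_frame_iff:
  assumes f: "smooth_map B A f" and cd: "c \<in> B" "d \<in> A" "p \<in> cdom c" "f p \<in> cdom d"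
  shows "bij (frame_map (J (f p)) (frame_of (tm f p))) \<longleftrightarrow>
    bij (frame_map (acs_in A J d (rep f c d (coord c p))) (frame_of (fd (rep f c d) (coord c p))))"
proof -
  define x where "x = coord c p"
  have x: "x \<in> rep_dom f c d" using cd by (auto simp: x_def)
  have xd: "rep f c d x \<in> cimg d" using rep_image[OF f cd(1,2)] x by blast
  have l: "linear (acs_in A J d (rep f c d x))"
    using hermitian_space_in[OF cd(2) xd] by (simp add: hermitian_space_def complex_space_def)
  have lJ: "linear (J (f p))" using complex_space complex_space.J_linear by blast
  have lf: "linear (fd (rep f c d) x)" by (rule smooth_on_linear_fd[OF smooth_rep[OF f cd(1,2)] x])
  show ?thesis
  proof
    assume "bij (frame_map (J (f p)) (frame_of (tm f p)))"
    then have "bij (frame_map (acs_in A J d (rep f c d x)) (frame_of (\<lambda>v. to_chart A d (f p) (tm f p (from_chart B c p v)))))"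
      by (intro bij_frame_map_conjugate[OF linear_tangent_map[OF f] lJ l] acs_rep[of c d p f, OF cd, folded x_def])
         (auto simp: to_from_chart cd B.to_from_chart)
    then show "bij (frame_map (acs_in A J d (rep f c d (coord c p))) (frame_of (fd (rep f c d) (coord c p))))"
      by (simp add: to_chart_tangent_map[OF f cd] B.to_from_chart cd x_def)
  next
    assume "bij (frame_map (acs_in A J d (rep f c d (coord c p))) (frame_of (fd (rep f c d) (coord c p))))"
    then have "bij (frame_map (J (f p)) (frame_of (\<lambda>v. from_chart A d (f p) (fd (rep f c d) x (to_chart B c p v)))))"
    proof (intro bij_frame_map_conjugate[OF lf l lJ])
      show "from_chart A d (f p) (acs_in A J d (rep f c d x) u) = J (f p) (from_chart A d (f p) u)" for u
        using acs_rep[of c d p f "from_chart A d (f p) u", OF cd] cd by (simp add: to_from_chart x_def)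
          (metis from_chart_to_chart)
    qed (auto simp: to_from_chart cd B.to_from_chart x_def)
    then show "bij (frame_map (J (f p)) (frame_of (tm f p)))"
      by (simp add: to_chart_tangent_map[OF f cd, symmetric] to_from_chart cd x_def)
  qed
qed

lemma totally_real_immersion_iff:
  "totally_real_immersion A J B f \<longleftrightarrow> smooth_map B A f \<and> (\<forall>p. bij (frame_map (J (f p)) (frame_of (tm f p))))"
  unfolding totally_real_immersion_def
  using totally_real_iff_bij[OF linear_tangent_map complex_space] by blast

context
  fixes f assumes f: "totally_real_immersion A J B f"
begin

lemma sf: "smooth_map B A f" using f by (simp add: totally_real_immersion_def)

lemma bij_frame: "bij (frame_map (J (f p)) (frame_of (tm f p)))"
  using f totally_real_immersion_iff by blast

lemma bij_frame_in:
  assumes "c \<in> B" "d \<in> A" "x \<in> rep_dom f c d"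
  shows "bij (frame_map (acs_in A J d (rep f c d x)) (\<lambda>i. fd (rep f c d) x (axis i 1)))"
proof -
  obtain p where "p \<in> cdom c" "f p \<in> cdom d" "x = coord c p" using assms(3) by blast
  then show ?thesis using bij_frame_iff[OF sf assms(1,2), of p] bij_frame[of p] by simp
qed

definition gram_at :: "'l \<Rightarrow> ('n \<Rightarrow> real^'n) \<Rightarrow> complex^'n^'n" where
  "gram_at p v = (\<chi> i j. herm (g (f p)) (J (f p)) (tm f p (v i)) (tm f p (v j)))"

text \<open>\<open>coframe_wedge\<close> with the definite description of \<open>coframe\<close>
  replaced by the inverse of the frame map.\<close>

definition wedge_at :: "'l \<Rightarrow> ('n \<Rightarrow> real^'n) \<Rightarrow> ('n \<Rightarrow> 'e) \<Rightarrow> complex" where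
  "wedge_at p v w = det (\<chi> i j. inv (frame_map (J (f p)) (\<lambda>i. tm f p (v i))) (w j) $ i)"

lemma bij_basis_frame:
  assumes "det (\<chi> i j. v i $ j) \<noteq> 0"
  shows "bij (frame_map (J (f p)) (\<lambda>i. tm f p (v i)))"
proof -
  define P where "P a = transpose (\<chi> i j. v i $ j) *v a" for a
  have inv: "invertible (transpose (\<chi> i j. v i $ j))" using assms by (simp add: invertible_det_nz)
  have "linear P" unfolding P_def[abs_def] by (rule matrix_vector_mul_linear)
  moreover have "bij P"
    unfolding P_def[abs_def] using inv invertible_eq_bij by blast
  moreover have "P (axis i 1) = v i" for i
    by (simp add: P_def matrix_vector_mul_component vec_eq_iff matrix_vector_mult_basis column_def transpose_def)
  ultimately show ?thesis
    using bij_frame_map_conjugate[OF linear_tangent_map[OF sf] complex_space.J_linear[OF complex_space]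
      complex_space.J_linear[OF complex_space] linear_id bij_id, of P] bij_frame by simp
qed

lemma unitary_basis_iff: "unitary_basis g J q e \<longleftrightarrow> (\<forall>i j. herm (g q) (J q) (e i) (e j) = (if i = j then 1 else 0))"
  by (simp add: unitary_basis_def hermitian_form_def kform_def herm_def)

lemma coframe_eq:
  assumes "bij (frame_map (J (f p)) (\<lambda>i. tm f p (v i)))"
  shows "coframe A J B f p v w = inv (frame_map (J (f p)) (\<lambda>i. tm f p (v i))) w"
  unfolding coframe_def cact_def[symmetric] frame_map_def[symmetric]
  using assms by (intro the_equality) (auto simp: bij_is_surj surj_f_inv_f bij_is_inj)

lemma coframe_wedge_eq:
  assumes "det (\<chi> i j. v i $ j) \<noteq> 0"
  shows "coframe_wedge A J B f p v w = wedge_at p v w"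
  by (simp add: coframe_wedge_def wedge_at_def coframe_eq[OF bij_basis_frame[OF assms]])

text \<open>All unitary bases give the same modulus and at least one exists, so the description in
  \<open>canonical_norm\<close> has exactly one solution.\<close>

lemma canonical_norm_eq:
  assumes "det (\<chi> i j. v i $ j) \<noteq> 0"
  shows "canonical_norm g J (f p) (coframe_wedge A J B f p v) = 1 / sqrt (Re (det (gram_at p v)))"
proof -
  interpret h: hermitian_space "g (f p)" "J (f p)" by (rule hermitian_space)
  note bij = bij_basis_frame[OF assms, of p]
  have *: "cmod (coframe_wedge A J B f p v e) = 1 / sqrt (Re (det (gram_at p v)))" if "unitary_basis g J (f p) e" for e
  proof -
    have "cmod (coframe_wedge A J B f p v e) = cmod (det (\<chi> i j. inv (frame_map (J (f p)) (\<lambda>i. tm f p (v i))) (e i) $ j))"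
      unfolding coframe_wedge_eq[OF assms] wedge_at_def
      by (subst det_transpose[symmetric]) (simp add: transpose_def)
    also have "\<dots> = 1 / sqrt (Re (det (gram_at p v)))"
      using h.norm_det_cof_unitary[OF bij dim, of e] that by (simp add: unitary_basis_iff gram_at_def)
    finally show ?thesis .
  qed
  obtain e0 :: "'n \<Rightarrow> 'e" where "unitary_basis g J (f p) e0"
    using h.exists_unitary[of "UNIV :: 'n set"] dim by (auto simp: unitary_basis_iff)
  then show ?thesis unfolding canonical_norm_def using * by (intro the_equality) auto
qed

text \<open>Passing from \<open>v\<close> to \<open>v'\<close> by a matrix N multiplies the Gram
  determinant by the square of det N and divides the wedge product by det N. Both bases are
  positive, so det N > 0 and it comes out of the square root without a modulus.\<close>

lemma normalized_wedge_unique: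
  assumes v: "positive_basis v" and v': "positive_basis v'"
  shows "of_real (sqrt (Re (det (gram_at p v')))) * wedge_at p v' w = of_real (sqrt (Re (det (gram_at p v)))) * wedge_at p v w"
proof -
  interpret h: hermitian_space "g (f p)" "J (f p)" by (rule hermitian_space)
  define V where "V = (\<chi> i j. v i $ j)"
  define V' where "V' = (\<chi> i j. v' i $ j)"
  have d: "det V > 0" "det V' > 0" using v v' by (simp_all add: positive_basis_def V_def V'_def)
  have "invertible V" using d by (simp add: invertible_det_nz)
  then obtain V1 where V1: "V1 ** V = mat 1" by (auto simp: invertible_def)
  define N where "N = V' ** V1"
  have NV: "N ** V = V'" by (simp add: N_def matrix_mul_assoc[symmetric] V1)
  have "det N * det V = det V'" using arg_cong[OF NV, of det] by (simp add: det_mul)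
  then have dN: "det N > 0" using d by (metis zero_less_mult_pos2)
  have v'_eq: "v' i = (\<Sum>j\<in>UNIV. N $ i $ j *\<^sub>R v j)" for i
    using NV by (simp add: vec_eq_iff matrix_matrix_mult_def V_def V'_def)
  have lt: "linear (tm f p)" by (rule linear_tangent_map[OF sf])
  have E': "tm f p (v' i) = (\<Sum>j\<in>UNIV. N $ i $ j *\<^sub>R tm f p (v j))" for i
    by (simp add: v'_eq linear_sum[OF lt] linear_cmul[OF lt])
  have b: "bij (frame_map (J (f p)) (\<lambda>i. tm f p (v i)))" "bij (frame_map (J (f p)) (\<lambda>i. tm f p (v' i)))"
    using d by (auto intro!: bij_basis_frame simp: V_def V'_def)
  define NC where "NC = (\<chi> i j. complex_of_real (N $ i $ j))"
  have dNC: "det NC = of_real (det N)" unfolding NC_def by (rule det_of_real)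
  have "inv (frame_map (J (f p)) (\<lambda>i. tm f p (v i))) u = (\<chi> j. \<Sum>i\<in>UNIV. of_real (N $ i $ j) * inv (frame_map (J (f p)) (\<lambda>i. tm f p (v' i))) u $ i)" for u
    by (rule h.cof_eqI[OF b(1)])
       (simp only: frame_map_real_change[OF h.J_linear, symmetric] E'[symmetric] h.frame_map_cof[OF b(2)])
  then have "(\<chi> i j. inv (frame_map (J (f p)) (\<lambda>i. tm f p (v i))) (w j) $ i)
     = transpose NC ** (\<chi> i j. inv (frame_map (J (f p)) (\<lambda>i. tm f p (v' i))) (w j) $ i)"
    by (simp add: vec_eq_iff matrix_matrix_mult_def transpose_def NC_def)
  then have wd: "wedge_at p v w = of_real (det N) * wedge_at p v' w"
    by (simp add: wedge_at_def det_mul dNC)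
  have "gram_at p v' = NC ** gram_at p v ** transpose NC"
  proof -
    have s: "herm (g (f p)) (J (f p)) (r *\<^sub>R a) b = of_real r * herm (g (f p)) (J (f p)) a b"
      "herm (g (f p)) (J (f p)) a (r *\<^sub>R b) = of_real r * herm (g (f p)) (J (f p)) a b" for r a b
      using h.herm_cact_left[of "of_real r" a b] h.herm_cact_right[of a "of_real r" b] by simp_all
    have "gram_at p v' $ i $ j = (\<Sum>l\<in>UNIV. \<Sum>k\<in>UNIV. NC $ i $ k * gram_at p v $ k $ l * NC $ j $ l)" for i j
      by (simp add: gram_at_def E' h.herm_sum_left h.herm_sum_right s NC_def sum_distrib_left mult_ac)
    then show ?thesis by (simp add: vec_eq_iff matrix_matrix_mult_def transpose_def sum_distrib_right)
  qed
  then have "det (gram_at p v') = of_real ((det N)\<^sup>2) * det (gram_at p v)"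
    by (simp add: det_mul dNC power2_eq_square)
  then have "sqrt (Re (det (gram_at p v'))) = det N * sqrt (Re (det (gram_at p v)))"
    using dN by (simp add: real_sqrt_mult)
  then show ?thesis by (simp add: wd)
qed

lemma positive_basis_axis: "positive_basis (\<lambda>i::'n. axis i 1)"
proof -
  have "(\<chi> (i::'n) j. axis i (1::real) $ j) = mat 1" by (auto simp: vec_eq_iff mat_def axis_def)
  then show ?thesis by (simp add: positive_basis_def)
qed

lemma Omega_J_eq:
  assumes v: "positive_basis v"
  shows "Omega_J A g J B f p w = of_real (sqrt (Re (det (gram_at p v)))) * wedge_at p v w"
proof -
  have "coframe_wedge A J B f p u w / of_real (canonical_norm g J (f p) (coframe_wedge A J B f p u))
     = of_real (sqrt (Re (det (gram_at p v)))) * wedge_at p v w" if "positive_basis u" for u w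
  proof -
    have "det (\<chi> i j. u i $ j) \<noteq> 0" using that by (simp add: positive_basis_def)
    then show ?thesis
      using normalized_wedge_unique[OF v that, of p w] by (simp add: canonical_norm_eq coframe_wedge_eq mult.commute)
  qed
  then have "Omega_J A g J B f p = (\<lambda>w. of_real (sqrt (Re (det (gram_at p v)))) * wedge_at p v w)"
    unfolding Omega_J_def using v by (intro the_equality) (auto simp: fun_eq_iff)
  then show ?thesis by simp
qed

lemma positive_chart_basis:
  assumes "c \<in> B" "p \<in> cdom c"
  shows "positive_basis (\<lambda>i. from_chart B c p (axis i 1))"
proof -
  have "det (matrix (transition c (chart_at B p) p)) > 0"
    using oriented assms B.chart_at[of p] by (auto simp: oriented_atlas_def)
  moreover have "(\<chi> i j. from_chart B c p (axis i 1) $ j) = transpose (matrix (transition c (chart_at B p) p))"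
    by (simp add: from_chart_def matrix_def transpose_def vec_eq_iff)
  ultimately show ?thesis by (simp add: positive_basis_def)
qed

context
  fixes c d p assumes cd: "c \<in> B" "d \<in> A" "p \<in> cdom c" "f p \<in> cdom d"
begin

lemma frm_eq: "frm f c d i (coord c p) = to_chart A d (f p) (tm f p (from_chart B c p (axis i 1)))"
  by (simp add: to_chart_tangent_map[OF sf cd] B.to_from_chart cd)

lemma coef_in_eq: "coef_in d (rep f c d) (frm f c d) (\<lambda>_. to_chart A d (f p) w) (coord c p)
   = inv (frame_map (J (f p)) (\<lambda>i. tm f p (from_chart B c p (axis i 1)))) w"
proof -
  interpret K: kaehler_chart "cimg d" "metric_in A g d" "acs_in A J d" "christoffel A g d" by (rule kaehler_chart[OF cd(2)])
  have x: "coord c p \<in> rep_dom f c d" using cd by auto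
  have det: "det (\<chi> i j. from_chart B c p (axis i 1) $ j) \<noteq> 0"
    using positive_chart_basis[OF cd(1,3)] by (simp add: positive_basis_def)
  show ?thesis
    unfolding K.frame_coef_def using bij_frame_in[OF cd(1,2) x] unfolding frm_eq
    by (intro inv_frame_map_intertwine[OF linear_to_chart[OF cd(2,4)] acs_rep[of c d p f, OF cd] bij_basis_frame[OF det]])
qed

lemma dens_in_eq: "dens_in d (rep f c d) (frm f c d) (coord c p)
   = sqrt (Re (det (gram_at p (\<lambda>i. from_chart B c p (axis i 1)))))"
proof -
  interpret K: kaehler_chart "cimg d" "metric_in A g d" "acs_in A J d" "christoffel A g d" by (rule kaehler_chart[OF cd(2)])
  have r: "rep f c d (coord c p) = coord d (f p)" using cd by (simp add: B.chart_simps)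
  have "herm (metric_in A g d (rep f c d (coord c p))) (acs_in A J d (rep f c d (coord c p)))
    (frm f c d i (coord c p)) (frm f c d j (coord c p)) = herm (g (f p)) (J (f p)) (tm f p (from_chart B c p (axis i 1)))
     (tm f p (from_chart B c p (axis j 1)))" for i j
    unfolding frm_eq herm_def r using cd(2,4) by (simp add: metric_in_to_chart acs_in_to_chart)
  then show ?thesis by (simp add: K.J_density_def K.gram_matrix_def gram_at_def)
qed

lemma Omega_J_in_chart:
  "Omega_J A g J B f p w = of_real (dens_in d (rep f c d) (frm f c d) (coord c p)) *
     det (\<chi> i j. coef_in d (rep f c d) (frm f c d) (\<lambda>_. to_chart A d (f p) (w j)) (coord c p) $ i)"
  unfolding Omega_J_eq[OF positive_chart_basis[OF cd(1,3)]] dens_in_eq wedge_at_def coef_in_eq ..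

lemma vol_J_in_chart:
  "vol_J A g J B f p (\<lambda>i. from_chart B c p (axis i 1)) = of_real (dens_in d (rep f c d) (frm f c d) (coord c p))"
proof -
  let ?E = "\<lambda>i. tm f p (from_chart B c p (axis i 1))"
  have det: "det (\<chi> i j. from_chart B c p (axis i 1) $ j) \<noteq> 0"
    using positive_chart_basis[OF cd(1,3)] by (simp add: positive_basis_def)
  have "inv (frame_map (J (f p)) ?E) (?E j) = axis j 1" for j
    using complex_space.cof_frame[OF complex_space bij_basis_frame[OF det]] .
  then have "wedge_at p (\<lambda>i. from_chart B c p (axis i 1)) ?E = det (\<chi> (i::'n) j. axis j (1::complex) $ i)"
    by (simp add: wedge_at_def)
  also have "(\<chi> (i::'n) j. axis j (1::complex) $ i) = mat 1" by (auto simp: vec_eq_iff mat_def axis_def)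
  finally show ?thesis
    unfolding vol_J_def Omega_J_eq[OF positive_chart_basis[OF cd(1,3)]] dens_in_eq by simp
qed

end

text \<open>This is the determinant law required by \<open>real_form\<close>. The frame coordinates
  are real linear, so the real matrix \<open>N\<close> appears as a factor of the coordinate
  matrix.\<close>

lemma vol_J_change:
  "vol_J A g J B f p (\<lambda>i. \<Sum>j\<in>UNIV. N $ i $ j *\<^sub>R v j) = of_real (det N) * vol_J A g J B f p v"
proof -
  interpret h: hermitian_space "g (f p)" "J (f p)" by (rule hermitian_space)
  define u where "u = (\<lambda>i::'n. axis i (1::real))"
  have b: "bij (frame_map (J (f p)) (\<lambda>i. tm f p (u i)))"
    using positive_basis_axis by (intro bij_basis_frame) (auto simp: positive_basis_def u_def)
  note lc = h.linear_cof[OF b]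
  have lt: "linear (tm f p)" by (rule linear_tangent_map[OF sf])
  have "(\<chi> i j. inv (frame_map (J (f p)) (\<lambda>i. tm f p (u i))) (tm f p (\<Sum>k\<in>UNIV. N $ j $ k *\<^sub>R v k)) $ i)
    = (\<chi> i j. inv (frame_map (J (f p)) (\<lambda>i. tm f p (u i))) (tm f p (v j)) $ i) ** transpose (\<chi> i j. complex_of_real (N $ i $ j))"
    by (simp add: vec_eq_iff linear_sum[OF lt] linear_cmul[OF lt] linear_sum[OF lc] linear_cmul[OF lc]
        matrix_matrix_mult_def transpose_def) (simp add: scaleR_conv_of_real mult.commute)
  then have "wedge_at p u (\<lambda>j. tm f p (\<Sum>k\<in>UNIV. N $ j $ k *\<^sub>R v k)) = of_real (det N) * wedge_at p u (\<lambda>j. tm f p (v j))"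
    by (simp add: wedge_at_def det_mul det_of_real)
  then show ?thesis using positive_basis_axis by (simp add: vol_J_def Omega_J_eq[of u] u_def)
qed

end

end

section \<open>The Maslov form of an immersion and the meaning of its vanishing\<close>

context kaehler_chart
begin

lemma sff_cong:
  assumes "open S" "x \<in> S" "\<And>y. y \<in> S \<Longrightarrow> F y = F' y"
  shows "sff F x X v = sff F' x X v"
proof -
  have e: "fd F y = fd F' y" if "y \<in> S" for y by (rule fd_cong[OF assms(1) that assms(3)])
  have "fd (\<lambda>y. fd F y v) x = fd (\<lambda>y. fd F' y v) x"
    by (rule fd_cong[OF assms(1,2)]) (simp add: e)
  then show ?thesis using e[OF assms(2)] assms by (simp add: sff_def cov_def)
qed

lemma maslov_cong:
  assumes "open S" "x \<in> S" "\<And>y. y \<in> S \<Longrightarrow> F y = F' y"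
  shows "maslov F x X = maslov F' x X"
  using fd_cong[OF assms] sff_cong[OF assms] assms(2,3) by (simp add: maslov_def)

end

context jgeometry
begin

context
  fixes f assumes f: "totally_real_immersion A J B f"
begin

lemmas sfm = sf[OF f]

context
  fixes p c d
  assumes cd: "c = chart_at B p" "d = chart_at A (f p)"
begin

lemma at_charts: "c \<in> B" "d \<in> A" "p \<in> cdom c" "f p \<in> cdom d" "coord c p \<in> rep_dom f c d"
  using B.chart_at[of p] chart_at[of "f p"] cd by auto

lemma rep_at: "rep f c d (coord c p) = coord d (f p)"
  using at_charts by (simp add: B.chart_simps)

text \<open>In the chosen charts at \<open>p\<close> a tangent vector equals its components, so at
  this one point the objects on the manifold coincide with those of the chart, without any
  transition map.\<close>

lemma tm_at: "tm f p = fd (rep f c d) (coord c p)"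
  by (simp add: tangent_map_def cd)

lemma J_at: "acs_in A J d (rep f c d (coord c p)) = J (f p)"
  unfolding rep_at using acs_in_to_chart[OF at_charts(2,4)] by (auto simp: cd)

lemma g_at: "metric_in A g d (rep f c d (coord c p)) = g (f p)"
  unfolding rep_at using metric_in_to_chart[OF at_charts(2,4)] by (auto simp: cd)

lemma cov_deriv_extension:
  "cov_deriv A g B f (extension A B f p v) p X
     = kaehler_chart.sff (christoffel A g d) (rep f c d) (coord c p) X v"
proof -
  interpret K: kaehler_chart "cimg d" "metric_in A g d" "acs_in A J d" "christoffel A g d" by (rule kaehler_chart[OF at_charts(2)])
  have "fd (\<lambda>x. to_chart A d (f (cinv c x)) (extension A B f p v (cinv c x))) (coord c p)
    = fd (\<lambda>x. fd (rep f c d) x v) (coord c p)"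
  proof (rule fd_cong[OF open_rep_dom[OF sfm at_charts(1,2)] at_charts(5)])
    fix x assume "x \<in> rep_dom f c d"
    then obtain q where q: "q \<in> cdom c" "f q \<in> cdom d" "x = coord c q" by blast
    then show "to_chart A d (f (cinv c x)) (extension A B f p v (cinv c x)) = fd (rep f c d) x v"
      using to_chart_tangent_map[OF sfm at_charts(1,2) q(1,2)] at_charts
      by (simp add: extension_def B.chart_simps B.to_from_chart cd[symmetric])
  qed
  moreover have "extension A B f p v p = tm f p v" by (simp add: extension_def)
  ultimately show ?thesis
    by (simp add: cov_deriv_def cd[symmetric] K.sff_def K.cov_def tm_at rep_at del: comp_apply)
qed

lemma proj_J_eq:
  "proj_J A J B f p w = J (f p) (tm f p (im_vec (inv (frame_map (J (f p)) (frame_of (tm f p))) w)))"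
proof -
  interpret h: complex_space "J (f p)" by (rule complex_space)
  have lt: "linear (tm f p)" by (rule linear_tangent_map[OF sfm])
  define z where "z = inv (frame_map (J (f p)) (frame_of (tm f p))) w"
  have w: "w = tm f p (re_vec z) + J (f p) (tm f p (im_vec z))"
    using frame_map_linear[OF lt h.J_linear, of z] h.frame_map_cof[OF bij_frame[OF f, of p], of w] by (simp add: z_def)
  have "b = J (f p) (tm f p (im_vec z))"
    if b: "b \<in> J (f p) ` range (tm f p)" "w - b \<in> range (tm f p)" for b
  proof -
    from b(1) obtain v where v: "b = J (f p) (tm f p v)" by (elim imageE) simp
    from b(2) obtain u where "w - b = tm f p u" by (elim rangeE)
    then have "w = tm f p u + J (f p) (tm f p v)" using v by (simp add: algebra_simps)
    then have "z = complex_vec u v"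
      unfolding z_def by (rule inv_frame_map_eqI[OF lt h.J_linear bij_frame[OF f]])
    then show ?thesis by (simp add: v)
  qed
  then have "(THE b. b \<in> J (f p) ` range (tm f p) \<and> w - b \<in> range (tm f p)) = J (f p) (tm f p (im_vec z))"
    by (intro the_equality) (auto simp: w)
  then show ?thesis by (simp add: proj_J_def z_def)
qed

lemma maslov_form_at: "maslov_form A g J B f p X = maslov_in d (rep f c d) (coord c p) X"
proof -
  interpret K: kaehler_chart "cimg d" "metric_in A g d" "acs_in A J d" "christoffel A g d" by (rule kaehler_chart[OF at_charts(2)])
  interpret h: complex_space "J (f p)" by (rule complex_space)
  have lt: "linear (tm f p)" by (rule linear_tangent_map[OF sfm])
  have inj: "inj (tm f p)" using f by (simp add: totally_real_immersion_def)
  have "inv (tm f p) (J (f p) (J (f p) (tm f p v))) = - v" for v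
    using inv_f_f[OF inj, of "- v"] by (simp add: h.J_J linear_neg[OF lt])
  then show ?thesis
    by (simp add: maslov_form_def proj_J_eq cov_deriv_extension K.maslov_def trace_lin_uminus tm_at[symmetric] J_at del: comp_apply)
qed

end

text \<open>The definition uses charts chosen separately at each point. Here \<open>c\<close> and
  \<open>d\<close> stay fixed while \<open>p\<close> moves, which is what differentiating or
  integrating \<xi> requires.\<close>

lemma maslov_form_in_chart:
  assumes cd: "c \<in> B" "d \<in> A" "p \<in> cdom c" "f p \<in> cdom d"
  shows "maslov_form A g J B f p X = maslov_in d (rep f c d) (coord c p) (to_chart B c p X)"
proof -
  define c0 where "c0 = chart_at B p"
  define d0 where "d0 = chart_at A (f p)"
  note at = at_charts[OF c0_def d0_def]
  interpret K': kaehler_chart "cimg d" "metric_in A g d" "acs_in A J d" "christoffel A g d" by (rule kaehler_chart[OF cd(2)])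
  interpret T: chart_transition "cimg d0" "metric_in A g d0" "acs_in A J d0" "christoffel A g d0"
    "cimg d" "metric_in A g d" "acs_in A J d" "christoffel A g d" "coord d0 ` (cdom d0 \<inter> cdom d)" "coord d \<circ> cinv d0"
    by (rule chart_transition[OF at(2) cd(2)])
  have of: "open (f -` cdom d')" if "d' \<in> A" for d'
    using sfm chart_open(1)[OF that] by (simp add: smooth_map_def continuous_on_open_vimage)
  define V where "V = coord c0 ` (cdom c0 \<inter> (f -` cdom d0 \<inter> f -` cdom d))"
  define V' where "V' = coord c ` (cdom c \<inter> (cdom c0 \<inter> (f -` cdom d0 \<inter> f -` cdom d)))"
  have oV: "open V" "open V'" unfolding V_def V'_def
    by (auto intro!: B.open_coord_image open_Int of B.chart_open at cd)
  have F: "smooth_on V (rep f c0 d0)"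
    by (rule smooth_on_subset[OF smooth_rep[OF sfm at(1,2)] oV(1)]) (auto simp: V_def)
  have FS: "rep f c0 d0 ` V \<subseteq> coord d0 ` (cdom d0 \<inter> cdom d)"
    using at(1) by (auto simp: V_def B.chart_simps)
  have \<phi>: "smooth_on V' (coord c0 \<circ> cinv c)"
    by (rule smooth_on_subset[OF B.smooth_transition[OF cd(1) at(1)] oV(2)]) (auto simp: V'_def)
  have \<phi>V: "(coord c0 \<circ> cinv c) ` V' \<subseteq> V"
    using cd(1) by (auto simp: V'_def V_def B.chart_simps)
  have y: "coord c p \<in> V'" using cd at by (auto simp: V'_def)
  have \<phi>y: "(coord c0 \<circ> cinv c) (coord c p) = coord c0 p" using cd by (simp add: B.chart_simps)
  have tr: "fd (coord c0 \<circ> cinv c) (coord c p) = transition c c0 p" by (simp add: transition_def)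
  have "maslov_in d (\<lambda>y. (coord d \<circ> cinv d0) (rep f c0 d0 ((coord c0 \<circ> cinv c) y))) (coord c p) (to_chart B c p X)
    = maslov_in d0 (rep f c0 d0) ((coord c0 \<circ> cinv c) (coord c p)) (fd (coord c0 \<circ> cinv c) (coord c p) (to_chart B c p X))"
  proof (rule T.maslov_transition[OF F FS \<phi> \<phi>V y])
    show "bij (fd (coord c0 \<circ> cinv c) (coord c p))"
      unfolding tr by (rule B.bij_transition[OF cd(1) at(1) cd(3) at(3)])
    show "bij (frame_map (acs_in A J d0 (rep f c0 d0 ((coord c0 \<circ> cinv c) (coord c p))))
       (frame_of (fd (rep f c0 d0) ((coord c0 \<circ> cinv c) (coord c p)))))"
      unfolding \<phi>y using bij_frame_in[OF f at(1,2,5)] .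
  qed
  also have "\<dots> = maslov_form A g J B f p X"
    unfolding \<phi>y tr B.transition_to_chart[OF cd(1) at(1) cd(3) at(3)]
    using maslov_form_at[OF c0_def d0_def] by (simp add: c0_def)
  finally have "maslov_form A g J B f p X = maslov_in d (\<lambda>y. (coord d \<circ> cinv d0) (rep f c0 d0 ((coord c0 \<circ> cinv c) y))) (coord c p) (to_chart B c p X)" ..
  also have "\<dots> = maslov_in d (rep f c d) (coord c p) (to_chart B c p X)"
    by (rule K'.maslov_cong[OF oV(2) y]) (use at cd in \<open>auto simp: V'_def B.chart_simps chart_simps\<close>)
  finally show ?thesis .
qed

lemma maslov_in_eq_form:
  assumes "c \<in> B" "d \<in> A" "x \<in> rep_dom f c d"
  shows "maslov_in d (rep f c d) x X = maslov_form A g J B f (cinv c x) (from_chart B c (cinv c x) X)"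
proof -
  obtain p where p: "p \<in> cdom c" "f p \<in> cdom d" "x = coord c p" using assms(3) by blast
  then show ?thesis using maslov_form_in_chart[OF assms(1,2) p(1,2)] assms(1) by (simp add: B.chart_simps B.to_from_chart)
qed

lemma parallel_iff_maslov:
  "parallel_form A g B f (Omega_J A g J B f) \<longleftrightarrow> (\<forall>p X. maslov_form A g J B f p X = 0)"
proof -
  have main: "cov_deriv_form A g B f (Omega_J A g J B f) p X w =
     \<i> * of_real (maslov_form A g J B f p X) * Omega_J A g J B f p w" for p X w
  proof -
    define c where "c = chart_at B p"
    define d where "d = chart_at A (f p)"
    note at = at_charts[OF c_def d_def]
    interpret K: kaehler_chart "cimg d" "metric_in A g d" "acs_in A J d" "christoffel A g d" by (rule kaehler_chart[OF at(2)])
    let ?F = "rep f c d" and ?V = "rep_dom f c d" and ?E = "frm f c d" and ?x = "coord c p"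
    note oV = open_rep_dom[OF sfm at(1,2)]
    note ctx = smooth_rep[OF sfm at(1,2)] rep_image[OF sfm at(1,2)] smooth_on_fd[OF smooth_rep[OF sfm at(1,2)]]
      bij_frame_in[OF f at(1,2)] dim
    have W: "smooth_on ?V (\<lambda>_. w j)" for j using oV by simp
    have Om: "Omega_J A g J B f q (\<lambda>j. from_chart A d (f q) (u j)) =
      of_real (dens_in d ?F ?E (coord c q)) * det (\<chi> i j. coef_in d ?F ?E (\<lambda>_. u j) (coord c q) $ i)"
      if "q \<in> cdom c" "f q \<in> cdom d" for q u
      using Omega_J_in_chart[OF f at(1,2) that, of "\<lambda>j. from_chart A d (f q) (u j)"] at that by (simp add: to_from_chart)
    have 1: "fd (\<lambda>x. Omega_J A g J B f (cinv c x) (\<lambda>j. from_chart A d (f (cinv c x)) (w j))) ?x X =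
      fd (\<lambda>y. of_real (dens_in d ?F ?E y) * det (\<chi> i j. coef_in d ?F ?E (\<lambda>_. w j) y $ i)) ?x X"
    proof (rule fun_cong[OF fd_cong[OF oV at(5)]])
      fix x assume "x \<in> ?V"
      then obtain q where q: "q \<in> cdom c" "f q \<in> cdom d" "x = coord c q" by blast
      show "Omega_J A g J B f (cinv c x) (\<lambda>j. from_chart A d (f (cinv c x)) (w j)) =
        of_real (dens_in d ?F ?E x) * det (\<chi> i j. coef_in d ?F ?E (\<lambda>_. w j) x $ i)"
        using Om[OF q(1,2)] q at by (simp add: B.chart_simps)
    qed
    have Omp: "Omega_J A g J B f p u = of_real (dens_in d ?F ?E ?x) * det (\<chi> i j. coef_in d ?F ?E (\<lambda>_. u j) ?x $ i)" for u
      using Om[OF at(3,4), of u] by (simp add: d_def)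
    have W': "cov_deriv A g B f (\<lambda>q. from_chart A d (f q) v) p X = K.cov ?F (\<lambda>_. v) ?x X" for v
    proof -
      have "fd (\<lambda>x. to_chart A d (f (cinv c x)) (from_chart A d (f (cinv c x)) v)) ?x = fd (\<lambda>x. v) ?x"
      proof (rule fd_cong[OF oV at(5)])
        fix x assume "x \<in> ?V"
        then obtain q where q: "q \<in> cdom c" "f q \<in> cdom d" "x = coord c q" by blast
        then show "to_chart A d (f (cinv c x)) (from_chart A d (f (cinv c x)) v) = v"
          using at by (simp add: B.chart_simps to_from_chart)
      qed
      moreover have "from_chart A d (f p) v = v" by (simp add: d_def)
      ultimately show ?thesis
        by (simp add: cov_deriv_def c_def[symmetric] d_def[symmetric] K.cov_def tm_at[OF c_def d_def] rep_at[OF c_def d_def] del: comp_apply)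
    qed
    have fp: "from_chart A d (f p) v = v" for v by (simp add: d_def)
    have 2: "Omega_J A g J B f p (w(j := K.cov ?F (\<lambda>_. w j) ?x X)) =
       of_real (dens_in d ?F ?E ?x) * det (\<chi> i k. (if k = j then coef_in d ?F ?E (\<lambda>y. K.cov ?F (\<lambda>_. w j) y X) ?x else coef_in d ?F ?E (\<lambda>_. w k) ?x) $ i)" for j
    proof -
      have "coef_in d ?F ?E (\<lambda>_. (w(j := K.cov ?F (\<lambda>_. w j) ?x X)) k) ?x =
        (if k = j then coef_in d ?F ?E (\<lambda>y. K.cov ?F (\<lambda>_. w j) y X) ?x else coef_in d ?F ?E (\<lambda>_. w k) ?x)" for k
        by (simp add: K.frame_coef_def)
      then show ?thesis unfolding Omp by simp
    qed
    have "cov_deriv_form A g B f (Omega_J A g J B f) p X w =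
      fd (\<lambda>y. of_real (dens_in d ?F ?E y) * det (\<chi> i j. coef_in d ?F ?E (\<lambda>_. w j) y $ i)) ?x X
      - (\<Sum>j\<in>UNIV. of_real (dens_in d ?F ?E ?x) * det (\<chi> i k. (if k = j then coef_in d ?F ?E (\<lambda>y. K.cov ?F (\<lambda>_. w j) y X) ?x else coef_in d ?F ?E (\<lambda>_. w k) ?x) $ i))"
      unfolding cov_deriv_form_def Let_def c_def[symmetric] d_def[symmetric] W' 1 2 ..
    also have "\<dots> = - \<i> * of_real (Im (conn_in d ?F ?E X ?x)) * (of_real (dens_in d ?F ?E ?x) * det (\<chi> i j. coef_in d ?F ?E (\<lambda>_. w j) ?x $ i))"
      by (rule K.cov_det_form[OF ctx W at(5)])
    also have "\<dots> = \<i> * of_real (maslov_form A g J B f p X) * Omega_J A g J B f p w"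
      unfolding Omp maslov_form_at[OF c_def d_def] K.maslov_conn_trace by simp
    finally show ?thesis .
  qed
  \<comment> \<open>\<Omega> has no zeros: on the tangent frame of L it equals the density, which is
    positive. So \<nabla>\<Omega> = i \<xi> \<Omega> vanishes only if \<xi> does.\<close>
  have nz: "Omega_J A g J B f p (\<lambda>i. tm f p (axis i 1)) \<noteq> 0" for p
  proof -
    define c where "c = chart_at B p"
    define d where "d = chart_at A (f p)"
    note at = at_charts[OF c_def d_def]
    interpret K: kaehler_chart "cimg d" "metric_in A g d" "acs_in A J d" "christoffel A g d" by (rule kaehler_chart[OF at(2)])
    have "dens_in d (rep f c d) (frm f c d) (coord c p) > 0"
      by (rule K.density_pos[OF smooth_rep[OF sfm at(1,2)] rep_image[OF sfm at(1,2)] smooth_on_fd[OF smooth_rep[OF sfm at(1,2)]]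
      bij_frame_in[OF f at(1,2)] dim at(5)])
    then have "vol_J A g J B f p (\<lambda>i. from_chart B c p (axis i 1)) \<noteq> 0"
      using vol_J_in_chart[OF f at(1-4)] by simp
    then show ?thesis by (simp add: vol_J_def c_def)
  qed
  show ?thesis
    unfolding parallel_form_def main using nz by fastforce
qed

lemma ricci_lagrangian_if_maslov_zero:
  assumes zero: "\<forall>p X. maslov_form A g J B f p X = 0"
  shows "ricci_lagrangian A g J B f"
  unfolding ricci_lagrangian_def
proof (intro allI)
  fix p u v
  define c where "c = chart_at B p"
  define d where "d = chart_at A (f p)"
  note at = at_charts[OF c_def d_def]
  interpret K: kaehler_chart "cimg d" "metric_in A g d" "acs_in A J d" "christoffel A g d" by (rule kaehler_chart[OF at(2)])
  let ?F = "rep f c d" and ?V = "rep_dom f c d" and ?E = "frm f c d" and ?x = "coord c p"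
  have Fx: "?F ?x \<in> cimg d" using rep_image[OF sfm at(1,2)] at(5) by blast
  interpret h: complex_space "acs_in A J d (?F ?x)" by (rule K.hermitian_space_at[OF Fx])
  note oV = open_rep_dom[OF sfm at(1,2)]
  note ctx = smooth_rep[OF sfm at(1,2)] rep_image[OF sfm at(1,2)] smooth_on_fd[OF smooth_rep[OF sfm at(1,2)]]
    bij_frame_in[OF f at(1,2)] dim
  \<comment> \<open>\<xi> vanishes on the whole chart domain, not just at \<open>p\<close>, so this
    equation may be differentiated.\<close>
  have Im0: "Im (conn_in d ?F ?E X x) = 0" if "x \<in> ?V" for x X
    using maslov_in_eq_form[OF at(1,2) that, of X] zero K.maslov_conn_trace[of ?F x X] by simp
  have "Im (fd (conn_in d ?F ?E X) ?x Y) = 0" for X Y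
  proof -
    have "Im (fd (conn_in d ?F ?E X) ?x Y) = fd (\<lambda>y. Im (conn_in d ?F ?E X y)) ?x Y"
      by (rule fd_bounded_linear[OF bounded_linear_Im smooth_on_differentiable[OF K.smooth_on_conn_trace[OF ctx] at(5)], symmetric])
    also have "\<dots> = fd (\<lambda>y. 0) ?x Y"
      by (rule fun_cong[OF fd_cong[OF oV at(5)]]) (rule Im0)
    finally show ?thesis by simp
  qed
  then have "(\<Sum>i\<in>UNIV. Im (inv (frame_map (acs_in A J d (?F ?x)) (\<lambda>i. ?E i ?x)) (K.curv (?F ?x) (tm f p u) (tm f p v) (?E i ?x)) $ i)) = 0"
    using arg_cong[OF K.trace_curv[OF ctx at(5), of u v], of Im] by (simp add: Im_sum tm_at[OF c_def d_def] del: comp_apply)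
  \<comment> \<open>The curvature is complex linear in its last argument, so the imaginary part of
    its complex trace is, up to the factor -2, the real trace of \<open>J\<close> composed with
    it.\<close>
  then have "trace_lin (\<lambda>z. acs_in A J d (?F ?x) (K.curv (?F ?x) (tm f p u) (tm f p v) z)) = 0"
    using h.trace_complex_linear(2)[OF bij_frame_in[OF f at(1,2,5)] K.curv_linear(3)[OF Fx] K.curv_J[OF Fx]] by simp
  then have "K.Ric (?F ?x) (J (f p) (tm f p u)) (tm f p v) = 0"
    using K.trace_J_curv[OF Fx, of "tm f p u" "tm f p v"] by (simp add: J_at[OF c_def d_def] del: comp_apply)
  moreover have "Ricci A g (f p) a b = K.Ric (?F ?x) a b" for a b
    unfolding Ricci_def K.Ric_def curvature_in_def K.curv_def d_def[symmetric] rep_at[OF c_def d_def] ..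
  ultimately show "ricci_form A g J (f p) (tm f p u) (tm f p v) = 0" by (simp add: ricci_form_def)
qed

lemma minimal_iff_maslov_zero:
  assumes lag: "lagrangian A g J B f"
  shows "minimal_immersion A g B f \<longleftrightarrow> (\<forall>p X. maslov_form A g J B f p X = 0)"
proof -
  have "mean_curvature A g B f p = 0 \<longleftrightarrow> (\<forall>X. maslov_form A g J B f p X = 0)" for p
  proof -
    define c where "c = chart_at B p"
    define d where "d = chart_at A (f p)"
    note at = at_charts[OF c_def d_def]
    interpret K: kaehler_chart "cimg d" "metric_in A g d" "acs_in A J d" "christoffel A g d" by (rule kaehler_chart[OF at(2)])
    interpret h: hermitian_space "g (f p)" "J (f p)" by (rule hermitian_space)
    let ?F = "rep f c d" and ?V = "rep_dom f c d" and ?x = "coord c p"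
    note F = smooth_rep[OF sfm at(1,2)] and FU = rep_image[OF sfm at(1,2)]
    have Fx: "?F ?x \<in> cimg d" using FU at(5) by blast
    note oV = open_rep_dom[OF sfm at(1,2)]
    define L where "L = tm f p"
    have lL: "linear L" unfolding L_def by (rule linear_tangent_map[OF sfm])
    have inj: "inj L" using f by (simp add: totally_real_immersion_def L_def)
    have fdL: "fd ?F ?x = L" by (simp add: L_def tm_at[OF c_def d_def])
    define b where "b X Y = K.sff ?F ?x X Y" for X Y
    define S where "S X v = im_vec (inv (frame_map (J (f p)) (frame_of L)) (b X v))" for X v
    have GJ: "g (f p) (L u) (J (f p) (L v)) = 0" for u v
      using lag h.G_J_left[of "L u" "L v"] by (simp add: lagrangian_def kform_def L_def)
    have bS: "\<exists>a. b X v = L a + J (f p) (L (S X v))" for X v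
      by (rule exI[of _ "re_vec (inv (frame_map (J (f p)) (frame_of L)) (b X v))"],
          subst h.frame_map_cof[OF bij_frame[OF f, of p, folded L_def], symmetric])
         (simp only: frame_map_linear[OF lL h.J_linear] S_def)
    have bsym: "b X Y = b Y X" for X Y
      unfolding b_def K.sff_def by (rule K.cov_torsion_free[OF F FU at(5)])
    have linb: "linear (\<lambda>v. b X v)" for X
    proof -
      have "(\<lambda>v. b X v) = K.cov ?F (\<lambda>y. fd ?F y X) ?x"
        unfolding b_def K.sff_def using K.cov_torsion_free[OF F FU at(5)] by blast
      then show ?thesis using K.linear_cov[OF F FU smooth_on_fd[OF F] at(5)] by simp
    qed
    have linS: "linear (S X)" for X
      using linear_compose[OF linear_compose[OF linb h.linear_cof[OF bij_frame[OF f]]] linear_im_vec]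
      by (simp add: S_def[abs_def] L_def o_def)
    have gb: "g (f p) (b X v) (J (f p) (L u)) = g (f p) (L (S X v)) (L u)" for X v u
      using bS[of X v] by (auto simp: h.G_simps GJ h.J_isometry)
    \<comment> \<open>Differentiate the Lagrangian condition g(dF Y, J dF Z) = 0 in direction
      \<open>X\<close>. Together with \<open>bsym\<close> this makes the cubic form totally
      symmetric.\<close>
    have cubic: "g (f p) (b X Y) (J (f p) (L Z)) = g (f p) (b X Z) (J (f p) (L Y))" for X Y Z
    proof -
      have sY: "smooth_on ?V (\<lambda>y. fd ?F y Y)" for Y by (rule smooth_on_fd[OF F])
      have sJ: "smooth_on ?V (\<lambda>y. acs_in A J d (?F y) (fd ?F y Z))" by (rule K.smooth_on_J_field[OF F FU sY])
      have "fd (\<lambda>y. metric_in A g d (?F y) (fd ?F y Y) (acs_in A J d (?F y) (fd ?F y Z))) ?x X = fd (\<lambda>y. 0) ?x X"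
      proof (rule fun_cong[OF fd_cong[OF oV at(5)]])
        fix y assume "y \<in> ?V"
        then obtain q where q: "q \<in> cdom c" "f q \<in> cdom d" "y = coord c q" by blast
        interpret hq: hermitian_space "g (f q)" "J (f q)" by (rule hermitian_space)
        have e: "fd ?F y v = to_chart A d (f q) (tm f q (from_chart B c q v))" for v
          using to_chart_tangent_map[OF sfm at(1,2) q(1,2)] q at by (simp add: B.to_from_chart)
        have Fy: "?F y = coord d (f q)" using q at by (simp add: B.chart_simps)
        show "metric_in A g d (?F y) (fd ?F y Y) (acs_in A J d (?F y) (fd ?F y Z)) = 0"
          unfolding Fy e
          using lag hq.G_J_left[of "tm f q (from_chart B c q Y)" "tm f q (from_chart B c q Z)"] q(1,2) at
          by (simp add: acs_in_to_chart metric_in_to_chart lagrangian_def kform_def)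
      qed
      then have "g (f p) (b X Y) (J (f p) (L Z)) + g (f p) (L Y) (J (f p) (b X Z)) = 0"
        using K.fd_G_field[OF F FU sY sJ at(5), of Y X] K.cov_J[OF F FU sY at(5), of Z X]
        by (simp add: b_def K.sff_def g_at[OF c_def d_def] J_at[OF c_def d_def] fdL del: comp_apply)
      then show ?thesis using h.G_J_left[of "L Y" "b X Z"] h.sym[of "J (f p) (L Y)" "b X Z"] by linarith
    qed
    interpret i: inner_form "\<lambda>u v. g (f p) (L u) (L v)"
    proof
      show "bilinear (\<lambda>u v. g (f p) (L u) (L v))"
        unfolding bilinear_def by (intro conjI allI linearI) (simp_all add: h.G_simps linear_add[OF lL] linear_cmul[OF lL])
      show "0 < g (f p) (L v) (L v)" if "v \<noteq> 0" for v
        using that inj linear_injective_0[OF lL] by (intro h.pos) blast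
    qed (rule h.sym)
    \<comment> \<open>For a Lagrangian immersion J TL is the normal space, so the normal part and
      the J-part of a vector are the same.\<close>
    have nf: "normal_part A g B f p (b X Y) = J (f p) (L (S X Y))" for X Y
      unfolding normal_part_def L_def[symmetric]
    proof (rule the_equality)
      have "b X Y - J (f p) (L (S X Y)) \<in> range L" using bS[of X Y] by auto
      then show "(\<forall>u\<in>range L. g (f p) (J (f p) (L (S X Y))) u = 0) \<and> b X Y - J (f p) (L (S X Y)) \<in> range L"
        using GJ h.sym by auto
      fix \<nu> assume \<nu>: "(\<forall>u\<in>range L. g (f p) \<nu> u = 0) \<and> b X Y - \<nu> \<in> range L"
      from \<nu> obtain a' where a': "b X Y - \<nu> = L a'" by blast
      obtain a where a: "b X Y = L a + J (f p) (L (S X Y))" using bS by blast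
      have \<nu>eq: "\<nu> - J (f p) (L (S X Y)) = L (a - a')" using a a' by (simp add: linear_diff[OF lL] algebra_simps)
      have "g (f p) (\<nu> - J (f p) (L (S X Y))) (L (a - a')) = 0"
        using \<nu> GJ by (simp add: h.G_simps h.sym[of "J (f p) _"])
      then have "L (a - a') = 0" using \<nu>eq h.pos[of "L (a - a')"] by force
      then show "\<nu> = J (f p) (L (S X Y))" using \<nu>eq by simp
    qed
    have tr: "trace_lin (S X) = - maslov_form A g J B f p X" for X
      by (simp add: maslov_form_at[OF c_def d_def] K.maslov_def S_def[abs_def] b_def J_at[OF c_def d_def] fdL del: comp_apply)
    \<comment> \<open>The symmetry of the cubic form moves \<open>X\<close> from the last slot to
      the first, which turns the mean curvature sum into the trace of \<open>S X\<close>.\<close>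
    have H: "g (f p) (J (f p) (L (\<Sum>i\<in>UNIV. S (e i) (e i)))) (J (f p) (L X)) = - maslov_form A g J B f p X"
      if e: "\<And>i j. g (f p) (L (e i)) (L (e j)) = (if i = j then 1 else 0)" for e :: "'n \<Rightarrow> real^'n" and X
    proof -
      have "g (f p) (J (f p) (L (\<Sum>i\<in>UNIV. S (e i) (e i)))) (J (f p) (L X)) = (\<Sum>i\<in>UNIV. g (f p) (L (S (e i) (e i))) (L X))"
        by (simp add: h.J_isometry linear_sum[OF lL] h.G_sum_left)
      also have "\<dots> = (\<Sum>i\<in>UNIV. g (f p) (L (S X (e i))) (L (e i)))"
        using cubic[of "e _" "e _" X] bsym[of "e _" X] by (simp add: gb[symmetric])
      also have "\<dots> = trace_lin (S X)"
        by (rule i.trace_orthonormal[OF _ _ e linS, symmetric]) simp_all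
      finally show ?thesis by (simp add: tr)
    qed
    have uniq: "a = a'" if "\<And>X. g (f p) (J (f p) (L a)) (J (f p) (L X)) = g (f p) (J (f p) (L a')) (J (f p) (L X))" for a a'
      using that by (intro i.G_eqI) (simp add: h.J_isometry)
    have sf': "second_fundamental_form A g B f p X Y = J (f p) (L (S X Y))" for X Y
      unfolding second_fundamental_form_def cov_deriv_extension[OF c_def d_def] b_def[symmetric] by (rule nf)
    \<comment> \<open>The description in \<open>mean_curvature\<close> quantifies over orthonormal
      bases, so it determines a vector only because one exists.\<close>
    obtain e0 :: "'n \<Rightarrow> real^'n" where e0: "\<And>i j. g (f p) (L (e0 i)) (L (e0 j)) = (if i = j then 1 else 0)"
      using i.exists_orthonormal[of "UNIV :: 'n set"] by auto
    define a0 where "a0 = (\<Sum>i\<in>UNIV. S (e0 i) (e0 i))"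
    have sums: "(\<Sum>i\<in>UNIV. second_fundamental_form A g B f p (e i) (e i)) = J (f p) (L (\<Sum>i\<in>UNIV. S (e i) (e i)))" for e :: "'n \<Rightarrow> real^'n"
      by (simp add: sf' linear_sum[OF lL] linear_sum[OF h.J_linear])
    have "mean_curvature A g B f p = J (f p) (L a0)"
      unfolding mean_curvature_def L_def[symmetric] sums
    proof (rule the_equality)
      show "\<forall>e :: 'n \<Rightarrow> real^'n. (\<forall>i j. g (f p) (L (e i)) (L (e j)) = (if i = j then 1 else 0)) \<longrightarrow> J (f p) (L a0) = J (f p) (L (\<Sum>i\<in>UNIV. S (e i) (e i)))"
      proof (intro allI impI)
        fix e :: "'n \<Rightarrow> real^'n" assume "\<forall>i j. g (f p) (L (e i)) (L (e j)) = (if i = j then 1 else 0)"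
        then have "a0 = (\<Sum>i\<in>UNIV. S (e i) (e i))" unfolding a0_def by (intro uniq) (simp add: H e0)
        then show "J (f p) (L a0) = J (f p) (L (\<Sum>i\<in>UNIV. S (e i) (e i)))" by simp
      qed
    qed (use e0 a0_def in blast)
    moreover have "J (f p) (L a0) = 0 \<longleftrightarrow> (\<forall>X. maslov_form A g J B f p X = 0)"
    proof
      assume "J (f p) (L a0) = 0"
      then show "\<forall>X. maslov_form A g J B f p X = 0" using H[OF e0] by (simp add: a0_def h.G_simps)
    next
      assume "\<forall>X. maslov_form A g J B f p X = 0"
      then have "a0 = 0" using H[OF e0] by (intro uniq) (simp add: a0_def linear_0[OF lL] h.J_simps h.G_simps)
      then show "J (f p) (L a0) = 0" by (simp add: linear_0[OF lL] h.J_simps)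
    qed
    ultimately show ?thesis by simp
  qed
  then show ?thesis by (simp add: minimal_immersion_def)
qed

end

end

section \<open>Integration over closed oriented manifolds\<close>

text \<open>The change of variables formula of the library is available for well-ordered index types only;
  any finite index type has a well-ordered copy.\<close>

typedef (overloaded) 'n ordered_index = "{..<CARD('n::finite)}"
  by (rule exI[of _ 0]) simp

instantiation ordered_index :: (finite) wellorder
begin

definition "x \<le> y \<longleftrightarrow> Rep_ordered_index x \<le> Rep_ordered_index y"
definition "x < y \<longleftrightarrow> Rep_ordered_index x < Rep_ordered_index y"

instance
proof
  fix P :: "'a ordered_index \<Rightarrow> bool" and a
  assume *: "\<And>x. (\<And>y. y < x \<Longrightarrow> P y) \<Longrightarrow> P x"
  show "P a"
  proof (induction "Rep_ordered_index a" arbitrary: a rule: less_induct)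
    case less
    then show ?case using * by (metis less_ordered_index_def)
  qed
qed (auto simp: less_eq_ordered_index_def less_ordered_index_def Rep_ordered_index_inject)

end

lemma UNIV_ordered_index: "(UNIV :: 'n::finite ordered_index set) = Abs_ordered_index ` {..<CARD('n)}"
  by (metis type_definition.univ type_definition_ordered_index)

instance ordered_index :: (finite) finite
  by standard (simp add: UNIV_ordered_index)

lemma card_ordered_index: "CARD('n::finite ordered_index) = CARD('n)"
  by (simp add: type_definition.card[OF type_definition_ordered_index])

lemma ex_bij_ordered_index: "\<exists>\<pi> :: 'n::finite ordered_index \<Rightarrow> 'n. bij \<pi>"
  using finite_same_card_bij[of "UNIV :: 'n ordered_index set" "UNIV :: 'n set"] by (simp add: card_ordered_index)

section \<open>Change of variables for any finite index type\<close>

text \<open>Conjugation by \<open>\<pi>\<close> is a sign-preserving bijection between the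
  permutations of the two index types, and it matches the terms of Leibniz's formula.\<close>

lemma det_reindex:
  fixes M :: "'a::comm_ring_1^'n^'n" and \<pi> :: "'k::finite \<Rightarrow> 'n"
  assumes "bij \<pi>"
  shows "det (\<chi> k l. M $ \<pi> k $ \<pi> l) = det M"
proof -
  have inv: "inv \<pi> (\<pi> k) = k" "\<pi> (inv \<pi> i) = i" for k i
    using assms by (auto simp: bij_is_inj bij_is_surj surj_f_inv_f)
  have mp: "map_permutation UNIV \<pi> p = \<pi> \<circ> p \<circ> inv \<pi>" for p
    using bij_is_surj[OF assms] by (simp add: map_permutation_def restrict_id_def fun_eq_iff)
  have "det (\<chi> k l. M $ \<pi> k $ \<pi> l) = (\<Sum>p | p permutes UNIV. of_int (sign p) * (\<Prod>k\<in>UNIV. M $ \<pi> k $ \<pi> (p k)))"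
    by (simp add: det_def)
  also have "\<dots> = (\<Sum>q | q permutes UNIV. of_int (sign q) * (\<Prod>i\<in>UNIV. M $ i $ q i))"
  proof (rule sum.reindex_bij_witness[where j="\<lambda>p. \<pi> \<circ> p \<circ> inv \<pi>" and i="\<lambda>q. inv \<pi> \<circ> q \<circ> \<pi>"])
    fix p :: "'k \<Rightarrow> 'k" assume p: "p \<in> {p. p permutes UNIV}"
    show "inv \<pi> \<circ> (\<pi> \<circ> p \<circ> inv \<pi>) \<circ> \<pi> = p" by (simp add: fun_eq_iff inv)
    show "\<pi> \<circ> p \<circ> inv \<pi> \<in> {q. q permutes UNIV}"
      using bij_comp[OF bij_comp[OF bij_imp_bij_inv[OF assms] permutes_bij] assms] p
      by (auto intro!: bij_imp_permutes simp: o_assoc)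
    have "(\<Prod>k\<in>UNIV. M $ \<pi> k $ \<pi> (p k)) = (\<Prod>i\<in>UNIV. M $ i $ (\<pi> \<circ> p \<circ> inv \<pi>) i)"
      by (rule prod.reindex_bij_witness[where i="inv \<pi>" and j=\<pi>]) (auto simp: inv)
    moreover have "sign (\<pi> \<circ> p \<circ> inv \<pi>) = sign p"
      using sign_map_permutation[of \<pi> UNIV p] p assms by (simp add: mp bij_is_inj)
    ultimately show "of_int (sign (\<pi> \<circ> p \<circ> inv \<pi>)) * (\<Prod>i\<in>UNIV. M $ i $ (\<pi> \<circ> p \<circ> inv \<pi>) i)
      = of_int (sign p) * (\<Prod>k\<in>UNIV. M $ \<pi> k $ \<pi> (p k))" by simp
  next
    fix q :: "'n \<Rightarrow> 'n" assume q: "q \<in> {q. q permutes UNIV}"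
    show "\<pi> \<circ> (inv \<pi> \<circ> q \<circ> \<pi>) \<circ> inv \<pi> = q" by (simp add: fun_eq_iff inv)
    show "inv \<pi> \<circ> q \<circ> \<pi> \<in> {p. p permutes UNIV}"
      using bij_comp[OF bij_comp[OF assms permutes_bij] bij_imp_bij_inv[OF assms]] q
      by (auto intro!: bij_imp_permutes simp: o_assoc)
  qed
  finally show ?thesis by (simp add: det_def)
qed

lemma set_integrable_continuous_compact:
  fixes h :: "'a::euclidean_space \<Rightarrow> 'b::euclidean_space"
  assumes "compact K" "continuous_on K h"
  shows "set_integrable lborel K h" and "h absolutely_integrable_on K"
    and "(LINT x:K|lborel. h x) = integral K h"
proof -
  show 1: "set_integrable lborel K h"
    using borel_integrable_compact[OF assms] by (simp add: set_integrable_def)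
  then show "h absolutely_integrable_on K"
    unfolding set_integrable_def using integrable_completion by (metis borel_measurable_integrable measurable_lborel1)
  show "(LINT x:K|lborel. h x) = integral K h" by (rule set_borel_integral_eq_integral(2)[OF 1])
qed

lemma change_of_variables_wellorder:
  fixes \<theta> :: "real^'m::{finite,wellorder} \<Rightarrow> real^'m::_" and h :: "real^'m::_ \<Rightarrow> real"
  assumes K: "compact K" and der: "\<And>x. x \<in> K \<Longrightarrow> (\<theta> has_derivative \<theta>' x) (at x)" and inj: "inj_on \<theta> K"
    and det: "continuous_on K (\<lambda>x. det (matrix (\<theta>' x)))" and h: "continuous_on (\<theta> ` K) h"
  shows "(LINT y:\<theta> ` K|lborel. h y) = (LINT x:K|lborel. \<bar>det (matrix (\<theta>' x))\<bar> * h (\<theta> x))"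
proof -
  have c\<theta>: "continuous_on K \<theta>"
    using der by (meson continuous_at_imp_continuous_on has_derivative_continuous)
  have K': "compact (\<theta> ` K)" by (rule compact_continuous_image[OF c\<theta> K])
  have cb: "continuous_on K (\<lambda>x. \<bar>det (matrix (\<theta>' x))\<bar> * h (\<theta> x))"
    by (intro continuous_intros det continuous_on_compose2[OF h c\<theta>]) auto
  \<comment> \<open>The change of variables formula is stated for integrands with values in
    \<open>real^k\<close>; \<open>H\<close> is \<open>h\<close> as a vector with one entry.\<close>
  define H :: "real^'m::_ \<Rightarrow> real^1" where "H y = vec (h y)" for y
  have cH: "continuous_on (\<theta> ` K) H"
    unfolding H_def vec_def by (intro continuous_on_vec_lambda h)
  have cH': "continuous_on K (\<lambda>x. \<bar>det (matrix (\<theta>' x))\<bar> *\<^sub>R H (\<theta> x))"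
    by (intro continuous_intros det continuous_on_compose2[OF cH c\<theta>]) auto
  have "integral (\<theta> ` K) H = integral K (\<lambda>x. \<bar>det (matrix (\<theta>' x))\<bar> *\<^sub>R H (\<theta> x))"
    using has_absolute_integral_change_of_variables_compact[OF K has_derivative_at_withinI[OF der] inj, of H "integral (\<theta> ` K) H"]
      set_integrable_continuous_compact(2)[OF K' cH] by simp
  then have "integral (\<theta> ` K) H \<bullet> axis 1 1 = integral K (\<lambda>x. \<bar>det (matrix (\<theta>' x))\<bar> *\<^sub>R H (\<theta> x)) \<bullet> axis 1 1" by simp
  moreover have "integral (\<theta> ` K) H \<bullet> axis 1 1 = integral (\<theta> ` K) h"
    using integral_component_eq[OF set_lebesgue_integral_eq_integral(1)[OF set_integrable_continuous_compact(2)[OF K' cH]], of "axis 1 1"]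
    by (simp add: H_def inner_axis)
  moreover have "integral K (\<lambda>x. \<bar>det (matrix (\<theta>' x))\<bar> *\<^sub>R H (\<theta> x)) \<bullet> axis 1 1 = integral K (\<lambda>x. \<bar>det (matrix (\<theta>' x))\<bar> * h (\<theta> x))"
    using integral_component_eq[OF set_lebesgue_integral_eq_integral(1)[OF set_integrable_continuous_compact(2)[OF K cH']], of "axis 1 1"]
    by (simp add: H_def inner_axis)
  ultimately show ?thesis
    using set_integrable_continuous_compact(3)[OF K' h] set_integrable_continuous_compact(3)[OF K cb] by simp
qed

context
  fixes \<pi> :: "'k::finite \<Rightarrow> 'n::finite"
  assumes bij: "bij \<pi>"
begin

definition relabel :: "real^'n \<Rightarrow> real^'k" where "relabel x = (\<chi> k. x $ \<pi> k)"
definition unlabel :: "real^'k \<Rightarrow> real^'n" where "unlabel y = (\<chi> i. y $ inv \<pi> i)"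

lemma relabel_simps [simp]: "relabel (unlabel y) = y" "unlabel (relabel x) = x"
  using bij by (simp_all add: relabel_def unlabel_def vec_eq_iff bij_is_inj bij_is_surj surj_f_inv_f)

lemma linear_relabel: "linear relabel" and linear_unlabel: "linear unlabel"
  by (rule linearI; simp add: relabel_def unlabel_def vec_eq_iff)+

text \<open>A permutation of the coordinates carries boxes to boxes of the same volume, and these
  determine Lebesgue measure.\<close>

lemma lborel_relabel: "distr lborel borel relabel = lborel"
proof (rule lborel_eqI[symmetric])
  have m: "relabel \<in> borel \<rightarrow>\<^sub>M borel"
    by (rule borel_measurable_continuous_onI) (simp add: linear_continuous_on linear_conv_bounded_linear[symmetric] linear_relabel)
  fix l u :: "real^'k" assume le: "\<And>b. b \<in> Basis \<Longrightarrow> l \<bullet> b \<le> u \<bullet> b"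
  then have le': "l $ k \<le> u $ k" for k by (metis axis_in_Basis_iff inner_axis mult.right_neutral inner_real_def Basis_real_def insertI1)
  have B: "(Basis :: (real^'m::finite) set) = (\<lambda>i. axis i 1) ` UNIV" by (auto simp: Basis_vec_def)
  have pr: "(\<Prod>b\<in>Basis. (u - l) \<bullet> b) = (\<Prod>i\<in>UNIV. u $ i - l $ i)" for u l :: "real^'m::finite"
    unfolding B by (subst prod.reindex) (auto simp: inj_on_def axis_eq_axis inner_axis)
  have "relabel -` box l u = box (unlabel l) (unlabel u)"
  proof -
    have "(\<forall>k. l $ k < x $ \<pi> k \<and> x $ \<pi> k < u $ k) \<longleftrightarrow> (\<forall>i. l $ inv \<pi> i < x $ i \<and> x $ i < u $ inv \<pi> i)" for x :: "real^'n"
      using bij by (metis bij_inv_eq_iff)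
    then show ?thesis by (auto simp: relabel_def unlabel_def mem_box_cart)
  qed
  then have "emeasure (distr lborel borel relabel) (box l u) = emeasure lborel (box (unlabel l) (unlabel u))"
    using m by (simp add: emeasure_distr)
  also have "\<dots> = (\<Prod>b\<in>Basis. (unlabel u - unlabel l) \<bullet> b)"
  proof -
    have "unlabel l \<bullet> b \<le> unlabel u \<bullet> b" if "b \<in> Basis" for b
      using that le' unfolding B by (auto simp: inner_axis unlabel_def)
    then show ?thesis by (simp add: emeasure_lborel_box_eq)
  qed
  also have "\<dots> = (\<Prod>b\<in>Basis. (u - l) \<bullet> b)"
  proof -
    have "(\<Prod>i\<in>UNIV. unlabel u $ i - unlabel l $ i) = (\<Prod>k\<in>UNIV. u $ k - l $ k)"
      by (rule prod.reindex_bij_witness[where i=\<pi> and j="inv \<pi>"])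
         (use bij in \<open>auto simp: unlabel_def bij_is_inj bij_is_surj surj_f_inv_f\<close>)
    then show ?thesis by (simp add: pr)
  qed
  finally show "emeasure (distr lborel borel relabel) (box l u) = (\<Prod>b\<in>Basis. (u - l) \<bullet> b)" .
qed simp

lemma set_integral_unlabel:
  fixes h :: "real^'n \<Rightarrow> real"
  assumes "compact K" "continuous_on K h"
  shows "(LINT y:relabel ` K|lborel. h (unlabel y)) = (LINT x:K|lborel. h x)"
proof -
  have m: "relabel \<in> borel \<rightarrow>\<^sub>M borel" "unlabel \<in> borel \<rightarrow>\<^sub>M borel"
    by (auto intro!: borel_measurable_continuous_onI simp: linear_continuous_on linear_conv_bounded_linear[symmetric] linear_relabel linear_unlabel)
  have hm: "(\<lambda>x. indicator K x *\<^sub>R h x) \<in> borel_measurable borel"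
    using set_integrable_continuous_compact(1)[OF assms] by (simp add: set_integrable_def borel_measurable_integrable)
  have ind: "indicator (relabel ` K) y = (indicator K (unlabel y) :: real)" for y
  proof -
    have "y \<in> relabel ` K \<longleftrightarrow> unlabel y \<in> K" by (metis image_iff relabel_simps)
    then show ?thesis by (simp add: indicator_def)
  qed
  have "(LINT y:relabel ` K|lborel. h (unlabel y)) = (\<integral>y. indicator K (unlabel y) *\<^sub>R h (unlabel y) \<partial>distr lborel borel relabel)"
    by (simp add: set_lebesgue_integral_def ind lborel_relabel)
  also have "\<dots> = (\<integral>x. indicator K (unlabel (relabel x)) *\<^sub>R h (unlabel (relabel x)) \<partial>lborel)"
    by (rule integral_distr) (use m hm measurable_compose[OF m(2) hm] in auto)
  finally show ?thesis by (simp add: set_lebesgue_integral_def)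
qed

end

text \<open>The formula for the ordered copy of the index type, conjugated by the relabelling of
  coordinates, which preserves Lebesgue measure and the determinant of the derivative.\<close>

lemma change_of_variables:
  fixes \<theta> :: "real^'n::finite \<Rightarrow> real^'n" and h :: "real^'n \<Rightarrow> real"
  assumes K: "compact K" and der: "\<And>x. x \<in> K \<Longrightarrow> (\<theta> has_derivative \<theta>' x) (at x)" and inj: "inj_on \<theta> K"
    and det: "continuous_on K (\<lambda>x. det (matrix (\<theta>' x)))" and h: "continuous_on (\<theta> ` K) h"
  shows "(LINT y:\<theta> ` K|lborel. h y) = (LINT x:K|lborel. \<bar>det (matrix (\<theta>' x))\<bar> * h (\<theta> x))"
proof -
  obtain \<pi> :: "'n ordered_index \<Rightarrow> 'n" where \<pi>: "bij \<pi>" using ex_bij_ordered_index by blast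
  note simps = relabel_simps[OF \<pi>]
  let ?R = "relabel \<pi>" and ?U = "unlabel \<pi>"
  have cR: "continuous_on X ?R" and cU: "continuous_on Y ?U" for X Y
    by (simp_all add: linear_continuous_on linear_conv_bounded_linear[symmetric] linear_relabel[OF \<pi>] linear_unlabel[OF \<pi>])
  have bR: "bounded_linear ?R" and bU: "bounded_linear ?U"
    by (simp_all add: linear_conv_bounded_linear[symmetric] linear_relabel[OF \<pi>] linear_unlabel[OF \<pi>])
  have c\<theta>: "continuous_on K \<theta>"
    using der by (meson continuous_at_imp_continuous_on has_derivative_continuous)
  define T where "T y = ?R (\<theta> (?U y))" for y
  define T' where "T' y v = ?R (\<theta>' (?U y) (?U v))" for y v
  have K1: "compact (?R ` K)" by (rule compact_continuous_image[OF cR K])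
  have im: "T ` ?R ` K = ?R ` \<theta> ` K" by (simp add: T_def image_image simps)
  have dT: "det (matrix (T' y)) = det (matrix (\<theta>' (?U y)))" for y
  proof -
    have ax: "?U (axis l 1) = axis (\<pi> l) 1" for l
      using \<pi> by (auto simp: unlabel_def[OF \<pi>] vec_eq_iff axis_def bij_is_inj bij_is_surj surj_f_inv_f)
    have "matrix (T' y) = (\<chi> k l. matrix (\<theta>' (?U y)) $ \<pi> k $ \<pi> l)"
      by (simp add: matrix_def T'_def ax relabel_def[OF \<pi>] vec_eq_iff)
    then show ?thesis using det_reindex[OF \<pi>] by simp
  qed
  have "(LINT z:T ` ?R ` K|lborel. h (?U z)) = (LINT y:?R ` K|lborel. \<bar>det (matrix (T' y))\<bar> * h (?U (T y)))"
  proof (rule change_of_variables_wellorder[OF K1])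
    fix y assume "y \<in> ?R ` K"
    then have "?U y \<in> K" by (auto simp: simps)
    have "((\<lambda>y. \<theta> (?U y)) has_derivative (\<lambda>v. \<theta>' (?U y) (?U v))) (at y)"
      by (rule has_derivative_compose[OF bounded_linear_imp_has_derivative[OF bU] der[OF \<open>?U y \<in> K\<close>]])
    then show "(T has_derivative T' y) (at y)"
      unfolding T_def[abs_def] T'_def[abs_def] by (rule bounded_linear.has_derivative[OF bR])
  next
    show "inj_on T (?R ` K)"
      using inj by (auto simp: inj_on_def T_def simps) (metis simps(2))
    show "continuous_on (?R ` K) (\<lambda>y. det (matrix (T' y)))"
      unfolding dT by (rule continuous_on_compose2[OF det cU]) (auto simp: simps)
    show "continuous_on (T ` ?R ` K) (\<lambda>z. h (?U z))"
      unfolding im by (rule continuous_on_compose2[OF h cU]) (auto simp: simps)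
  qed
  also have "(LINT z:T ` ?R ` K|lborel. h (?U z)) = (LINT y:\<theta> ` K|lborel. h y)"
    unfolding im by (rule set_integral_unlabel[OF \<pi> compact_continuous_image[OF c\<theta> K] h])
  also have "(LINT y:?R ` K|lborel. \<bar>det (matrix (T' y))\<bar> * h (?U (T y))) = (LINT x:K|lborel. \<bar>det (matrix (\<theta>' x))\<bar> * h (\<theta> x))"
    using set_integral_unlabel[OF \<pi> K, of "\<lambda>x. \<bar>det (matrix (\<theta>' x))\<bar> * h (\<theta> x)"]
      continuous_on_compose2[OF h c\<theta>] det
    by (simp add: dT T_def simps continuous_intros)
  finally show ?thesis .
qed

section \<open>Functions with compact support\<close>

lemma smooth_on_extend_zero:
  assumes u: "smooth_on S u" and K: "closed K" "K \<subseteq> S" and z: "\<And>x. x \<in> S \<Longrightarrow> x \<notin> K \<Longrightarrow> u x = 0"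
  shows "smooth_on UNIV (\<lambda>x. if x \<in> S then u x else 0)"
proof (rule smooth_on_local)
  fix x
  show "\<exists>T. x \<in> T \<and> T \<subseteq> UNIV \<and> smooth_on T (\<lambda>x. if x \<in> S then u x else 0)"
  proof (cases "x \<in> S")
    case True
    then show ?thesis by (intro exI[of _ S]) (auto intro: smooth_on_cong[OF u])
  next
    case False
    have "smooth_on (- K) (\<lambda>x. if x \<in> S then u x else 0)"
      by (rule smooth_on_cong[of _ "\<lambda>_. 0"]) (use K z open_Compl[OF K(1)] in auto)
    then show ?thesis using False K by (intro exI[of _ "- K"]) auto
  qed
qed

lemma fd_zero_outside:
  assumes K: "closed K" and z: "\<And>x. x \<notin> K \<Longrightarrow> u x = 0" and x: "x \<notin> K"
  shows "fd u x v = 0"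
proof -
  have "fd u x = fd (\<lambda>_. 0) x"
    by (rule fd_cong[of "- K"]) (use K z x in auto)
  then show ?thesis by simp
qed

lemma integral_UNIV_eq_cbox:
  fixes u :: "'a::euclidean_space \<Rightarrow> real"
  assumes "\<And>x. x \<notin> cbox a b \<Longrightarrow> u x = 0"
  shows "integral UNIV u = integral (cbox a b) u"
proof -
  have "u = (\<lambda>x. if x \<in> cbox a b then u x else 0)" using assms by auto
  then have "integral UNIV u = integral UNIV (\<lambda>x. if x \<in> cbox a b then u x else 0)" by simp
  then show ?thesis by (simp only: integral_restrict_UNIV)
qed

lemma integral_translate:
  fixes u :: "'a::euclidean_space \<Rightarrow> real"
  assumes "u \<in> borel_measurable borel"
  shows "(\<integral>x. u (x + c) \<partial>lborel) = (\<integral>x. u x \<partial>lborel)"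
proof -
  have "(\<integral>x. u x \<partial>lborel) = (\<integral>x. u x \<partial>distr lborel borel ((+) c))"
    by (simp add: lborel_distr_plus)
  also have "\<dots> = (\<integral>x. u (c + x) \<partial>lborel)"
    by (rule integral_distr) (use assms in auto)
  finally show ?thesis by (simp add: add.commute)
qed

lemma integrable_compact_support:
  fixes u :: "'a::euclidean_space \<Rightarrow> 'b::euclidean_space"
  assumes "continuous_on UNIV u" "compact K" "\<And>x. x \<notin> K \<Longrightarrow> u x = 0"
  shows "integrable lborel u"
proof -
  have "u = (\<lambda>x. indicator K x *\<^sub>R u x)" using assms(3) by (auto simp: fun_eq_iff indicator_def)
  then show ?thesis
    using borel_integrable_compact[OF assms(2) continuous_on_subset[OF assms(1)]] by simp
qed

text \<open>By translation invariance the integral of \<open>u (x + t *\<^sub>R e)\<close> does not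
  depend on \<open>t\<close>; differentiate it under the integral sign at 0.\<close>

lemma integral_directional_derivative:
  fixes u :: "'a::euclidean_space \<Rightarrow> real"
  assumes u: "smooth_on UNIV u" and K: "compact K" and z: "\<And>x. x \<notin> K \<Longrightarrow> u x = 0"
  shows "(\<integral>x. fd u x e \<partial>lborel) = 0"
proof -
  obtain r where r: "r > 0" "\<And>x. x \<in> K \<Longrightarrow> norm x \<le> r" using compact_imp_bounded[OF K] bounded_pos by blast
  \<comment> \<open>One box for the supports of all translates with \<open>t\<close> between -1 and
    1, hence the radius enlarged by \<open>norm e\<close>.\<close>
  obtain a b where ab: "cball 0 (r + norm e) \<subseteq> cbox a (b::'a)"
    using bounded_subset_cbox_symmetric[OF bounded_cball] by metis
  define U where "U = {-1..1::real}"
  have shift: "u (x + t *\<^sub>R e) = 0" if "t \<in> U" "x \<notin> cbox a b" for t x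
  proof (rule z)
    show "x + t *\<^sub>R e \<notin> K"
    proof
      assume "x + t *\<^sub>R e \<in> K"
      then have "norm (x + t *\<^sub>R e) \<le> r" by (rule r)
      moreover have "norm (t *\<^sub>R e) \<le> norm e" using that(1) by (auto simp: U_def mult_left_le_one_le abs_le_iff)
      ultimately have "norm x \<le> r + norm e"
        using norm_triangle_ineq4[of "x + t *\<^sub>R e" "t *\<^sub>R e"] by simp
      then show False using ab that(2) by auto
    qed
  qed
  have cu: "continuous_on UNIV u" by (rule smooth_on_continuous[OF u])
  have cs: "continuous_on UNIV (\<lambda>x. u (x + t *\<^sub>R e))" for t
    by (intro continuous_on_compose2[OF cu] continuous_intros) auto
  have const: "integral (cbox a b) (\<lambda>x. u (x + t *\<^sub>R e)) = (\<integral>x. u x \<partial>lborel)" if "t \<in> U" for t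
  proof -
    have "integrable lborel (\<lambda>x. u (x + t *\<^sub>R e))"
      by (rule integrable_compact_support[OF cs compact_cbox[of a b]]) (rule shift[OF that])
    then have "integral UNIV (\<lambda>x. u (x + t *\<^sub>R e)) = (\<integral>x. u (x + t *\<^sub>R e) \<partial>lborel)" by (rule integral_lborel)
    then show ?thesis using integral_UNIV_eq_cbox[of a b "\<lambda>x. u (x + t *\<^sub>R e)"] shift[OF that]
      by (simp add: integral_translate borel_measurable_continuous_onI[OF cu])
  qed
  have d1: "((\<lambda>t. integral (cbox a b) (\<lambda>x. u (x + t *\<^sub>R e))) has_vector_derivative
      integral (cbox a b) (\<lambda>x. fd u (x + 0 *\<^sub>R e) e)) (at 0 within U)"
  proof (rule leibniz_rule_vector_derivative)
    fix t x assume "t \<in> U" "x \<in> cbox a b"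
    have "((\<lambda>s. u (x + s *\<^sub>R e)) has_real_derivative fd u (x + t *\<^sub>R e) e) (at t)"
      by (rule has_real_derivative_along[OF u]) simp
    then show "((\<lambda>s. u (x + s *\<^sub>R e)) has_vector_derivative fd u (x + t *\<^sub>R e) e) (at t within U)"
      by (simp add: has_real_derivative_iff_has_vector_derivative has_vector_derivative_at_within)
  next
    fix t show "(\<lambda>x. u (x + t *\<^sub>R e)) integrable_on cbox a b"
      by (rule integrable_continuous) (rule continuous_on_subset[OF cs], simp)
  next
    show "continuous_on (U \<times> cbox a b) (\<lambda>(t, x). fd u (x + t *\<^sub>R e) e)"
      unfolding split_beta
      by (intro continuous_on_compose2[OF smooth_on_continuous[OF smooth_on_fd[OF u]]] continuous_intros) auto
  qed (auto simp: U_def)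
  have d2: "((\<lambda>t. integral (cbox a b) (\<lambda>x. u (x + t *\<^sub>R e))) has_vector_derivative 0) (at 0 within U)"
    by (rule has_vector_derivative_transform[OF _ _ has_vector_derivative_const[of "\<integral>x. u x \<partial>lborel"]]) (auto simp: const, simp add: U_def)
  have nb: "at 0 within U \<noteq> bot" by (simp add: U_def at_within_Icc_at)
  have 1: "integral (cbox a b) (\<lambda>x. fd u (x + 0 *\<^sub>R e) e) = 0"
    by (rule vector_derivative_unique_within[OF nb d1 d2])
  have 2: "integral UNIV (\<lambda>x. fd u x e) = integral (cbox a b) (\<lambda>x. fd u x e)"
  proof (rule integral_UNIV_eq_cbox)
    fix x assume x: "x \<notin> cbox a b"
    have "K \<subseteq> cbox a b"
    proof
      fix y assume "y \<in> K" then have "y \<in> cball 0 (r + norm e)" using r(2)[of y] by (simp add: add_increasing2)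
      then show "y \<in> cbox a b" using ab by blast
    qed
    then show "fd u x e = 0" using x z by (intro fd_zero_outside[OF compact_imp_closed[OF K]]) auto
  qed
  have "integrable lborel (\<lambda>x. fd u x e)"
    by (rule integrable_compact_support[OF smooth_on_continuous[OF smooth_on_fd[OF u]] K])
       (rule fd_zero_outside[OF compact_imp_closed[OF K] z])
  from integral_lborel[OF this] show ?thesis using 1 2 by simp
qed

section \<open>Bump functions and partitions of unity on a manifold\<close>

context atlas
begin

lemma smooth_fun_sum: "(\<And>i. i \<in> I \<Longrightarrow> smooth_fun A (f i)) \<Longrightarrow> smooth_fun A (\<lambda>p. \<Sum>i\<in>I. f i p)"
  unfolding smooth_fun_def o_def using chart_open by (auto intro!: smooth_on_sum)

text \<open>The quotient solves a one-dimensional linear system with coefficient \<open>h\<close>,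
  so its smoothness is an instance of \<open>smooth_on_linear_system\<close>.\<close>

lemma smooth_fun_divide:
  assumes "smooth_fun A f" "smooth_fun A h" "\<And>p. h p \<noteq> (0::real)"
  shows "smooth_fun A (\<lambda>p. f p / h p)"
  unfolding smooth_fun_def o_def
proof
  fix c assume c: "c \<in> A"
  show "smooth_on (cimg c) (\<lambda>x. f (cinv c x) / h (cinv c x))"
  proof (rule smooth_on_linear_system[where L="\<lambda>x u. h (cinv c x) * u" and b="\<lambda>x. f (cinv c x)"])
    show "linear ((*) (h (cinv c x)))" for x by (rule linearI) (simp_all add: algebra_simps)
    show "bij ((*) (h (cinv c x)))" for x
      using assms(3) by (intro bij_betwI[where g="\<lambda>u. u / h (cinv c x)"]) auto
    show "smooth_on (cimg c) (\<lambda>x. h (cinv c x) * u)" for u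
      using assms(2) c chart_open(2)[OF c] by (intro smooth_on_mult) (auto simp: smooth_fun_def o_def)
  qed (use assms c in \<open>auto simp: smooth_fun_def o_def\<close>)
qed

lemma continuous_in_charts:
  assumes "\<And>c. c \<in> A \<Longrightarrow> continuous_on (cimg c) (\<lambda>x. f (cinv c x))"
  shows "continuous_on UNIV f"
proof -
  have "isCont f p" for p
  proof -
    note c = chart_at[of p]
    let ?c = "chart_at A p"
    have "continuous_on (cdom ?c) (\<lambda>q. f (cinv ?c (coord ?c q)))"
      by (rule continuous_on_compose2[OF assms[OF c(1)] continuous_coord[OF is_chart[OF c(1)]]])
         (use chart_simps(3)[OF c(1)] in blast)
    then have "continuous_on (cdom ?c) f"
      by (rule continuous_on_eq) (simp add: chart_simps(1)[OF c(1)])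
    then show ?thesis using c chart_open(1)[OF c(1)] by (simp add: continuous_on_eq_continuous_at)
  qed
  then show ?thesis by (simp add: continuous_on_eq_continuous_at)
qed

lemma smooth_fun_continuous: "smooth_fun A f \<Longrightarrow> continuous_on UNIV f"
  by (rule continuous_in_charts, rule smooth_on_continuous) (simp add: smooth_fun_def o_def)

definition chart_bump :: "('m, 'e) chart \<Rightarrow> 'e \<Rightarrow> real \<Rightarrow> 'm \<Rightarrow> real" where
  "chart_bump c a r q = (if q \<in> cdom c then bump a r (coord c q) else 0)"

context
  fixes c a r
  assumes c: "c \<in> A" and r: "r > 0" "cball a r \<subseteq> cimg c"
begin

lemma compact_chart_ball: "compact (cinv c ` cball a r)"
  by (rule compact_continuous_image[OF continuous_on_subset[OF continuous_cinv[OF is_chart[OF c]] r(2)] compact_cball])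

lemma chart_ball_subset: "cinv c ` cball a r \<subseteq> cdom c"
  using r(2) chart_simps(4)[OF c] by auto

lemma chart_bump_nonneg: "chart_bump c a r q \<ge> 0"
  by (simp add: chart_bump_def bump_nonneg)

lemma chart_bump_outside: "q \<notin> cinv c ` cball a r \<Longrightarrow> chart_bump c a r q = 0"
proof -
  assume "q \<notin> cinv c ` cball a r"
  then have "coord c q \<notin> cball a r" if "q \<in> cdom c" using that chart_simps(1)[OF c that] by (metis image_eqI)
  then show ?thesis using bump_eq_0[OF r(1), of "coord c q" a] by (auto simp: chart_bump_def)
qed

lemma chart_bump_pos_iff: "chart_bump c a r q > 0 \<longleftrightarrow> q \<in> cdom c \<and> coord c q \<in> ball a r"
  using bump_pos_iff[OF r(1), of a "coord c q"] by (auto simp: chart_bump_def simp del: mem_ball)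

lemma closure_chart_bump: "closure {q. chart_bump c a r q \<noteq> 0} \<subseteq> cinv c ` cball a r"
  using chart_bump_outside by (intro closure_minimal compact_imp_closed compact_chart_ball) blast

text \<open>Extension by zero out of a chart domain is smooth because the closed coordinate ball has
  a compact and therefore, in a Hausdorff space, closed image: its complement is an open set on
  which the bump vanishes.\<close>

lemma smooth_chart_bump: "smooth_fun A (chart_bump c a r)"
  unfolding smooth_fun_def
proof
  fix c' assume c': "c' \<in> A"
  show "smooth_on (cimg c') (chart_bump c a r \<circ> cinv c')"
  proof (rule smooth_on_local)
    fix x assume x: "x \<in> cimg c'"
    define q where "q = cinv c' x"
    have q: "q \<in> cdom c'" "x = coord c' q" using x c' by (auto simp: q_def chart_simps)
    show "\<exists>T. x \<in> T \<and> T \<subseteq> cimg c' \<and> smooth_on T (chart_bump c a r \<circ> cinv c')"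
    proof (cases "q \<in> cdom c")
      case True
      let ?T = "coord c' ` (cdom c' \<inter> cdom c)"
      have "smooth_on ?T (\<lambda>y. bump a r ((coord c \<circ> cinv c') y))"
        by (rule smooth_on_compose[OF smooth_on_bump smooth_transition[OF c' c]]) simp
      then have "smooth_on ?T (chart_bump c a r \<circ> cinv c')"
        by (rule smooth_on_cong) (use c' in \<open>auto simp: chart_bump_def chart_simps\<close>)
      then show ?thesis using True q chart_simps(3)[OF c'] by (intro exI[of _ ?T]) auto
    next
      case False
      let ?T = "coord c' ` (cdom c' \<inter> - cinv c ` cball a r)"
      have "open ?T" by (rule open_coord_image[OF c']) (intro open_Compl compact_imp_closed compact_chart_ball)
      then have "smooth_on ?T (chart_bump c a r \<circ> cinv c')"
        by (intro smooth_on_cong[OF smooth_on_const[of _ 0]]) (use c' chart_bump_outside in \<open>auto simp: chart_simps(1)\<close>)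
      moreover have "x \<in> ?T" using False q chart_ball_subset by blast
      ultimately show ?thesis using chart_simps(3)[OF c'] by (intro exI[of _ ?T]) auto
    qed
  qed
qed

end

lemma exists_chart_ball:
  assumes "c \<in> A" "p \<in> cdom c" "open P" "p \<in> P"
  obtains r where "r > 0" "cball (coord c p) r \<subseteq> cimg c" "cinv c ` cball (coord c p) r \<subseteq> P"
proof -
  have "coord c p \<in> coord c ` (cdom c \<inter> P)" using assms by blast
  then obtain r where r: "r > 0" "cball (coord c p) r \<subseteq> coord c ` (cdom c \<inter> P)"
    using open_contains_cball[THEN iffD1, OF open_coord_image[OF assms(1,3)]] by blast
  have s: "coord c ` (cdom c \<inter> P) \<subseteq> cimg c" "cinv c ` coord c ` (cdom c \<inter> P) \<subseteq> P"
    by (auto simp: chart_simps[OF assms(1)])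
  show ?thesis
    by (rule that[OF r(1) subset_trans[OF r(2) s(1)] subset_trans[OF image_mono[OF r(2)] s(2)]])
qed

end

text \<open>Finitely many of the open sets where a chart bump is positive cover the compact
  manifold; divide those bumps by their sum.\<close>

lemma (in atlas) exists_partition_of_unity:
  assumes "compact (UNIV :: 'm set)"
  shows "\<exists>k c \<psi>. partition_of_unity A k c \<psi>"
proof -
  have "\<forall>p. \<exists>r>0. cball (coord (chart_at A p) p) r \<subseteq> cimg (chart_at A p)"
  proof
    fix p
    obtain r where "r > 0" "cball (coord (chart_at A p) p) r \<subseteq> cimg (chart_at A p)"
      "cinv (chart_at A p) ` cball (coord (chart_at A p) p) r \<subseteq> UNIV"
      by (rule exists_chart_ball[OF chart_at[of p] open_UNIV UNIV_I])
    then show "\<exists>r>0. cball (coord (chart_at A p) p) r \<subseteq> cimg (chart_at A p)" by blast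
  qed
  then obtain r where r: "\<And>p. r p > 0" "\<And>p. cball (coord (chart_at A p) p) (r p) \<subseteq> cimg (chart_at A p)" by metis
  define b where "b p = chart_bump (chart_at A p) (coord (chart_at A p) p) (r p)" for p
  note cb = chart_at(1) r
  have sb: "smooth_fun A (b p)" for p unfolding b_def by (rule smooth_chart_bump[OF cb])
  define P where "P p = {q. b p q > 0}" for p
  have oP: "open (P p)" for p
    unfolding P_def using open_Collect_less[OF continuous_on_const smooth_fun_continuous[OF sb]] .
  have pP: "p \<in> P p" for p
    using chart_bump_pos_iff[OF chart_at(1)[of p] r(1)[of p] r(2)[of p], of p] chart_at[of p] r(1)[of p] by (simp add: P_def b_def)
  obtain T where T: "finite T" "UNIV \<subseteq> (\<Union>p\<in>T. P p)"
    by (rule compactE_image[OF assms, of UNIV P]) (use oP pP in auto)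
  obtain e where e: "bij_betw e {..<card T} T" using ex_bij_betw_nat_finite[OF T(1)] lessThan_atLeast0 by metis
  define S where "S q = (\<Sum>p\<in>T. b p q)" for q
  have S: "S q > 0" for q
  proof -
    obtain p where "p \<in> T" "b p q > 0" using T(2) by (auto simp: P_def)
    then show ?thesis unfolding S_def using chart_bump_nonneg[OF cb] T(1)
      by (intro sum_pos2) (auto simp: b_def)
  qed
  have sS: "smooth_fun A S" unfolding S_def[abs_def] by (intro smooth_fun_sum sb)
  define \<psi> where "\<psi> i q = b (e i) q / S q" for i q
  have "partition_of_unity A (card T) (\<lambda>i. chart_at A (e i)) \<psi>"
    unfolding partition_of_unity_def
  proof (intro conjI allI impI)
    fix i q
    show "chart_at A (e i) \<in> A" by (rule chart_at)
    show "smooth_fun A (\<psi> i)" unfolding \<psi>_def using S by (intro smooth_fun_divide sb sS) (metis less_irrefl)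
    show "0 \<le> \<psi> i q" unfolding \<psi>_def b_def using chart_bump_nonneg[OF cb] S[of q] by (simp add: less_imp_le)
    have "{q. \<psi> i q \<noteq> 0} \<subseteq> {q. b (e i) q \<noteq> 0}" by (auto simp: \<psi>_def)
    then have "closure {q. \<psi> i q \<noteq> 0} \<subseteq> closure {q. b (e i) q \<noteq> 0}" by (rule closure_mono)
    also have "\<dots> \<subseteq> cdom (chart_at A (e i))"
      unfolding b_def using closure_chart_bump[OF cb] chart_ball_subset[OF cb] by blast
    finally show "closure {q. \<psi> i q \<noteq> 0} \<subseteq> cdom (chart_at A (e i))" .
  next
    fix q
    have "(\<Sum>i<card T. b (e i) q) = S q" unfolding S_def by (rule sum.reindex_bij_betw[OF e])
    then show "(\<Sum>i<card T. \<psi> i q) = 1" using S[of q] by (simp add: \<psi>_def sum_divide_distrib[symmetric])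
  qed
  then show ?thesis by blast
qed

abbreviation supp :: "('a::topological_space \<Rightarrow> real) \<Rightarrow> 'a set" where
  "supp \<phi> \<equiv> closure {p. \<phi> p \<noteq> 0}"

lemma zero_outside_supp: "p \<notin> supp \<phi> \<Longrightarrow> \<phi> p = 0"
  using closure_subset[of "{p. \<phi> p \<noteq> 0}"] by auto

lemma supp_mult_subset: "supp (\<lambda>p. \<phi> p * \<psi> p) \<subseteq> supp \<phi>" "supp (\<lambda>p. \<phi> p * \<psi> p) \<subseteq> supp \<psi>"
  by (rule closure_mono; auto)+

section \<open>Integration of top-degree forms\<close>

locale oriented_compact = B: atlas B
  for B :: "('l::{t2_space, second_countable_topology}, real^'n::finite) chart set" +
  assumes oriented: "oriented_atlas B" and compact: "compact (UNIV :: 'l set)"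
begin

text \<open>The determinant law expresses that \<alpha> is alternating and multilinear, in the form
  in which a change of chart uses it. Continuous coefficients without imaginary part reduce all
  integrals to those of real continuous functions.\<close>

definition real_form :: "('l \<Rightarrow> ('n \<Rightarrow> real^'n) \<Rightarrow> complex) \<Rightarrow> bool" where
  "real_form \<alpha> \<longleftrightarrow> (\<forall>p N v. \<alpha> p (\<lambda>i. \<Sum>j\<in>UNIV. N $ i $ j *\<^sub>R v j) = of_real (det N) * \<alpha> p v) \<and>
     (\<forall>c\<in>B. continuous_on (cimg c) (form_coeff B c \<alpha>) \<and> (\<forall>x\<in>cimg c. Im (form_coeff B c \<alpha> x) = 0))"

text \<open>The contribution of one chart to \<open>form_integral\<close>, for an arbitrary cut-off
  function in place of a member of a partition of unity.\<close>

definition cint :: "('l, real^'n) chart \<Rightarrow> ('l \<Rightarrow> ('n \<Rightarrow> real^'n) \<Rightarrow> complex) \<Rightarrow> ('l \<Rightarrow> real) \<Rightarrow> complex" where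
  "cint c \<alpha> \<phi> = (LINT x:cimg c|lborel. \<phi> (cinv c x) *\<^sub>R form_coeff B c \<alpha> x)"

abbreviation smul :: "('l \<Rightarrow> real) \<Rightarrow> ('l \<Rightarrow> ('n \<Rightarrow> real^'n) \<Rightarrow> complex) \<Rightarrow> 'l \<Rightarrow> ('n \<Rightarrow> real^'n) \<Rightarrow> complex" where
  "smul \<phi> \<alpha> \<equiv> \<lambda>p v. of_real (\<phi> p) * \<alpha> p v"

lemma form_coeff_smul: "form_coeff B c (smul \<phi> \<alpha>) x = of_real (\<phi> (cinv c x)) * form_coeff B c \<alpha> x"
  by (simp add: form_coeff_def)

lemma continuous_cinv_compose:
  "c \<in> B \<Longrightarrow> continuous_on UNIV \<phi> \<Longrightarrow> continuous_on (cimg c) (\<lambda>x. \<phi> (cinv c x))"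
  by (rule continuous_on_compose2[OF _ continuous_cinv[OF B.is_chart]]) auto

lemma real_form_smul:
  assumes "real_form \<alpha>" "continuous_on UNIV \<phi>"
  shows "real_form (smul \<phi> \<alpha>)"
  using assms unfolding real_form_def
  by (auto simp: form_coeff_smul intro!: continuous_intros continuous_cinv_compose)

lemma form_coeff_transition:
  assumes \<alpha>: "real_form \<alpha>" and cd: "c \<in> B" "d \<in> B" "p \<in> cdom c" "p \<in> cdom d"
  shows "form_coeff B c \<alpha> (coord c p) = of_real (det (matrix (transition c d p))) * form_coeff B d \<alpha> (coord d p)"
proof -
  have "from_chart B c p (axis i 1) = (\<Sum>j\<in>UNIV. transpose (matrix (transition c d p)) $ i $ j *\<^sub>R from_chart B d p (axis j 1))" for i
  proof -
    have "from_chart B c p (axis i 1) = from_chart B d p (transition c d p (axis i 1))"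
      using B.from_chart_transition[OF cd] by simp
    also have "\<dots> = (\<Sum>j\<in>UNIV. transition c d p (axis i 1) $ j *\<^sub>R from_chart B d p (axis j 1))"
      by (rule linear_vec_expand[OF B.linear_from_chart[OF cd(2,4)]])
    finally show ?thesis by (simp add: transpose_def matrix_def)
  qed
  then have "\<alpha> p (\<lambda>i. from_chart B c p (axis i 1)) = \<alpha> p (\<lambda>i. \<Sum>j\<in>UNIV. transpose (matrix (transition c d p)) $ i $ j *\<^sub>R from_chart B d p (axis j 1))"
    by simp
  also have "\<dots> = of_real (det (matrix (transition c d p))) * \<alpha> p (\<lambda>i. from_chart B d p (axis i 1))"
    using \<alpha> unfolding real_form_def by (simp only: det_transpose)
  finally show ?thesis using cd by (simp add: form_coeff_def B.chart_simps)
qed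

context
  fixes \<alpha> assumes \<alpha>: "real_form \<alpha>"
begin

lemma form_coeff_Re: "c \<in> B \<Longrightarrow> x \<in> cimg c \<Longrightarrow> form_coeff B c \<alpha> x = of_real (Re (form_coeff B c \<alpha> x))"
  using \<alpha> by (simp add: real_form_def complex_eq_iff)

lemma continuous_Re_coeff: "c \<in> B \<Longrightarrow> continuous_on (cimg c) (\<lambda>x. Re (form_coeff B c \<alpha> x))"
  using \<alpha> by (auto simp: real_form_def intro!: continuous_on_Re)

text \<open>Since the cut-off vanishes near the boundary of the chart, the integral over
  \<open>cimg c\<close> is one of a continuous real function over a compact set, as the change of
  variables needs.\<close>

lemma cint_compact:
  assumes c: "c \<in> B" and \<phi>: "continuous_on UNIV \<phi>" and P: "closed P" "supp \<phi> \<subseteq> P" "P \<subseteq> cdom c"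
  shows "compact (coord c ` P)" "coord c ` P \<subseteq> cimg c"
    and "set_integrable lborel (cimg c) (\<lambda>x. \<phi> (cinv c x) *\<^sub>R form_coeff B c \<alpha> x)"
    and "cint c \<alpha> \<phi> = of_real (LINT x:coord c ` P|lborel. \<phi> (cinv c x) * Re (form_coeff B c \<alpha> x))"
proof -
  let ?K = "coord c ` P"
  have "compact P" using closed_Int_compact[OF P(1) compact] by simp
  then show K: "compact ?K"
    by (rule compact_continuous_image[OF continuous_on_subset[OF continuous_coord[OF B.is_chart[OF c]] P(3)]])
  show Kc: "?K \<subseteq> cimg c" using P(3) B.chart_simps(3)[OF c] by auto
  have eq: "indicator (cimg c) x *\<^sub>R (\<phi> (cinv c x) *\<^sub>R form_coeff B c \<alpha> x) =
    indicator ?K x *\<^sub>R complex_of_real (\<phi> (cinv c x) * Re (form_coeff B c \<alpha> x))" for x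
  proof (cases "x \<in> cimg c")
    case True
    then have "cinv c x \<in> P \<Longrightarrow> x \<in> ?K" using B.chart_simps(2)[OF c True] by (metis image_eqI)
    then have "x \<notin> ?K \<Longrightarrow> \<phi> (cinv c x) = 0" using P(2) zero_outside_supp by blast
    then show ?thesis using True form_coeff_Re[OF c True]
      by (auto simp: indicator_def scaleR_conv_of_real of_real_mult)
  next
    case False
    then show ?thesis using Kc by (auto simp: indicator_def)
  qed
  have cont: "continuous_on ?K (\<lambda>x. \<phi> (cinv c x) * Re (form_coeff B c \<alpha> x))"
    by (rule continuous_on_subset[OF continuous_on_mult[OF continuous_cinv_compose[OF c \<phi>] continuous_Re_coeff[OF c]] Kc])
  then have "continuous_on ?K (\<lambda>x. complex_of_real (\<phi> (cinv c x) * Re (form_coeff B c \<alpha> x)))"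
    by (intro continuous_on_of_real)
  from set_integrable_continuous_compact(1)[OF K this]
  show "set_integrable lborel (cimg c) (\<lambda>x. \<phi> (cinv c x) *\<^sub>R form_coeff B c \<alpha> x)"
    unfolding set_integrable_def eq .
  have "cint c \<alpha> \<phi> = (LINT x:?K|lborel. complex_of_real (\<phi> (cinv c x) * Re (form_coeff B c \<alpha> x)))"
    unfolding cint_def set_lebesgue_integral_def eq ..
  then show "cint c \<alpha> \<phi> = of_real (LINT x:?K|lborel. \<phi> (cinv c x) * Re (form_coeff B c \<alpha> x))"
    by (simp only: set_integral_complex_of_real)
qed

text \<open>The coefficients of a top-degree form transform with the Jacobian determinant and the
  integral with its modulus; orientation makes the two equal.\<close>

lemma cint_change:
  assumes cd: "c \<in> B" "d \<in> B" and \<phi>: "continuous_on UNIV \<phi>" and supp: "supp \<phi> \<subseteq> cdom c \<inter> cdom d"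
  shows "cint c \<alpha> \<phi> = cint d \<alpha> \<phi>"
proof -
  let ?P = "supp \<phi>"
  have Pc: "?P \<subseteq> cdom c" and Pd: "?P \<subseteq> cdom d" using supp by auto
  note c = cint_compact[OF cd(1) \<phi> closed_closure subset_refl Pc]
  note d = cint_compact[OF cd(2) \<phi> closed_closure subset_refl Pd]
  let ?\<theta> = "coord d \<circ> cinv c" and ?K = "coord c ` ?P"
  have im: "?\<theta> ` ?K = coord d ` ?P"
    unfolding image_image by (rule image_cong) (use Pc in \<open>auto simp: B.chart_simps(1)[OF cd(1)]\<close>)
  have Ksub: "?K \<subseteq> coord c ` (cdom c \<inter> cdom d)" using Pc Pd by auto
  note s = B.smooth_transition[OF cd]
  have tr: "fd ?\<theta> (coord c p) = transition c d p" for p by (simp add: transition_def)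
  have det: "continuous_on ?K (\<lambda>x. det (matrix (fd ?\<theta> x)))"
  proof (rule continuous_on_subset[OF _ Ksub])
    have *: "continuous_on (coord c ` (cdom c \<inter> cdom d)) (\<lambda>x. fd ?\<theta> x (axis j 1) $ i)" for i j
      by (intro continuous_on_component smooth_on_continuous[OF smooth_on_fd[OF s]])
    have "det (matrix (fd ?\<theta> x)) = (\<Sum>q | q permutes UNIV. of_int (sign q) * (\<Prod>i\<in>UNIV. fd ?\<theta> x (axis (q i) 1) $ i))" for x
      by (simp add: det_def matrix_def)
    then show "continuous_on (coord c ` (cdom c \<inter> cdom d)) (\<lambda>x. det (matrix (fd ?\<theta> x)))"
      by (simp only:) (intro continuous_on_sum continuous_on_mult continuous_on_const continuous_on_prod *)
  qed
  have inj: "inj_on ?\<theta> ?K"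
  proof (rule inj_onI)
    fix x y assume xy: "x \<in> ?K" "y \<in> ?K" and eq: "?\<theta> x = ?\<theta> y"
    then obtain p q where pq: "p \<in> ?P" "q \<in> ?P" "x = coord c p" "y = coord c q" by blast
    then have in_c: "p \<in> cdom c" "q \<in> cdom c" and in_d: "p \<in> cdom d" "q \<in> cdom d" using Pc Pd by auto
    have "coord d p = coord d q"
      using eq unfolding pq(3,4) by (simp add: B.chart_simps(1)[OF cd(1)] in_c)
    from arg_cong[OF this, of "cinv d"] have "p = q"
      by (simp add: B.chart_simps(1)[OF cd(2)] in_d)
    then show "x = y" by (simp add: pq)
  qed
  have h: "continuous_on (?\<theta> ` ?K) (\<lambda>y. \<phi> (cinv d y) * Re (form_coeff B d \<alpha> y))"
    unfolding im
    by (rule continuous_on_subset[OF continuous_on_mult[OF continuous_cinv_compose[OF cd(2) \<phi>] continuous_Re_coeff[OF cd(2)]] d(2)])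
  have "(LINT y:coord d ` ?P|lborel. \<phi> (cinv d y) * Re (form_coeff B d \<alpha> y)) =
    (LINT x:?K|lborel. \<bar>det (matrix (fd ?\<theta> x))\<bar> * (\<phi> (cinv d (?\<theta> x)) * Re (form_coeff B d \<alpha> (?\<theta> x))))"
    using change_of_variables[OF c(1) _ inj det h] smooth_on_has_derivative[OF s] Ksub unfolding im by blast
  also have "\<dots> = (LINT x:?K|lborel. \<phi> (cinv c x) * Re (form_coeff B c \<alpha> x))"
    unfolding set_lebesgue_integral_def
  proof (rule Bochner_Integration.integral_cong[OF refl])
    fix x
    show "indicator ?K x *\<^sub>R (\<bar>det (matrix (fd ?\<theta> x))\<bar> * (\<phi> (cinv d (?\<theta> x)) * Re (form_coeff B d \<alpha> (?\<theta> x)))) =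
      indicator ?K x *\<^sub>R (\<phi> (cinv c x) * Re (form_coeff B c \<alpha> x))"
    proof (cases "x \<in> ?K")
      case True
      then obtain p where p: "p \<in> ?P" "x = coord c p" by blast
      then have pc: "p \<in> cdom c" "p \<in> cdom d" using Pc Pd by auto
      have "det (matrix (transition c d p)) > 0"
        using oriented cd pc by (auto simp: oriented_atlas_def)
      then show ?thesis
        using form_coeff_transition[OF \<alpha> cd pc] pc
        by (simp add: p(2) tr[unfolded o_def] B.chart_simps(1)[OF cd(1)] B.chart_simps(1)[OF cd(2)] tr)
    qed simp
  qed
  finally show ?thesis using c(4) d(4) by simp
qed

lemma cint_sum:
  assumes c: "c \<in> B" and I: "finite I" and \<phi>: "\<And>i. i \<in> I \<Longrightarrow> continuous_on UNIV (\<phi> i)" "\<And>i. i \<in> I \<Longrightarrow> supp (\<phi> i) \<subseteq> cdom c"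
  shows "cint c \<alpha> (\<lambda>p. \<Sum>i\<in>I. \<phi> i p) = (\<Sum>i\<in>I. cint c \<alpha> (\<phi> i))"
proof -
  have "integrable lborel (\<lambda>x. indicator (cimg c) x *\<^sub>R (\<phi> i (cinv c x) *\<^sub>R form_coeff B c \<alpha> x))" if "i \<in> I" for i
    using cint_compact(3)[OF c \<phi>(1)[OF that] closed_closure subset_refl \<phi>(2)[OF that]] by (simp add: set_integrable_def)
  then have "(\<Sum>i\<in>I. cint c \<alpha> (\<phi> i)) = (\<integral>x. (\<Sum>i\<in>I. indicator (cimg c) x *\<^sub>R (\<phi> i (cinv c x) *\<^sub>R form_coeff B c \<alpha> x)) \<partial>lborel)"
    unfolding cint_def set_lebesgue_integral_def by (subst Bochner_Integration.integral_sum) auto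
  also have "\<dots> = cint c \<alpha> (\<lambda>p. \<Sum>i\<in>I. \<phi> i p)"
    unfolding cint_def set_lebesgue_integral_def by (simp add: scaleR_sum_right scaleR_sum_left)
  finally show ?thesis ..
qed

lemma partition_simps:
  assumes "partition_of_unity B k c \<psi>" "i < k"
  shows "c i \<in> B" "smooth_fun B (\<psi> i)" "continuous_on UNIV (\<psi> i)" "\<psi> i p \<ge> 0" "supp (\<psi> i) \<subseteq> cdom (c i)"
  using assms B.smooth_fun_continuous[of "\<psi> i"] by (auto simp: partition_of_unity_def)

lemma partition_sum: "partition_of_unity B k c \<psi> \<Longrightarrow> (\<Sum>i<k. \<psi> i p) = 1"
  by (simp add: partition_of_unity_def)

lemma cint_partition:
  assumes pu: "partition_of_unity B k c \<psi>" and d: "d \<in> B" and \<phi>: "continuous_on UNIV \<phi>" "supp \<phi> \<subseteq> cdom d"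
  shows "cint d \<alpha> \<phi> = (\<Sum>i<k. cint (c i) \<alpha> (\<lambda>p. \<psi> i p * \<phi> p))"
proof -
  have "cint d \<alpha> \<phi> = cint d \<alpha> (\<lambda>p. \<Sum>i<k. \<psi> i p * \<phi> p)"
    by (simp add: sum_distrib_right[symmetric] partition_sum[OF pu])
  also have "\<dots> = (\<Sum>i<k. cint d \<alpha> (\<lambda>p. \<psi> i p * \<phi> p))"
  proof (rule cint_sum[OF d])
    fix i assume "i \<in> {..<k}"
    then show "continuous_on UNIV (\<lambda>p. \<psi> i p * \<phi> p)"
      using partition_simps(3)[OF pu] by (intro continuous_on_mult \<phi>(1)) simp
    show "supp (\<lambda>p. \<psi> i p * \<phi> p) \<subseteq> cdom d" by (rule subset_trans[OF supp_mult_subset(2) \<phi>(2)])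
  qed simp
  also have "\<dots> = (\<Sum>i<k. cint (c i) \<alpha> (\<lambda>p. \<psi> i p * \<phi> p))"
  proof (rule sum.cong[OF refl])
    fix i assume "i \<in> {..<k}"
    then have i: "i < k" by simp
    show "cint d \<alpha> (\<lambda>p. \<psi> i p * \<phi> p) = cint (c i) \<alpha> (\<lambda>p. \<psi> i p * \<phi> p)"
      using supp_mult_subset[of "\<psi> i" \<phi>] partition_simps(5)[OF pu i] \<phi>(2)
      by (intro cint_change d partition_simps(1)[OF pu i] continuous_on_mult partition_simps(3)[OF pu i] \<phi>(1)) blast
  qed
  finally show ?thesis .
qed

text \<open>Given two partitions of unity, both sums are refined by the products of their members;
  each product is supported in two charts and may be integrated in either.\<close>

lemma form_integral_eq:
  assumes pu: "partition_of_unity B k c \<psi>"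
  shows "form_integral B \<alpha> = (\<Sum>i<k. cint (c i) \<alpha> (\<psi> i))"
proof -
  have "(\<Sum>i<k. cint (c i) \<alpha> (\<psi> i)) = (\<Sum>i<l. cint (d i) \<alpha> (\<eta> i))"
    if pu': "partition_of_unity B l d \<eta>" for l d \<eta>
  proof -
    have "(\<Sum>i<k. cint (c i) \<alpha> (\<psi> i)) = (\<Sum>i<k. \<Sum>j<l. cint (d j) \<alpha> (\<lambda>p. \<eta> j p * \<psi> i p))"
      by (intro sum.cong refl cint_partition[OF pu']) (simp_all add: partition_simps[OF pu])
    also have "\<dots> = (\<Sum>j<l. \<Sum>i<k. cint (c i) \<alpha> (\<lambda>p. \<psi> i p * \<eta> j p))"
    proof (subst sum.swap, intro sum.cong refl)
      fix i j assume "j \<in> {..<l}" "i \<in> {..<k}"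
      then have ij: "j < l" "i < k" by auto
      have "cint (d j) \<alpha> (\<lambda>p. \<eta> j p * \<psi> i p) = cint (c i) \<alpha> (\<lambda>p. \<eta> j p * \<psi> i p)"
        using supp_mult_subset[of "\<eta> j" "\<psi> i"] partition_simps(5)[OF pu ij(2)] partition_simps(5)[OF pu' ij(1)]
        by (intro cint_change partition_simps(1)[OF pu ij(2)] partition_simps(1)[OF pu' ij(1)] continuous_on_mult
           partition_simps(3)[OF pu ij(2)] partition_simps(3)[OF pu' ij(1)]) blast
      then show "cint (d j) \<alpha> (\<lambda>p. \<eta> j p * \<psi> i p) = cint (c i) \<alpha> (\<lambda>p. \<psi> i p * \<eta> j p)" by (simp add: mult.commute)
    qed
    also have "\<dots> = (\<Sum>j<l. cint (d j) \<alpha> (\<eta> j))"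
      by (intro sum.cong refl cint_partition[OF pu, symmetric]) (simp_all add: partition_simps[OF pu'])
    finally show ?thesis .
  qed
  then show ?thesis
    unfolding form_integral_def cint_def[symmetric]
    by (intro the_equality allI impI) (use pu in blast)+
qed

end

lemma form_integral_smul:
  assumes \<alpha>: "real_form \<alpha>" and \<phi>: "continuous_on UNIV \<phi>" and pu: "partition_of_unity B k c \<psi>"
  shows "form_integral B (smul \<phi> \<alpha>) = (\<Sum>i<k. cint (c i) \<alpha> (\<lambda>p. \<psi> i p * \<phi> p))"
  unfolding form_integral_eq[OF real_form_smul[OF \<alpha> \<phi>] pu]
  by (simp add: cint_def form_coeff_smul scaleR_conv_of_real mult.assoc)

lemma form_integral_supported:
  assumes \<alpha>: "real_form \<alpha>" and \<phi>: "continuous_on UNIV \<phi>" and d: "d \<in> B" "supp \<phi> \<subseteq> cdom d"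
  shows "form_integral B (smul \<phi> \<alpha>) = cint d \<alpha> \<phi>"
proof -
  obtain k c \<psi> where pu: "partition_of_unity B k c \<psi>" using B.exists_partition_of_unity[OF compact] by blast
  show ?thesis
    unfolding form_integral_smul[OF \<alpha> \<phi> pu] by (rule cint_partition[OF \<alpha> pu d(1) \<phi> d(2), symmetric])
qed

lemma form_integral_smul_sum:
  assumes \<alpha>: "real_form \<alpha>" and I: "finite I" and \<phi>: "\<And>i. i \<in> I \<Longrightarrow> continuous_on UNIV (\<phi> i)"
  shows "form_integral B (smul (\<lambda>p. \<Sum>i\<in>I. \<phi> i p) \<alpha>) = (\<Sum>i\<in>I. form_integral B (smul (\<phi> i) \<alpha>))"
proof -
  obtain k c \<psi> where pu: "partition_of_unity B k c \<psi>" using B.exists_partition_of_unity[OF compact] by blast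
  have "cint (c j) \<alpha> (\<lambda>p. \<psi> j p * (\<Sum>i\<in>I. \<phi> i p)) = (\<Sum>i\<in>I. cint (c j) \<alpha> (\<lambda>p. \<psi> j p * \<phi> i p))" if "j < k" for j
    unfolding sum_distrib_left
    by (rule cint_sum[OF \<alpha> partition_simps(1)[OF \<alpha> pu that] I])
       (intro continuous_on_mult partition_simps(3)[OF \<alpha> pu that] \<phi>,
        assumption, rule subset_trans[OF supp_mult_subset(1) partition_simps(5)[OF \<alpha> pu that]])
  then have "form_integral B (smul (\<lambda>p. \<Sum>i\<in>I. \<phi> i p) \<alpha>) = (\<Sum>j<k. \<Sum>i\<in>I. cint (c j) \<alpha> (\<lambda>p. \<psi> j p * \<phi> i p))"
    by (subst form_integral_smul[OF \<alpha> continuous_on_sum[OF \<phi>] pu]) auto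
  also have "\<dots> = (\<Sum>i\<in>I. form_integral B (smul (\<phi> i) \<alpha>))"
    by (subst sum.swap) (simp add: form_integral_smul[OF \<alpha> \<phi> pu])
  finally show ?thesis .
qed

text \<open>The integrand is continuous and non-negative. If its integral were zero, so would be
  that over a small box around the point, and a continuous non-negative function with zero integral
  vanishes on a box.\<close>

lemma form_integral_pos:
  assumes \<alpha>: "real_form \<alpha>" and pos: "\<And>c x. c \<in> B \<Longrightarrow> x \<in> cimg c \<Longrightarrow> Re (form_coeff B c \<alpha> x) > 0"
    and \<phi>: "continuous_on UNIV \<phi>" "\<And>p. \<phi> p \<ge> 0" and d: "d \<in> B" "supp \<phi> \<subseteq> cdom d" and p: "\<phi> p > 0"
  shows "form_integral B (smul \<phi> \<alpha>) \<noteq> 0"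
proof
  assume 0: "form_integral B (smul \<phi> \<alpha>) = 0"
  let ?K = "coord d ` supp \<phi>"
  note K = cint_compact[OF \<alpha> d(1) \<phi>(1) closed_closure subset_refl d(2)]
  define u where "u x = \<phi> (cinv d x) * Re (form_coeff B d \<alpha> x)" for x
  have uc: "continuous_on (cimg d) u"
    unfolding u_def by (intro continuous_intros continuous_cinv_compose continuous_Re_coeff \<alpha> d \<phi>)
  have up: "u x \<ge> 0" if "x \<in> cimg d" for x
    unfolding u_def using pos[OF d(1) that] \<phi>(2) by simp
  have pd: "p \<in> cdom d" using p d(2) zero_outside_supp[of p \<phi>] by fastforce
  have z: "(LINT x:?K|lborel. u x) = 0"
    using 0 K(4) form_integral_supported[OF \<alpha> \<phi>(1) d] by (simp add: u_def)
  obtain e where e: "e > 0" "cball (coord d p) e \<subseteq> cimg d"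
    using open_contains_cball[THEN iffD1, OF B.chart_open(2)[OF d(1)]] B.chart_simps(3)[OF d(1) pd] by blast
  obtain a b where ab: "coord d p \<in> box a b" "cbox a b \<subseteq> cball (coord d p) e"
    using open_contains_cbox[OF open_ball, of "coord d p" "coord d p" e] e(1) by (metis ball_subset_cball centre_in_ball subset_trans)
  have cs: "cbox a b \<subseteq> cimg d" using ab(2) e(2) by blast
  have "integral (cbox a b) u \<le> 0"
  proof -
    have i1: "set_integrable lborel ?K u"
      by (rule set_integrable_continuous_compact(1)[OF K(1) continuous_on_subset[OF uc K(2)]])
    have i2: "set_integrable lborel (cbox a b) u"
      by (rule set_integrable_continuous_compact(1)[OF compact_cbox continuous_on_subset[OF uc cs]])
    have "(LINT x:cbox a b|lborel. u x) \<le> (LINT x:?K|lborel. u x)"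
      unfolding set_lebesgue_integral_def
    proof (rule integral_mono)
      fix x
      have "u x = 0" if "x \<in> cimg d" "x \<notin> ?K"
      proof -
        have "cinv d x \<notin> supp \<phi>" using that B.chart_simps(2)[OF d(1) that(1)] by (metis image_eqI)
        then have "\<phi> (cinv d x) = 0" by (rule zero_outside_supp)
        then show ?thesis by (simp add: u_def)
      qed
      then show "indicator (cbox a b) x *\<^sub>R u x \<le> indicator ?K x *\<^sub>R u x"
        using cs up K(2) by (auto simp: indicator_def subset_iff)
    qed (use i1 i2 in \<open>auto simp: set_integrable_def\<close>)
    then show ?thesis using z set_integrable_continuous_compact(3)[OF compact_cbox continuous_on_subset[OF uc cs]] by simp
  qed
  moreover have "integral (cbox a b) u \<ge> 0" using up cs by (intro integral_nonneg integrable_continuous continuous_on_subset[OF uc cs]) auto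
  ultimately have "(u has_integral 0) (cbox a b)"
    using integrable_integral[OF integrable_continuous[OF continuous_on_subset[OF uc cs]]] by simp
  then have "u (coord d p) = 0"
    using has_integral_0_cbox_imp_0[OF continuous_on_subset[OF uc cs] _ _ _ , of "coord d p"] up cs ab(1) box_subset_cbox by blast
  moreover have "u (coord d p) > 0"
    unfolding u_def using p pos[OF d(1) B.chart_simps(3)[OF d(1) pd]] pd by (simp add: B.chart_simps(1)[OF d(1)])
  ultimately show False by simp
qed

definition dfun :: "('l \<Rightarrow> real) \<Rightarrow> 'l \<Rightarrow> real^'n \<Rightarrow> real" where
  "dfun \<psi> p X = fd (\<psi> \<circ> cinv (chart_at B p)) (coord (chart_at B p) p) X"

lemma dfun_in_chart:
  assumes \<psi>: "smooth_fun B \<psi>" and c: "c \<in> B" "p \<in> cdom c"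
  shows "dfun \<psi> p X = fd (\<psi> \<circ> cinv c) (coord c p) (to_chart B c p X)"
proof -
  define c0 where "c0 = chart_at B p"
  have c0: "c0 \<in> B" "p \<in> cdom c0" using B.chart_at[of p] by (auto simp: c0_def)
  let ?S = "coord c0 ` (cdom c0 \<inter> cdom c)"
  have S: "open ?S" "coord c0 p \<in> ?S" using B.open_coord_image[OF c0(1) B.chart_open(1)[OF c(1)]] c c0 by auto
  have "fd (\<psi> \<circ> cinv c0) (coord c0 p) X = fd (\<lambda>x. (\<psi> \<circ> cinv c) ((coord c \<circ> cinv c0) x)) (coord c0 p) X"
    by (rule fun_cong[OF fd_cong[OF S]]) (auto simp: B.chart_simps(1)[OF c0(1)] B.chart_simps(1)[OF c(1)])
  also have "\<dots> = fd (\<psi> \<circ> cinv c) ((coord c \<circ> cinv c0) (coord c0 p)) (fd (coord c \<circ> cinv c0) (coord c0 p) X)"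
  proof (rule fd_compose(1)[OF _ B.smooth_transition[OF c0(1) c(1)] _ S(2)])
    show "smooth_on (cimg c) (\<psi> \<circ> cinv c)" using \<psi> c(1) by (simp add: smooth_fun_def)
    show "(coord c \<circ> cinv c0) (coord c0 p) \<in> cimg c"
      using B.chart_simps(3)[OF c] by (simp add: B.chart_simps(1)[OF c0])
  qed
  finally show ?thesis using c0 by (simp add: dfun_def c0_def[symmetric] to_chart_def transition_def B.chart_simps(1)[OF c0(1)])
qed

end

section \<open>The first variation of the J-volume\<close>

lemma leibniz_compact_support:
  fixes q :: "real \<times> 'a::euclidean_space \<Rightarrow> real"
  assumes \<epsilon>: "\<epsilon> > 0" and q: "smooth_on ({-\<epsilon><..<\<epsilon>} \<times> UNIV) q"
    and K: "compact K" and z: "\<And>t x. \<bar>t\<bar> < \<epsilon> \<Longrightarrow> x \<notin> K \<Longrightarrow> q (t, x) = 0"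
  shows "((\<lambda>t. \<integral>x. q (t, x) \<partial>lborel) has_vector_derivative (\<integral>x. fd q (0, x) (1, 0) \<partial>lborel)) (at 0)"
proof -
  obtain a b where ab: "K \<subseteq> cbox a (b::'a)"
    using bounded_subset_cbox_symmetric[OF compact_imp_bounded[OF K]] by metis
  \<comment> \<open>A closed interval inside the time domain of \<open>q\<close> with 0 in its
    interior: the Leibniz rule gives a derivative within \<open>U\<close>, which at 0 is an ordinary
    one.\<close>
  define U where "U = {- (\<epsilon>/2)..\<epsilon>/2}"
  have U: "t \<in> {-\<epsilon><..<\<epsilon>}" "\<bar>t\<bar> < \<epsilon>" if "t \<in> U" for t using that \<epsilon> by (auto simp: U_def)
  have cq: "continuous_on ({-\<epsilon><..<\<epsilon>} \<times> UNIV) q" by (rule smooth_on_continuous[OF q])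
  have ct: "continuous_on UNIV (\<lambda>x. q (t, x))" if "t \<in> U" for t
    by (rule continuous_on_compose2[OF cq]) (use U[OF that] in \<open>auto intro!: continuous_intros\<close>)
  have dq: "smooth_on ({-\<epsilon><..<\<epsilon>} \<times> UNIV) (\<lambda>p. fd q p (1, 0))" by (rule smooth_on_fd[OF q])
  have d0: "fd q (t, x) (1, 0) = 0" if "t \<in> U" "x \<notin> K" for t x
  proof -
    have op: "open ({-\<epsilon><..<\<epsilon>} \<times> - K)"
      by (intro open_Times open_Compl compact_imp_closed K) simp
    have "fd q (t, x) = fd (\<lambda>_. 0) (t, x)"
      by (rule fd_cong[OF op]) (use that U z in auto)
    then show ?thesis by simp
  qed
  have i1: "(\<integral>x. q (t, x) \<partial>lborel) = integral (cbox a b) (\<lambda>x. q (t, x))" if "t \<in> U" for t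
  proof -
    have "integrable lborel (\<lambda>x. q (t, x))"
      by (rule integrable_compact_support[OF ct[OF that] K]) (use z U[OF that] in auto)
    from integral_lborel[OF this] show ?thesis
      using integral_UNIV_eq_cbox[of a b "\<lambda>x. q (t, x)"] z[OF U(2)[OF that]] ab by auto
  qed
  have U0: "0 \<in> U" using \<epsilon> by (simp add: U_def)
  have cd: "continuous_on UNIV (\<lambda>x. fd q (0, x) (1, 0))"
    by (rule continuous_on_compose2[OF smooth_on_continuous[OF dq]]) (use \<epsilon> in \<open>auto intro!: continuous_intros\<close>)
  have i2: "(\<integral>x. fd q (0, x) (1, 0) \<partial>lborel) = integral (cbox a b) (\<lambda>x. fd q (0, x) (1, 0))"
  proof -
    have "integrable lborel (\<lambda>x. fd q (0, x) (1, 0))"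
      by (rule integrable_compact_support[OF cd K]) (rule d0[OF U0])
    from integral_lborel[OF this] show ?thesis
      using integral_UNIV_eq_cbox[of a b "\<lambda>x. fd q (0, x) (1, 0)"] d0[OF U0] ab by auto
  qed
  have d: "((\<lambda>t. integral (cbox a b) (\<lambda>x. q (t, x))) has_vector_derivative
      integral (cbox a b) (\<lambda>x. fd q (0, x) (1, 0))) (at 0 within U)"
  proof (rule leibniz_rule_vector_derivative)
    fix t x assume t: "t \<in> U" and "x \<in> cbox a b"
    have "(t, x) = (0, x) + t *\<^sub>R (1, 0)" by simp
    then have m: "(0, x) + t *\<^sub>R (1, 0) \<in> {-\<epsilon><..<\<epsilon>} \<times> UNIV" using U[OF t] by auto
    have "((\<lambda>s. q ((0, x) + s *\<^sub>R (1, 0))) has_real_derivative fd q ((0, x) + t *\<^sub>R (1, 0)) (1, 0)) (at t)"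
      by (rule has_real_derivative_along[OF q m])
    then show "((\<lambda>t. q (t, x)) has_vector_derivative fd q (t, x) (1, 0)) (at t within U)"
      by (simp add: has_real_derivative_iff_has_vector_derivative has_vector_derivative_at_within)
  next
    fix t assume "t \<in> U"
    then show "(\<lambda>x. q (t, x)) integrable_on cbox a b"
      by (intro integrable_continuous continuous_on_subset[OF ct]) auto
  next
    show "continuous_on (U \<times> cbox a b) (\<lambda>(t, x). fd q (t, x) (1, 0))"
      unfolding split_beta prod.collapse
      by (rule continuous_on_subset[OF smooth_on_continuous[OF dq]]) (use U in auto)
  qed (use \<epsilon> in \<open>auto simp: U_def\<close>)
  have "((\<lambda>t. \<integral>x. q (t, x) \<partial>lborel) has_vector_derivative (\<integral>x. fd q (0, x) (1, 0) \<partial>lborel)) (at 0 within U)"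
    unfolding i2 by (rule has_vector_derivative_transform[OF U0 i1 d])
  moreover have "at 0 within U = at 0" using \<epsilon> by (intro at_within_interior) (simp add: U_def)
  ultimately show ?thesis by simp
qed

section \<open>The J-volume density on a closed manifold and the divergence theorem\<close>

locale closed_jgeometry = jgeometry A g J B
  for A :: "('m::{t2_space, second_countable_topology}, 'e::euclidean_space) chart set"
    and g :: "'m \<Rightarrow> 'e \<Rightarrow> 'e \<Rightarrow> real" and J :: "'m \<Rightarrow> 'e \<Rightarrow> 'e"
    and B :: "('l::{t2_space, second_countable_topology}, real^'n::finite) chart set" +
  assumes compact_L: "compact (UNIV :: 'l set)"
begin

sublocale oriented_compact B
  using oriented compact_L by unfold_locales

abbreviation "vol f \<equiv> vol_J A g J B f"

text \<open>The density \<rho> as a function on a whole chart of L. In contrast to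
  \<open>dens_in\<close> no chart of M is involved, so local formulas for it glue.\<close>

definition rho :: "('l \<Rightarrow> 'm) \<Rightarrow> ('l, real^'n) chart \<Rightarrow> real^'n \<Rightarrow> real" where
  "rho f c x = Re (form_coeff B c (vol f) x)"

context
  fixes f assumes f: "totally_real_immersion A J B f"
begin

lemma vol_coeff:
  assumes "c \<in> B" "d \<in> A" "x \<in> rep_dom f c d"
  shows "form_coeff B c (vol f) x = of_real (dens_in d (rep f c d) (frm f c d) x)"
proof -
  obtain p where "p \<in> cdom c" "f p \<in> cdom d" "x = coord c p" using assms(3) by blast
  then show ?thesis
    using vol_J_in_chart[OF f assms(1,2), of p] by (simp add: form_coeff_def B.chart_simps(1)[OF assms(1)])
qed

lemma exists_target_chart:
  assumes "c \<in> B" "x \<in> cimg c"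
  obtains d where "d \<in> A" "x \<in> rep_dom f c d"
  using that[of "chart_at A (f (cinv c x))"] chart_at[of "f (cinv c x)"] rep_dom_mem[OF assms(1)] assms(2) by auto

lemma rho_eq:
  assumes "c \<in> B" "d \<in> A" "x \<in> rep_dom f c d"
  shows "rho f c x = dens_in d (rep f c d) (frm f c d) x"
  using vol_coeff[OF assms] by (simp add: rho_def)

lemma rho_pos:
  assumes c: "c \<in> B" and x: "x \<in> cimg c"
  shows "rho f c x > 0"
proof -
  obtain d where d: "d \<in> A" "x \<in> rep_dom f c d" by (rule exists_target_chart[OF c x])
  show ?thesis
    unfolding rho_eq[OF c d]
    by (rule kaehler_chart.density_pos[OF kaehler_chart[OF d(1)] smooth_rep[OF sfm[OF f] c d(1)] rep_image[OF sfm[OF f] c d(1)]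
      smooth_on_fd[OF smooth_rep[OF sfm[OF f] c d(1)]] bij_frame_in[OF f c d(1)] dim d(2)])
qed

lemma smooth_rho:
  assumes c: "c \<in> B"
  shows "smooth_on (cimg c) (rho f c)"
proof (rule smooth_on_local)
  fix x assume x: "x \<in> cimg c"
  obtain d where d: "d \<in> A" "x \<in> rep_dom f c d" by (rule exists_target_chart[OF c x])
  have "smooth_on (rep_dom f c d) (dens_in d (rep f c d) (frm f c d))"
    by (rule kaehler_chart.smooth_on_density[OF kaehler_chart[OF d(1)] smooth_rep[OF sfm[OF f] c d(1)] rep_image[OF sfm[OF f] c d(1)]
      smooth_on_fd[OF smooth_rep[OF sfm[OF f] c d(1)]] bij_frame_in[OF f c d(1)] dim])
  then have "smooth_on (rep_dom f c d) (rho f c)"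
    by (rule smooth_on_cong) (rule rho_eq[OF c d(1), symmetric])
  then show "\<exists>T. x \<in> T \<and> T \<subseteq> cimg c \<and> smooth_on T (rho f c)"
    using d rep_dom_mem[OF c] by (intro exI[of _ "rep_dom f c d"]) blast
qed

lemma form_coeff_vol: "c \<in> B \<Longrightarrow> x \<in> cimg c \<Longrightarrow> form_coeff B c (vol f) x = of_real (rho f c x)"
  by (rule exists_target_chart[of c x]) (auto simp: vol_coeff rho_eq)

lemma real_form_vol: "real_form (vol f)"
  unfolding real_form_def
proof (intro conjI allI ballI)
  fix c assume c: "c \<in> B"
  have "continuous_on (cimg c) (\<lambda>x. complex_of_real (rho f c x))"
    by (rule continuous_on_of_real[OF smooth_on_continuous[OF smooth_rho[OF c]]])
  then show "continuous_on (cimg c) (form_coeff B c (vol f))"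
    by (rule continuous_on_eq) (rule form_coeff_vol[OF c, symmetric])
  show "Im (form_coeff B c (vol f) x) = 0" if "x \<in> cimg c" for x by (simp add: form_coeff_vol[OF c that])
qed (rule vol_J_change[OF f])

lemma integral_eq_UNIV:
  assumes c: "c \<in> B" and \<phi>: "continuous_on UNIV \<phi>" "supp \<phi> \<subseteq> cdom c"
  shows "cint c (vol f) \<phi> = of_real (\<integral>x. (if x \<in> cimg c then \<phi> (cinv c x) * rho f c x else 0) \<partial>lborel)"
proof -
  have "cint c (vol f) \<phi> = (\<integral>x. complex_of_real (if x \<in> cimg c then \<phi> (cinv c x) * rho f c x else 0) \<partial>lborel)"
    unfolding cint_def set_lebesgue_integral_def
    by (rule Bochner_Integration.integral_cong)
       (auto simp: indicator_def form_coeff_vol[OF c] scaleR_conv_of_real)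
  then show ?thesis by simp
qed

lemma compact_supp_image:
  assumes c: "c \<in> B" and \<phi>: "supp \<phi> \<subseteq> cdom c"
  shows "compact (coord c ` supp \<phi>)" "coord c ` supp \<phi> \<subseteq> cimg c"
    and "\<And>x. x \<in> cimg c \<Longrightarrow> x \<notin> coord c ` supp \<phi> \<Longrightarrow> \<phi> (cinv c x) = 0"
proof -
  show "compact (coord c ` supp \<phi>)"
    using compact_continuous_image[OF continuous_on_subset[OF continuous_coord[OF B.is_chart[OF c]] \<phi>]]
      closed_Int_compact[OF closed_closure compact_L, of "{p. \<phi> p \<noteq> 0}"] by simp
  show "coord c ` supp \<phi> \<subseteq> cimg c" using \<phi> B.chart_simps(3)[OF c] by auto
  fix x assume x: "x \<in> cimg c" "x \<notin> coord c ` supp \<phi>"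
  then have "cinv c x \<notin> supp \<phi>" using B.chart_simps(2)[OF c x(1)] by (metis image_eqI)
  then show "\<phi> (cinv c x) = 0" by (rule zero_outside_supp)
qed

text \<open>By Leibniz the integrand is a divergence of \<open>\<psi>\<^sub>i \<rho> T\<close> minus \<open>T(\<psi>\<^sub>i) \<rho>\<close>, and \<open>\<Sum>\<^sub>i T(\<psi>\<^sub>i) = 0\<close>.\<close>

lemma divergence_theorem:
  assumes pu: "partition_of_unity B k c \<psi>" and T: "smooth_vector_field B T"
  defines "tc \<equiv> \<lambda>c x. to_chart B c (cinv c x) (T (cinv c x))"
  shows "(\<Sum>i<k. \<integral>x. (if x \<in> cimg (c i) then \<psi> i (cinv (c i) x) *
     (\<Sum>j\<in>UNIV. fd (\<lambda>x. rho f (c i) x * tc (c i) x $ j) x (axis j 1)) else 0) \<partial>lborel) = 0"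
proof -
  have tc: "smooth_on (cimg c) (tc c)" if "c \<in> B" for c
    using T that by (simp add: smooth_vector_field_def tc_def)
  define \<delta> where "\<delta> i p = dfun (\<psi> i) p (T p)" for i p
  have \<delta>c: "\<delta> i (cinv d x) = fd (\<psi> i \<circ> cinv d) x (tc d x)" if "i < k" "d \<in> B" "x \<in> cimg d" for i d x
    using dfun_in_chart[OF partition_simps(2)[OF real_form_vol pu that(1)] that(2) B.chart_simps(4)[OF that(2,3)]]
    by (simp add: \<delta>_def tc_def B.chart_simps(2)[OF that(2,3)])
  have sps: "smooth_on (cimg d) (\<psi> i \<circ> cinv d)" if "i < k" "d \<in> B" for i d
    using partition_simps(2)[OF real_form_vol pu that(1)] that(2) by (simp add: smooth_fun_def)
  have \<delta>s: "smooth_fun B (\<delta> i)" if i: "i < k" for i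
    unfolding smooth_fun_def
  proof
    fix d assume d: "d \<in> B"
    have "smooth_on (cimg d) (\<lambda>x. fd (\<psi> i \<circ> cinv d) x (tc d x))"
      by (rule smooth_on_linear_app[OF smooth_on_linear_fd[OF sps[OF i d]] smooth_on_fd[OF sps[OF i d]] tc[OF d]])
    then show "smooth_on (cimg d) (\<delta> i \<circ> cinv d)" by (rule smooth_on_cong) (simp add: \<delta>c[OF i d])
  qed
  have supp\<delta>: "supp (\<delta> i) \<subseteq> supp (\<psi> i)" if i: "i < k" for i
  proof (rule closure_minimal)
    show "{p. \<delta> i p \<noteq> 0} \<subseteq> supp (\<psi> i)"
    proof
      fix p assume ne: "p \<in> {p. \<delta> i p \<noteq> 0}"
      show "p \<in> supp (\<psi> i)"
      proof (rule ccontr)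
        assume n: "p \<notin> supp (\<psi> i)"
        let ?c = "chart_at B p"
        note cp = B.chart_at[of p]
        let ?S = "coord ?c ` (cdom ?c \<inter> - supp (\<psi> i))"
        have op: "open ?S" by (rule B.open_coord_image[OF cp(1)]) auto
        have "fd (\<psi> i \<circ> cinv ?c) (coord ?c p) = fd (\<lambda>_. 0) (coord ?c p)"
          by (rule fd_cong[OF op]) (use n cp zero_outside_supp in \<open>auto simp: B.chart_simps(1)[OF cp(1)]\<close>)
        then show False using ne by (simp add: \<delta>_def dfun_def)
      qed
    qed
  qed simp
  have main: "complex_of_real (\<integral>x. (if x \<in> cimg (c i) then \<psi> i (cinv (c i) x) *
     (\<Sum>j\<in>UNIV. fd (\<lambda>x. rho f (c i) x * tc (c i) x $ j) x (axis j 1)) else 0) \<partial>lborel)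
     = - form_integral B (smul (\<delta> i) (vol f))" if i: "i < k" for i
  proof -
    let ?c = "c i"
    have c: "?c \<in> B" by (rule partition_simps(1)[OF real_form_vol pu i])
    have sub: "supp (\<psi> i) \<subseteq> cdom ?c" by (rule partition_simps(5)[OF real_form_vol pu i])
    note K = compact_supp_image[OF c sub]
    let ?K = "coord ?c ` supp (\<psi> i)"
    define u where "u j x = (if x \<in> cimg ?c then (\<psi> i \<circ> cinv ?c) x * (rho f ?c x * tc ?c x $ j) else 0)" for j x
    have sj: "smooth_on (cimg ?c) (\<lambda>x. rho f ?c x * tc ?c x $ j)" for j
      by (intro smooth_on_mult smooth_rho c smooth_on_linear_compose[OF bounded_linear_vec_nth] tc)
    have su: "smooth_on UNIV (u j)" for j
      unfolding u_def using K
      by (intro smooth_on_extend_zero[OF smooth_on_mult[OF sps[OF i c] sj] compact_imp_closed[OF K(1)] K(2)]) auto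
    have u0: "u j x = 0" if "x \<notin> ?K" for j x using K(3) that by (auto simp: u_def)
    have int: "integrable lborel (\<lambda>x. fd (u j) x (axis j 1))" for j
      by (rule integrable_compact_support[OF smooth_on_continuous[OF smooth_on_fd[OF su]] K(1)])
         (rule fd_zero_outside[OF compact_imp_closed[OF K(1)] u0])
    have fdu: "fd (u j) x v = (\<psi> i \<circ> cinv ?c) x * fd (\<lambda>x. rho f ?c x * tc ?c x $ j) x v + fd (\<psi> i \<circ> cinv ?c) x v * (rho f ?c x * tc ?c x $ j)"
      if x: "x \<in> cimg ?c" for j x v
    proof -
      have "fd (u j) x = fd (\<lambda>x. (\<psi> i \<circ> cinv ?c) x * (rho f ?c x * tc ?c x $ j)) x"
        by (rule fd_cong[OF B.chart_open(2)[OF c] x]) (simp add: u_def)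
      then show ?thesis
        by (simp only: fd_eqI[OF has_derivative_mult[OF smooth_on_has_derivative[OF sps[OF i c] x] smooth_on_has_derivative[OF sj x]]])
    qed
    have pt: "(if x \<in> cimg ?c then \<psi> i (cinv ?c x) * (\<Sum>j\<in>UNIV. fd (\<lambda>x. rho f ?c x * tc ?c x $ j) x (axis j 1)) else 0)
       = (\<Sum>j\<in>UNIV. fd (u j) x (axis j 1)) - (if x \<in> cimg ?c then \<delta> i (cinv ?c x) * rho f ?c x else 0)" for x
    proof (cases "x \<in> cimg ?c")
      case True
      have "\<delta> i (cinv ?c x) = (\<Sum>j\<in>UNIV. tc ?c x $ j * fd (\<psi> i \<circ> cinv ?c) x (axis j 1))"
        using linear_vec_expand[OF smooth_on_linear_fd[OF sps[OF i c] True], of "tc ?c x"] by (simp add: \<delta>c[OF i c True])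
      then show ?thesis
        using True by (simp only: fdu if_True) (simp add: sum.distrib sum_distrib_left sum_distrib_right mult_ac)
    next
      case False
      then have "x \<notin> ?K" using K(2) by blast
      then show ?thesis using False by (simp add: fd_zero_outside[OF compact_imp_closed[OF K(1)] u0])
    qed
    have c\<delta>: "continuous_on UNIV (\<delta> i)" by (rule B.smooth_fun_continuous[OF \<delta>s[OF i]])
    have sub\<delta>: "supp (\<delta> i) \<subseteq> cdom ?c" using supp\<delta>[OF i] sub by blast
    have int\<delta>: "integrable lborel (\<lambda>x. if x \<in> cimg ?c then \<delta> i (cinv ?c x) * rho f ?c x else 0)"
    proof -
      have s\<delta>: "smooth_on (cimg ?c) (\<delta> i \<circ> cinv ?c)" using \<delta>s[OF i] c by (simp add: smooth_fun_def)
      have z\<delta>: "(\<delta> i \<circ> cinv ?c) x * rho f ?c x = 0" if "x \<in> cimg ?c" "x \<notin> coord ?c ` supp (\<delta> i)" for x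
        using compact_supp_image(3)[OF c sub\<delta> that] by simp
      have "smooth_on UNIV (\<lambda>x. if x \<in> cimg ?c then (\<delta> i \<circ> cinv ?c) x * rho f ?c x else 0)"
        by (rule smooth_on_extend_zero[OF smooth_on_mult[OF s\<delta> smooth_rho[OF c]] compact_imp_closed[OF compact_supp_image(1)[OF c sub\<delta>]]
           compact_supp_image(2)[OF c sub\<delta>] z\<delta>])
      then have "continuous_on UNIV (\<lambda>x. if x \<in> cimg ?c then \<delta> i (cinv ?c x) * rho f ?c x else 0)"
        by (rule smooth_on_continuous[THEN continuous_on_eq]) simp
      then show ?thesis
        by (rule integrable_compact_support[OF _ compact_supp_image(1)[OF c sub\<delta>]]) (use compact_supp_image(3)[OF c sub\<delta>] in auto)
    qed
    have "(\<integral>x. (if x \<in> cimg ?c then \<psi> i (cinv ?c x) * (\<Sum>j\<in>UNIV. fd (\<lambda>x. rho f ?c x * tc ?c x $ j) x (axis j 1)) else 0) \<partial>lborel)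
      = (\<Sum>j\<in>UNIV. \<integral>x. fd (u j) x (axis j 1) \<partial>lborel) - (\<integral>x. (if x \<in> cimg ?c then \<delta> i (cinv ?c x) * rho f ?c x else 0) \<partial>lborel)"
      unfolding pt using int int\<delta> by (subst Bochner_Integration.integral_diff) (auto simp: Bochner_Integration.integral_sum)
    also have "(\<Sum>j\<in>UNIV. \<integral>x. fd (u j) x (axis j 1) \<partial>lborel) = 0"
      by (intro sum.neutral ballI integral_directional_derivative[OF su K(1) u0])
    finally show ?thesis
      using integral_eq_UNIV[OF c c\<delta> sub\<delta>] form_integral_supported[OF real_form_vol c\<delta> c sub\<delta>] by simp
  qed
  have "(\<Sum>i<k. \<delta> i p) = 0" for p
  proof -
    let ?c = "chart_at B p"
    note cp = B.chart_at[of p]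
    have x: "coord ?c p \<in> cimg ?c" by (rule B.chart_simps(3)[OF cp])
    have "((\<lambda>x. \<Sum>i<k. (\<psi> i \<circ> cinv ?c) x) has_derivative (\<lambda>v. \<Sum>i<k. fd (\<psi> i \<circ> cinv ?c) (coord ?c p) v)) (at (coord ?c p))"
      by (intro has_derivative_sum smooth_on_has_derivative[OF sps[OF _ cp(1)] x]) simp
    moreover have e: "(\<lambda>x. \<Sum>i<k. (\<psi> i \<circ> cinv ?c) x) = (\<lambda>_. 1)"
      using partition_sum[OF real_form_vol pu] by (intro ext) simp
    ultimately have "((\<lambda>x. 1) has_derivative (\<lambda>v. \<Sum>i<k. fd (\<psi> i \<circ> cinv ?c) (coord ?c p) v)) (at (coord ?c p))"
      by (simp only: e)
    then have "(\<lambda>v. \<Sum>i<k. fd (\<psi> i \<circ> cinv ?c) (coord ?c p) v) = (\<lambda>v. 0)"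
      by (rule has_derivative_unique[OF _ has_derivative_const])
    from fun_cong[OF this, of "T p"] show ?thesis by (simp add: \<delta>_def dfun_def)
  qed
  then have z: "form_integral B (smul (\<lambda>p. \<Sum>i<k. \<delta> i p) (vol f)) = 0"
    using form_integral_smul[OF real_form_vol continuous_on_const[of UNIV 0] pu] by (simp add: cint_def set_lebesgue_integral_def)
  have "complex_of_real (\<Sum>i<k. \<integral>x. (if x \<in> cimg (c i) then \<psi> i (cinv (c i) x) *
     (\<Sum>j\<in>UNIV. fd (\<lambda>x. rho f (c i) x * tc (c i) x $ j) x (axis j 1)) else 0) \<partial>lborel)
     = - (\<Sum>i<k. form_integral B (smul (\<delta> i) (vol f)))"
    unfolding of_real_sum sum_negf[symmetric] by (intro sum.cong refl main) simp
  also have "\<dots> = - form_integral B (smul (\<lambda>p. \<Sum>i<k. \<delta> i p) (vol f))"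
    by (subst form_integral_smul_sum[OF real_form_vol]) (auto intro: B.smooth_fun_continuous \<delta>s)
  finally show ?thesis unfolding z by (simp only: neg_equal_0_iff_equal of_real_eq_0_iff minus_zero)
qed

end

end

section \<open>Variations as maps of space-time\<close>

lemma fd_slice:
  assumes "smooth_on S q" "(t, x) \<in> S"
  shows "fd (\<lambda>x. q (t, x)) x v = fd q (t, x) (0, v)"
proof -
  have "((\<lambda>x. (t, x)) has_derivative (\<lambda>v. (0, v))) (at x)" by (auto intro!: derivative_eq_intros)
  from has_derivative_compose[OF this smooth_on_has_derivative[OF assms]]
  have "fd (\<lambda>x. q (t, x)) x = (\<lambda>v. fd q (t, x) (0, v))" by (rule fd_eqI)
  then show ?thesis by simp
qed

lemma smooth_on_slice:
  fixes q :: "'a::euclidean_space \<times> 'b::euclidean_space \<Rightarrow> 'c::real_normed_vector"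
  assumes "smooth_on S q" "open T" "\<And>x. x \<in> T \<Longrightarrow> (t, x) \<in> S"
  shows "smooth_on T (\<lambda>x. q (t, x))"
  by (rule smooth_on_compose[OF assms(1) smooth_on_Pair[OF smooth_on_const smooth_on_id]]) (use assms in auto)

context closed_jgeometry
begin

context
  fixes f assumes f: "totally_real_immersion A J B f"
begin

lemma linear_maslov_form: "linear (maslov_form A g J B f p)"
proof -
  define c where "c = chart_at B p"
  define d where "d = chart_at A (f p)"
  note at = at_charts[OF f c_def d_def]
  interpret K: kaehler_chart "cimg d" "metric_in A g d" "acs_in A J d" "christoffel A g d" by (rule kaehler_chart[OF at(2)])
  note l = K.linear_conn_trace[OF smooth_rep[OF sfm[OF f] at(1,2)] rep_image[OF sfm[OF f] at(1,2)]
    smooth_on_fd[OF smooth_rep[OF sfm[OF f] at(1,2)]] bij_frame_in[OF f at(1,2)] dim at(5)]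
  show ?thesis
    by (rule linearI)
       (simp_all add: maslov_form_at[OF f c_def d_def] K.maslov_conn_trace linear_add[OF l] linear_cmul[OF l] del: comp_apply)
qed

lemma smooth_maslov:
  assumes c: "c \<in> B"
  shows "smooth_on (cimg c) (\<lambda>x. maslov_form A g J B f (cinv c x) (from_chart B c (cinv c x) X))"
proof (rule smooth_on_local)
  fix x assume x: "x \<in> cimg c"
  obtain d where d: "d \<in> A" "x \<in> rep_dom f c d" by (rule exists_target_chart[OF f c x])
  interpret K: kaehler_chart "cimg d" "metric_in A g d" "acs_in A J d" "christoffel A g d" by (rule kaehler_chart[OF d(1)])
  have "smooth_on (rep_dom f c d) (conn_in d (rep f c d) (frm f c d) X)"
    by (rule K.smooth_on_conn_trace[OF smooth_rep[OF sfm[OF f] c d(1)] rep_image[OF sfm[OF f] c d(1)]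
    smooth_on_fd[OF smooth_rep[OF sfm[OF f] c d(1)]] bij_frame_in[OF f c d(1)] dim])
  then have "smooth_on (rep_dom f c d) (\<lambda>x. - Im (conn_in d (rep f c d) (frm f c d) X x))"
    by (intro smooth_on_minus smooth_on_linear_compose[OF bounded_linear_Im])
  then have "smooth_on (rep_dom f c d) (\<lambda>x. maslov_form A g J B f (cinv c x) (from_chart B c (cinv c x) X))"
    by (rule smooth_on_cong) (simp only: maslov_in_eq_form[OF f c d(1), symmetric] K.maslov_conn_trace)
  then show "\<exists>T. x \<in> T \<and> T \<subseteq> cimg c \<and> smooth_on T (\<lambda>x. maslov_form A g J B f (cinv c x) (from_chart B c (cinv c x) X))"
    using d rep_dom_mem[OF c] by (intro exI[of _ "rep_dom f c d"]) blast
qed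

end

lemma smooth_one_form_app:
  assumes l: "\<And>p. linear (\<eta> p)" and s: "\<And>c X. c \<in> B \<Longrightarrow> smooth_on (cimg c) (\<lambda>x. \<eta> (cinv c x) (from_chart B c (cinv c x) X))"
    and Y: "smooth_vector_field B Y" and c: "c \<in> B"
  shows "smooth_on (cimg c) (\<lambda>x. \<eta> (cinv c x) (Y (cinv c x)) :: real)"
proof -
  have "smooth_on (cimg c) (\<lambda>x. \<eta> (cinv c x) (from_chart B c (cinv c x) (to_chart B c (cinv c x) (Y (cinv c x)))))"
  proof (rule smooth_on_linear_app[OF _ s[OF c]])
    show "linear (\<lambda>X. \<eta> (cinv c x) (from_chart B c (cinv c x) X))" if "x \<in> cimg c" for x
      using linear_compose[OF B.linear_from_chart[OF c B.chart_simps(4)[OF c that]] l] by (simp add: o_def)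
  qed (use Y c in \<open>simp add: smooth_vector_field_def\<close>)
  then show ?thesis
    by (rule smooth_on_cong) (simp add: B.from_chart_to_chart[OF c B.chart_simps(4)[OF c]])
qed

context
  fixes \<iota> \<epsilon> F assumes var: "variation A J B \<iota> \<epsilon> F"
begin

lemma variation_pos: "\<epsilon> > 0" and variation_0: "F 0 = \<iota>"
  and variation_tri: "\<bar>t\<bar> < \<epsilon> \<Longrightarrow> totally_real_immersion A J B (F t)"
  using var by (simp_all add: variation_def)

lemma base_tri: "totally_real_immersion A J B \<iota>"
  using variation_tri[of 0] variation_pos variation_0 by simp

text \<open>The set of pairs (t, x) for which the charts \<open>c\<close> and \<open>d\<close>
  describe \<open>F\<close>. There \<open>vrep\<close> is a single map of space and time, to which
  the calculus of frames along maps applies.\<close>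

definition vdom :: "('l, real^'n) chart \<Rightarrow> ('m, 'e) chart \<Rightarrow> (real \<times> (real^'n)) set" where
  "vdom c d = {p. \<bar>fst p\<bar> < \<epsilon> \<and> snd p \<in> cimg c \<and> F (fst p) (cinv c (snd p)) \<in> cdom d}"

definition vrep :: "('l, real^'n) chart \<Rightarrow> ('m, 'e) chart \<Rightarrow> real \<times> (real^'n) \<Rightarrow> 'e" where
  "vrep c d p = coord d (F (fst p) (cinv c (snd p)))"

definition vfrm :: "('l, real^'n) chart \<Rightarrow> ('m, 'e) chart \<Rightarrow> 'n \<Rightarrow> real \<times> (real^'n) \<Rightarrow> 'e" where
  "vfrm c d i p = fd (vrep c d) p (0, axis i 1)"

definition vfield :: "('l, real^'n) chart \<Rightarrow> ('m, 'e) chart \<Rightarrow> real \<times> (real^'n) \<Rightarrow> 'e" where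
  "vfield c d p = fd (vrep c d) p (1, 0)"

lemma vrep_slice: "(\<lambda>x. vrep c d (t, x)) = rep (F t) c d"
  by (simp add: vrep_def fun_eq_iff)

context
  fixes c d assumes cd: "c \<in> B" "d \<in> A"
begin

lemma smooth_vrep: "smooth_on (vdom c d) (vrep c d)"
proof -
  have "vdom c d = {(t, x). \<bar>t\<bar> < \<epsilon> \<and> x \<in> cimg c \<and> F t (cinv c x) \<in> cdom d}"
    by (auto simp: vdom_def)
  moreover have "vrep c d = (\<lambda>(t, x). coord d (F t (cinv c x)))" by (auto simp: vrep_def)
  ultimately show ?thesis using var cd by (simp add: variation_def)
qed

lemma vrep_image: "vrep c d ` vdom c d \<subseteq> cimg d"
  using chart_simps(3)[OF cd(2)] by (auto simp: vrep_def vdom_def)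

lemma vdom_mem: "(t, x) \<in> vdom c d \<longleftrightarrow> \<bar>t\<bar> < \<epsilon> \<and> x \<in> rep_dom (F t) c d"
  by (auto simp: vdom_def rep_dom_mem[OF cd(1)])

lemma vfrm_eq: "(t, x) \<in> vdom c d \<Longrightarrow> vfrm c d i (t, x) = frm (F t) c d i x"
  unfolding vfrm_def by (rule fd_slice[OF smooth_vrep, symmetric, unfolded vrep_slice])

lemma vfrm_bij: "p \<in> vdom c d \<Longrightarrow> bij (frame_map (acs_in A J d (vrep c d p)) (\<lambda>i. vfrm c d i p))"
proof -
  assume p: "p \<in> vdom c d"
  obtain t x where tx: "p = (t, x)" by (cases p)
  have x: "\<bar>t\<bar> < \<epsilon>" "x \<in> rep_dom (F t) c d" using p by (simp_all add: tx vdom_mem)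
  have "vrep c d p = rep (F t) c d x" by (simp add: tx vrep_def)
  then show ?thesis
    using bij_frame_in[OF variation_tri[OF x(1)] cd x(2)] vfrm_eq[OF p[unfolded tx]] by (simp add: tx)
qed

lemma smooth_vfrm: "smooth_on (vdom c d) (vfrm c d i)"
  unfolding vfrm_def[abs_def] by (rule smooth_on_fd[OF smooth_vrep])

lemma smooth_vfield: "smooth_on (vdom c d) (vfield c d)"
  unfolding vfield_def[abs_def] by (rule smooth_on_fd[OF smooth_vrep])

lemmas vctx = smooth_vrep vrep_image smooth_vfrm vfrm_bij dim

lemma rho_variation:
  assumes "(t, x) \<in> vdom c d"
  shows "rho (F t) c x = dens_in d (vrep c d) (vfrm c d) (t, x)"
proof -
  interpret K: kaehler_chart "cimg d" "metric_in A g d" "acs_in A J d" "christoffel A g d" by (rule kaehler_chart[OF cd(2)])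
  have x: "\<bar>t\<bar> < \<epsilon>" "x \<in> rep_dom (F t) c d" using assms by (simp_all add: vdom_mem)
  have "vrep c d (t, x) = rep (F t) c d x" by (simp add: vrep_def)
  then show ?thesis
    unfolding rho_eq[OF variation_tri[OF x(1)] cd x(2)]
    by (simp only: K.J_density_def K.gram_matrix_def vfrm_eq[OF assms])
qed

text \<open>\<open>variation_field\<close> is measured in the chart chosen at
  \<open>\<iota> p\<close>; the chain rule through the transition map carries it to the fixed chart
  \<open>d\<close>.\<close>

lemma vfield_0:
  assumes x: "(0, x) \<in> vdom c d"
  shows "vfield c d (0, x) = to_chart A d (\<iota> (cinv c x)) (variation_field A F (cinv c x))"
proof -
  define p where "p = cinv c x"
  define d0 where "d0 = chart_at A (\<iota> p)"
  have d0: "d0 \<in> A" "\<iota> p \<in> cdom d0" using chart_at[of "\<iota> p"] by (auto simp: d0_def)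
  have xd: "x \<in> cimg c" "\<iota> p \<in> cdom d" using x variation_0 by (auto simp: vdom_def p_def)
  have x0: "(0, x) \<in> vdom c d0" using x d0 variation_0 by (simp add: vdom_def p_def)
  have sm0: "smooth_on (vdom c d0) (vrep c d0)"
  proof -
    have "vdom c d0 = {(t, x). \<bar>t\<bar> < \<epsilon> \<and> x \<in> cimg c \<and> F t (cinv c x) \<in> cdom d0}"
      by (auto simp: vdom_def)
    moreover have "vrep c d0 = (\<lambda>(t, x). coord d0 (F t (cinv c x)))" by (auto simp: vrep_def)
    ultimately show ?thesis using var cd d0 by (simp add: variation_def)
  qed
  have "((\<lambda>t. (t, x)) has_derivative (\<lambda>s. (s, 0))) (at 0)" by (auto intro!: derivative_eq_intros)
  from has_derivative_compose[OF this smooth_on_has_derivative[OF sm0 x0]]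
  have "((\<lambda>t. vrep c d0 (t, x)) has_derivative (\<lambda>s. fd (vrep c d0) (0, x) (s, 0))) (at 0)" .
  moreover have "fd (vrep c d0) (0, x) (s, 0) = s *\<^sub>R vfield c d0 (0, x)" for s
    using linear_cmul[OF smooth_on_linear_fd[OF sm0 x0], of s "(1, 0)"] by (simp add: vfield_def)
  ultimately have "((\<lambda>t. vrep c d0 (t, x)) has_vector_derivative vfield c d0 (0, x)) (at 0)"
    by (simp add: has_vector_derivative_def)
  then have vf: "variation_field A F p = vfield c d0 (0, x)"
    unfolding variation_field_def variation_0 d0_def[symmetric]
    by (intro vector_derivative_at) (simp add: vrep_def p_def)
  have S: "open (vdom c d0 \<inter> vdom c d)" "(0, x) \<in> vdom c d0 \<inter> vdom c d"
    using smooth_on_open[OF sm0] smooth_on_open[OF smooth_vrep] x x0 by auto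
  have "fd (vrep c d) (0, x) (1, 0) = fd (\<lambda>q. (coord d \<circ> cinv d0) (vrep c d0 q)) (0, x) (1, 0)"
    by (rule fun_cong[OF fd_cong[OF S]]) (simp add: vrep_def vdom_def chart_simps(1)[OF d0(1)])
  also have "\<dots> = fd (coord d \<circ> cinv d0) (vrep c d0 (0, x)) (fd (vrep c d0) (0, x) (1, 0))"
    by (rule fd_compose(1)[OF smooth_transition[OF d0(1) cd(2)] sm0 _ x0])
       (use d0 xd in \<open>auto simp: vrep_def variation_0 p_def\<close>)
  also have "vrep c d0 (0, x) = coord d0 (\<iota> p)" by (simp add: vrep_def variation_0 p_def)
  finally show ?thesis
    by (simp add: vfield_def vf p_def[symmetric] to_chart_def transition_def d0_def[symmetric] vf del: comp_apply)
qed

context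
  fixes T Y
  assumes dec: "\<And>p. variation_field A F p = tm \<iota> p (T p) + J (\<iota> p) (tm \<iota> p (Y p))"
begin

lemma vcoef_0:
  assumes x: "(0, x) \<in> vdom c d"
  shows "coef_in d (vrep c d) (vfrm c d) (vfield c d) (0, x) =
    complex_vec (to_chart B c (cinv c x) (T (cinv c x))) (to_chart B c (cinv c x) (Y (cinv c x)))"
proof -
  interpret K: kaehler_chart "cimg d" "metric_in A g d" "acs_in A J d" "christoffel A g d" by (rule kaehler_chart[OF cd(2)])
  define p where "p = cinv c x"
  have xr: "x \<in> rep_dom \<iota> c d" using x variation_0 by (simp add: vdom_mem)
  have xc: "x \<in> cimg c" and pd: "\<iota> p \<in> cdom d" using xr by (simp_all add: rep_dom_mem[OF cd(1)] p_def)
  have pc: "p \<in> cdom c" "coord c p = x" using B.chart_simps(2,4)[OF cd(1) xc] by (simp_all add: p_def)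
  have r: "vrep c d (0, x) = rep \<iota> c d x" by (simp add: vrep_def variation_0)
  define L where "L = fd (rep \<iota> c d) x"
  have L: "linear L" unfolding L_def by (rule smooth_on_linear_fd[OF smooth_rep[OF sfm[OF base_tri] cd] xr])
  have e: "vfrm c d i (0, x) = L (axis i 1)" for i using vfrm_eq[OF x] variation_0 by (simp add: L_def)
  have Jx: "vrep c d (0, x) \<in> cimg d" using vrep_image x by blast
  note lt = linear_to_chart[OF cd(2) pd]
  have tl: "to_chart A d (\<iota> p) (tm \<iota> p v) = L (to_chart B c p v)" for v
    using to_chart_tangent_map[OF sfm[OF base_tri] cd pc(1) pd] by (simp add: L_def pc)
  have "vfield c d (0, x) = L (to_chart B c p (T p)) + acs_in A J d (vrep c d (0, x)) (L (to_chart B c p (Y p)))"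
    unfolding vfield_0[OF x] p_def[symmetric] dec linear_add[OF lt] tl r
    using acs_rep[of c d p \<iota> "tm \<iota> p (Y p)", OF cd pc(1) pd] by (simp only: pc tl)
  from inv_frame_map_eqI[OF L K.J_linear[OF Jx] _ this] show ?thesis
    using vfrm_bij[OF x] by (simp add: K.frame_coef_def e p_def)
qed

lemma vconn_0:
  assumes x: "(0, x) \<in> vdom c d"
  shows "conn_in d (vrep c d) (vfrm c d) (0, v) (0, x) = conn_in d (rep \<iota> c d) (frm \<iota> c d) v x"
proof -
  interpret K: kaehler_chart "cimg d" "metric_in A g d" "acs_in A J d" "christoffel A g d" by (rule kaehler_chart[OF cd(2)])
  have xr: "x \<in> rep_dom \<iota> c d" using x variation_0 by (simp add: vdom_mem)
  have r: "vrep c d (0, x) = rep \<iota> c d x" by (simp add: vrep_def variation_0)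
  have e: "vfrm c d i (0, y) = frm \<iota> c d i y" if "y \<in> rep_dom \<iota> c d" for i y
    using vfrm_eq[of 0 y i] that variation_0 variation_pos by (simp add: vdom_mem)
  have 1: "fd (vfrm c d i) (0, x) (0, v) = fd (frm \<iota> c d i) x v" for i
    unfolding fd_slice[OF smooth_vfrm x, symmetric]
    by (rule fun_cong[OF fd_cong[OF open_rep_dom[OF sfm[OF base_tri] cd] xr]]) (rule e)
  have 2: "fd (vrep c d) (0, x) (0, v) = fd (rep \<iota> c d) x v"
    unfolding fd_slice[OF smooth_vrep x, symmetric] vrep_slice variation_0 ..
  show ?thesis
    unfolding K.connection_trace_def K.connection_coef_def K.frame_coef_def K.cov_def 1 2 r e[OF xr] ..
qed

text \<open>\<open>first_variation_density\<close> at time 0. There the complex coordinates of the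
  velocity are T + i Y, so only \<open>T\<close> enters the divergence, and Im \<theta> = - \<xi>
  turns the other term into \<xi>(Y).\<close>

lemma fd_rho_variation_local:
  assumes x: "(0, x) \<in> vdom c d"
  shows "fd (\<lambda>p. rho (F (fst p)) c (snd p)) (0, x) (1, 0) =
    (\<Sum>j\<in>UNIV. fd (\<lambda>x. rho \<iota> c x * to_chart B c (cinv c x) (T (cinv c x)) $ j) x (axis j 1))
    + rho \<iota> c x * maslov_form A g J B \<iota> (cinv c x) (Y (cinv c x))"
proof -
  interpret K: kaehler_chart "cimg d" "metric_in A g d" "acs_in A J d" "christoffel A g d" by (rule kaehler_chart[OF cd(2)])
  note o = smooth_on_open[OF smooth_vrep]
  have xr: "x \<in> rep_dom \<iota> c d" using x variation_0 by (simp add: vdom_mem)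
  have xc: "x \<in> cimg c" and pd: "\<iota> (cinv c x) \<in> cdom d" using xr by (simp_all add: rep_dom_mem[OF cd(1)])
  note pc = B.chart_simps(4)[OF cd(1) xc] and cx = B.chart_simps(2)[OF cd(1) xc]
  have m0: "(0, y) \<in> vdom c d \<longleftrightarrow> y \<in> rep_dom \<iota> c d" for y using variation_0 variation_pos by (simp add: vdom_mem)
  let ?\<rho> = "dens_in d (vrep c d) (vfrm c d)" and ?z = "coef_in d (vrep c d) (vfrm c d) (vfield c d)"
  let ?t = "\<lambda>T x. to_chart B c (cinv c x) (T (cinv c x))"
  have s\<rho>: "smooth_on (vdom c d) ?\<rho>" by (rule K.smooth_on_density[OF vctx])
  have sz: "smooth_on (vdom c d) ?z" by (rule K.smooth_on_coef[OF vctx smooth_vfield])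
  have A1: "fd (\<lambda>p. rho (F (fst p)) c (snd p)) (0, x) (1, 0) = fd ?\<rho> (0, x) (1, 0)"
  proof (rule fun_cong[OF fd_cong[OF o x]])
    fix p assume "p \<in> vdom c d"
    then show "rho (F (fst p)) c (snd p) = ?\<rho> p" using rho_variation[of "fst p" "snd p"] by simp
  qed
  have A2: "fd ?\<rho> (0, x) (1, 0) = (\<Sum>j\<in>UNIV. fd (\<lambda>p. ?\<rho> p * Re (?z p $ j)) (0, x) (0, axis j 1))
    - ?\<rho> (0, x) * (\<Sum>j\<in>UNIV. Im (?z (0, x) $ j) * Im (conn_in d (vrep c d) (vfrm c d) (0, axis j 1) (0, x)))"
    unfolding vfrm_def[abs_def] vfield_def[abs_def]
    by (rule K.first_variation_density[OF smooth_vrep vrep_image vfrm_bij[unfolded vfrm_def] dim x])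
  have A3: "fd (\<lambda>p. ?\<rho> p * Re (?z p $ j)) (0, x) (0, axis j 1) = fd (\<lambda>x. rho \<iota> c x * ?t T x $ j) x (axis j 1)" for j
  proof -
    have sj: "smooth_on (vdom c d) (\<lambda>p. ?\<rho> p * Re (?z p $ j))"
      by (intro smooth_on_mult s\<rho> smooth_on_linear_compose[OF bounded_linear_Re] smooth_on_linear_compose[OF bounded_linear_vec_nth] sz)
    show ?thesis
      unfolding fd_slice[OF sj x, symmetric]
    proof (rule fun_cong[OF fd_cong[OF open_rep_dom[OF sfm[OF base_tri] cd] xr]])
      fix y assume "y \<in> rep_dom \<iota> c d"
      then have y: "(0, y) \<in> vdom c d" by (simp only: m0)
      show "?\<rho> (0, y) * Re (?z (0, y) $ j) = rho \<iota> c y * ?t T y $ j"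
        using rho_variation[OF y] by (simp add: vcoef_0[OF y] variation_0 complex_vec_def)
    qed
  qed
  have A4: "?\<rho> (0, x) = rho \<iota> c x" using rho_variation[OF x] variation_0 by simp
  have A5: "(\<Sum>j\<in>UNIV. Im (?z (0, x) $ j) * Im (conn_in d (vrep c d) (vfrm c d) (0, axis j 1) (0, x)))
    = - maslov_form A g J B \<iota> (cinv c x) (Y (cinv c x))"
  proof -
    have "maslov_form A g J B \<iota> (cinv c x) (Y (cinv c x)) = - Im (conn_in d (rep \<iota> c d) (frm \<iota> c d) (?t Y x) x)"
      using maslov_form_in_chart[OF base_tri cd pc pd, of "Y (cinv c x)"] cx by (simp only: K.maslov_conn_trace)
    also have "conn_in d (rep \<iota> c d) (frm \<iota> c d) (?t Y x) x = (\<Sum>j\<in>UNIV. ?t Y x $ j *\<^sub>R conn_in d (rep \<iota> c d) (frm \<iota> c d) (axis j 1) x)"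
      by (rule linear_vec_expand[OF K.linear_conn_trace[OF smooth_rep[OF sfm[OF base_tri] cd] rep_image[OF sfm[OF base_tri] cd]
        smooth_on_fd[OF smooth_rep[OF sfm[OF base_tri] cd]] bij_frame_in[OF base_tri cd] dim xr]])
    finally show ?thesis by (simp add: vcoef_0[OF x] vconn_0[OF x] complex_vec_def Im_sum del: comp_apply)
  qed
  show ?thesis unfolding A1 A2 A3 A4 A5 by simp
qed

end

end

end

end

section \<open>The first variation formula\<close>

context closed_jgeometry
begin

context
  fixes \<iota> \<epsilon> F T Y
  assumes var: "variation A J B \<iota> \<epsilon> F"
    and dec: "\<And>p. variation_field A F p = tm \<iota> p (T p) + J (\<iota> p) (tm \<iota> p (Y p))"
begin

lemma vdom_exists:
  assumes c: "c \<in> B" and t: "\<bar>t\<bar> < \<epsilon>" and x: "x \<in> cimg c"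
  obtains d where "d \<in> A" "(t, x) \<in> vdom \<epsilon> F c d"
  using exists_target_chart[OF variation_tri[OF var t] c x] vdom_mem[OF var c] t by metis

lemma vdom_slice: "c \<in> B \<Longrightarrow> d \<in> A \<Longrightarrow> (0, x) \<in> vdom \<epsilon> F c d \<longleftrightarrow> x \<in> rep_dom \<iota> c d"
  using vdom_mem[OF var] variation_pos[OF var] variation_0[OF var] by simp

text \<open>\<open>T\<close> and \<open>Y\<close> are only assumed to decompose the variation field
  pointwise. They are the real and imaginary parts of its frame coordinates, which are smooth as
  solutions of a linear system.\<close>

lemma smooth_decomposition: "smooth_vector_field B T" "smooth_vector_field B Y"
proof -
  let ?t = "\<lambda>c T x. to_chart B c (cinv c x) (T (cinv c x))"
  have *: "\<exists>S. x \<in> S \<and> S \<subseteq> cimg c \<and> smooth_on S (?t c T) \<and> smooth_on S (?t c Y)" if c: "c \<in> B" and x: "x \<in> cimg c" for c x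
  proof -
    obtain d where d: "d \<in> A" "x \<in> rep_dom \<iota> c d" by (rule exists_target_chart[OF base_tri[OF var] c x])
    interpret K: kaehler_chart "cimg d" "metric_in A g d" "acs_in A J d" "christoffel A g d" by (rule kaehler_chart[OF d(1)])
    let ?z = "\<lambda>x. coef_in d (vrep F c d) (vfrm F c d) (vfield F c d) (0, x)"
    have o: "open (rep_dom \<iota> c d)" by (rule open_rep_dom[OF sfm[OF base_tri[OF var]] c d(1)])
    have "smooth_on (vdom \<epsilon> F c d) (coef_in d (vrep F c d) (vfrm F c d) (vfield F c d))"
      by (rule K.smooth_on_coef[OF vctx[OF var c d(1)] smooth_vfield[OF var c d(1)]])
    then have z: "smooth_on (rep_dom \<iota> c d) ?z"
      by (rule smooth_on_slice[OF _ o])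
         (rule vdom_slice[OF c d(1), THEN iffD2])
    have e: "?z y = complex_vec (?t c T y) (?t c Y y)" if "y \<in> rep_dom \<iota> c d" for y
      using vcoef_0[OF var c d(1) dec] vdom_slice[OF c d(1)] that by blast
    have "smooth_on (rep_dom \<iota> c d) (?t c T)"
      by (rule smooth_on_cong[OF smooth_on_linear_compose[OF linear_conv_bounded_linear[THEN iffD1, OF linear_re_vec] z]]) (simp only: e re_complex_vec)
    moreover have "smooth_on (rep_dom \<iota> c d) (?t c Y)"
      by (rule smooth_on_cong[OF smooth_on_linear_compose[OF linear_conv_bounded_linear[THEN iffD1, OF linear_im_vec] z]]) (simp only: e im_complex_vec)
    ultimately show ?thesis using d rep_dom_mem[OF c] by (intro exI[of _ "rep_dom \<iota> c d"]) blast
  qed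
  show "smooth_vector_field B T" "smooth_vector_field B Y"
    unfolding smooth_vector_field_def by (intro ballI smooth_on_local; use * in blast)+
qed

lemma smooth_rho_variation:
  assumes c: "c \<in> B"
  shows "smooth_on ({-\<epsilon><..<\<epsilon>} \<times> cimg c) (\<lambda>p. rho (F (fst p)) c (snd p))"
proof (rule smooth_on_local)
  fix p assume p: "p \<in> {-\<epsilon><..<\<epsilon>} \<times> cimg c"
  obtain t x where tx: "p = (t, x)" by (cases p)
  have t: "\<bar>t\<bar> < \<epsilon>" and x: "x \<in> cimg c" using p tx by auto
  obtain d where d: "d \<in> A" "(t, x) \<in> vdom \<epsilon> F c d" by (rule vdom_exists[OF c t x])
  interpret K: kaehler_chart "cimg d" "metric_in A g d" "acs_in A J d" "christoffel A g d" by (rule kaehler_chart[OF d(1)])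
  have "smooth_on (vdom \<epsilon> F c d) (dens_in d (vrep F c d) (vfrm F c d))"
    by (rule K.smooth_on_density[OF vctx[OF var c d(1)]])
  then have "smooth_on (vdom \<epsilon> F c d) (\<lambda>p. rho (F (fst p)) c (snd p))"
  proof (rule smooth_on_cong)
    fix q assume "q \<in> vdom \<epsilon> F c d"
    then show "dens_in d (vrep F c d) (vfrm F c d) q = rho (F (fst q)) c (snd q)"
      using rho_variation[OF var c d(1), of "fst q" "snd q"] by simp
  qed
  then show "\<exists>S. p \<in> S \<and> S \<subseteq> {-\<epsilon><..<\<epsilon>} \<times> cimg c \<and> smooth_on S (\<lambda>p. rho (F (fst p)) c (snd p))"
    using d tx by (intro exI[of _ "vdom \<epsilon> F c d"]) (auto simp: vdom_def[OF var])
qed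

lemma fd_rho_variation:
  assumes c: "c \<in> B" and x: "x \<in> cimg c"
  shows "fd (\<lambda>p. rho (F (fst p)) c (snd p)) (0, x) (1, 0) =
    (\<Sum>j\<in>UNIV. fd (\<lambda>x. rho \<iota> c x * to_chart B c (cinv c x) (T (cinv c x)) $ j) x (axis j 1))
    + rho \<iota> c x * maslov_form A g J B \<iota> (cinv c x) (Y (cinv c x))"
proof -
  obtain d where d: "d \<in> A" "x \<in> rep_dom \<iota> c d" by (rule exists_target_chart[OF base_tri[OF var] c x])
  show ?thesis by (rule fd_rho_variation_local[OF var c d(1) dec]) (simp only: vdom_slice[OF c d(1)] d(2))
qed

text \<open>One partition of unity serves all times, so the volume is a sum of integrals over fixed
  compact sets. Differentiating each leaves a divergence part, which cancels only in the sum over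
  all charts, and the integral of \<xi>(Y).\<close>

lemma first_variation:
  "((\<lambda>t. Vol_J A g J B (F t)) has_vector_derivative
     form_integral B (smul (\<lambda>p. maslov_form A g J B \<iota> p (Y p)) (vol \<iota>))) (at 0)"
proof -
  note tri = base_tri[OF var] and rf = real_form_vol[OF base_tri[OF var]]
  obtain k c \<psi> where pu: "partition_of_unity B k c \<psi>" using B.exists_partition_of_unity[OF compact_L] by blast
  note ps = partition_simps[OF rf pu]
  define \<eta> where "\<eta> p = maslov_form A g J B \<iota> p (Y p)" for p
  have \<eta>s: "smooth_on (cimg d) (\<lambda>x. \<eta> (cinv d x))" if "d \<in> B" for d
    unfolding \<eta>_def by (rule smooth_one_form_app[OF linear_maslov_form[OF tri] smooth_maslov[OF tri] smooth_decomposition(2) that])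
  have \<eta>c: "continuous_on UNIV \<eta>"
    by (rule B.continuous_in_charts) (rule smooth_on_continuous[OF \<eta>s])
  define P where "P i p = rho (F (fst p)) (c i) (snd p)" for i p
  define D where "D i x = (\<Sum>j\<in>UNIV. fd (\<lambda>x. rho \<iota> (c i) x * to_chart B (c i) (cinv (c i) x) (T (cinv (c i) x)) $ j) x (axis j 1))" for i x
  \<comment> \<open>The integrand of the i-th chart, extended by zero to all of space so that
    \<open>leibniz_compact_support\<close> applies.\<close>
  define q where "q i p = (if snd p \<in> cimg (c i) then \<psi> i (cinv (c i) (snd p)) * P i p else 0)" for i p
  define I where "I = {-\<epsilon><..<\<epsilon>}"
  have I: "0 \<in> I" "open I" using variation_pos[OF var] by (auto simp: I_def)
  have P: "smooth_on (I \<times> cimg (c i)) (P i)" if "i < k" for i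
    unfolding P_def I_def by (rule smooth_rho_variation[OF ps(1)[OF that]])
  have \<psi>s: "smooth_on (cimg (c i)) (\<lambda>x. \<psi> i (cinv (c i) x))" if "i < k" for i
    using ps(1,2)[OF that] by (simp add: smooth_fun_def o_def)
  note K = compact_supp_image[OF tri ps(1) ps(5)]
  have oc: "open (cimg (c i))" if "i < k" for i by (rule B.chart_open(2)[OF ps(1)[OF that]])
  have \<psi>P: "smooth_on (I \<times> cimg (c i)) (\<lambda>p. \<psi> i (cinv (c i) (snd p)) * P i p)" if i: "i < k" for i
  proof (rule smooth_on_mult[OF _ P[OF i]])
    have "smooth_on (I \<times> cimg (c i)) snd"
      by (rule smooth_on_bounded_linear[OF bounded_linear_snd open_Times[OF I(2) oc[OF i]]])
    then show "smooth_on (I \<times> cimg (c i)) (\<lambda>p. \<psi> i (cinv (c i) (snd p)))"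
      by (rule smooth_on_compose[OF \<psi>s[OF i]]) auto
  qed
  have q0: "q i (t, x) = 0" if "i < k" "x \<notin> coord (c i) ` supp (\<psi> i)" for i t x
    using K(3)[OF that(1,1)] that(2) by (simp add: q_def)
  have qs: "smooth_on (I \<times> UNIV) (q i)" if i: "i < k" for i
  proof (rule smooth_on_local)
    fix p :: "real \<times> (real^'n)" assume p: "p \<in> I \<times> UNIV"
    show "\<exists>S. p \<in> S \<and> S \<subseteq> I \<times> UNIV \<and> smooth_on S (q i)"
    proof (cases "snd p \<in> cimg (c i)")
      case True
      have "smooth_on (I \<times> cimg (c i)) (q i)"
        by (rule smooth_on_cong[OF \<psi>P[OF i]]) (auto simp: q_def)
      then show ?thesis using True p by (intro exI[of _ "I \<times> cimg (c i)"]) (auto simp: mem_Times_iff)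
    next
      case False
      let ?S = "I \<times> - (coord (c i) ` supp (\<psi> i))"
      have "open ?S" by (intro open_Times I(2) open_Compl compact_imp_closed K(1)[OF i i])
      then have "smooth_on ?S (q i)"
        by (intro smooth_on_cong[OF smooth_on_const[of _ 0]]) (use q0[OF i] in auto)
      moreover have "p \<in> ?S" using False p K(2)[OF i i] by (auto simp: mem_Times_iff)
      ultimately show ?thesis by (intro exI[of _ ?S]) auto
    qed
  qed
  have fdq: "fd (q i) (0, x) (1, 0) = (if x \<in> cimg (c i) then \<psi> i (cinv (c i) x) * D i x else 0)
     + (if x \<in> cimg (c i) then (\<psi> i (cinv (c i) x) * \<eta> (cinv (c i) x)) * rho \<iota> (c i) x else 0)" if i: "i < k" for i x
  proof (cases "x \<in> cimg (c i)")
    case True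
    have m: "(0, x) \<in> I \<times> cimg (c i)" using True I by simp
    have "fd (q i) (0, x) = fd (\<lambda>p. \<psi> i (cinv (c i) (snd p)) * P i p) (0, x)"
      by (rule fd_cong[OF open_Times[OF I(2) oc[OF i]] m]) (auto simp: q_def)
    moreover have "((\<lambda>t. (t, x)) has_derivative (\<lambda>s. (s, 0))) (at (0::real))" by (auto intro!: derivative_eq_intros)
    note has_derivative_compose[OF this]
    note d1 = this[OF smooth_on_has_derivative[OF \<psi>P[OF i] m]] and d2 = this[OF smooth_on_has_derivative[OF P[OF i] m]]
    have "(\<lambda>s. fd (\<lambda>p. \<psi> i (cinv (c i) (snd p)) * P i p) (0, x) (s, 0)) = (\<lambda>s. \<psi> i (cinv (c i) x) * fd (P i) (0, x) (s, 0))"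
      using d1 has_derivative_mult_right[OF d2, of "\<psi> i (cinv (c i) x)"] unfolding snd_conv by (rule has_derivative_unique)
    from fun_cong[OF this, of 1] have "fd (\<lambda>p. \<psi> i (cinv (c i) (snd p)) * P i p) (0, x) (1, 0) = \<psi> i (cinv (c i) x) * fd (P i) (0, x) (1, 0)" .
    moreover have "fd (P i) (0, x) (1, 0) = D i x + rho \<iota> (c i) x * \<eta> (cinv (c i) x)"
      unfolding P_def[abs_def] D_def \<eta>_def by (rule fd_rho_variation[OF ps(1)[OF i] True])
    ultimately show ?thesis using True by (simp add: algebra_simps)
  next
    case False
    have "fd (q i) (0, x) = fd (\<lambda>_. 0) (0, x)"
    proof (rule fd_cong)
      show "open (I \<times> - (coord (c i) ` supp (\<psi> i)))" by (intro open_Times I(2) open_Compl compact_imp_closed K(1)[OF i i])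
      show "(0, x) \<in> I \<times> - (coord (c i) ` supp (\<psi> i))" using False I(1) K(2)[OF i i] by auto
    qed (use q0[OF i] in auto)
    then show ?thesis using False by simp
  qed
  have Vol: "Vol_J A g J B (F t) = (\<Sum>i<k. of_real (\<integral>x. q i (t, x) \<partial>lborel))" if "\<bar>t\<bar> < \<epsilon>" for t
  proof -
    note trt = variation_tri[OF var that]
    have "Vol_J A g J B (F t) = (\<Sum>i<k. cint (c i) (vol (F t)) (\<psi> i))"
      unfolding Vol_J_def by (rule form_integral_eq[OF real_form_vol[OF trt] pu])
    also have "\<dots> = (\<Sum>i<k. of_real (\<integral>x. q i (t, x) \<partial>lborel))"
      by (intro sum.cong refl) (simp add: integral_eq_UNIV[OF trt ps(1) ps(3) ps(5)] q_def P_def cong: if_cong)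
    finally show ?thesis .
  qed
  have int: "integrable lborel (\<lambda>x. if x \<in> cimg (c i) then u (cinv (c i) x) * h x else 0)"
    if i: "i < k" and u: "continuous_on UNIV u" "supp u \<subseteq> supp (\<psi> i)" and h: "continuous_on (cimg (c i)) h" for i u h
  proof (rule integrable_compact_support[OF _ K(1)[OF i i]])
    let ?v = "\<lambda>x. if x \<in> cimg (c i) then u (cinv (c i) x) * h x else 0"
    have z: "?v x = 0" if "x \<notin> coord (c i) ` supp (\<psi> i)" for x
      using compact_supp_image(3)[OF tri ps(1)[OF i], of u x] u(2) ps(5)[OF i] that by auto
    then show "x \<notin> coord (c i) ` supp (\<psi> i) \<Longrightarrow> ?v x = 0" for x .
    have "continuous_on (cimg (c i)) ?v"
      by (rule continuous_on_eq[OF continuous_on_mult[OF continuous_cinv_compose[OF ps(1)[OF i] u(1)] h]]) simp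
    moreover have "continuous_on (- (coord (c i) ` supp (\<psi> i))) ?v"
      by (rule continuous_on_eq[OF continuous_on_const[of _ 0]]) (rule z[symmetric], simp)
    ultimately have "continuous_on (cimg (c i) \<union> - (coord (c i) ` supp (\<psi> i))) ?v"
      by (intro continuous_on_open_Un oc[OF i] open_Compl compact_imp_closed K(1)[OF i i])
    then show "continuous_on UNIV ?v" by (rule continuous_on_subset) (use K(2)[OF i i] in blast)
  qed
  have Dc: "continuous_on (cimg (c i)) (D i)" if i: "i < k" for i
  proof -
    have "smooth_on (cimg (c i)) (\<lambda>x. to_chart B (c i) (cinv (c i) x) (T (cinv (c i) x)))"
      using smooth_decomposition(1) ps(1)[OF i] by (simp add: smooth_vector_field_def)
    then show ?thesis
      unfolding D_def
      by (intro smooth_on_continuous smooth_on_sum oc[OF i] smooth_on_fd smooth_on_mult smooth_rho[OF tri ps(1)[OF i]]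
          smooth_on_linear_compose[OF bounded_linear_vec_nth])
  qed
  let ?i1 = "\<lambda>i. \<integral>x. (if x \<in> cimg (c i) then \<psi> i (cinv (c i) x) * D i x else 0) \<partial>lborel"
  let ?i2 = "\<lambda>i. \<integral>x. (if x \<in> cimg (c i) then (\<psi> i (cinv (c i) x) * \<eta> (cinv (c i) x)) * rho \<iota> (c i) x else 0) \<partial>lborel"
  have split: "(\<integral>x. fd (q i) (0, x) (1, 0) \<partial>lborel) = ?i1 i + ?i2 i" if i: "i < k" for i
    unfolding fdq[OF i]
    by (rule Bochner_Integration.integral_add[OF int[OF i ps(3)[OF i] subset_refl Dc[OF i]]
       int[OF i continuous_on_mult[OF ps(3)[OF i] \<eta>c] supp_mult_subset(1) smooth_on_continuous[OF smooth_rho[OF tri ps(1)[OF i]]]]])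
  have "((\<lambda>t. \<Sum>i<k. complex_of_real (\<integral>x. q i (t, x) \<partial>lborel)) has_vector_derivative
     (\<Sum>i<k. complex_of_real (\<integral>x. fd (q i) (0, x) (1, 0) \<partial>lborel))) (at 0)"
  proof (rule has_vector_derivative_sum)
    fix i assume "i \<in> {..<k}"
    then have i: "i < k" by simp
    have "((\<lambda>t. \<integral>x. q i (t, x) \<partial>lborel) has_vector_derivative (\<integral>x. fd (q i) (0, x) (1, 0) \<partial>lborel)) (at 0)"
      by (rule leibniz_compact_support[OF variation_pos[OF var] qs[OF i, unfolded I_def] K(1)[OF i i] q0[OF i]])
    then show "((\<lambda>t. complex_of_real (\<integral>x. q i (t, x) \<partial>lborel)) has_vector_derivative complex_of_real (\<integral>x. fd (q i) (0, x) (1, 0) \<partial>lborel)) (at 0)"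
      by (rule bounded_linear.has_vector_derivative[OF bounded_linear_of_real])
  qed
  also have "(\<Sum>i<k. complex_of_real (\<integral>x. fd (q i) (0, x) (1, 0) \<partial>lborel)) = of_real (\<Sum>i<k. ?i1 i) + (\<Sum>i<k. of_real (?i2 i))"
    by (simp add: split sum.distrib)
  also have "(\<Sum>i<k. ?i1 i) = 0"
    unfolding D_def by (rule divergence_theorem[OF tri pu smooth_decomposition(1)])
  also have "(\<Sum>i<k. complex_of_real (?i2 i)) = form_integral B (smul \<eta> (vol \<iota>))"
    unfolding form_integral_smul[OF rf \<eta>c pu]
  proof (intro sum.cong refl)
    fix i assume "i \<in> {..<k}"
    then have i: "i < k" by simp
    show "complex_of_real (?i2 i) = cint (c i) (vol \<iota>) (\<lambda>p. \<psi> i p * \<eta> p)"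
      by (rule integral_eq_UNIV[OF tri ps(1)[OF i] continuous_on_mult[OF ps(3)[OF i] \<eta>c] subset_trans[OF supp_mult_subset(1) ps(5)[OF i]], symmetric])
  qed
  finally have "((\<lambda>t. \<Sum>i<k. complex_of_real (\<integral>x. q i (t, x) \<partial>lborel)) has_vector_derivative form_integral B (smul \<eta> (vol \<iota>))) (at 0)" by simp
  then show ?thesis
    unfolding \<eta>_def[symmetric]
    by (rule has_vector_derivative_transform_within_open[OF _ I(2,1)]) (auto simp: I_def Vol abs_less_iff)
qed

end

end

section \<open>Local variations and the J-mean curvature\<close>

lemma linear_inj_imp_bij:
  fixes L :: "'a::euclidean_space \<Rightarrow> 'b::euclidean_space"
  assumes L: "linear L" "inj L" and dim: "DIM('a) = DIM('b)"
  shows "bij L"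
proof -
  have "dim (range L) = dim (UNIV :: 'a set)"
    by (rule dim_image_eq[OF L(1)]) (use L(2) in simp)
  then have "span (range L) = UNIV" using dim by (simp only: dim_UNIV dim_eq_full)
  moreover have "span (range L) = range L"
    by (simp add: span_eq_iff linear_subspace_image[OF L(1)])
  ultimately show ?thesis using L(2) by (simp add: bij_def)
qed

lemma tube_at_0:
  fixes W :: "(real \<times> 'a::t2_space) set"
  assumes W: "open W" and K: "compact K" and sub: "\<And>x. x \<in> K \<Longrightarrow> (0, x) \<in> W"
  obtains \<epsilon> where "\<epsilon> > 0" "\<And>t x. \<bar>t\<bar> < \<epsilon> \<Longrightarrow> x \<in> K \<Longrightarrow> (t, x) \<in> W"
proof -
  have "openin (prod_topology euclidean euclidean) W" by (simp add: euclidean_product_topology W)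
  moreover have "compactin euclidean K" by (simp add: K)
  moreover have "(0::real) \<in> topspace euclidean" "{0} \<times> K \<subseteq> W" using sub by auto
  ultimately have "\<exists>U V. openin euclidean U \<and> openin euclidean V \<and> (0::real) \<in> U \<and> K \<subseteq> V \<and> U \<times> V \<subseteq> W"
    by (rule tube_lemma_right)
  then obtain U V where UV: "open U" "(0::real) \<in> U" "K \<subseteq> V" "U \<times> V \<subseteq> W" by auto
  then obtain \<epsilon> where \<epsilon>: "\<epsilon> > 0" "ball 0 \<epsilon> \<subseteq> U" using open_contains_ball by blast
  show ?thesis
  proof (rule that[OF \<epsilon>(1)])
    fix t x assume "\<bar>t\<bar> < \<epsilon>" "x \<in> K"
    moreover from this have "t \<in> U" using \<epsilon>(2) by (auto simp: subset_iff dist_real_def)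
    ultimately show "(t, x) \<in> W" using UV by blast
  qed
qed

text \<open>The locally uniform lower bound of \<open>linear_family_bound_below\<close> keeps nearby
  members injective.\<close>

lemma open_injective_family:
  fixes L :: "'p::t2_space \<Rightarrow> 'a::euclidean_space \<Rightarrow> 'b::real_normed_vector"
  assumes S: "open S" and lin: "\<And>x. x \<in> S \<Longrightarrow> linear (L x)" and cont: "\<And>u. continuous_on S (\<lambda>x. L x u)"
  shows "open {x \<in> S. inj (L x)}"
  unfolding open_subopen[of "{x \<in> S. inj (L x)}"]
proof
  fix x0 assume x0: "x0 \<in> {x \<in> S. inj (L x)}"
  then obtain m where m: "m > 0" "\<forall>\<^sub>F x in nhds x0. x \<in> S \<and> (\<forall>u. m * norm u \<le> norm (L x u))"
    using linear_family_bound_below[OF lin cont S, of x0] by blast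
  have "inj (L x)" if "x \<in> S" "\<forall>u. m * norm u \<le> norm (L x u)" for x
    unfolding linear_injective_0[OF lin[OF that(1)]]
  proof (intro allI impI)
    fix u assume "L x u = 0"
    then have "m * norm u \<le> 0" using that(2)[rule_format, of u] by simp
    then show "u = 0" using m(1) by (simp add: mult_le_0_iff)
  qed
  then show "\<exists>T. open T \<and> x0 \<in> T \<and> T \<subseteq> {x \<in> S. inj (L x)}"
    using m(2) unfolding eventually_nhds by blast
qed

context closed_jgeometry
begin

text \<open>In the charts the variation is the affine motion f + t w; outside the support of
  \<open>w\<close> nothing moves. The image stays in the chart and the immersion totally real for
  small times because both are open conditions on a compact set.\<close>

lemma exists_local_variation:
  assumes tri: "totally_real_immersion A J B \<iota>" and c: "c \<in> B" and d: "d \<in> A"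
    and K: "compact K" "K \<subseteq> rep_dom \<iota> c d"
    and w: "smooth_on (rep_dom \<iota> c d) w" "\<And>x. x \<in> rep_dom \<iota> c d \<Longrightarrow> x \<notin> K \<Longrightarrow> w x = 0"
  obtains \<epsilon> F where "variation A J B \<iota> \<epsilon> F"
    and "\<And>x. x \<in> rep_dom \<iota> c d \<Longrightarrow> to_chart A d (\<iota> (cinv c x)) (variation_field A F (cinv c x)) = w x"
    and "\<And>p. p \<notin> cinv c ` K \<Longrightarrow> variation_field A F p = 0"
proof -
  interpret KC: kaehler_chart "cimg d" "metric_in A g d" "acs_in A J d" "christoffel A g d" by (rule kaehler_chart[OF d])
  define V where "V = rep_dom \<iota> c d"
  note sm = sfm[OF tri]
  have V: "open V" unfolding V_def by (rule open_rep_dom[OF sm c d])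
  have Vc: "x \<in> cimg c" "\<iota> (cinv c x) \<in> cdom d" if "x \<in> V" for x
    using that by (simp_all add: V_def rep_dom_mem[OF c])
  have KV: "K \<subseteq> V" using K(2) by (simp add: V_def)
  define f where "f = rep \<iota> c d"
  have f: "smooth_on V f" unfolding V_def f_def by (rule smooth_rep[OF sm c d])
  have w': "smooth_on V w" "\<And>x. x \<in> V \<Longrightarrow> x \<notin> K \<Longrightarrow> w x = 0" using w by (simp_all add: V_def)
  have oU: "open ((UNIV :: real set) \<times> V)" by (rule open_Times[OF open_UNIV V])
  define G where "G p = f (snd p) + fst p *\<^sub>R w (snd p)" for p :: "real \<times> (real^'n)"
  have snd: "smooth_on (UNIV \<times> V) (snd :: real \<times> (real^'n) \<Rightarrow> _)" and fst: "smooth_on (UNIV \<times> V) (fst :: real \<times> (real^'n) \<Rightarrow> _)"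
    using oU by (auto intro: smooth_on_bounded_linear bounded_linear_snd bounded_linear_fst)
  have G: "smooth_on (UNIV \<times> V) G"
    unfolding G_def[abs_def]
    by (intro smooth_on_add smooth_on_scaleR fst smooth_on_compose[OF f snd] smooth_on_compose[OF w'(1) snd]) auto
  have G0: "(\<lambda>x. G (0, x)) = f" by (simp add: G_def)
  define E where "E i p = fd G p (0, axis i 1)" for i :: 'n and p
  have E: "smooth_on (UNIV \<times> V) (E i)" for i unfolding E_def[abs_def] by (rule smooth_on_fd[OF G])
  define S1 where "S1 = (UNIV \<times> V) \<inter> G -` cimg d"
  have S1: "open S1" unfolding S1_def by (rule continuous_open_preimage[OF smooth_on_continuous[OF G] oU chart_open(2)[OF d]])
  have S1U: "S1 \<subseteq> UNIV \<times> V" and GS1: "G ` S1 \<subseteq> cimg d" by (auto simp: S1_def)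
  define L where "L p = frame_map (acs_in A J d (G p)) (\<lambda>i. E i p)" for p
  have L: "linear (L p)" for p unfolding L_def by (rule linear_frame_map)
  have Lc: "continuous_on S1 (\<lambda>p. L p u)" for u
    unfolding L_def frame_map_def
    by (intro smooth_on_continuous smooth_on_sum S1 KC.smooth_on_cact[OF smooth_on_subset[OF G S1 S1U] GS1] smooth_on_const
        smooth_on_subset[OF E S1 S1U])
  have fV: "f x \<in> cimg d" if "x \<in> V" for x
    using rep_image[OF sm c d] that by (auto simp: f_def V_def)
  \<comment> \<open>The tube lemma turns the open condition at time 0, which holds along the compact
    set \<open>K\<close>, into one time interval valid for all of \<open>K\<close>.\<close>
  obtain \<epsilon> where \<epsilon>: "\<epsilon> > 0" "\<And>t x. \<bar>t\<bar> < \<epsilon> \<Longrightarrow> x \<in> K \<Longrightarrow> (t, x) \<in> {p \<in> S1. inj (L p)}"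
  proof (rule tube_at_0[OF open_injective_family[OF S1 L Lc] K(1)])
    fix x assume "x \<in> K"
    then have x: "x \<in> V" using KV by blast
    have "E i (0, x) = fd f x (axis i 1)" for i
      unfolding E_def by (subst fd_slice[OF G, symmetric]) (simp_all add: G0 x)
    then have "bij (L (0, x))"
      using bij_frame_in[OF tri c d x[unfolded V_def]] by (simp add: L_def G_def f_def)
    then show "(0, x) \<in> {p \<in> S1. inj (L p)}" using x fV[OF x] by (simp add: S1_def G_def bij_def)
  qed blast
  define I where "I = {-\<epsilon><..<\<epsilon>}"
  have I: "t \<in> I \<longleftrightarrow> \<bar>t\<bar> < \<epsilon>" "open I" for t by (auto simp: I_def)
  have I0: "0 \<in> I" using \<epsilon>(1) by (simp add: I)
  have Gout: "G (t, x) = f x" if "x \<in> V" "x \<notin> K" for t x using w'(2)[OF that] by (simp add: G_def)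
  have Gin: "G (t, x) \<in> cimg d" if "\<bar>t\<bar> < \<epsilon>" "x \<in> V" for t x
    using \<epsilon>(2)[OF that(1), of x] Gout[OF that(2)] fV[OF that(2)] by (cases "x \<in> K") (simp_all add: S1_def)
  have Lbij: "bij (L (t, x))" if "\<bar>t\<bar> < \<epsilon>" "x \<in> K" for t x
    by (rule linear_inj_imp_bij[OF L]) (use \<epsilon>(2)[OF that] dim in simp_all)
  have \<iota>c: "continuous_on UNIV \<iota>" using sm by (simp add: smooth_map_def)
  define P where "P = cdom c \<inter> \<iota> -` cdom d"
  have P: "open P"
    unfolding P_def by (intro open_Int B.chart_open(1)[OF c] open_vimage chart_open(1)[OF d] \<iota>c)
  have PV: "coord c q \<in> V" "cinv c (coord c q) = q" if "q \<in> P" for q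
    using that B.chart_simps(1)[OF c] by (auto simp: P_def V_def)
  have VP: "cinv c x \<in> P" "coord c (cinv c x) = x" if "x \<in> V" for x
    using Vc[OF that] B.chart_simps(2,4)[OF c] by (auto simp: P_def)
  define Q where "Q = - cinv c ` K"
  have KP: "cinv c ` K \<subseteq> P" using VP(1) KV by auto
  have "compact (cinv c ` K)"
    by (rule compact_continuous_image[OF continuous_on_subset[OF continuous_cinv[OF B.is_chart[OF c]]] K(1)]) (use KV Vc in auto)
  then have Q: "open Q" unfolding Q_def by (intro open_Compl compact_imp_closed)
  have PQ: "P \<union> Q = UNIV" using KP by (auto simp: Q_def)
  \<comment> \<open>\<open>P\<close> is the region seen by both charts and \<open>Q\<close> the
    complement of the moving part. They are open and cover L, and by \<open>FQ\<close> the two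
    descriptions agree on the overlap, so smoothness can be checked on each.\<close>
  define F where "F t q = (if q \<in> P then cinv d (G (t, coord c q)) else \<iota> q)" for t q
  have FQ: "F t q = \<iota> q" if "q \<in> Q" for t q
  proof (cases "q \<in> P")
    case True
    have "coord c q \<notin> K" using that PV(2)[OF True] unfolding Q_def by (metis ComplD image_eqI)
    then have "G (t, coord c q) = coord d (\<iota> q)" using Gout[OF PV(1)[OF True]] PV(2)[OF True] by (simp add: f_def)
    then show ?thesis using True chart_simps(1)[OF d] by (simp add: F_def P_def)
  qed (simp add: F_def)
  have F0: "F 0 = \<iota>"
  proof
    fix q show "F 0 q = \<iota> q"
      using chart_simps(1)[OF d] PV(2)[of q] by (simp add: F_def G_def f_def) (simp add: P_def)
  qed
  have cont: "continuous_on (I \<times> UNIV) (\<lambda>(t, p). F t p)"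
  proof -
    have "continuous_on (I \<times> P) (\<lambda>z. cinv d (G (fst z, coord c (snd z))))"
    proof (rule continuous_on_compose2[OF continuous_cinv[OF is_chart[OF d]]])
      show "continuous_on (I \<times> P) (\<lambda>z. G (fst z, coord c (snd z)))"
        by (rule continuous_on_compose2[OF smooth_on_continuous[OF G]])
           (auto intro!: continuous_intros continuous_on_compose2[OF continuous_coord[OF B.is_chart[OF c]]] simp: PV P_def)
      show "(\<lambda>z. G (fst z, coord c (snd z))) ` (I \<times> P) \<subseteq> cimg d" using Gin PV(1) by (auto simp: I)
    qed
    then have 1: "continuous_on (I \<times> P) (\<lambda>(t, p). F t p)"
      by (rule continuous_on_eq) (auto simp: F_def)
    have "continuous_on (I \<times> Q) (\<lambda>z. \<iota> (snd z))"
      by (rule continuous_on_compose2[OF \<iota>c]) (auto intro!: continuous_intros)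
    then have 2: "continuous_on (I \<times> Q) (\<lambda>(t, p). F t p)"
      by (rule continuous_on_eq) (auto simp: FQ)
    have "I \<times> UNIV = I \<times> P \<union> I \<times> Q" using PQ by blast
    then show ?thesis using continuous_on_open_Un[OF open_Times[OF I(2) P] open_Times[OF I(2) Q] 1 2] by simp
  qed
  have joint: "smooth_on {(t, x). \<bar>t\<bar> < \<epsilon> \<and> x \<in> cimg c' \<and> F t (cinv c' x) \<in> cdom d'} (\<lambda>(t, x). coord d' (F t (cinv c' x)))"
    (is "smooth_on ?S ?H") if c': "c' \<in> B" and d': "d' \<in> A" for c' d'
  proof (rule smooth_on_local)
    fix z assume z: "z \<in> ?S"
    obtain t x where tx: "z = (t, x)" by (cases z)
    have zt: "t \<in> I" "x \<in> cimg c'" "F t (cinv c' x) \<in> cdom d'" using z by (simp_all add: tx I)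
    note xc = B.chart_simps(2,4)[OF c' zt(2)]
    show "\<exists>T. z \<in> T \<and> T \<subseteq> ?S \<and> smooth_on T ?H"
    proof (cases "cinv c' x \<in> P")
      case True
      define V1 where "V1 = coord c' ` (cdom c' \<inter> P)"
      have V1: "open V1" unfolding V1_def by (rule B.open_coord_image[OF c' P])
      have V1m: "y \<in> V1 \<longleftrightarrow> y \<in> cimg c' \<and> cinv c' y \<in> P" for y
        unfolding V1_def using B.coord_image_mem[OF c', of "cdom c' \<inter> P" y] B.chart_simps(4)[OF c', of y] by auto
      have tr: "smooth_on V1 (coord c \<circ> cinv c')"
        by (rule smooth_on_subset[OF B.smooth_transition[OF c' c] V1]) (auto simp: V1_def P_def)
      have I1: "open (I \<times> V1)" by (rule open_Times[OF I(2) V1])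
      define G1 where "G1 p = G (fst p, (coord c \<circ> cinv c') (snd p))" for p
      have s1: "smooth_on (I \<times> V1) fst" "smooth_on (I \<times> V1) snd"
        using I1 by (auto intro: smooth_on_bounded_linear bounded_linear_snd bounded_linear_fst)
      have G1: "smooth_on (I \<times> V1) G1"
        unfolding G1_def[abs_def]
        by (rule smooth_on_compose[OF G smooth_on_Pair[OF s1(1) smooth_on_compose[OF tr s1(2)]]])
           (auto simp: V1m PV(1))
      have G1in: "G1 p \<in> cimg d" if "p \<in> I \<times> V1" for p
        using that Gin PV(1) unfolding G1_def by (cases p) (simp add: I V1m)
      define T where "T = (I \<times> V1) \<inter> G1 -` (coord d ` (cdom d \<inter> cdom d'))"
      have T: "open T"
        unfolding T_def
        by (rule continuous_open_preimage[OF smooth_on_continuous[OF G1] I1 open_coord_image[OF d chart_open(1)[OF d']]])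
      have HT: "F (fst p) (cinv c' (snd p)) = cinv d (G1 p)" if "p \<in> T" for p
        using that by (auto simp: T_def V1m F_def G1_def)
      have "smooth_on T (\<lambda>p. (coord d' \<circ> cinv d) (G1 p))"
        by (rule smooth_on_compose[OF smooth_transition[OF d d'] smooth_on_subset[OF G1 T]]) (auto simp: T_def)
      then have "smooth_on T ?H" by (rule smooth_on_cong) (simp add: HT split_beta)
      moreover have "T \<subseteq> ?S"
      proof
        fix p assume p: "p \<in> T"
        obtain s y where sy: "p = (s, y)" by (cases p)
        have "G1 p \<in> coord d ` (cdom d \<inter> cdom d')" using p by (simp add: T_def)
        then have "cinv d (G1 p) \<in> cdom d'" using coord_image_mem[OF d, of "cdom d \<inter> cdom d'" "G1 p"] by simp
        then show "p \<in> ?S" using HT[OF p] p by (simp add: sy T_def V1m I)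
      qed
      moreover have "z \<in> T"
      proof -
        have m: "z \<in> I \<times> V1" using zt True by (simp add: tx V1m)
        have "cinv d (G1 z) \<in> cdom d'" using zt(3) True by (simp add: F_def G1_def tx)
        then have "G1 z \<in> coord d ` (cdom d \<inter> cdom d')"
          using coord_image_mem[OF d, of "cdom d \<inter> cdom d'" "G1 z"] G1in[OF m] chart_simps(4)[OF d] by simp
        then show ?thesis using m by (simp add: T_def)
      qed
      ultimately show ?thesis by (intro exI[of _ T] conjI)
    next
      case False
      then have q: "cinv c' x \<in> Q" using PQ by blast
      define V2 where "V2 = coord c' ` (cdom c' \<inter> (Q \<inter> \<iota> -` cdom d'))"
      have V2: "open V2"
        unfolding V2_def by (intro B.open_coord_image[OF c'] open_Int Q open_vimage chart_open(1)[OF d'] \<iota>c)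
      have V2m: "y \<in> V2 \<longleftrightarrow> y \<in> cimg c' \<and> cinv c' y \<in> Q \<and> \<iota> (cinv c' y) \<in> cdom d'" for y
        unfolding V2_def using B.coord_image_mem[OF c', of "cdom c' \<inter> (Q \<inter> \<iota> -` cdom d')" y] B.chart_simps(4)[OF c', of y] by auto
      have s: "smooth_on (I \<times> V2) snd"
        by (rule smooth_on_bounded_linear[OF bounded_linear_snd open_Times[OF I(2) V2]])
      have "smooth_on (I \<times> V2) (\<lambda>p. rep \<iota> c' d' (snd p))"
        by (rule smooth_on_compose[OF smooth_rep[OF sm c' d'] s]) (auto simp: V2m rep_dom_mem[OF c'])
      then have "smooth_on (I \<times> V2) ?H" by (rule smooth_on_cong) (auto simp: V2m FQ)
      moreover have "I \<times> V2 \<subseteq> ?S" by (auto simp: V2m FQ I)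
      moreover have "z \<in> I \<times> V2" using zt q by (simp add: tx V2m FQ)
      ultimately show ?thesis by (intro exI[of _ "I \<times> V2"] conjI)
    qed
  qed
  have trt: "totally_real_immersion A J B (F t)" if t: "\<bar>t\<bar> < \<epsilon>" for t
    unfolding totally_real_immersion_iff
  proof
    have "range (Pair t) \<subseteq> I \<times> UNIV" using t by (auto simp: I)
    then have Fc: "continuous_on UNIV (F t)"
      using continuous_on_compose2[OF cont continuous_on_Pair[OF continuous_on_const[of UNIV t] continuous_on_id]] by simp
    show smt: "smooth_map B A (F t)"
      unfolding smooth_map_def
    proof (intro conjI ballI Fc)
      fix c' d' assume cd': "c' \<in> B" "d' \<in> A"
      have "open (rep_dom (F t) c' d')"
        by (intro B.open_coord_image[OF cd'(1)] open_vimage chart_open(1)[OF cd'(2)] Fc)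
      from smooth_on_slice[OF joint[OF cd'] this, of t]
      have "smooth_on (rep_dom (F t) c' d') (\<lambda>x. coord d' (F t (cinv c' x)))"
        using t rep_dom_mem[OF cd'(1)] by simp
      then show "smooth_on (rep_dom (F t) c' d') (rep (F t) c' d')" by (rule smooth_on_cong) simp
    qed
    show "\<forall>p. bij (frame_map (J (F t p)) (frame_of (tm (F t) p)))"
    proof
      fix p
      show "bij (frame_map (J (F t p)) (frame_of (tm (F t) p)))"
      \<comment> \<open>On \<open>Q\<close> the map equals \<open>\<iota>\<close> near
        \<open>p\<close> and has the same differential. Elsewhere \<open>p\<close> comes from
        \<open>K\<close>, and the frame map is one of those controlled by the tube.\<close>
      proof (cases "p \<in> Q")
        case True
        define c0 where "c0 = chart_at B p"
        have c0: "c0 \<in> B" "p \<in> cdom c0" using B.chart_at[of p] by (auto simp: c0_def)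
        have "fd (coord (chart_at A (\<iota> p)) \<circ> F t \<circ> cinv c0) (coord c0 p) = fd (coord (chart_at A (\<iota> p)) \<circ> \<iota> \<circ> cinv c0) (coord c0 p)"
        proof (rule fd_cong[OF B.open_coord_image[OF c0(1) Q]])
          show "coord c0 p \<in> coord c0 ` (cdom c0 \<inter> Q)" using c0 True by blast
        qed (auto simp: FQ B.chart_simps(1)[OF c0(1)])
        then have "tm (F t) p = tm \<iota> p" by (simp add: tangent_map_def FQ[OF True] c0_def[symmetric])
        then show ?thesis using bij_frame[OF tri, of p] by (simp add: FQ[OF True])
      next
        case False
        then obtain x where x: "x \<in> K" "p = cinv c x" by (auto simp: Q_def)
        have xV: "x \<in> V" using x KV by blast
        have pP: "p \<in> P" and cp: "coord c p = x" using VP[OF xV] by (simp_all add: x)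
        have Fp: "F t p = cinv d (G (t, x))" using pP by (simp add: F_def cp)
        have pd: "F t p \<in> cdom d" unfolding Fp by (rule chart_simps(4)[OF d Gin[OF t xV]])
        have eq: "rep (F t) c d y = G (t, y)" if "y \<in> V" for y
          using VP[OF that] chart_simps(2)[OF d Gin[OF t that]] by (simp add: F_def)
        have "fd (rep (F t) c d) x = fd (\<lambda>y. G (t, y)) x" by (rule fd_cong[OF V xV eq])
        then have fdE: "fd (rep (F t) c d) x (axis i 1) = E i (t, x)" for i
          using fd_slice[OF G, of t x] xV by (simp add: E_def)
        have pc: "p \<in> cdom c" using pP by (simp add: P_def)
        show ?thesis
          unfolding bij_frame_iff[OF smt c d pc pd] cp fdE eq[OF xV]
          using Lbij[OF t x(1)] by (simp only: L_def)
      qed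
    qed
  qed
  have var: "variation A J B \<iota> \<epsilon> F"
    unfolding variation_def using \<epsilon>(1) F0 trt cont joint by (simp add: I_def)
  show ?thesis
  proof (rule that[OF var])
    fix x assume "x \<in> rep_dom \<iota> c d"
    then have x: "x \<in> V" by (simp add: V_def)
    have m: "(0, x) \<in> vdom \<epsilon> F c d" using x \<epsilon>(1) Vc[OF x] by (simp add: vdom_def[OF var] F0)
    have "fd (vrep F c d) (0, x) = fd G (0, x)"
    proof (rule fd_cong[OF open_Times[OF I(2) V]])
      show "(0, x) \<in> I \<times> V" using I0 x by simp
      fix p assume p: "p \<in> I \<times> V"
      show "vrep F c d p = G p"
        using p VP[of "snd p"] chart_simps(2)[OF d Gin[of "fst p" "snd p"]] by (auto simp: vrep_def[OF var] F_def I)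
    qed
    moreover have "((\<lambda>t. (t, x)) has_derivative (\<lambda>s. (s, 0))) (at (0::real))" by (auto intro!: derivative_eq_intros)
    from has_derivative_compose[OF this smooth_on_has_derivative[OF G, of "(0, x)"]]
    have "((\<lambda>t. G (t, x)) has_derivative (\<lambda>s. fd G (0, x) (s, 0))) (at 0)" using x by simp
    moreover have "((\<lambda>t. G (t, x)) has_derivative (\<lambda>s. s *\<^sub>R w x)) (at 0)"
      unfolding G_def by (auto intro!: derivative_eq_intros)
    ultimately have "fd (vrep F c d) (0, x) (1, 0) = w x"
      using has_derivative_unique[of "\<lambda>t. G (t, x)" "\<lambda>s. fd G (0, x) (s, 0)" 0 "\<lambda>s. s *\<^sub>R w x"] by (auto dest: fun_cong[of _ _ 1])
    then show "to_chart A d (\<iota> (cinv c x)) (variation_field A F (cinv c x)) = w x"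
      using vfield_0[OF var c d m] by (simp add: vfield_def[OF var])
  next
    fix p assume "p \<notin> cinv c ` K"
    then have "F t p = \<iota> p" for t by (intro FQ) (simp add: Q_def)
    then show "variation_field A F p = 0" by (simp add: variation_field_def)
  qed
qed

end

section \<open>The fundamental lemma and J-minimality\<close>

context closed_jgeometry
begin

lemma continuous_one_form_app:
  assumes l: "\<And>p. linear (\<eta> p)" and s: "\<And>c X. c \<in> B \<Longrightarrow> continuous_on (cimg c) (\<lambda>x. \<eta> (cinv c x) (from_chart B c (cinv c x) X) :: real)"
    and Y: "smooth_vector_field B Y"
  shows "continuous_on UNIV (\<lambda>p. \<eta> p (Y p))"
proof (rule B.continuous_in_charts)
  fix c assume c: "c \<in> B"
  let ?t = "\<lambda>x. to_chart B c (cinv c x) (Y (cinv c x))"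
  have t: "continuous_on (cimg c) ?t"
    by (rule smooth_on_continuous) (use Y c in \<open>simp add: smooth_vector_field_def\<close>)
  have e: "(\<Sum>i\<in>UNIV. ?t x $ i *\<^sub>R \<eta> (cinv c x) (from_chart B c (cinv c x) (axis i 1))) = \<eta> (cinv c x) (Y (cinv c x))"
    if x: "x \<in> cimg c" for x
  proof -
    note p = B.chart_simps(4)[OF c x]
    have "linear (\<lambda>X. \<eta> (cinv c x) (from_chart B c (cinv c x) X))"
      using linear_compose[OF B.linear_from_chart[OF c p] l] by (simp add: o_def)
    from linear_vec_expand[OF this, of "?t x"] show ?thesis by (simp only: B.from_chart_to_chart[OF c p])
  qed
  have "continuous_on (cimg c) (\<lambda>x. \<Sum>i\<in>UNIV. ?t x $ i *\<^sub>R \<eta> (cinv c x) (from_chart B c (cinv c x) (axis i 1)))"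
    by (intro continuous_on_sum continuous_on_scaleR continuous_on_component t s c)
  then show "continuous_on (cimg c) (\<lambda>x. \<eta> (cinv c x) (Y (cinv c x)))"
    by (rule continuous_on_eq) (rule e)
qed

lemma form_integral_zero: "real_form \<alpha> \<Longrightarrow> form_integral B (smul (\<lambda>p. 0) \<alpha>) = 0"
  using B.exists_partition_of_unity[OF compact_L] form_integral_smul[of \<alpha> "\<lambda>p. 0"]
  by (auto simp: cint_def set_lebesgue_integral_def)

lemma form_integral_minus:
  assumes "real_form \<alpha>" "continuous_on UNIV \<phi>"
  shows "form_integral B (smul (\<lambda>p. - \<phi> p) \<alpha>) = - form_integral B (smul \<phi> \<alpha>)"
proof -
  \<comment> \<open>The sum rule over the index type \<open>bool\<close>: the two summands are
    \<phi> and - \<phi>, and their total is zero.\<close>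
  have "form_integral B (smul (\<lambda>p. \<Sum>b\<in>UNIV. if b then \<phi> p else - \<phi> p) \<alpha>) =
    (\<Sum>b\<in>UNIV. form_integral B (smul (\<lambda>p. if b then \<phi> p else - \<phi> p) \<alpha>))"
    by (rule form_integral_smul_sum[OF assms(1)]) (simp, rename_tac b, case_tac b, simp_all add: assms continuous_on_minus)
  then show ?thesis using form_integral_zero[OF assms(1)] by (simp add: UNIV_bool eq_neg_iff_add_eq_0)
qed

lemma form_integral_add:
  assumes "real_form \<alpha>" "continuous_on UNIV \<phi>" "continuous_on UNIV \<psi>"
  shows "form_integral B (smul (\<lambda>p. \<phi> p + \<psi> p) \<alpha>) = form_integral B (smul \<phi> \<alpha>) + form_integral B (smul \<psi> \<alpha>)"
proof -
  have "form_integral B (smul (\<lambda>p. \<Sum>b\<in>UNIV. if b then \<psi> p else \<phi> p) \<alpha>) =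
    (\<Sum>b\<in>UNIV. form_integral B (smul (\<lambda>p. if b then \<psi> p else \<phi> p) \<alpha>))"
    by (rule form_integral_smul_sum[OF assms(1)]) (simp, rename_tac b, case_tac b, simp_all add: assms)
  then show ?thesis by (simp add: UNIV_bool)
qed

context
  fixes \<iota> assumes tri: "totally_real_immersion A J B \<iota>"
begin

lemma lin_tm: "linear (tm \<iota> p)" by (rule linear_tangent_map[OF sfm[OF tri]])

lemma inj_tm: "tm \<iota> p v = 0 \<longleftrightarrow> v = 0"
proof -
  have "inj (tm \<iota> p)" using tri by (simp add: totally_real_immersion_def)
  then show ?thesis using linear_injective_0[OF lin_tm] linear_0[OF lin_tm] by blast
qed

text \<open>The fundamental lemma of the calculus of variations, for an arbitrary continuous 1-form
  \<eta>. A bump times a constant field in a chart, with the right sign, makes \<eta>(Y)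
  non-negative everywhere and positive at \<open>p0\<close>. It will be applied to \<xi> and to the
  difference between \<xi> and a candidate for the J-mean curvature.\<close>

lemma fundamental_lemma:
  assumes l: "\<And>p. linear (\<eta> p)" and s: "\<And>c X. c \<in> B \<Longrightarrow> continuous_on (cimg c) (\<lambda>x. \<eta> (cinv c x) (from_chart B c (cinv c x) X) :: real)"
    and ne: "\<eta> p0 X0 \<noteq> 0"
  obtains \<epsilon> F Y where "variation A J B \<iota> \<epsilon> F" "smooth_vector_field B Y"
    "variation_field A F = (\<lambda>p. J (\<iota> p) (tm \<iota> p (Y p)))"
    "form_integral B (smul (\<lambda>p. \<eta> p (Y p)) (vol \<iota>)) \<noteq> 0"
proof -
  define c where "c = chart_at B p0"
  define d where "d = chart_at A (\<iota> p0)"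
  note at = at_charts[OF tri c_def d_def]
  note c = at(1) and d = at(2)
  interpret KC: kaehler_chart "cimg d" "metric_in A g d" "acs_in A J d" "christoffel A g d" by (rule kaehler_chart[OF d])
  define x0 where "x0 = coord c p0"
  define V where "V = rep_dom \<iota> c d"
  define f where "f = rep \<iota> c d"
  note sm = sfm[OF tri]
  have V: "open V" unfolding V_def by (rule open_rep_dom[OF sm c d])
  have f: "smooth_on V f" "f ` V \<subseteq> cimg d" unfolding V_def f_def by (rule smooth_rep[OF sm c d], rule rep_image[OF sm c d])
  have Vc: "x \<in> cimg c" "\<iota> (cinv c x) \<in> cdom d" if "x \<in> V" for x
    using that by (simp_all add: V_def rep_dom_mem[OF c])
  have x0: "x0 \<in> V" "cinv c x0 = p0" using at(5) B.chart_simps(1)[OF c at(3)] by (simp_all add: x0_def V_def)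
  define h where "h x = \<eta> (cinv c x) (from_chart B c (cinv c x) X0)" for x
  have h0: "h x0 = \<eta> p0 X0" by (simp add: h_def x0(2)) (simp add: c_def)
  have hc: "continuous_on V h" unfolding h_def by (rule continuous_on_subset[OF s[OF c]]) (use Vc in auto)
  \<comment> \<open>The sign of \<eta> at \<open>p0\<close>; with this factor in \<open>Y\<close>
    the integrand is non-negative near \<open>p0\<close>, whichever sign \<eta> has there.\<close>
  define \<sigma> where "\<sigma> = sgn (h x0)"
  have "open (V \<inter> (\<lambda>x. \<sigma> * h x) -` {0<..})"
    by (rule continuous_open_preimage[OF continuous_on_mult[OF continuous_on_const hc] V]) simp
  moreover have "x0 \<in> V \<inter> (\<lambda>x. \<sigma> * h x) -` {0<..}"
    using x0 ne h0 by (simp add: \<sigma>_def sgn_if)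
  ultimately obtain r where r: "r > 0" "cball x0 r \<subseteq> V \<inter> (\<lambda>x. \<sigma> * h x) -` {0<..}"
    using open_contains_cball by blast
  define K where "K = cball x0 r"
  have KV: "K \<subseteq> V" and Kh: "\<And>x. x \<in> K \<Longrightarrow> \<sigma> * h x > 0" using r(2) by (auto simp: K_def)
  define \<phi> where "\<phi> x = \<sigma> * bump x0 r x" for x
  have \<phi>0: "\<phi> x = 0" if "x \<notin> K" for x
    using bump_eq_0[OF r(1), of x x0] that by (auto simp: \<phi>_def K_def)
  define w where "w x = \<phi> x *\<^sub>R acs_in A J d (f x) (fd f x X0)" for x
  have ws: "smooth_on V w"
    unfolding w_def \<phi>_def
    by (intro smooth_on_scaleR smooth_on_mult smooth_on_const V smooth_on_subset[OF smooth_on_bump] subset_UNIV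
        KC.smooth_on_J_field[OF f] smooth_on_fd[OF f(1)])
  obtain \<epsilon> F where var: "variation A J B \<iota> \<epsilon> F"
    and vin: "\<And>x. x \<in> V \<Longrightarrow> to_chart A d (\<iota> (cinv c x)) (variation_field A F (cinv c x)) = w x"
    and vout: "\<And>p. p \<notin> cinv c ` K \<Longrightarrow> variation_field A F p = 0"
    by (rule exists_local_variation[OF tri c d _ _ ws[unfolded V_def], of K, folded V_def])
       (use KV \<phi>0 in \<open>auto simp: K_def w_def\<close>)
  define Y where "Y p = (if p \<in> cdom c then \<phi> (coord c p) *\<^sub>R from_chart B c p X0 else 0)" for p
  have Yout: "Y p = 0" if "p \<notin> cinv c ` K" for p
  proof (cases "p \<in> cdom c")
    case True
    then have "coord c p \<notin> K" using that B.chart_simps(1)[OF c True] by (metis image_eqI)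
    then show ?thesis by (simp add: Y_def \<phi>0)
  qed (simp add: Y_def)
  have Yin: "Y (cinv c x) = \<phi> x *\<^sub>R from_chart B c (cinv c x) X0" if "x \<in> K" for x
  proof -
    have x: "x \<in> cimg c" using that KV Vc by blast
    show ?thesis by (simp add: Y_def B.chart_simps(4)[OF c x] B.chart_simps(2)[OF c x])
  qed
  have field: "variation_field A F p = J (\<iota> p) (tm \<iota> p (Y p))" for p
  proof (cases "p \<in> cinv c ` K")
    case True
    then obtain x where x: "x \<in> K" "p = cinv c x" by blast
    have xV: "x \<in> V" using x KV by blast
    have pc: "p \<in> cdom c" "coord c p = x" using Vc[OF xV] B.chart_simps(2,4)[OF c] by (simp_all add: x)
    have pd: "\<iota> p \<in> cdom d" using Vc[OF xV] by (simp add: x)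
    have fx: "f x \<in> cimg d" using f(2) xV by blast
    have "to_chart A d (\<iota> p) (J (\<iota> p) (tm \<iota> p (Y p))) = acs_in A J d (f x) (fd f x (to_chart B c p (Y p)))"
      using acs_rep[of c d p \<iota> "tm \<iota> p (Y p)", OF c d pc(1) pd] to_chart_tangent_map[OF sm c d pc(1) pd, of "Y p"]
      by (simp only: pc(2) f_def)
    also have "to_chart B c p (Y p) = \<phi> x *\<^sub>R X0"
      using Yin[OF x(1)] by (simp add: x(2)[symmetric] linear_cmul[OF B.linear_to_chart[OF c pc(1)]] B.to_chart_from_chart[OF c pc(1)])
    also have "acs_in A J d (f x) (fd f x (\<phi> x *\<^sub>R X0)) = w x"
      by (simp add: linear_cmul[OF smooth_on_linear_fd[OF f(1) xV]] linear_cmul[OF KC.J_linear[OF fx]] w_def)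
    finally have "to_chart A d (\<iota> p) (variation_field A F p) = to_chart A d (\<iota> p) (J (\<iota> p) (tm \<iota> p (Y p)))"
      using vin[OF xV] by (simp add: x(2))
    from arg_cong[OF this, of "from_chart A d (\<iota> p)"] show ?thesis by (simp add: from_chart_to_chart[OF d pd])
  next
    case False
    then show ?thesis
      by (simp add: vout Yout linear_0[OF lin_tm] complex_space.J_simps(5)[OF complex_space])
  qed
  \<comment> \<open>A by-product of the variation: \<open>Y\<close> is the J-part of its velocity,
    with tangential part zero.\<close>
  have Ys: "smooth_vector_field B Y"
    by (rule smooth_decomposition(2)[OF var, of "\<lambda>_. 0"]) (simp add: field linear_0[OF lin_tm])
  have \<eta>out: "\<eta> p (Y p) = 0" if "p \<notin> cinv c ` K" for p using Yout[OF that] by (simp add: linear_0[OF l])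
  have \<eta>in: "\<eta> (cinv c x) (Y (cinv c x)) = bump x0 r x * (\<sigma> * h x)" if "x \<in> K" for x
    by (simp add: Yin[OF that] linear_cmul[OF l] \<phi>_def h_def)
  have "form_integral B (smul (\<lambda>p. \<eta> p (Y p)) (vol \<iota>)) \<noteq> 0"
  proof (rule form_integral_pos[OF real_form_vol[OF tri]])
    show "0 < Re (form_coeff B c' (vol \<iota>) x)" if "c' \<in> B" "x \<in> cimg c'" for c' x
      using rho_pos[OF tri that] by (simp add: form_coeff_vol[OF tri that])
    show "continuous_on UNIV (\<lambda>p. \<eta> p (Y p))" by (rule continuous_one_form_app[OF l s Ys])
    show "0 \<le> \<eta> p (Y p)" for p
    proof (cases "p \<in> cinv c ` K")
      case True
      then obtain x where x: "x \<in> K" "p = cinv c x" by blast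
      then show ?thesis using \<eta>in[OF x(1)] Kh[OF x(1)] bump_nonneg[of x0 r x] by simp
    qed (simp add: \<eta>out)
    have "compact (cinv c ` K)"
      by (rule compact_continuous_image[OF continuous_on_subset[OF continuous_cinv[OF B.is_chart[OF c]]]])
         (use KV Vc in \<open>auto simp: K_def\<close>)
    then have "supp (\<lambda>p. \<eta> p (Y p)) \<subseteq> cinv c ` K"
      by (intro closure_minimal compact_imp_closed) (use \<eta>out in blast)
    also have "\<dots> \<subseteq> cdom c" using KV Vc B.chart_simps(4)[OF c] by blast
    finally show "supp (\<lambda>p. \<eta> p (Y p)) \<subseteq> cdom c" .
    have xK: "x0 \<in> K" using r(1) by (simp add: K_def)
    show "0 < \<eta> p0 (Y p0)"
      using \<eta>in[OF xK] Kh[OF xK] bump_pos_iff[OF r(1), of x0 x0] r(1) by (simp add: x0(2))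
  qed (rule c)
  moreover have "variation_field A F = (\<lambda>p. J (\<iota> p) (tm \<iota> p (Y p)))" using field by (intro ext)
  ultimately show ?thesis using that[OF var Ys] by blast
qed

text \<open>A general variation also has a tangential velocity. The frame coordinates split it
  pointwise, and by the first variation formula the tangential part leaves no trace in the
  result.\<close>

lemma first_variation_exists:
  assumes var: "variation A J B \<iota> \<epsilon> F"
  obtains Y where "((\<lambda>t. Vol_J A g J B (F t)) has_vector_derivative
     form_integral B (smul (\<lambda>p. maslov_form A g J B \<iota> p (Y p)) (vol \<iota>))) (at 0)"
proof -
  define z where "z p = inv (frame_map (J (\<iota> p)) (frame_of (tm \<iota> p))) (variation_field A F p)" for p
  have "variation_field A F p = tm \<iota> p (re_vec (z p)) + J (\<iota> p) (tm \<iota> p (im_vec (z p)))" for p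
  proof -
    interpret h: complex_space "J (\<iota> p)" by (rule complex_space)
    show ?thesis
      using frame_map_linear[OF lin_tm h.J_linear, of p "z p"] h.frame_map_cof[OF bij_frame[OF tri, of p], of "variation_field A F p"]
      by (simp add: z_def)
  qed
  from first_variation[OF var this] show ?thesis by (rule that)
qed

lemma first_variation_normal:
  assumes var: "variation A J B \<iota> \<epsilon> F" and Y: "variation_field A F = (\<lambda>p. J (\<iota> p) (tm \<iota> p (Y p)))"
  shows "((\<lambda>t. Vol_J A g J B (F t)) has_vector_derivative
     form_integral B (smul (\<lambda>p. maslov_form A g J B \<iota> p (Y p)) (vol \<iota>))) (at 0)"
  by (rule first_variation[OF var, of "\<lambda>_. 0"]) (simp add: Y linear_0[OF lin_tm])

lemma continuous_maslov:
  "c \<in> B \<Longrightarrow> continuous_on (cimg c) (\<lambda>x. maslov_form A g J B \<iota> (cinv c x) (from_chart B c (cinv c x) X))"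
  by (rule smooth_on_continuous[OF smooth_maslov[OF tri]])

lemma J_minimal_iff: "J_minimal A g J B \<iota> \<longleftrightarrow> (\<forall>p X. maslov_form A g J B \<iota> p X = 0)"
proof
  assume min: "J_minimal A g J B \<iota>"
  show "\<forall>p X. maslov_form A g J B \<iota> p X = 0"
  proof (rule ccontr)
    assume "\<not> (\<forall>p X. maslov_form A g J B \<iota> p X = 0)"
    then obtain p X where ne: "maslov_form A g J B \<iota> p X \<noteq> 0" by blast
    obtain \<epsilon> F Y where v: "variation A J B \<iota> \<epsilon> F" "variation_field A F = (\<lambda>p. J (\<iota> p) (tm \<iota> p (Y p)))"
      "form_integral B (smul (\<lambda>p. maslov_form A g J B \<iota> p (Y p)) (vol \<iota>)) \<noteq> 0"
      by (rule fundamental_lemma[OF linear_maslov_form[OF tri] continuous_maslov ne])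
    have "((\<lambda>t. Vol_J A g J B (F t)) has_vector_derivative 0) (at 0)"
      using min v(1) unfolding J_minimal_def by blast
    from vector_derivative_unique_at[OF this first_variation_normal[OF v(1,2)]] v(3) show False by simp
  qed
next
  assume z: "\<forall>p X. maslov_form A g J B \<iota> p X = 0"
  show "J_minimal A g J B \<iota>"
    unfolding J_minimal_def
  proof (intro allI impI)
    fix \<epsilon> F assume "variation A J B \<iota> \<epsilon> F"
    then obtain Y where "((\<lambda>t. Vol_J A g J B (F t)) has_vector_derivative
       form_integral B (smul (\<lambda>p. maslov_form A g J B \<iota> p (Y p)) (vol \<iota>))) (at 0)"
      by (rule first_variation_exists)
    then show "((\<lambda>t. Vol_J A g J B (F t)) has_vector_derivative 0) (at 0)"
      by (simp only: z form_integral_zero[OF real_form_vol[OF tri]])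
  qed
qed

end

end

section \<open>The J-mean curvature as dual of the Maslov form\<close>

context closed_jgeometry
begin

context
  fixes \<iota> assumes tri: "totally_real_immersion A J B \<iota>"
begin

lemma induced_inner_form: "inner_form (\<lambda>u v. g (\<iota> p) (tm \<iota> p u) (tm \<iota> p v))"
proof -
  interpret h: hermitian_space "g (\<iota> p)" "J (\<iota> p)" by (rule hermitian_space)
  note lt = lin_tm[OF tri, of p]
  show ?thesis
  proof
    show "bilinear (\<lambda>u v. g (\<iota> p) (tm \<iota> p u) (tm \<iota> p v))"
      unfolding bilinear_def by (intro conjI allI linearI) (simp_all add: h.G_simps linear_add[OF lt] linear_cmul[OF lt])
    show "0 < g (\<iota> p) (tm \<iota> p v) (tm \<iota> p v)" if "v \<noteq> 0" for v
      using that by (intro h.pos) (simp add: inj_tm[OF tri])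
  qed (rule h.sym)
qed

definition induced_in :: "('l, real^'n) chart \<Rightarrow> real^'n \<Rightarrow> real^'n \<Rightarrow> real^'n \<Rightarrow> real" where
  "induced_in c x u v = g (\<iota> (cinv c x)) (tm \<iota> (cinv c x) (from_chart B c (cinv c x) u)) (tm \<iota> (cinv c x) (from_chart B c (cinv c x) v))"

lemma smooth_section_in_chart:
  assumes c: "c \<in> B" and Y: "smooth_vector_field B Y" and d: "d \<in> A"
  shows "smooth_on (rep_dom \<iota> c d) (\<lambda>x. to_chart A d (\<iota> (cinv c x)) (tm \<iota> (cinv c x) (Y (cinv c x))))"
proof -
  note sm = sfm[OF tri]
  have V: "x \<in> cimg c" "\<iota> (cinv c x) \<in> cdom d" if "x \<in> rep_dom \<iota> c d" for x
    using that by (simp_all add: rep_dom_mem[OF c])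
  have t: "smooth_on (rep_dom \<iota> c d) (\<lambda>x. to_chart B c (cinv c x) (Y (cinv c x)))"
    by (rule smooth_on_subset[of "cimg c"]) (use Y c V(1) open_rep_dom[OF sm c d] in \<open>auto simp: smooth_vector_field_def simp del: image_iff\<close>)
  have "smooth_on (rep_dom \<iota> c d) (\<lambda>x. fd (rep \<iota> c d) x (to_chart B c (cinv c x) (Y (cinv c x))))"
    by (rule smooth_on_linear_app[OF smooth_on_linear_fd[OF smooth_rep[OF sm c d]] smooth_on_fd[OF smooth_rep[OF sm c d]] t])
  then show ?thesis
  proof (rule smooth_on_cong)
    fix x assume x: "x \<in> rep_dom \<iota> c d"
    show "fd (rep \<iota> c d) x (to_chart B c (cinv c x) (Y (cinv c x))) = to_chart A d (\<iota> (cinv c x)) (tm \<iota> (cinv c x) (Y (cinv c x)))"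
      using to_chart_tangent_map[OF sm c d B.chart_simps(4)[OF c V(1)[OF x]] V(2)[OF x]] B.chart_simps(2)[OF c V(1)[OF x]] by simp
  qed
qed

lemma acs_section:
  assumes c: "c \<in> B" and d: "d \<in> A" and x: "x \<in> rep_dom \<iota> c d"
  shows "to_chart A d (\<iota> (cinv c x)) (J (\<iota> (cinv c x)) u) = acs_in A J d (rep \<iota> c d x) (to_chart A d (\<iota> (cinv c x)) u)"
    and "g (\<iota> (cinv c x)) u v = metric_in A g d (rep \<iota> c d x) (to_chart A d (\<iota> (cinv c x)) u) (to_chart A d (\<iota> (cinv c x)) v)"
  using x acs_in_to_chart[OF d, of "\<iota> (cinv c x)" u] metric_in_to_chart[OF d, of "\<iota> (cinv c x)" u v] by (simp_all add: rep_dom_mem[OF c])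

lemma frame_section:
  assumes c: "c \<in> B" and d: "d \<in> A" and x: "x \<in> rep_dom \<iota> c d"
  shows "to_chart A d (\<iota> (cinv c x)) (tm \<iota> (cinv c x) (from_chart B c (cinv c x) u)) = fd (rep \<iota> c d) x u"
proof -
  have V: "x \<in> cimg c" "\<iota> (cinv c x) \<in> cdom d" using x by (simp_all add: rep_dom_mem[OF c])
  note pc = B.chart_simps(4)[OF c V(1)]
  show ?thesis
    using to_chart_tangent_map[OF sfm[OF tri] c d pc V(2)] B.chart_simps(2)[OF c V(1)] by (simp add: B.to_chart_from_chart[OF c pc])
qed

text \<open>The induced metric is smooth and positive definite in charts of L, so
  \<open>metric_chart\<close> supplies the raising of indices needed for the dual of \<xi>.\<close>

lemma metric_chart_induced:
  assumes c: "c \<in> B"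
  shows "metric_chart (cimg c) (induced_in c)"
proof (rule metric_chart.intro)
  show "open (cimg c)" by (rule B.chart_open(2)[OF c])
next
  fix x assume x: "x \<in> cimg c"
  define p where "p = cinv c x"
  have p: "p \<in> cdom c" using B.chart_simps(4)[OF c x] by (simp add: p_def)
  interpret i: inner_form "\<lambda>u v. g (\<iota> p) (tm \<iota> p u) (tm \<iota> p v)" by (rule induced_inner_form)
  note lf = B.linear_from_chart[OF c p]
  have l1: "linear (\<lambda>u. induced_in c x u v)" "linear (\<lambda>v. induced_in c x u v)" for u v
    unfolding induced_in_def p_def[symmetric]
    by (intro linearI; simp only: linear_add[OF lf] linear_cmul[OF lf] i.G_simps)+
  have p1: "0 < induced_in c x v v" if "v \<noteq> 0" for v
  proof -
    have "from_chart B c p v \<noteq> 0"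
      using B.to_chart_from_chart[OF c p, of v] that linear_0[OF B.linear_to_chart[OF c p]] by metis
    from i.pos[OF this] show ?thesis by (simp add: induced_in_def p_def)
  qed
  show "inner_form (induced_in c x)"
    by (rule inner_form.intro) (use l1 p1 i.sym in \<open>auto simp: bilinear_def induced_in_def p_def\<close>)
next
  fix u v
  show "smooth_on (cimg c) (\<lambda>x. induced_in c x u v)"
  proof (rule smooth_on_local)
    fix x assume x: "x \<in> cimg c"
    obtain d where d: "d \<in> A" "x \<in> rep_dom \<iota> c d" by (rule exists_target_chart[OF tri c x])
    interpret K: kaehler_chart "cimg d" "metric_in A g d" "acs_in A J d" "christoffel A g d" by (rule kaehler_chart[OF d(1)])
    note F = smooth_rep[OF sfm[OF tri] c d(1)]
    have "smooth_on (rep_dom \<iota> c d) (\<lambda>x. metric_in A g d (rep \<iota> c d x) (fd (rep \<iota> c d) x u) (fd (rep \<iota> c d) x v))"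
      by (intro K.smooth_on_G_field[OF F rep_image[OF sfm[OF tri] c d(1)]] smooth_on_fd[OF F])
    then have "smooth_on (rep_dom \<iota> c d) (\<lambda>x. induced_in c x u v)"
      by (rule smooth_on_cong) (simp only: induced_in_def acs_section(2)[OF c d(1)] frame_section[OF c d(1)])
    then show "\<exists>T. x \<in> T \<and> T \<subseteq> cimg c \<and> smooth_on T (\<lambda>x. induced_in c x u v)"
      using d rep_dom_mem[OF c, of _ \<iota> d] by (intro exI[of _ "rep_dom \<iota> c d"] conjI subsetI) simp_all
  qed
qed

text \<open>With H = J y the isometry \<open>J\<close> turns g(H, J Y) into g(y, Y). The first
  variation is the integral of \<xi>(Y), and the definition of H carries a minus sign, so
  \<open>y\<close> must be dual to - \<xi>. Smoothness comes from the linear system that raises the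
  index.\<close>

lemma exists_maslov_gradient:
  obtains y where "smooth_vector_field B y"
    "\<forall>p v. g (\<iota> p) (tm \<iota> p (y p)) (tm \<iota> p v) = - maslov_form A g J B \<iota> p v"
proof -
  let ?\<xi> = "maslov_form A g J B \<iota>"
  have "\<exists>y. \<forall>v. g (\<iota> p) (tm \<iota> p y) (tm \<iota> p v) = - ?\<xi> p v" for p
  proof -
    define c where "c = chart_at B p"
    have c: "c \<in> B" "p \<in> cdom c" using B.chart_at[of p] by (simp_all add: c_def)
    interpret M: metric_chart "cimg c" "induced_in c" by (rule metric_chart_induced[OF c(1)])
    define x where "x = coord c p"
    have x: "x \<in> cimg c" "cinv c x = p" using B.chart_simps(1,3)[OF c] by (simp_all add: x_def)
    define b where "b = (\<Sum>b\<in>Basis. - ?\<xi> p b *\<^sub>R b)"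
    have b: "b \<bullet> v = - ?\<xi> p v" for v
    proof -
      have "?\<xi> p v = (\<Sum>b\<in>Basis. (v \<bullet> b) *\<^sub>R ?\<xi> p b)" by (rule linear_sum_Basis[OF linear_maslov_form[OF tri]])
      then show ?thesis by (simp add: b_def inner_sum_left sum_negf inner_commute[of v] mult.commute)
    qed
    obtain y where y: "M.lower x y = b" using M.bij_lower[OF x(1)] by (metis bij_pointE)
    have "induced_in c x y v = - ?\<xi> p v" for v using M.inner_lower[OF x(1), of y v] by (simp add: y b)
    then show ?thesis by (intro exI[of _ y]) (simp add: induced_in_def x(2), simp add: c_def)
  qed
  then obtain y where y: "\<And>p v. g (\<iota> p) (tm \<iota> p (y p)) (tm \<iota> p v) = - ?\<xi> p v" by metis
  have "smooth_vector_field B y"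
    unfolding smooth_vector_field_def
  proof
    fix c assume c: "c \<in> B"
    interpret M: metric_chart "cimg c" "induced_in c" by (rule metric_chart_induced[OF c])
    let ?\<xi>c = "\<lambda>x v. ?\<xi> (cinv c x) (from_chart B c (cinv c x) v)"
    show "smooth_on (cimg c) (\<lambda>x. to_chart B c (cinv c x) (y (cinv c x)))"
    proof (rule smooth_on_linear_system[where L=M.lower and b="\<lambda>x. \<Sum>b\<in>Basis. - ?\<xi>c x b *\<^sub>R b"])
      show "smooth_on (cimg c) (\<lambda>x. M.lower x a)" for a
        unfolding M.lower_def by (intro smooth_on_sum M.open_U smooth_on_scaleR M.smooth_G smooth_on_const)
      show "smooth_on (cimg c) (\<lambda>x. \<Sum>b\<in>Basis. - ?\<xi>c x b *\<^sub>R b)"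
        by (intro smooth_on_sum M.open_U smooth_on_scaleR smooth_on_minus smooth_maslov[OF tri c] smooth_on_const)
      fix x assume x: "x \<in> cimg c"
      show "M.lower x (to_chart B c (cinv c x) (y (cinv c x))) = (\<Sum>b\<in>Basis. - ?\<xi>c x b *\<^sub>R b)"
        unfolding M.lower_def induced_in_def by (simp only: B.from_chart_to_chart[OF c B.chart_simps(4)[OF c x]] y)
    qed (auto intro: M.linear_lower M.bij_lower)
  qed
  then show ?thesis by (rule that) (simp add: y)
qed

lemma J_mean_curvature_eq:
  obtains y where "\<forall>p v. g (\<iota> p) (tm \<iota> p (y p)) (tm \<iota> p v) = - maslov_form A g J B \<iota> p v"
    "J_mean_curvature A g J B \<iota> = (\<lambda>p. J (\<iota> p) (tm \<iota> p (y p)))"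
proof -
  let ?\<xi> = "maslov_form A g J B \<iota>"
  obtain y where ys: "smooth_vector_field B y" and y': "\<forall>p v. g (\<iota> p) (tm \<iota> p (y p)) (tm \<iota> p v) = - ?\<xi> p v"
    by (rule exists_maslov_gradient)
  have y: "g (\<iota> p) (tm \<iota> p (y p)) (tm \<iota> p v) = - ?\<xi> p v" for p v using y' by simp
  let ?H = "\<lambda>p. J (\<iota> p) (tm \<iota> p (y p))"
  have gJ: "g (\<iota> p) (J (\<iota> p) u) (J (\<iota> p) v) = g (\<iota> p) u v" for p u v
    by (rule hermitian_space.J_isometry[OF hermitian_space])
  note rf = real_form_vol[OF tri]
  have \<xi>c: "continuous_on UNIV (\<lambda>p. ?\<xi> p (Y p))" if "smooth_vector_field B Y" for Y
    by (rule continuous_one_form_app[OF linear_maslov_form[OF tri] continuous_maslov[OF tri] that])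
  have Hs: "smooth_section_along B A \<iota> ?H"
    unfolding smooth_section_along_def
  proof (intro ballI)
    fix c d assume cd: "c \<in> B" "d \<in> A"
    interpret K: kaehler_chart "cimg d" "metric_in A g d" "acs_in A J d" "christoffel A g d" by (rule kaehler_chart[OF cd(2)])
    have "smooth_on (rep_dom \<iota> c d) (\<lambda>x. acs_in A J d (rep \<iota> c d x) (to_chart A d (\<iota> (cinv c x)) (tm \<iota> (cinv c x) (y (cinv c x)))))"
      by (rule K.smooth_on_J_field[OF smooth_rep[OF sfm[OF tri] cd] rep_image[OF sfm[OF tri] cd] smooth_section_in_chart[OF cd(1) ys cd(2)]])
    then show "smooth_on (rep_dom \<iota> c d) (\<lambda>x. to_chart A d (\<iota> (cinv c x)) (?H (cinv c x)))"
      by (rule smooth_on_cong) (simp only: acs_section(1)[OF cd])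
  qed
  have "J_mean_curvature A g J B \<iota> = ?H"
    unfolding J_mean_curvature_def
  proof (rule the_equality, intro conjI allI impI)
    show "smooth_section_along B A \<iota> ?H" by (rule Hs)
    show "?H p \<in> J (\<iota> p) ` range (tm \<iota> p)" for p by blast
    fix \<epsilon> F Y
    assume v: "variation A J B \<iota> \<epsilon> F \<and> smooth_vector_field B Y \<and> variation_field A F = (\<lambda>p. J (\<iota> p) (tm \<iota> p (Y p)))"
    then have v: "variation A J B \<iota> \<epsilon> F" "smooth_vector_field B Y" "variation_field A F = (\<lambda>p. J (\<iota> p) (tm \<iota> p (Y p)))" by blast+
    have "form_integral B (\<lambda>p v. of_real (g (\<iota> p) (?H p) (J (\<iota> p) (tm \<iota> p (Y p)))) * vol \<iota> p v)
      = - form_integral B (smul (\<lambda>p. ?\<xi> p (Y p)) (vol \<iota>))"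
      unfolding gJ y by (rule form_integral_minus[OF rf \<xi>c[OF v(2)]])
    then show "((\<lambda>t. Vol_J A g J B (F t)) has_vector_derivative
       - form_integral B (\<lambda>p v. of_real (g (\<iota> p) (?H p) (J (\<iota> p) (tm \<iota> p (Y p)))) * vol \<iota> p v)) (at 0)"
      using first_variation_normal[OF tri v(1,3)] by simp
  next
    fix H
    assume H: "smooth_section_along B A \<iota> H \<and> (\<forall>p. H p \<in> J (\<iota> p) ` range (tm \<iota> p)) \<and>
      (\<forall>\<epsilon> F Y. variation A J B \<iota> \<epsilon> F \<and> smooth_vector_field B Y \<and> variation_field A F = (\<lambda>p. J (\<iota> p) (tm \<iota> p (Y p))) \<longrightarrow>
        ((\<lambda>t. Vol_J A g J B (F t)) has_vector_derivative
           - form_integral B (\<lambda>p v. of_real (g (\<iota> p) (H p) (J (\<iota> p) (tm \<iota> p (Y p)))) * vol \<iota> p v)) (at 0))"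
    \<comment> \<open>Uniqueness: any candidate \<open>H\<close> gives the same first variation, so
      \<xi> + \<beta> integrates to zero against all variations of the form J Y and vanishes by
      \<open>fundamental_lemma\<close>. Smoothness of \<open>H\<close> enters as continuity of
      \<beta>.\<close>
    define \<beta> where "\<beta> p v = g (\<iota> p) (H p) (J (\<iota> p) (tm \<iota> p v))" for p v
    define \<eta> where "\<eta> p v = ?\<xi> p v + \<beta> p v" for p v
    have l\<beta>: "linear (\<beta> p)" for p
    proof -
      interpret h: hermitian_space "g (\<iota> p)" "J (\<iota> p)" by (rule hermitian_space)
      show ?thesis
        unfolding \<beta>_def
        by (rule linearI) (simp_all add: linear_add[OF lin_tm[OF tri]] linear_cmul[OF lin_tm[OF tri]] h.J_simps h.G_simps)
    qed
    have l: "linear (\<eta> p)" for p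
      unfolding \<eta>_def by (rule linear_compose_add[OF linear_maslov_form[OF tri] l\<beta>])
    have c\<beta>: "continuous_on (cimg c) (\<lambda>x. \<beta> (cinv c x) (from_chart B c (cinv c x) X))" if c: "c \<in> B" for c X
    proof (rule smooth_on_continuous, rule smooth_on_local)
      fix x assume x: "x \<in> cimg c"
      obtain d where d: "d \<in> A" "x \<in> rep_dom \<iota> c d" by (rule exists_target_chart[OF tri c x])
      interpret K: kaehler_chart "cimg d" "metric_in A g d" "acs_in A J d" "christoffel A g d" by (rule kaehler_chart[OF d(1)])
      note F = smooth_rep[OF sfm[OF tri] c d(1)] and FU = rep_image[OF sfm[OF tri] c d(1)]
      have "smooth_on (rep_dom \<iota> c d) (\<lambda>x. to_chart A d (\<iota> (cinv c x)) (H (cinv c x)))"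
        using H c d(1) unfolding smooth_section_along_def by blast
      then have "smooth_on (rep_dom \<iota> c d) (\<lambda>x. metric_in A g d (rep \<iota> c d x) (to_chart A d (\<iota> (cinv c x)) (H (cinv c x)))
         (acs_in A J d (rep \<iota> c d x) (fd (rep \<iota> c d) x X)))"
        by (intro K.smooth_on_G_field[OF F FU] K.smooth_on_J_field[OF F FU] smooth_on_fd[OF F])
      then have "smooth_on (rep_dom \<iota> c d) (\<lambda>x. \<beta> (cinv c x) (from_chart B c (cinv c x) X))"
        by (rule smooth_on_cong)
           (simp only: \<beta>_def acs_section(2)[OF c d(1)], simp only: acs_section(1)[OF c d(1)] frame_section[OF c d(1)])
      then show "\<exists>T. x \<in> T \<and> T \<subseteq> cimg c \<and> smooth_on T (\<lambda>x. \<beta> (cinv c x) (from_chart B c (cinv c x) X))"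
        using d rep_dom_mem[OF c, of _ \<iota> d] by (intro exI[of _ "rep_dom \<iota> c d"] conjI subsetI) simp_all
    qed
    have c\<eta>: "continuous_on (cimg c) (\<lambda>x. \<eta> (cinv c x) (from_chart B c (cinv c x) X))" if "c \<in> B" for c X
      unfolding \<eta>_def by (intro continuous_on_add continuous_maslov[OF tri] c\<beta> that)
    have \<eta>0: "\<eta> p X = 0" for p X
    proof (rule ccontr)
      assume ne: "\<eta> p X \<noteq> 0"
      obtain \<epsilon> F Y where v: "variation A J B \<iota> \<epsilon> F" "smooth_vector_field B Y" "variation_field A F = (\<lambda>p. J (\<iota> p) (tm \<iota> p (Y p)))"
        "form_integral B (smul (\<lambda>p. \<eta> p (Y p)) (vol \<iota>)) \<noteq> 0"
        by (rule fundamental_lemma[OF tri l c\<eta> ne])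
      have "((\<lambda>t. Vol_J A g J B (F t)) has_vector_derivative - form_integral B (smul (\<lambda>p. \<beta> p (Y p)) (vol \<iota>))) (at 0)"
        using H v(1-3) unfolding \<beta>_def by blast
      note e = vector_derivative_unique_at[OF this first_variation_normal[OF tri v(1,3)]]
      have "form_integral B (smul (\<lambda>p. ?\<xi> p (Y p)) (vol \<iota>)) + form_integral B (smul (\<lambda>p. \<beta> p (Y p)) (vol \<iota>)) = 0"
        unfolding e[symmetric] by (rule ab_left_minus)
      then have "form_integral B (smul (\<lambda>p. \<eta> p (Y p)) (vol \<iota>)) = 0"
        unfolding \<eta>_def
        by (subst form_integral_add[OF rf \<xi>c[OF v(2)] continuous_one_form_app[OF l\<beta> c\<beta> v(2)]])
      then show False using v(4) by simp
    qed
    show "H = ?H"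
    proof (rule ext)
      fix p
      interpret i: inner_form "\<lambda>u v. g (\<iota> p) (tm \<iota> p u) (tm \<iota> p v)" by (rule induced_inner_form)
      have "H p \<in> J (\<iota> p) ` range (tm \<iota> p)" using H by (elim conjE) (rule spec)
      then obtain a where a: "H p = J (\<iota> p) (tm \<iota> p a)" by (elim imageE rangeE) simp
      have "a = y p"
      proof (rule i.G_eqI)
        show "g (\<iota> p) (tm \<iota> p a) (tm \<iota> p v) = g (\<iota> p) (tm \<iota> p (y p)) (tm \<iota> p v)" for v
          using \<eta>0[of p v] by (simp add: \<eta>_def \<beta>_def a gJ y)
      qed
      then show "H p = ?H p" by (simp add: a)
    qed
  qed
  with y' show ?thesis by (rule that)
qed

lemma J_mean_curvature_zero_iff:
  "(\<forall>p. J_mean_curvature A g J B \<iota> p = 0) \<longleftrightarrow> (\<forall>p X. maslov_form A g J B \<iota> p X = 0)"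
proof -
  obtain y where y: "\<forall>p v. g (\<iota> p) (tm \<iota> p (y p)) (tm \<iota> p v) = - maslov_form A g J B \<iota> p v"
    and H: "J_mean_curvature A g J B \<iota> = (\<lambda>p. J (\<iota> p) (tm \<iota> p (y p)))" by (rule J_mean_curvature_eq)
  have "J (\<iota> p) (tm \<iota> p (y p)) = 0 \<longleftrightarrow> (\<forall>X. maslov_form A g J B \<iota> p X = 0)" for p
  proof -
    interpret h: hermitian_space "g (\<iota> p)" "J (\<iota> p)" by (rule hermitian_space)
    interpret i: inner_form "\<lambda>u v. g (\<iota> p) (tm \<iota> p u) (tm \<iota> p v)" by (rule induced_inner_form)
    have "J (\<iota> p) (tm \<iota> p (y p)) = 0 \<longleftrightarrow> tm \<iota> p (y p) = 0"
      using h.J_J[of "tm \<iota> p (y p)"] h.J_simps(5) by (metis neg_equal_0_iff_equal)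
    also have "\<dots> \<longleftrightarrow> (\<forall>X. g (\<iota> p) (tm \<iota> p (y p)) (tm \<iota> p X) = 0)"
      using i.G_nondegenerate[of "y p"] by (auto simp: inj_tm[OF tri] linear_0[OF lin_tm[OF tri]] h.G_simps)
    finally show ?thesis by (simp add: y)
  qed
  then show ?thesis by (simp add: H)
qed

text \<open>The Ricci form is a constant multiple \<open>a\<close> of the Kaehler form. For
  \<open>a = 0\<close> the metric would be Ricci flat, hence of zero scalar curvature; so
  \<open>a\<close> can be divided out.\<close>

lemma lagrangian_if_ricci_lagrangian:
  assumes ke: "kaehler_einstein A g J" and sc: "\<And>q. scalar_curvature A g q \<noteq> 0" and rl: "ricci_lagrangian A g J B \<iota>"
  shows "lagrangian A g J B \<iota>"
proof -
  obtain a where a: "\<And>p u v. ricci_form A g J p u v = a * kform g J p u v" using ke unfolding kaehler_einstein_def by blast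
  have "a \<noteq> 0"
  proof
    assume "a = 0"
    fix q :: 'm
    interpret h: hermitian_space "g q" "J q" by (rule hermitian_space)
    have R: "Ricci A g q u v = 0" for u v
      using a[of q "- J q u" v] \<open>a = 0\<close> by (simp add: ricci_form_def h.J_simps)
    \<comment> \<open>The description in \<open>scalar_curvature\<close> quantifies over orthonormal
      bases; one of them is needed to pin its value to 0.\<close>
    obtain e :: "'e \<Rightarrow> 'e" where e: "\<And>i j. i \<in> Basis \<Longrightarrow> j \<in> Basis \<Longrightarrow> g q (e i) (e j) = (if i = j then 1 else 0)"
      using h.exists_orthonormal[of "Basis :: 'e set"] by auto
    have inj: "inj_on e Basis" by (rule inj_onI) (metis e zero_neq_one)
    have E: "card (e ` Basis) = DIM('e)" "\<forall>u\<in>e ` Basis. \<forall>v\<in>e ` Basis. g q u v = (if u = v then 1 else 0)"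
      using e inj by (auto simp: card_image inj_on_def)
    have "scalar_curvature A g q = 0"
      unfolding scalar_curvature_def R using E by (intro the_equality) auto
    then show False using sc by blast
  qed
  then show ?thesis using rl by (simp add: lagrangian_def ricci_lagrangian_def a)
qed

end

end

theorem theorem2p4:
  fixes A :: "('m::{t2_space, second_countable_topology}, 'e::euclidean_space) chart set"
    and g :: "'m \<Rightarrow> 'e \<Rightarrow> 'e \<Rightarrow> real"
    and J :: "'m \<Rightarrow> 'e \<Rightarrow> 'e"
    and B :: "('l::{t2_space, second_countable_topology}, real^'n::finite) chart set"
    and \<iota> :: "'l \<Rightarrow> 'm"
  assumes "kaehler_manifold A g J"
    and "DIM('e) = 2 * CARD('n)"
    and "oriented_atlas B"
    and "compact (UNIV :: 'l set)"
    and "totally_real_immersion A J B \<iota>"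
  shows "(J_minimal A g J B \<iota> \<longleftrightarrow> (\<forall>p. J_mean_curvature A g J B \<iota> p = 0)) \<and>
         ((\<forall>p. J_mean_curvature A g J B \<iota> p = 0) \<longleftrightarrow> (\<forall>p X. maslov_form A g J B \<iota> p X = 0)) \<and>
         ((\<forall>p X. maslov_form A g J B \<iota> p X = 0) \<longleftrightarrow>
            parallel_form A g B \<iota> (Omega_J A g J B \<iota>)) \<and>
         (kaehler_einstein A g J \<and> (\<forall>q. scalar_curvature A g q \<noteq> 0) \<longrightarrow>
            (J_minimal A g J B \<iota> \<longleftrightarrow> minimal_immersion A g B \<iota> \<and> lagrangian A g J B \<iota>)) \<and>
         (definite_ricci A g \<longrightarrow> J_minimal A g J B \<iota> \<longrightarrow> ricci_lagrangian A g J B \<iota>)"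
proof -
  interpret closed_jgeometry A g J B
  proof (intro closed_jgeometry.intro jgeometry.intro kaehler_atlas.intro atlas.intro jgeometry_axioms.intro
      closed_jgeometry_axioms.intro)
    show "smooth_atlas B" using assms(3) by (simp add: oriented_atlas_def)
  qed (rule assms)+
  note tri = assms(5)
  \<comment> \<open>The Einstein condition enters here: \<xi> = 0 makes the Ricci form vanish on L,
    and with it the Kaehler form. For Lagrangian immersions \<open>minimal_iff_maslov_zero\<close>
    then supplies both directions.\<close>
  have "lagrangian A g J B \<iota>"
    if "kaehler_einstein A g J" "\<forall>q. scalar_curvature A g q \<noteq> 0" "\<forall>p X. maslov_form A g J B \<iota> p X = 0"
    using lagrangian_if_ricci_lagrangian[OF tri that(1) that(2)[rule_format] ricci_lagrangian_if_maslov_zero[OF tri that(3)]] .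
  then have "kaehler_einstein A g J \<and> (\<forall>q. scalar_curvature A g q \<noteq> 0) \<longrightarrow>
      ((\<forall>p X. maslov_form A g J B \<iota> p X = 0) \<longleftrightarrow> minimal_immersion A g B \<iota> \<and> lagrangian A g J B \<iota>)"
    using minimal_iff_maslov_zero[OF tri] by blast
  then show ?thesis
    using J_minimal_iff[OF tri] J_mean_curvature_zero_iff[OF tri] parallel_iff_maslov[OF tri]
      ricci_lagrangian_if_maslov_zero[OF tri] by simp
qed

end
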